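(* Consider a tree-specification for $\mathcal T_0,\dots,\mathcal T_d$ such that the dependency graph restricted to critical families, $G^\star$, is strongly connected. Assume that (i) the specification is essentially linear; (ii) for all $i\in I^\star$, the series $F_i(0,\ldots,0,(T_\ell(z))_{\ell\notin I^\star})$ (zeros substituted for all $y_j$, $j\in I^\star$) has radius of convergence strictly larger than $\rho$, and for all $i,j\in I^\star$ the series $\frac{\partial F_i}{\partial y_j}\big|_{(T_0(z),\dots,T_d(z))}$ has radius of convergence strictly larger than $\rho$; (iii) at least one subcritical series is aperiodic. Then all critical families converge to the same $X$-permuton: there is a quadruple $\mathbf p=(p_+^{\mathrm{left}},p_+^{\mathrm{right}},p_-^{\mathrm{left}},p_-^{\mathrm{right}})\in[0,1]^4$ with sum $1$ such that for every $i\in I^\star$, letting $\boldsymbol\sigma_n$ be a uniform random permutation of size $n$ in $\mathcal T_i$ (for those $n$ for which one exists), $\mu_{\boldsymbol\sigma_n}\to\mu^X_{\mathbf p}$ in distribution as $n\to\infty$. Furthermore $\mathbf p$ is given, for $e\in\{\mathrm{left},\mathrm{right}\}$ and $\varepsilon\in\{+,-\}$, by $$p_\varepsilon^{e}=\frac{{}^{t}\mathbf u\,\mathbb D^{e,\varepsilon}(\rho)\,\mathbf v}{{}^{t}\mathbf u\,(\mathbb M^\star)'(\rho)\,\mathbf v},$$ where $\mathbf u,\mathbf v$ are left and right positive eigenvectors, normalized by ${}^t\mathbf u\mathbf v=1$, of the matrix $\mathbb M^\star(\rho)$ for its Perron eigenvalue, which equals $1$.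
   Context: Permutations and trees. Permutations of $[n]$ are written in one-line notation; $|\sigma|$ is the size. For $\theta$ of size $d$, $\theta[\pi^{(1)},\dots,\pi^{(d)}]$ is the permutation of size $\sum|\pi^{(i)}|$ obtained by replacing each $\theta(i)$ by a sequence of integers order-isomorphic to $\pi^{(i)}$, keeping between these blocks the relative order given by $\theta$. A substitution tree is a rooted plane tree in which each internal node has $k\ge2$ children and is labeled by a permutation of size $k$ ($\oplus$ stands for $12$, $\ominus$ for $21$); its size is its number of leaves. $\mathrm{perm}(t)=1$ if $t$ is a leaf, and $\mathrm{perm}(t)=\theta[\mathrm{perm}(t_1),\dots,\mathrm{perm}(t_r)]$ if the root is labeled $\theta$ with subtrees $t_1,\dots,t_r$ from left to right. A simple permutation is a permutation of size $n>2$ mapping no interval of $[n]$ with at least $2$ and at most $n-1$ elements onto an interval. A standard tree is a substitution tree whose internal nodes are labeled by $\oplus$, $\ominus$ or simple permutations, where the left child of a node labeled $\oplus$ (resp. $\ominus$) is not labeled $\oplus$ (resp. $\ominus$). The map $\mathrm{perm}$ is a bijection from standard trees with $n$ leaves to permutations of size $n$; permutations and standard trees are identified. Tree-specification. $\mathcal S_{\mathcal T}$ is the set of simple permutations in $\mathcal T$. A tree-specification of families of permutations $(\mathcal T_0,\dots,\mathcal T_d)$ is a system $$\mathcal T_i=\varepsilon_i\{\bullet\}\uplus\biguplus_{\pi\in\mathcal S_{\mathcal T_i}\uplus\{\oplus,\ominus\}}\ \biguplus_{(k_1,\dots,k_{|\pi|})\in K^i_\pi}\pi[\mathcal T_{k_1},\dots,\mathcal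 T_{k_{|\pi|}}]\qquad(0\le i\le d),$$ with disjoint unions, $\bullet$ the permutation of size $1$, $\varepsilon_i\in\{0,1\}$, $K^i_\pi\subset\{0,\dots,d\}^{|\pi|}$, and $\pi[\mathcal T_{k_1},\dots]$ the set of trees with root label $\pi$ and $q$-th subtree in $\mathcal T_{k_q}$ (all trees occurring are standard trees). Standing assumptions: every $\mathcal T_i$ is nonempty, at least one is infinite, at least one $\varepsilon_i\neq0$. $T_i(z)=\sum_{\sigma\in\mathcal T_i}z^{|\sigma|}$ and $F_i(y_0,\dots,y_d)=\sum_\pi\sum_{(k_1,\dots)\in K_\pi^i}y_{k_1}\cdots y_{k_{|\pi|}}$, so $T_i=\varepsilon_iz+F_i(T_0,\dots,T_d)$. $\rho_i$ is the radius of convergence of $T_i$, $\rho=\min_i\rho_i$; $\mathcal T_i$ and $T_i$ are critical if $\rho_i=\rho$, subcritical otherwise; $I^\star$ is the set of critical indices. The dependency graph has vertices $\mathcal T_0,\dots,\mathcal T_d$ and an edge $\mathcal T_j\to\mathcal T_i$ whenever $\mathcal T_j$ appears in the equation of $\mathcal T_i$; $G^\star$ is its subgraph induced by the critical families. Standing assumption: from each subcritical family there is a directed path to a critical family. The specification is essentially branching if for some $i,j,j'\in I^\star$ the equation of $\mathcal T_i$ contains a term $\pi[\dots,\mathcal T_j,\dots,\mathcal T_{j'},\dots]$ (possibly $j=j'$, at two different positions); otherwise essentially linear. A series $\sum a_nz^n$ is periodic if $\{n:a_n\ne0\}\subset r+d\mathbb Z_{\ge0}$ for some $r\ge0$, $d\ge2$;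 otherwise aperiodic. Matrices. $\mathbb M^\star(z)=\big(\frac{\partial F_i}{\partial y_j}\big|_{(T_0(z),\dots,T_d(z))}\big)_{i,j\in I^\star}$ (in the essentially linear case it involves only subcritical series). $\mathbb D^{e,\varepsilon}=(D^{e,\varepsilon}_{i,j})_{i,j\in I^\star}$ where $$D^{e,\varepsilon}_{i,j}(z)=\sum_{\pi}\sum_{(k_1,\dots,k_{|\pi|})\in K^i_\pi}\ \sum_{\ell:\,k_\ell=j}\ \sum_{m}T'_{k_m}(z)\prod_{q\ne\ell,m}T_{k_q}(z),$$ the sum over $m$ being over $m<\ell$ if $e=\mathrm{left}$ and $m>\ell$ if $e=\mathrm{right}$, with $(m-\ell)(\pi(m)-\pi(\ell))>0$ if $\varepsilon=+$ and $<0$ if $\varepsilon=-$. (It counts trees of $\mathcal T_i$ in which a child of the root of type $j$ is replaced by a blossom, with one other marked leaf lying on side $e$ of the blossom and inducing with it the sign $\varepsilon$, by number of leaves other than the blossom and the marked leaf.) Permutons. A permuton is a probability measure on $[0,1]^2$ with uniform marginals; the space of permutons carries the weak topology. For $\sigma$ of size $n$, $\mu_\sigma$ has density $n\mathbf 1_{\sigma(\lceil xn\rceil)=\lceil yn\rceil}$. The $X$-permuton with parameter $\mathbf p$ is $\mu^X_{\mathbf p}=\sum_{e,\varepsilon}p_\varepsilon^e\,\nu(z_\varepsilon^e,(a,b))$, with $z_+^{\mathrm{left}}=(0,0)$, $z_-^{\mathrm{left}}=(0,1)$, $z_-^{\mathrm{right}}=(1,0)$, $z_+^{\mathrm{right}}=(1,1)$,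 $a=p_+^{\mathrm{left}}+p_-^{\mathrm{left}}$, $b=p_+^{\mathrm{left}}+p_-^{\mathrm{right}}$, and $\nu(P,Q)$ the normalized one-dimensional Lebesgue measure on the segment $[P,Q]$. *)

theory Defs
  imports "HOL-Probability.Probability" "HOL-Combinatorics.Multiset_Permutations"
begin

text \<open>One-line notation; lists are indexed from \<open>0\<close>, so \<open>\<sigma>(q)\<close> is \<open>\<sigma> ! (q - 1)\<close>.
  Permutations have size at least \<open>1\<close>.\<close>

type_synonym permutation = "nat list"

definition is_permutation :: "permutation \<Rightarrow> bool" where
  "is_permutation \<sigma> \<longleftrightarrow> \<sigma> \<noteq> [] \<and> \<sigma> \<in> permutations_of_set {1..length \<sigma>}"

abbreviation oplus :: permutation where "oplus \<equiv> [1, 2]"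
abbreviation ominus :: permutation where "ominus \<equiv> [2, 1]"

definition simple_permutation :: "permutation \<Rightarrow> bool" where
  "simple_permutation \<sigma> \<longleftrightarrow> is_permutation \<sigma> \<and> length \<sigma> > 2 \<and>
     \<not> (\<exists>i j. i < j \<and> j \<le> length \<sigma> \<and> 2 \<le> j - i \<and> j - i \<le> length \<sigma> - 1 \<and>
          (\<exists>a b. (\<lambda>q. \<sigma> ! q) ` {i..<j} = {a..b}))"

text \<open>The \<open>i\<close>-th block of \<open>\<theta>[\<pi>\<^sub>1,\<dots>,\<pi>\<^sub>d]\<close> is \<open>\<pi>\<^sub>i\<close> shifted by the total size of the blocks
  that \<open>\<theta>\<close> places below it.\<close>

definition inflate :: "permutation \<Rightarrow> permutation list \<Rightarrow> permutation" where
  "inflate \<theta> \<pi>s = concat (map (\<lambda>i.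
     map (\<lambda>x. x + (\<Sum>j | j < length \<theta> \<and> \<theta> ! j < \<theta> ! i. length (\<pi>s ! j))) (\<pi>s ! i))
     [0..<length \<theta>])"

datatype subst_tree = Leaf | Node permutation "subst_tree list"

fun root_label :: "subst_tree \<Rightarrow> permutation option" where
  "root_label Leaf = None"
| "root_label (Node \<theta> ts) = Some \<theta>"

fun tree_perm :: "subst_tree \<Rightarrow> permutation" where
  "tree_perm Leaf = [1]"
| "tree_perm (Node \<theta> ts) = inflate \<theta> (map tree_perm ts)"

fun standard_tree :: "subst_tree \<Rightarrow> bool" where
  "standard_tree Leaf \<longleftrightarrow> True"
| "standard_tree (Node \<theta> ts) \<longleftrightarrow>
     (\<theta> = oplus \<or> \<theta> = ominus \<or> simple_permutation \<theta>) \<and> length ts = length \<theta> \<and>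
     (\<forall>t\<in>set ts. standard_tree t) \<and>
     (\<theta> = oplus \<or> \<theta> = ominus \<longrightarrow> root_label (hd ts) \<noteq> Some \<theta>)"

text \<open>The data of a system of equations for families \<open>\<T>\<^sub>0,\<dots>,\<T>\<^sub>d\<close>: \<open>last_index\<close> is \<open>d\<close>,
  \<open>family i\<close> is \<open>\<T>\<^sub>i\<close>, \<open>leaf_coeff i\<close> is \<open>\<epsilon>\<^sub>i\<close>, and \<open>index_tuples i \<pi>\<close> is the set of tuples
  \<open>(k\<^sub>1,\<dots>,k\<^bsub>|\<pi>|\<^esub>)\<close> allowed for the root label \<open>\<pi>\<close> in the equation of \<open>\<T>\<^sub>i\<close>.\<close>

record tree_system =
  last_index :: nat
  family :: "nat \<Rightarrow> permutation set"
  leaf_coeff :: "nat \<Rightarrow> nat"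
  index_tuples :: "nat \<Rightarrow> permutation \<Rightarrow> nat list set"

definition family_trees :: "tree_system \<Rightarrow> nat \<Rightarrow> subst_tree set" where
  "family_trees S i = {t. standard_tree t \<and> tree_perm t \<in> family S i}"

definition root_labels :: "tree_system \<Rightarrow> nat \<Rightarrow> permutation set" where
  "root_labels S i = {\<pi> \<in> family S i. simple_permutation \<pi>} \<union> {oplus, ominus}"

definition equation_terms :: "tree_system \<Rightarrow> nat \<Rightarrow> (permutation \<times> nat list) set" where
  "equation_terms S i = (SIGMA \<pi>:root_labels S i. index_tuples S i \<pi>)"

definition term_trees :: "tree_system \<Rightarrow> permutation \<times> nat list \<Rightarrow> subst_tree set" where
  "term_trees S = (\<lambda>(\<pi>, k). Node \<pi> ` listset (map (family_trees S) k))"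

text \<open>The leaf is automatically disjoint from every \<^const>\<open>term_trees\<close>. The equation itself
  forces all trees on its right-hand side to be standard.\<close>

definition tree_specification :: "tree_system \<Rightarrow> bool" where
  "tree_specification S \<longleftrightarrow> (\<forall>i \<le> last_index S.
     (\<forall>\<sigma>\<in>family S i. is_permutation \<sigma>) \<and>
     leaf_coeff S i \<in> {0, 1} \<and>
     (\<forall>\<pi>\<in>root_labels S i. \<forall>k\<in>index_tuples S i \<pi>.
        length k = length \<pi> \<and> set k \<subseteq> {..last_index S}) \<and>
     family_trees S i =
       (if leaf_coeff S i = 1 then {Leaf} else {}) \<union> (\<Union>x\<in>equation_terms S i. term_trees S x) \<and>
     disjoint_family_on (term_trees S) (equation_terms S i))"

definition of_size :: "tree_system \<Rightarrow> nat \<Rightarrow> nat \<Rightarrow> permutation set" where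
  "of_size S i n = {\<sigma> \<in> family S i. length \<sigma> = n}"

definition genfun :: "tree_system \<Rightarrow> nat \<Rightarrow> real fps" where
  "genfun S i = Abs_fps (\<lambda>n. of_nat (card (of_size S i n)))"

text \<open>Coefficientwise sum of a family of formal power series. In the uses below only finitely
  many members of the family contribute to a given coefficient.\<close>

definition fps_infsum :: "('a \<Rightarrow> real fps) \<Rightarrow> 'a set \<Rightarrow> real fps" where
  "fps_infsum f A = Abs_fps (\<lambda>n. \<Sum>\<^sub>\<infinity>x\<in>A. fps_nth (f x) n)"

text \<open>\<open>F_subst S i Y\<close> is \<open>F\<^sub>i(Y\<^sub>0,\<dots>,Y\<^sub>d)\<close>, and \<open>dF_subst S i j Y\<close> is the (term by term) partial
  derivative of \<open>F\<^sub>i\<close> with respect to \<open>y\<^sub>j\<close>, evaluated at \<open>(Y\<^sub>0,\<dots>,Y\<^sub>d)\<close>. The \<open>Y\<^sub>k\<close> are meant to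
  be power series without constant term.\<close>

definition F_subst :: "tree_system \<Rightarrow> nat \<Rightarrow> (nat \<Rightarrow> real fps) \<Rightarrow> real fps" where
  "F_subst S i Y = fps_infsum (\<lambda>(\<pi>, k). \<Prod>q<length \<pi>. Y (k ! q)) (equation_terms S i)"

definition dF_subst :: "tree_system \<Rightarrow> nat \<Rightarrow> nat \<Rightarrow> (nat \<Rightarrow> real fps) \<Rightarrow> real fps" where
  "dF_subst S i j Y =
     fps_infsum (\<lambda>(\<pi>, k). \<Sum>l | l < length \<pi> \<and> k ! l = j. \<Prod>q\<in>{..<length \<pi>} - {l}. Y (k ! q))
       (equation_terms S i)"

definition rho :: "tree_system \<Rightarrow> ereal" where
  "rho S = Min ((\<lambda>i. fps_conv_radius (genfun S i)) ` {..last_index S})"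

definition critical :: "tree_system \<Rightarrow> nat set" where
  "critical S = {i. i \<le> last_index S \<and> fps_conv_radius (genfun S i) = rho S}"

definition subcritical :: "tree_system \<Rightarrow> nat set" where
  "subcritical S = {..last_index S} - critical S"

definition periodic_fps :: "real fps \<Rightarrow> bool" where
  "periodic_fps f \<longleftrightarrow> (\<exists>r d. d \<ge> 2 \<and> {n. fps_nth f n \<noteq> 0} \<subseteq> {r + d * m | m. True})"

text \<open>\<open>(j, i)\<close> is an edge when \<open>\<T>\<^sub>j\<close> appears in the equation of \<open>\<T>\<^sub>i\<close>.\<close>

definition dependency :: "tree_system \<Rightarrow> (nat \<times> nat) set" where
  "dependency S = {(j, i). i \<le> last_index S \<and> j \<le> last_index S \<and>
     (\<exists>(\<pi>, k)\<in>equation_terms S i. j \<in> set k)}"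

definition induced_strongly_connected :: "(nat \<times> nat) set \<Rightarrow> nat set \<Rightarrow> bool" where
  "induced_strongly_connected E V \<longleftrightarrow> (\<forall>i\<in>V. \<forall>j\<in>V. (i, j) \<in> (Restr E V)\<^sup>*)"

definition essentially_branching :: "tree_system \<Rightarrow> bool" where
  "essentially_branching S \<longleftrightarrow> (\<exists>i\<in>critical S. \<exists>(\<pi>, k)\<in>equation_terms S i.
     \<exists>p q. p < q \<and> q < length k \<and> k ! p \<in> critical S \<and> k ! q \<in> critical S)"

abbreviation essentially_linear :: "tree_system \<Rightarrow> bool" where
  "essentially_linear S \<equiv> \<not> essentially_branching S"

datatype side = LeftSide | RightSide
datatype sign = Plus | Minus

text \<open>Position \<open>m\<close> lies on side \<open>e\<close> of position \<open>l\<close>, and both induce the sign \<open>s\<close> in \<open>\<pi>\<close>.\<close>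

definition on_side :: "side \<Rightarrow> nat \<Rightarrow> nat \<Rightarrow> bool" where
  "on_side e l m \<longleftrightarrow> (case e of LeftSide \<Rightarrow> m < l | RightSide \<Rightarrow> m > l)"

definition induces_sign :: "sign \<Rightarrow> permutation \<Rightarrow> nat \<Rightarrow> nat \<Rightarrow> bool" where
  "induces_sign s \<pi> l m \<longleftrightarrow>
     (let c = (int m - int l) * (int (\<pi> ! m) - int (\<pi> ! l))
      in case s of Plus \<Rightarrow> c > 0 | Minus \<Rightarrow> c < 0)"

definition M_star :: "tree_system \<Rightarrow> nat \<Rightarrow> nat \<Rightarrow> real fps" where
  "M_star S i j = dF_subst S i j (genfun S)"

definition D_star :: "tree_system \<Rightarrow> side \<Rightarrow> sign \<Rightarrow> nat \<Rightarrow> nat \<Rightarrow> real fps" where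
  "D_star S e s i j = fps_infsum (\<lambda>(\<pi>, k).
     \<Sum>l | l < length \<pi> \<and> k ! l = j.
       \<Sum>m | m < length \<pi> \<and> on_side e l m \<and> induces_sign s \<pi> l m.
         fps_deriv (genfun S (k ! m)) * (\<Prod>q\<in>{..<length \<pi>} - {l, m}. genfun S (k ! q)))
     (equation_terms S i)"

definition at_rho :: "tree_system \<Rightarrow> (nat \<Rightarrow> nat \<Rightarrow> real fps) \<Rightarrow> nat \<Rightarrow> nat \<Rightarrow> real" where
  "at_rho S A i j = eval_fps (A i j) (real_of_ereal (rho S))"

text \<open>Matrices and vectors indexed by a finite set \<open>I\<close> of natural numbers (here \<open>I\<^sup>\<star>\<close>, which
  depends on the specification) are functions, considered on \<open>I\<close> only.\<close>

definition bilinear_value ::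
    "nat set \<Rightarrow> (nat \<Rightarrow> real) \<Rightarrow> (nat \<Rightarrow> nat \<Rightarrow> real) \<Rightarrow> (nat \<Rightarrow> real) \<Rightarrow> real" where
  "bilinear_value I u A v = (\<Sum>i\<in>I. \<Sum>j\<in>I. u i * A i j * v j)"

definition complex_eigenvalue :: "nat set \<Rightarrow> (nat \<Rightarrow> nat \<Rightarrow> real) \<Rightarrow> complex \<Rightarrow> bool" where
  "complex_eigenvalue I A c \<longleftrightarrow> (\<exists>x :: nat \<Rightarrow> complex.
     (\<exists>i\<in>I. x i \<noteq> 0) \<and> (\<forall>i\<in>I. (\<Sum>j\<in>I. of_real (A i j) * x j) = c * x i))"

definition perron_eigenvalue :: "nat set \<Rightarrow> (nat \<Rightarrow> nat \<Rightarrow> real) \<Rightarrow> real \<Rightarrow> bool" where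
  "perron_eigenvalue I A r \<longleftrightarrow> r \<ge> 0 \<and> complex_eigenvalue I A (of_real r) \<and>
     (\<forall>c. complex_eigenvalue I A c \<longrightarrow> cmod c \<le> r)"

definition positive_eigenvectors ::
    "nat set \<Rightarrow> (nat \<Rightarrow> nat \<Rightarrow> real) \<Rightarrow> real \<Rightarrow> (nat \<Rightarrow> real) \<Rightarrow> (nat \<Rightarrow> real) \<Rightarrow> bool" where
  "positive_eigenvectors I A r u v \<longleftrightarrow>
     (\<forall>i\<in>I. u i > 0) \<and> (\<forall>i\<in>I. v i > 0) \<and>
     (\<forall>j\<in>I. (\<Sum>i\<in>I. u i * A i j) = r * u j) \<and>
     (\<forall>i\<in>I. (\<Sum>j\<in>I. A i j * v j) = r * v i) \<and>
     (\<Sum>i\<in>I. u i * v i) = 1"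

abbreviation unit_square :: "(real \<times> real) set" where
  "unit_square \<equiv> {0..1} \<times> {0..1}"

abbreviation square_borel :: "(real \<times> real) measure" where
  "square_borel \<equiv> restrict_space borel unit_square"

definition permutons :: "(real \<times> real) measure set" where
  "permutons = {\<mu>. prob_space \<mu> \<and> sets \<mu> = sets square_borel \<and>
     distr \<mu> borel fst = uniform_measure lborel {0..1} \<and>
     distr \<mu> borel snd = uniform_measure lborel {0..1}}"

definition weak_topology_permutons :: "(real \<times> real) measure topology" where
  "weak_topology_permutons = topology_generated_by
     {{\<mu> \<in> permutons. (\<integral>x. f x \<partial>\<mu>) \<in> U} | (f :: real \<times> real \<Rightarrow> real) U.
        continuous_on unit_square f \<and> open U}"

text \<open>Convergence in distribution, along the filter \<open>G\<close>, of random elements of the space \<open>X\<close>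
  whose laws are the (discrete) distributions \<open>P n\<close>, to the law \<open>Q\<close>.\<close>

definition converges_in_distribution ::
    "'a topology \<Rightarrow> ('i \<Rightarrow> 'a pmf) \<Rightarrow> 'a pmf \<Rightarrow> 'i filter \<Rightarrow> bool" where
  "converges_in_distribution X P Q G \<longleftrightarrow>
     (\<forall>\<Phi>. continuous_map X euclideanreal \<Phi> \<and> bounded (\<Phi> ` topspace X) \<longrightarrow>
        ((\<lambda>n. measure_pmf.expectation (P n) \<Phi>) \<longlongrightarrow> measure_pmf.expectation Q \<Phi>) G)"

text \<open>The index \<open>nat \<lceil>x n\<rceil> - 1\<close> is the list position of \<open>\<lceil>x n\<rceil>\<close>; it is meaningful for
  \<open>0 < x \<le> 1\<close>, that is, outside a null set.\<close>

definition permuton_of :: "permutation \<Rightarrow> (real \<times> real) measure" where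
  "permuton_of \<sigma> = density (restrict_space lborel unit_square)
     (\<lambda>(x, y). ennreal (real (length \<sigma>) *
        of_bool (int (\<sigma> ! (nat \<lceil>x * real (length \<sigma>)\<rceil> - 1)) = \<lceil>y * real (length \<sigma>)\<rceil>)))"

text \<open>Normalized length measure on \<open>[P, Q]\<close>, as image of the uniform measure on \<open>[0, 1]\<close>
  (a Dirac mass if \<open>P = Q\<close>, which only occurs with weight zero in \<open>X_permuton\<close>).\<close>

definition segment_measure :: "real \<times> real \<Rightarrow> real \<times> real \<Rightarrow> (real \<times> real) measure" where
  "segment_measure P Q = distr (restrict_space lborel {0..1}) square_borel (linepath P Q)"

fun corner :: "side \<Rightarrow> sign \<Rightarrow> real \<times> real" where
  "corner LeftSide Plus = (0, 0)"
| "corner LeftSide Minus = (0, 1)"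
| "corner RightSide Minus = (1, 0)"
| "corner RightSide Plus = (1, 1)"

definition X_permuton :: "(side \<Rightarrow> sign \<Rightarrow> real) \<Rightarrow> (real \<times> real) measure" where
  "X_permuton p =
     (let a = p LeftSide Plus + p LeftSide Minus;
          b = p LeftSide Plus + p RightSide Minus
      in measure_of unit_square (sets square_borel)
           (\<lambda>B. \<Sum>e\<in>{LeftSide, RightSide}. \<Sum>s\<in>{Plus, Minus}.
              ennreal (p e s) * emeasure (segment_measure (corner e s) (a, b)) B))"

end

theory Submission
  imports Defs
begin

text \<open>In the essentially linear case every tree of a critical family consists of a spine of
  critical vertices, along which contexts with subcritical side trees are stacked, and of a terminal
  tree without critical vertex below the root. The critical matrix at \<open>\<rho>\<close> is the transfer matrix of
  these stacks. Its Perron eigenvalue is \<open>1\<close>: a smaller value would let the series converge beyond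
  \<open>\<rho>\<close>, a larger one would make them diverge before \<open>\<rho>\<close>. Since the contexts and the terminal trees
  have exponentially small tails, a Chernoff bound shows that, up to an exponentially small proportion
  of trees, every initial piece of the spine carries on each side \<open>e\<close> and with each sign \<open>\<epsilon>\<close> a
  proportion close to \<open>p\<close> of its leaves. Supermultiplicativity of the numbers of closed spines
  gives a subexponential lower bound for \<open>\<rho>\<^sup>n\<close> times the number of trees of size \<open>n\<close>, so that the
  exceptional trees are negligible without any singularity analysis. For the other trees the position
  of every leaf is determined, up to a small error, by the height at which it is attached to the spine
  and by its type \<open>(e, \<epsilon>)\<close>; this is the \<open>X\<close>-permuton.\<close>

section \<open>Inflations and blocks\<close>

text \<open>The families are sets of permutations while the equations speak of trees, so the
  bijection between standard trees and permutations has to be proved before coefficients can be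
  counted. Essential linearity leaves at most one critical child at each critical vertex; this makes
  filling a context injective, and \<open>M_star\<close> and \<open>D_star\<close> then count
  contexts, without and with a marked leaf. The formula for p is a solvability condition. Tilting
  the weight of a context by exp (s X) moves the eigenvalue 1, to first order in s, by s times the
  pairing of u and v with the mean of X. For X = (number of leaves of one type) - p (number of all
  leaves) this vanishes exactly for the stated p, so only O(s^2) is lost per level while a deviation
  \<delta> n gains exp (- s \<delta> n). The sizes that occur in a critical family may leave gaps,
  so the lower bound is proved for each n that occurs: closed spines of one fixed size m are put
  repeatedly above a smallest tree in each residue class modulo m. The price exp (- \<epsilon> n) is
  harmless, because every exceptional set has an exponential rate of its own and \<epsilon> is
  chosen after it.\<close>

lemma is_permutation_iff:
  "is_permutation \<sigma> \<longleftrightarrow> \<sigma> \<noteq> [] \<and> distinct \<sigma> \<and> set \<sigma> = {1..length \<sigma>}"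
  by (auto simp: is_permutation_def permutations_of_set_def)

lemma permutation_nth_eq_iff:
  assumes "is_permutation \<sigma>" "p < length \<sigma>" "q < length \<sigma>"
  shows "\<sigma> ! p = \<sigma> ! q \<longleftrightarrow> p = q"
  using assms by (simp add: is_permutation_iff nth_eq_iff_index_eq)

text \<open>The values are exactly 1, ..., n, so each value is its own rank. Hence a permutation can
  be recovered from its pairwise comparisons.\<close>

lemma permutation_nth_rank:
  assumes "is_permutation \<sigma>" "q < length \<sigma>"
  shows "\<sigma> ! q = card {p. p < length \<sigma> \<and> \<sigma> ! p \<le> \<sigma> ! q}"
proof -
  have d: "distinct \<sigma>" and s: "set \<sigma> = {1..length \<sigma>}"
    using assms by (auto simp: is_permutation_iff)
  have "inj_on (\<lambda>p. \<sigma> ! p) {p. p < length \<sigma> \<and> \<sigma> ! p \<le> \<sigma> ! q}"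
    using d by (auto simp: inj_on_def nth_eq_iff_index_eq)
  then have "card {p. p < length \<sigma> \<and> \<sigma> ! p \<le> \<sigma> ! q}
      = card ((\<lambda>p. \<sigma> ! p) ` {p. p < length \<sigma> \<and> \<sigma> ! p \<le> \<sigma> ! q})"
    by (simp add: card_image)
  also have "(\<lambda>p. \<sigma> ! p) ` {p. p < length \<sigma> \<and> \<sigma> ! p \<le> \<sigma> ! q} = {v \<in> set \<sigma>. v \<le> \<sigma> ! q}"
    by (auto simp: in_set_conv_nth)
  also have "\<dots> = {1..\<sigma> ! q}"
    using s assms(2) nth_mem[OF assms(2)] by auto
  finally show ?thesis by simp
qed

text \<open>Ranks depend on comparisons only. Equality of inflations and of skeletons is always
  established through this criterion, never by computing values.\<close>

lemma permutation_eqI: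
  assumes "is_permutation \<sigma>" "is_permutation \<tau>" "length \<sigma> = length \<tau>"
    and "\<And>p q. p < length \<sigma> \<Longrightarrow> q < length \<sigma> \<Longrightarrow> \<sigma> ! p < \<sigma> ! q \<longleftrightarrow> \<tau> ! p < \<tau> ! q"
  shows "\<sigma> = \<tau>"
proof (rule nth_equalityI[OF assms(3)])
  fix q assume q: "q < length \<sigma>"
  have "{p. p < length \<sigma> \<and> \<sigma> ! p \<le> \<sigma> ! q} = {p. p < length \<tau> \<and> \<tau> ! p \<le> \<tau> ! q}"
    using assms(3,4) q by (auto simp: not_less[symmetric])
  then show "\<sigma> ! q = \<tau> ! q"
    using permutation_nth_rank[OF assms(1) q] permutation_nth_rank[OF assms(2)] q assms(3) by simp
qed

lemma permutationI:
  assumes "\<sigma> \<noteq> []" "distinct \<sigma>" "set \<sigma> \<subseteq> {1..length \<sigma>}"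
  shows "is_permutation \<sigma>"
proof -
  have "set \<sigma> = {1..length \<sigma>}"
    using assms by (intro card_subset_eq) (auto simp: distinct_card)
  then show ?thesis using assms by (simp add: is_permutation_iff)
qed

text \<open>The pattern of a word: for distinct entries it is the unique permutation
  order-isomorphic to \<open>xs\<close>.\<close>

definition standardize :: "nat list \<Rightarrow> permutation" where
  "standardize xs = map (\<lambda>x. card {y \<in> set xs. y \<le> x}) xs"

lemma length_standardize [simp]: "length (standardize xs) = length xs"
  by (simp add: standardize_def)

lemma standardize_less_iff:
  assumes "p < length xs" "q < length xs"
  shows "standardize xs ! p < standardize xs ! q \<longleftrightarrow> xs ! p < xs ! q"
proof -
  have *: "card {y \<in> set xs. y \<le> a} < card {y \<in> set xs. y \<le> b}" if "a < b" "b \<in> set xs" for a b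
  proof (rule psubset_card_mono)
    have "b \<in> {y \<in> set xs. y \<le> b}" "b \<notin> {y \<in> set xs. y \<le> a}" using that by auto
    then show "{y \<in> set xs. y \<le> a} \<subset> {y \<in> set xs. y \<le> b}" using that by fastforce
  qed simp
  have **: "card {y \<in> set xs. y \<le> a} \<le> card {y \<in> set xs. y \<le> b}" if "a \<le> b" for a b
    using that by (intro card_mono) auto
  show ?thesis
    using *[of "xs ! p" "xs ! q"] **[of "xs ! q" "xs ! p"] assms
    by (auto simp: standardize_def not_less[symmetric])
qed

lemma is_permutation_standardize:
  assumes "distinct xs" "xs \<noteq> []"
  shows "is_permutation (standardize xs)"
proof (rule permutationI)
  show "standardize xs \<noteq> []" using assms by (simp add: standardize_def)
  show "distinct (standardize xs)"
  proof (rule distinct_conv_nth[THEN iffD2], intro allI impI)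
    fix i j assume "i < length (standardize xs)" "j < length (standardize xs)" "i \<noteq> j"
    then show "standardize xs ! i \<noteq> standardize xs ! j"
      using standardize_less_iff[of i xs j] standardize_less_iff[of j xs i] assms(1)
      by (metis length_standardize linorder_neq_iff nth_eq_iff_index_eq)
  qed
  show "set (standardize xs) \<subseteq> {1..length (standardize xs)}"
  proof
    fix v assume "v \<in> set (standardize xs)"
    then obtain x where x: "x \<in> set xs" "v = card {y \<in> set xs. y \<le> x}"
      by (auto simp: standardize_def)
    have "v \<le> card (set xs)" unfolding x by (intro card_mono) auto
    moreover have "v > 0" unfolding x using x(1) by (subst card_gt_0_iff) auto
    ultimately show "v \<in> {1..length (standardize xs)}"
      using card_length[of xs] by auto
  qed
qed

text \<open>No value outside the positions i, ..., j - 1 separates two values inside. The condition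
  uses comparisons alone, so it passes between a permutation and its skeleton without any
  computation of values.\<close>

definition block :: "permutation \<Rightarrow> nat \<Rightarrow> nat \<Rightarrow> bool" where
  "block \<sigma> i j \<longleftrightarrow> (\<forall>q<length \<sigma>. q \<notin> {i..<j} \<longrightarrow>
     (\<forall>p\<in>{i..<j}. \<forall>p'\<in>{i..<j}. \<sigma> ! q < \<sigma> ! p \<longleftrightarrow> \<sigma> ! q < \<sigma> ! p'))"

lemma blockD:
  assumes "block \<sigma> i j" "q < length \<sigma>" "q \<notin> {i..<j}" "p \<in> {i..<j}" "p' \<in> {i..<j}"
  shows "\<sigma> ! q < \<sigma> ! p \<longleftrightarrow> \<sigma> ! q < \<sigma> ! p'"
  using assms unfolding block_def by blast

text \<open>Every integer between the minimum and the maximum of the image is a value of \<sigma>;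
  if it were attained outside the block, it would separate these two entries.\<close>

lemma block_iff_interval:
  assumes "is_permutation \<sigma>" "i < j" "j \<le> length \<sigma>"
  shows "block \<sigma> i j \<longleftrightarrow> (\<exists>a b. (\<lambda>q. \<sigma> ! q) ` {i..<j} = {a..b})"
proof
  assume bl: "block \<sigma> i j"
  define A where "A = (\<lambda>q. \<sigma> ! q) ` {i..<j}"
  have fin: "finite A" "A \<noteq> {}" using assms by (auto simp: A_def)
  have "A = {Min A..Max A}"
  proof
    show "A \<subseteq> {Min A..Max A}" using fin by auto
    show "{Min A..Max A} \<subseteq> A"
    proof
      fix v assume v: "v \<in> {Min A..Max A}"
      obtain p where p: "p \<in> {i..<j}" "Min A = \<sigma> ! p" using Min_in[OF fin] by (auto simp: A_def)
      obtain p' where p': "p' \<in> {i..<j}" "Max A = \<sigma> ! p'" using Max_in[OF fin] by (auto simp: A_def)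
      have pp: "p < length \<sigma>" "p' < length \<sigma>" using p p' assms by auto
      have set: "set \<sigma> = {1..length \<sigma>}" using assms by (simp add: is_permutation_iff)
      have "1 \<le> \<sigma> ! p" "\<sigma> ! p' \<le> length \<sigma>" using nth_mem[OF pp(1)] nth_mem[OF pp(2)] unfolding set by auto
      then have "v \<in> set \<sigma>" using v p p' unfolding set by auto
      then obtain q where q: "q < length \<sigma>" "v = \<sigma> ! q" by (auto simp: in_set_conv_nth)
      show "v \<in> A"
      proof (cases "q \<in> {i..<j}")
        case False
        have "\<sigma> ! q < \<sigma> ! p \<longleftrightarrow> \<sigma> ! q < \<sigma> ! p'" using blockD[OF bl q(1) False p(1) p'(1)] .
        moreover have "\<sigma> ! q \<noteq> \<sigma> ! p'" using False p'(1) q(1) pp permutation_nth_eq_iff[OF assms(1), of q p'] by auto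
        ultimately show ?thesis using v p(2) p'(2) q(2) by auto
      qed (auto simp: A_def q)
    qed
  qed
  then show "\<exists>a b. (\<lambda>q. \<sigma> ! q) ` {i..<j} = {a..b}" unfolding A_def by blast
next
  assume "\<exists>a b. (\<lambda>q. \<sigma> ! q) ` {i..<j} = {a..b}"
  then obtain a b where ab: "(\<lambda>q. \<sigma> ! q) ` {i..<j} = {a..b}" by blast
  show "block \<sigma> i j" unfolding block_def
  proof (intro allI impI ballI)
    fix q p p' assume q: "q < length \<sigma>" "q \<notin> {i..<j}" and p: "p \<in> {i..<j}" "p' \<in> {i..<j}"
    have "\<sigma> ! q \<notin> {a..b}"
    proof
      assume "\<sigma> ! q \<in> {a..b}"
      then obtain r where "r \<in> {i..<j}" "\<sigma> ! q = \<sigma> ! r" using ab by (metis imageE)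
      then show False using q permutation_nth_eq_iff[OF assms(1), of q r] assms by auto
    qed
    moreover have "\<sigma> ! p \<in> {a..b}" "\<sigma> ! p' \<in> {a..b}" using ab p by blast+
    ultimately show "\<sigma> ! q < \<sigma> ! p \<longleftrightarrow> \<sigma> ! q < \<sigma> ! p'" by auto
  qed
qed

lemma simple_permutation_iff_block:
  "simple_permutation \<sigma> \<longleftrightarrow> is_permutation \<sigma> \<and> length \<sigma> > 2 \<and>
    (\<forall>i j. i < j \<longrightarrow> j \<le> length \<sigma> \<longrightarrow> 2 \<le> j - i \<longrightarrow> j - i \<le> length \<sigma> - 1 \<longrightarrow> \<not> block \<sigma> i j)"
proof (cases "is_permutation \<sigma>")
  case True
  show ?thesis unfolding simple_permutation_def
    by (simp add: True) (metis True block_iff_interval)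
qed (simp add: simple_permutation_def)

text \<open>The \<open>i\<close>-th block of \<open>\<sigma>\<close>, seen as an inflation of \<open>\<theta>\<close>, occupies the positions
  \<open>{s i..<s (Suc i)}\<close>.\<close>

definition blocks :: "permutation \<Rightarrow> permutation \<Rightarrow> (nat \<Rightarrow> nat) \<Rightarrow> bool" where
  "blocks \<sigma> \<theta> s \<longleftrightarrow> s 0 = 0 \<and> s (length \<theta>) = length \<sigma> \<and> (\<forall>i<length \<theta>. s i < s (Suc i)) \<and>
     (\<forall>i<length \<theta>. \<forall>j<length \<theta>. i \<noteq> j \<longrightarrow>
       (\<forall>q\<in>{s i..<s (Suc i)}. \<forall>q'\<in>{s j..<s (Suc j)}. \<sigma> ! q < \<sigma> ! q' \<longleftrightarrow> \<theta> ! i < \<theta> ! j))"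

lemma blocks_strict_mono:
  assumes "blocks \<sigma> \<theta> s" "i < j" "j \<le> length \<theta>"
  shows "s i < s j"
  using assms(2,3)
proof (induction j)
  case (Suc j)
  then have "s j < s (Suc j)" using assms(1) by (auto simp: blocks_def)
  with Suc show ?case by (cases "i = j") (auto intro: less_trans)
qed simp

lemma blocks_mono:
  assumes "blocks \<sigma> \<theta> s" "i \<le> j" "j \<le> length \<theta>"
  shows "s i \<le> s j"
  using blocks_strict_mono[OF assms(1), of i j] assms by (cases "i = j") auto

lemma blocks_le_length:
  assumes "blocks \<sigma> \<theta> s" "j \<le> length \<theta>"
  shows "s j \<le> length \<sigma>"
  using blocks_mono[OF assms(1), of j "length \<theta>"] assms by (auto simp: blocks_def)

lemma blocks_find:
  assumes "blocks \<sigma> \<theta> s" "q < length \<sigma>"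
  obtains i where "i < length \<theta>" "s i \<le> q" "q < s (Suc i)"
proof -
  have ex: "\<exists>k. q < s k" using assms by (intro exI[of _ "length \<theta>"]) (auto simp: blocks_def)
  define k where "k = (LEAST k. q < s k)"
  have k: "q < s k" unfolding k_def by (rule LeastI_ex[OF ex])
  have "k \<noteq> 0" using k assms by (auto simp: blocks_def intro!: gr0I)
  then obtain i where i: "k = Suc i" by (cases k) auto
  have "\<not> q < s i" using not_less_Least[of i "\<lambda>k. q < s k"] i k_def by auto
  moreover have "k \<le> length \<theta>" unfolding k_def using assms by (intro Least_le) (auto simp: blocks_def)
  ultimately show ?thesis using that[of i] k i by auto
qed

lemma blocks_less_iff:
  assumes "blocks \<sigma> \<theta> s" "i < length \<theta>" "j < length \<theta>" "i \<noteq> j"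
    "s i \<le> q" "q < s (Suc i)" "s j \<le> q'" "q' < s (Suc j)"
  shows "\<sigma> ! q < \<sigma> ! q' \<longleftrightarrow> \<theta> ! i < \<theta> ! j"
  using assms unfolding blocks_def by auto

lemma blocks_start_less_iff:
  assumes "blocks \<sigma> \<theta> s" "i < length \<theta>" "j < length \<theta>" "i \<noteq> j"
  shows "\<sigma> ! (s i) < \<sigma> ! (s j) \<longleftrightarrow> \<theta> ! i < \<theta> ! j"
  using assms blocks_less_iff[OF assms, of "s i" "s j"] by (auto simp: blocks_def)

text \<open>Comparisons between different blocks are those of \<theta>, and every position lies in
  some block. This is how the simplicity of \<theta> constrains the intervals of \<sigma>.\<close>

lemma blocks_block_iff:
  assumes bl: "blocks \<sigma> \<theta> s" and ij: "i < j" "j \<le> length \<theta>"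
  shows "block \<sigma> (s i) (s j) \<longleftrightarrow> block \<theta> i j"
proof
  assume b: "block \<sigma> (s i) (s j)"
  show "block \<theta> i j" unfolding block_def
  proof (intro allI impI ballI)
    fix q p p' assume q: "q < length \<theta>" "q \<notin> {i..<j}" and p: "p \<in> {i..<j}" "p' \<in> {i..<j}"
    have "s q \<notin> {s i..<s j}"
      using q ij blocks_strict_mono[OF bl, of q i] blocks_mono[OF bl, of j q]
      by (cases "q < i") auto
    moreover have "s p \<in> {s i..<s j}" "s p' \<in> {s i..<s j}"
      using p ij blocks_mono[OF bl, of i p] blocks_strict_mono[OF bl, of p j]
        blocks_mono[OF bl, of i p'] blocks_strict_mono[OF bl, of p' j] by auto
    moreover have "s q < length \<sigma>" using q bl blocks_strict_mono[OF bl, of q "length \<theta>"]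
      by (auto simp: blocks_def)
    ultimately have "\<sigma> ! s q < \<sigma> ! s p \<longleftrightarrow> \<sigma> ! s q < \<sigma> ! s p'" using blockD[OF b] by blast
    then show "\<theta> ! q < \<theta> ! p \<longleftrightarrow> \<theta> ! q < \<theta> ! p'"
      using blocks_start_less_iff[OF bl, of q p] blocks_start_less_iff[OF bl, of q p'] p q ij by auto
  qed
next
  assume b: "block \<theta> i j"
  show "block \<sigma> (s i) (s j)" unfolding block_def
  proof (intro allI impI ballI)
    fix q p p' assume q: "q < length \<sigma>" "q \<notin> {s i..<s j}" and p: "p \<in> {s i..<s j}" "p' \<in> {s i..<s j}"
    have len: "s j \<le> length \<sigma>" using blocks_le_length[OF bl ij(2)] .
    obtain a where a: "a < length \<theta>" "s a \<le> q" "q < s (Suc a)" using blocks_find[OF bl q(1)] .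
    have in_ij: "c \<in> {i..<j}" if "c < length \<theta>" "s c \<le> r" "r < s (Suc c)" "r \<in> {s i..<s j}" for c r
      using that ij blocks_mono[OF bl, of "Suc c" i] blocks_mono[OF bl, of j c]
      by (cases "c < i"; cases "c < j") auto
    obtain c where c: "c < length \<theta>" "s c \<le> p" "p < s (Suc c)" using blocks_find[OF bl, of p] p len by auto
    obtain c' where c': "c' < length \<theta>" "s c' \<le> p'" "p' < s (Suc c')"
      using blocks_find[OF bl, of p'] p len by auto
    have "a \<notin> {i..<j}"
      using a q ij blocks_mono[OF bl, of i a] blocks_mono[OF bl, of "Suc a" j] by auto
    moreover have "c \<in> {i..<j}" "c' \<in> {i..<j}" using in_ij[OF c p(1)] in_ij[OF c' p(2)] by auto
    ultimately have "\<theta> ! a < \<theta> ! c \<longleftrightarrow> \<theta> ! a < \<theta> ! c'" "a \<noteq> c" "a \<noteq> c'"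
      using blockD[OF b a(1), of c c'] by auto
    then show "\<sigma> ! q < \<sigma> ! p \<longleftrightarrow> \<sigma> ! q < \<sigma> ! p'"
      using blocks_less_iff[OF bl a(1) c(1) _ a(2,3) c(2,3)]
        blocks_less_iff[OF bl a(1) c'(1) _ a(2,3) c'(2,3)] by simp
  qed
qed

lemma block_singleton: "block \<sigma> i (Suc i)"
  by (auto simp: block_def)

lemma blocks_block:
  assumes "blocks \<sigma> \<theta> s" "i < length \<theta>"
  shows "block \<sigma> (s i) (s (Suc i))"
  using assms blocks_block_iff[OF assms(1), of i "Suc i"] block_singleton by auto

section \<open>Inflations as concatenations of shifted blocks\<close>

lemma sum_block_find:
  fixes l :: "nat \<Rightarrow> nat"
  assumes "q < (\<Sum>j<d. l j)"
  shows "\<exists>i p. i < d \<and> p < l i \<and> q = (\<Sum>j<i. l j) + p"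
  using assms
proof (induction d)
  case (Suc d)
  show ?case
  proof (cases "q < (\<Sum>j<d. l j)")
    case True
    then show ?thesis using Suc.IH less_Suc_eq by blast
  next
    case False
    then have "q = (\<Sum>j<d. l j) + (q - (\<Sum>j<d. l j))" "q - (\<Sum>j<d. l j) < l d" using Suc.prems by auto
    then show ?thesis by blast
  qed
qed simp

lemma nth_concat_block:
  assumes "i < length xss" "p < length (xss ! i)"
  shows "concat xss ! ((\<Sum>j<i. length (xss ! j)) + p) = xss ! i ! p"
  using assms
proof (induction xss arbitrary: i)
  case (Cons xs xss)
  show ?case
  proof (cases i)
    case 0
    then show ?thesis using Cons.prems by (simp add: nth_append)
  next
    case (Suc k)
    then show ?thesis using Cons.prems Cons.IH[of k]
      by (simp add: sum.lessThan_Suc_shift nth_append del: sum.lessThan_Suc)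
  qed
qed simp

lemma length_inflate:
  "length (inflate \<theta> \<pi>s) = (\<Sum>j<length \<theta>. length (\<pi>s ! j))"
  by (simp add: inflate_def length_concat o_def interv_sum_list_conv_sum_set_nat atLeast0LessThan)

lemma nth_inflate:
  assumes "i < length \<theta>" "p < length (\<pi>s ! i)"
  shows "inflate \<theta> \<pi>s ! ((\<Sum>j<i. length (\<pi>s ! j)) + p) =
    \<pi>s ! i ! p + (\<Sum>j | j < length \<theta> \<and> \<theta> ! j < \<theta> ! i. length (\<pi>s ! j))"
proof -
  define xss where "xss = map (\<lambda>i. map (\<lambda>x. x + (\<Sum>j | j < length \<theta> \<and> \<theta> ! j < \<theta> ! i. length (\<pi>s ! j))) (\<pi>s ! i))
     [0..<length \<theta>]"
  have "(\<Sum>j<i. length (\<pi>s ! j)) = (\<Sum>j<i. length (xss ! j))"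
    using assms by (intro sum.cong) (auto simp: xss_def)
  then have "inflate \<theta> \<pi>s ! ((\<Sum>j<i. length (\<pi>s ! j)) + p) = concat xss ! ((\<Sum>j<i. length (xss ! j)) + p)"
    by (simp add: inflate_def xss_def)
  also have "\<dots> = xss ! i ! p" using assms by (intro nth_concat_block) (auto simp: xss_def)
  finally show ?thesis using assms by (simp add: xss_def)
qed

text \<open>The values of block i fill the stretch of integers just above its offset, the total size
  of the blocks which \<theta> places below it; these stretches are stacked in the order of
  \<theta>.\<close>

lemma inflate_blocks:
  assumes \<theta>: "is_permutation \<theta>" and len: "length \<pi>s = length \<theta>"
    and \<pi>s: "\<And>i. i < length \<theta> \<Longrightarrow> is_permutation (\<pi>s ! i)"
  defines "s \<equiv> \<lambda>i. \<Sum>j<i. length (\<pi>s ! j)"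
  shows "is_permutation (inflate \<theta> \<pi>s)" "blocks (inflate \<theta> \<pi>s) \<theta> s"
    "\<And>i p p'. i < length \<theta> \<Longrightarrow> p < length (\<pi>s ! i) \<Longrightarrow> p' < length (\<pi>s ! i) \<Longrightarrow>
      inflate \<theta> \<pi>s ! (s i + p) < inflate \<theta> \<pi>s ! (s i + p') \<longleftrightarrow> \<pi>s ! i ! p < \<pi>s ! i ! p'"
proof -
  let ?\<sigma> = "inflate \<theta> \<pi>s" and ?d = "length \<theta>"
  define off where "off i = (\<Sum>j | j < ?d \<and> \<theta> ! j < \<theta> ! i. length (\<pi>s ! j))" for i
  have val: "?\<sigma> ! (s i + p) = \<pi>s ! i ! p + off i" if "i < ?d" "p < length (\<pi>s ! i)" for i p
    using nth_inflate[OF that] by (simp add: s_def off_def)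
  have rng: "1 \<le> \<pi>s ! i ! p \<and> \<pi>s ! i ! p \<le> length (\<pi>s ! i)" if "i < ?d" "p < length (\<pi>s ! i)" for i p
    using \<pi>s[OF that(1)] nth_mem[OF that(2)] by (auto simp: is_permutation_iff)
  \<comment> \<open>Adding the length of block i amounts to adding the index i to the index set of
    the sum, and the enlarged set is contained in the one belonging to j.\<close>
  have off_mono: "off i + length (\<pi>s ! i) \<le> off j" if "i < ?d" "j < ?d" "\<theta> ! i < \<theta> ! j" for i j
  proof -
    have "off i + length (\<pi>s ! i) = (\<Sum>j\<in>insert i {j. j < ?d \<and> \<theta> ! j < \<theta> ! i}. length (\<pi>s ! j))"
      by (simp add: off_def)
    also have "\<dots> \<le> off j" unfolding off_def using that by (intro sum_mono2) auto
    finally show ?thesis .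
  qed
  have less: "?\<sigma> ! (s i + p) < ?\<sigma> ! (s j + p') \<longleftrightarrow> \<theta> ! i < \<theta> ! j"
    if "i < ?d" "j < ?d" "i \<noteq> j" "p < length (\<pi>s ! i)" "p' < length (\<pi>s ! j)" for i j p p'
  proof -
    have "\<theta> ! i \<noteq> \<theta> ! j" using permutation_nth_eq_iff[OF \<theta>, of i j] that by auto
    then consider "\<theta> ! i < \<theta> ! j" | "\<theta> ! j < \<theta> ! i" by linarith
    then show ?thesis
      using val[OF that(1,4)] val[OF that(2,5)] rng[OF that(1,4)] rng[OF that(2,5)]
        off_mono[OF that(1,2)] off_mono[OF that(2,1)] by cases auto
  qed
  show same: "?\<sigma> ! (s i + p) < ?\<sigma> ! (s i + p') \<longleftrightarrow> \<pi>s ! i ! p < \<pi>s ! i ! p'"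
    if "i < ?d" "p < length (\<pi>s ! i)" "p' < length (\<pi>s ! i)" for i p p'
    using val that by simp
  have pos: "length (\<pi>s ! i) > 0" if "i < ?d" for i using \<pi>s[OF that] by (auto simp: is_permutation_iff)
  have sn: "s ?d = length ?\<sigma>" by (simp add: s_def length_inflate)
  have find: "\<exists>i p. i < ?d \<and> p < length (\<pi>s ! i) \<and> q = s i + p" if "q < length ?\<sigma>" for q
    using that sum_block_find[of q "\<lambda>j. length (\<pi>s ! j)" ?d] by (auto simp: s_def length_inflate)
  show bl: "blocks ?\<sigma> \<theta> s" unfolding blocks_def
  proof (intro conjI allI impI ballI)
    fix i j q q' assume *: "i < ?d" "j < ?d" "i \<noteq> j" "q \<in> {s i..<s (Suc i)}" "q' \<in> {s j..<s (Suc j)}"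
    then show "?\<sigma> ! q < ?\<sigma> ! q' \<longleftrightarrow> \<theta> ! i < \<theta> ! j"
      using less[of i j "q - s i" "q' - s j"] by (auto simp: s_def)
  qed (use pos sn in \<open>auto simp: s_def\<close>)
  show "is_permutation ?\<sigma>"
  proof (rule permutationI)
    have "?d > 0" using \<theta> by (auto simp: is_permutation_iff)
    then have "0 < s ?d" using blocks_strict_mono[OF bl, of 0 ?d] by auto
    then show "?\<sigma> \<noteq> []" using sn by auto
    show "distinct ?\<sigma>"
    proof (rule distinct_conv_nth[THEN iffD2], intro allI impI)
      fix q q' assume q: "q < length ?\<sigma>" "q' < length ?\<sigma>" "q \<noteq> q'"
      obtain i p where i: "i < ?d" "p < length (\<pi>s ! i)" "q = s i + p" using find[OF q(1)] by blast
      obtain j p' where j: "j < ?d" "p' < length (\<pi>s ! j)" "q' = s j + p'" using find[OF q(2)] by blast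
      show "?\<sigma> ! q \<noteq> ?\<sigma> ! q'"
      proof (cases "i = j")
        case True
        then have "p \<noteq> p'" using i j q by auto
        then show ?thesis using val[OF i(1,2)] val[OF j(1,2)] i j True
          permutation_nth_eq_iff[OF \<pi>s[OF i(1)], of p p'] by auto
      next
        case False
        then have "\<theta> ! i \<noteq> \<theta> ! j" using permutation_nth_eq_iff[OF \<theta>, of i j] i j by auto
        then show ?thesis using less[OF i(1) j(1) False i(2) j(2)] less[OF j(1) i(1) _ j(2) i(2)] False i j
          by auto
      qed
    qed
    show "set ?\<sigma> \<subseteq> {1..length ?\<sigma>}"
    proof
      fix v assume "v \<in> set ?\<sigma>"
      then obtain q where q: "q < length ?\<sigma>" "v = ?\<sigma> ! q" by (auto simp: in_set_conv_nth)
      obtain i p where i: "i < ?d" "p < length (\<pi>s ! i)" "q = s i + p" using find[OF q(1)] by blast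
      have "off i + length (\<pi>s ! i) = (\<Sum>j\<in>insert i {j. j < ?d \<and> \<theta> ! j < \<theta> ! i}. length (\<pi>s ! j))"
        by (simp add: off_def)
      also have "\<dots> \<le> length ?\<sigma>" unfolding length_inflate using i by (intro sum_mono2) auto
      finally show "v \<in> {1..length ?\<sigma>}" using rng[OF i(1,2)] val[OF i(1,2)] q i by auto
    qed
  qed
qed

text \<open>Once the block lengths agree, so do all starting positions and all value offsets, and
  the blocks can be read off entry by entry.\<close>

lemma inflate_inject:
  assumes "length \<pi>s = length \<theta>" "length \<pi>s' = length \<theta>"
    and len: "\<And>i. i < length \<theta> \<Longrightarrow> length (\<pi>s ! i) = length (\<pi>s' ! i)"
    and eq: "inflate \<theta> \<pi>s = inflate \<theta> \<pi>s'"
  shows "\<pi>s = \<pi>s'"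
proof (rule nth_equalityI)
  fix i assume "i < length \<pi>s"
  then have i: "i < length \<theta>" using assms by simp
  show "\<pi>s ! i = \<pi>s' ! i"
  proof (rule nth_equalityI[OF len[OF i]])
    fix p assume p: "p < length (\<pi>s ! i)"
    have "(\<Sum>j<i. length (\<pi>s ! j)) = (\<Sum>j<i. length (\<pi>s' ! j))"
      using i len by (intro sum.cong) auto
    moreover have "(\<Sum>j | j < length \<theta> \<and> \<theta> ! j < \<theta> ! i. length (\<pi>s ! j)) =
        (\<Sum>j | j < length \<theta> \<and> \<theta> ! j < \<theta> ! i. length (\<pi>s' ! j))"
      using len by (intro sum.cong) auto
    ultimately show "\<pi>s ! i ! p = \<pi>s' ! i ! p"
      using nth_inflate[of i \<theta> p \<pi>s] nth_inflate[of i \<theta> p \<pi>s'] i p len[OF i] eq by simp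
  qed
qed (use assms in simp)

text \<open>Each block is replaced by its pattern, and the two permutations are compared by order:
  inside a block the pattern decides, between blocks \<theta> does.\<close>

lemma inflate_of_blocks:
  assumes \<sigma>: "is_permutation \<sigma>" and \<theta>: "is_permutation \<theta>" and bl: "blocks \<sigma> \<theta> s"
  defines "\<pi>s \<equiv> map (\<lambda>i. standardize (take (s (Suc i) - s i) (drop (s i) \<sigma>))) [0..<length \<theta>]"
  shows "\<sigma> = inflate \<theta> \<pi>s"
    and "\<And>i. i < length \<theta> \<Longrightarrow> is_permutation (\<pi>s ! i) \<and> length (\<pi>s ! i) = s (Suc i) - s i"
proof -
  let ?d = "length \<theta>"
  have le: "s (Suc i) \<le> length \<sigma>" if "i < ?d" for i using blocks_le_length[OF bl, of "Suc i"] that by auto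
  have lt: "s i < s (Suc i)" if "i < ?d" for i using bl that by (auto simp: blocks_def)
  show props: "is_permutation (\<pi>s ! i) \<and> length (\<pi>s ! i) = s (Suc i) - s i" if "i < ?d" for i
  proof -
    have "take (s (Suc i) - s i) (drop (s i) \<sigma>) \<noteq> []" using le[OF that] lt[OF that] by simp
    moreover have "distinct (take (s (Suc i) - s i) (drop (s i) \<sigma>))"
      using \<sigma> by (simp add: is_permutation_iff)
    ultimately show ?thesis using that le[OF that] is_permutation_standardize by (simp add: \<pi>s_def)
  qed
  have st: "(\<Sum>j<i. length (\<pi>s ! j)) = s i" if "i \<le> ?d" for i
    using that
  proof (induction i)
    case 0 then show ?case using bl by (simp add: blocks_def)
  next
    case (Suc i) then show ?case using props[of i] lt[of i] by simp
  qed
  have len: "length \<pi>s = ?d" by (simp add: \<pi>s_def)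
  have perms: "\<And>i. i < ?d \<Longrightarrow> is_permutation (\<pi>s ! i)" using props by blast
  note ib = inflate_blocks[OF \<theta> len perms, simplified]
  have lenn: "length \<sigma> = length (inflate \<theta> \<pi>s)"
    using st[of ?d] bl by (simp add: length_inflate blocks_def)
  show "\<sigma> = inflate \<theta> \<pi>s"
  proof (rule permutation_eqI[OF \<sigma> ib(1) lenn])
    fix q q' assume q: "q < length \<sigma>" "q' < length \<sigma>"
    obtain i where i: "i < ?d" "s i \<le> q" "q < s (Suc i)" using blocks_find[OF bl q(1)] .
    obtain j where j: "j < ?d" "s j \<le> q'" "q' < s (Suc j)" using blocks_find[OF bl q(2)] .
    show "\<sigma> ! q < \<sigma> ! q' \<longleftrightarrow> inflate \<theta> \<pi>s ! q < inflate \<theta> \<pi>s ! q'"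
    proof (cases "i = j")
      case True
      have a: "q - s i < length (\<pi>s ! i)" "q' - s i < length (\<pi>s ! i)"
        using props[OF i(1)] i j True by auto
      have "inflate \<theta> \<pi>s ! q < inflate \<theta> \<pi>s ! q' \<longleftrightarrow> \<pi>s ! i ! (q - s i) < \<pi>s ! i ! (q' - s i)"
        using ib(3)[OF i(1) a] st[of i] i j True by simp
      also have "\<dots> \<longleftrightarrow> \<sigma> ! q < \<sigma> ! q'"
        using a props[OF i(1)] i j True le[OF i(1)] q
        by (simp add: \<pi>s_def standardize_less_iff)
      finally show ?thesis by simp
    next
      case False
      have "inflate \<theta> \<pi>s ! q < inflate \<theta> \<pi>s ! q' \<longleftrightarrow> \<theta> ! i < \<theta> ! j"
        using blocks_less_iff[OF ib(2) i(1) j(1) False, of q q'] st[of i] st[of j] st[of "Suc i"] st[of "Suc j"] i j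
        by simp
      then show ?thesis using blocks_less_iff[OF bl i(1) j(1) False i(2,3) j(2,3)] by simp
    qed
  qed
qed

section \<open>Standard trees\<close>

text \<open>The boolean stands for the direction, increasing for \<oplus> and decreasing for
  \<ominus>, so that one argument serves both labels.\<close>

definition dir_less :: "bool \<Rightarrow> nat \<Rightarrow> nat \<Rightarrow> bool" where
  "dir_less b x y \<longleftrightarrow> (if b then x < y else y < x)"

definition dir_label :: "bool \<Rightarrow> permutation" where
  "dir_label b = (if b then oplus else ominus)"

text \<open>A cut at m exhibits \<sigma> as a direct sum (for true \<open>b\<close>) or as a skew
  sum (for false \<open>b\<close>) of its first m entries and the rest.\<close>

definition cut :: "bool \<Rightarrow> permutation \<Rightarrow> nat \<Rightarrow> bool" where
  "cut b \<sigma> m \<longleftrightarrow> 0 < m \<and> m < length \<sigma> \<and> (\<forall>q<m. \<forall>q'\<in>{m..<length \<sigma>}. dir_less b (\<sigma> ! q) (\<sigma> ! q'))"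

lemma is_permutation_dir_label: "is_permutation (dir_label b)"
  by (auto simp: dir_label_def is_permutation_iff)

lemma length_dir_label [simp]: "length (dir_label b) = 2"
  by (simp add: dir_label_def)

lemma dir_label_nth: "dir_label b ! 0 = (if b then 1 else 2)" "dir_label b ! Suc 0 = (if b then 2 else 1)"
  by (auto simp: dir_label_def)

lemma cutD:
  assumes "cut b \<sigma> m" "q < m" "m \<le> q'" "q' < length \<sigma>"
  shows "dir_less b (\<sigma> ! q) (\<sigma> ! q')"
  using assms by (auto simp: cut_def)

text \<open>Every cut separates the first entry from the last one, so its direction is the order of
  this pair.\<close>

lemma cut_unique_direction:
  assumes "cut b \<sigma> m" "cut b' \<sigma> m'"
  shows "b = b'"
proof -
  have "dir_less b (\<sigma> ! 0) (\<sigma> ! (length \<sigma> - 1))"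
    using assms(1) by (intro cutD[OF assms(1)]) (auto simp: cut_def)
  moreover have "dir_less b' (\<sigma> ! 0) (\<sigma> ! (length \<sigma> - 1))"
    using assms(2) by (intro cutD[OF assms(2)]) (auto simp: cut_def)
  ultimately show ?thesis by (auto simp: dir_less_def split: if_splits)
qed

lemma blocks_cut:
  assumes bl: "blocks \<sigma> \<theta> s" and "length \<theta> = 2"
    and b: "dir_less b (\<theta> ! 0) (\<theta> ! 1)"
  shows "cut b \<sigma> (s 1)"
proof -
  have s: "s 0 = 0" "s 2 = length \<sigma>" "s 0 < s 1" "s 1 < s 2"
    using blocks_strict_mono[OF bl, of 0 1] blocks_strict_mono[OF bl, of 1 2] bl assms
    by (auto simp: blocks_def)
  show ?thesis unfolding cut_def
  proof (intro conjI allI impI ballI)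
    fix q q' assume *: "q < s 1" "q' \<in> {s 1..<length \<sigma>}"
    have "\<sigma> ! q < \<sigma> ! q' \<longleftrightarrow> \<theta> ! 0 < \<theta> ! 1" "\<sigma> ! q' < \<sigma> ! q \<longleftrightarrow> \<theta> ! 1 < \<theta> ! 0"
      using blocks_less_iff[OF bl, of 0 1 q q'] blocks_less_iff[OF bl, of 1 0 q' q] * s assms
      by (auto simp: numeral_2_eq_2)
    then show "dir_less b (\<sigma> ! q) (\<sigma> ! q')" using b by (auto simp: dir_less_def split: if_splits)
  qed (use s in auto)
qed

lemma cut_blocks:
  assumes "cut b \<sigma> m"
  shows "blocks \<sigma> (dir_label b) (\<lambda>i. if i = 0 then 0 else if i = 1 then m else length \<sigma>)"
  unfolding blocks_def
proof (intro conjI allI impI ballI)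
  let ?s = "\<lambda>i. if i = 0 then 0 else if i = 1 then m else length \<sigma>"
  fix i j q q' assume *: "i < length (dir_label b)" "j < length (dir_label b)" "i \<noteq> j"
    "q \<in> {?s i..<?s (Suc i)}" "q' \<in> {?s j..<?s (Suc j)}"
  then consider "i = 0" "j = 1" | "i = 1" "j = 0" by fastforce
  then show "\<sigma> ! q < \<sigma> ! q' \<longleftrightarrow> dir_label b ! i < dir_label b ! j"
  proof cases
    case 1
    then show ?thesis using cutD[OF assms, of q q'] *
      by (auto simp: dir_less_def dir_label_nth split: if_splits)
  next
    case 2
    then show ?thesis using cutD[OF assms, of q' q] *
      by (auto simp: dir_less_def dir_label_nth split: if_splits)
  qed
qed (use assms in \<open>auto simp: cut_def less_2_cases_iff\<close>)

lemma simple_permutation_no_block: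
  assumes "simple_permutation \<theta>" "i < j" "j \<le> length \<theta>" "2 \<le> j - i" "j - i \<le> length \<theta> - 1" "block \<theta> i j"
  shows False
  using assms simple_permutation_iff_block by blast

text \<open>Let the cut fall into block i. Then the first i letters of \<theta> lie on one side of
  all the others, which is a proper interval if i \<ge> 2. If i \<le> 1, the first letter alone lies
  on one side, and the remaining letters form a proper interval.\<close>

lemma simple_no_cut:
  assumes bl: "blocks \<sigma> \<theta> s" and \<theta>: "simple_permutation \<theta>" and cut: "cut b \<sigma> m"
  shows False
proof -
  have d: "length \<theta> > 2" and perm: "is_permutation \<theta>" using \<theta> by (auto simp: simple_permutation_iff_block)
  have m: "0 < m" "m < length \<sigma>" using cut by (auto simp: cut_def)
  obtain i where i: "i < length \<theta>" "s i \<le> m" "m < s (Suc i)" using blocks_find[OF bl m(2)] .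
  \<comment> \<open>The last entry of block c is used, not the first, because block i may straddle
    the cut: only its end is sure to lie to the right. For block a the first entry plays this
    role.\<close>
  have dir: "dir_less b (\<theta> ! a) (\<theta> ! c)"
    if a: "a < c" "c < length \<theta>" "a < i \<or> a = 0" "i \<le> c" "s a < m" for a c
  proof -
    have c1: "s (Suc i) \<le> s (Suc c)" using blocks_mono[OF bl, of "Suc i" "Suc c"] a by auto
    have c2: "s c < s (Suc c)" using blocks_strict_mono[OF bl, of c "Suc c"] a by auto
    have c3: "s (Suc c) \<le> length \<sigma>" using blocks_le_length[OF bl, of "Suc c"] a by auto
    have a1: "s a < s (Suc a)" using blocks_strict_mono[OF bl, of a "Suc a"] a by auto
    have "dir_less b (\<sigma> ! (s a)) (\<sigma> ! (s (Suc c) - 1))"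
      using cutD[OF cut, of "s a" "s (Suc c) - 1"] a c1 c2 c3 i by auto
    moreover have "\<sigma> ! (s a) < \<sigma> ! (s (Suc c) - 1) \<longleftrightarrow> \<theta> ! a < \<theta> ! c"
      using blocks_less_iff[OF bl, of a c "s a" "s (Suc c) - 1"] a a1 c2 by auto
    moreover have "\<sigma> ! (s (Suc c) - 1) < \<sigma> ! (s a) \<longleftrightarrow> \<theta> ! c < \<theta> ! a"
      using blocks_less_iff[OF bl, of c a "s (Suc c) - 1" "s a"] a a1 c2 by auto
    ultimately show ?thesis by (auto simp: dir_less_def split: if_splits)
  qed
  show False
  proof (cases "i \<ge> 2")
    case True
    have sm: "s a < m" if "a < i" for a using blocks_strict_mono[OF bl, of a i] that i by auto
    have "block \<theta> 0 i" unfolding block_def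
    proof (intro allI impI ballI)
      fix q p p' assume *: "q < length \<theta>" "q \<notin> {0..<i}" "p \<in> {0..<i}" "p' \<in> {0..<i}"
      show "\<theta> ! q < \<theta> ! p \<longleftrightarrow> \<theta> ! q < \<theta> ! p'"
        using dir[of p q] dir[of p' q] * sm by (auto simp: dir_less_def split: if_splits)
    qed
    moreover have "i - 0 \<le> length \<theta> - 1" using i by linarith
    ultimately show False using simple_permutation_no_block[OF \<theta>, of 0 i] True i by simp
  next
    case False
    have s0: "s 0 = 0" using bl by (simp add: blocks_def)
    have "block \<theta> 1 (length \<theta>)" unfolding block_def
    proof (intro allI impI ballI)
      fix q p p' assume *: "q < length \<theta>" "q \<notin> {1..<length \<theta>}" "p \<in> {1..<length \<theta>}" "p' \<in> {1..<length \<theta>}"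
      then have "q = 0" by auto
      then show "\<theta> ! q < \<theta> ! p \<longleftrightarrow> \<theta> ! q < \<theta> ! p'"
        using dir[of 0 p] dir[of 0 p'] * s0 m False by (auto simp: dir_less_def split: if_splits)
    qed
    then show False using simple_permutation_no_block[OF \<theta>, of 1 "length \<theta>"] d by linarith
  qed
qed

text \<open>If the larger interval ends at a block boundary, it is an interval of \<theta> with at
  least two letters, so it is everything. If it ends inside a block k, the letters from i to k - 1,
  or the two letters i and i + 1, form a proper interval of \<theta>.\<close>

lemma block_maximal:
  assumes bl: "blocks \<sigma> \<theta> s" and \<theta>: "simple_permutation \<theta>" and i: "i < length \<theta>"
    and j: "s (Suc i) < j" "j \<le> length \<sigma>" and b: "block \<sigma> (s i) j"
  shows "i = 0 \<and> j = length \<sigma>"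
proof -
  have d: "length \<theta> > 2" using \<theta> by (auto simp: simple_permutation_iff_block)
  have "j - 1 < length \<sigma>" using j by linarith
  then obtain k where k: "k < length \<theta>" "s k \<le> j - 1" "j - 1 < s (Suc k)" using blocks_find[OF bl] by blast
  have kj: "s k < j" "j \<le> s (Suc k)" using k j by auto
  have ik: "i < k"
  proof (rule ccontr)
    assume "\<not> i < k"
    then have "s (Suc k) \<le> s (Suc i)" using blocks_mono[OF bl, of "Suc k" "Suc i"] i by auto
    then show False using kj j by auto
  qed
  show ?thesis
  proof (cases "j = s (Suc k)")
    case True
    then have bk: "block \<theta> i (Suc k)" using b blocks_block_iff[OF bl, of i "Suc k"] ik k by auto
    have "i < Suc k" "Suc k \<le> length \<theta>" "2 \<le> Suc k - i" using ik k by auto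
    then have "\<not> Suc k - i \<le> length \<theta> - 1"
      using simple_permutation_no_block[OF \<theta> _ _ _ _ bk] by blast
    then have "i = 0 \<and> Suc k = length \<theta>" using k by auto
    then show ?thesis using True bl by (auto simp: blocks_def)
  next
    case False
    then have jk: "j < s (Suc k)" using kj by auto
    have inK: "s p \<in> {s i..<j}" if "i \<le> p" "p \<le> k" for p
      using blocks_mono[OF bl, of i p] blocks_mono[OF bl, of p k] that k kj by auto
    have outK: "s q \<notin> {s i..<j}" "s q < length \<sigma>" if "q < length \<theta>" "q < i \<or> k < q" for q
      using blocks_strict_mono[OF bl, of q i] blocks_mono[OF bl, of "Suc k" q] that i jk
        blocks_strict_mono[OF bl that(1)] bl by (auto simp: blocks_def)
    have out: "\<theta> ! q < \<theta> ! p \<longleftrightarrow> \<theta> ! q < \<theta> ! p'"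
      if "q < length \<theta>" "q < i \<or> k < q" "i \<le> p" "p \<le> k" "i \<le> p'" "p' \<le> k" for q p p'
      using blockD[OF b outK(2)[OF that(1,2)] outK(1)[OF that(1,2)] inK[OF that(3,4)] inK[OF that(5,6)]]
        blocks_start_less_iff[OF bl, of q p] blocks_start_less_iff[OF bl, of q p'] that k by auto
    have jl: "j < length \<sigma>" using blocks_le_length[OF bl, of "Suc k"] jk k by auto
    \<comment> \<open>Position j lies in block k but outside the interval, so its comparisons with
      earlier blocks are those of letter k and cannot separate them.\<close>
    have mid: "\<theta> ! k < \<theta> ! p \<longleftrightarrow> \<theta> ! k < \<theta> ! p'" if "i \<le> p" "p < k" "i \<le> p'" "p' < k" for p p'
    proof -
      have "\<sigma> ! j < \<sigma> ! s p \<longleftrightarrow> \<sigma> ! j < \<sigma> ! s p'"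
        using blockD[OF b jl, of "s p" "s p'"] inK[of p] inK[of p'] that by auto
      moreover have "\<sigma> ! j < \<sigma> ! s p \<longleftrightarrow> \<theta> ! k < \<theta> ! p" if "i \<le> p" "p < k" for p
        using blocks_less_iff[OF bl, of k p j "s p"] blocks_strict_mono[OF bl, of p "Suc p"] kj jk that k by auto
      ultimately show ?thesis using that by auto
    qed
    show ?thesis
    proof (cases "k - i \<ge> 2")
      case True
      have "block \<theta> i k" unfolding block_def
      proof (intro allI impI ballI)
        fix q p p' assume *: "q < length \<theta>" "q \<notin> {i..<k}" "p \<in> {i..<k}" "p' \<in> {i..<k}"
        then show "\<theta> ! q < \<theta> ! p \<longleftrightarrow> \<theta> ! q < \<theta> ! p'"
          using out[of q p p'] mid[of p p'] by (cases "q = k") auto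
      qed
      moreover have "k \<le> length \<theta>" "k - i \<le> length \<theta> - 1" using k by linarith+
      ultimately show ?thesis using simple_permutation_no_block[OF \<theta> ik _ True] by blast
    next
      case False
      then have k': "k = Suc i" using ik by auto
      \<comment> \<open>Here k = i + 1 and the letters before k number only one; instead the two
        letters i and k form an interval, proper since \<theta> has length at least 3.\<close>
      have "block \<theta> i (Suc k)" unfolding block_def
      proof (intro allI impI ballI)
        fix q p p' assume *: "q < length \<theta>" "q \<notin> {i..<Suc k}" "p \<in> {i..<Suc k}" "p' \<in> {i..<Suc k}"
        then show "\<theta> ! q < \<theta> ! p \<longleftrightarrow> \<theta> ! q < \<theta> ! p'" using out[of q p p'] by auto
      qed
      moreover have "i < Suc k" "Suc k \<le> length \<theta>" "2 \<le> Suc k - i" "Suc k - i \<le> length \<theta> - 1"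
        using k' k d by linarith+
      ultimately show ?thesis using simple_permutation_no_block[OF \<theta>] by blast
    qed
  qed
qed

text \<open>The boundaries are forced from left to right: by maximality neither decomposition can
  have the longer next block. Then the skeletons agree because both are the pattern of the first
  entries of the blocks.\<close>

lemma blocks_unique:
  assumes \<sigma>: "is_permutation \<sigma>" and bl: "blocks \<sigma> \<theta> s" "blocks \<sigma> \<theta>' s'"
    and simple: "simple_permutation \<theta>" "simple_permutation \<theta>'"
  shows "\<theta> = \<theta>'" "\<And>i. i \<le> length \<theta> \<Longrightarrow> s i = s' i"
proof -
  have d: "length \<theta> > 2" "length \<theta>' > 2" using simple by (auto simp: simple_permutation_iff_block)
  \<comment> \<open>Maximality leaves one exception, a first block equal to all of \<sigma>; the
    second decomposition excludes it by having more than two blocks. The claim is used with the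
    roles of the decompositions exchanged as well.\<close>
  have aux: "\<not> s (Suc i) < s' (Suc i)"
    if bl: "blocks \<sigma> \<theta> s" "blocks \<sigma> \<theta>' s'" and simple: "simple_permutation \<theta>" and d: "length \<theta>' > 2"
      and i: "i < length \<theta>" "i < length \<theta>'" "s i = s' i" for \<theta> \<theta>' s s' i
  proof
    assume lt: "s (Suc i) < s' (Suc i)"
    have "i = 0 \<and> s' (Suc i) = length \<sigma>"
      using block_maximal[OF bl(1) simple i(1) lt] blocks_block[OF bl(2) i(2)] i
        blocks_le_length[OF bl(2), of "Suc i"] by auto
    then show False using blocks_strict_mono[OF bl(2), of 1 2] blocks_le_length[OF bl(2), of 2] d by auto
  qed
  have eq: "i \<le> length \<theta> \<Longrightarrow> i \<le> length \<theta>' \<Longrightarrow> s i = s' i" for i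
  proof (induction i)
    case 0 then show ?case using bl by (simp add: blocks_def)
  next
    case (Suc i)
    then show ?case using aux[OF bl simple(1) d(2), of i] aux[OF bl(2,1) simple(2) d(1), of i] by auto
  qed
  have len: "length \<theta> = length \<theta>'"
  proof (rule ccontr)
    assume "length \<theta> \<noteq> length \<theta>'"
    then consider "length \<theta> < length \<theta>'" | "length \<theta>' < length \<theta>" by linarith
    then show False
    proof cases
      case 1
      then show False using eq[of "length \<theta>"] blocks_strict_mono[OF bl(2) 1] bl by (auto simp: blocks_def)
    next
      case 2
      then show False using eq[of "length \<theta>'"] blocks_strict_mono[OF bl(1) 2] bl by (auto simp: blocks_def)
    qed
  qed
  show "s i = s' i" if "i \<le> length \<theta>" for i using eq that len by auto
  show "\<theta> = \<theta>'"
  proof (rule permutation_eqI)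
    fix p q assume "p < length \<theta>" "q < length \<theta>"
    then show "\<theta> ! p < \<theta> ! q \<longleftrightarrow> \<theta>' ! p < \<theta>' ! q"
      using blocks_start_less_iff[OF bl(1), of p q] blocks_start_less_iff[OF bl(2), of p q] eq[of p] eq[of q] len
      by (cases "p = q") auto
  qed (use simple len in \<open>auto simp: simple_permutation_iff_block\<close>)
qed

text \<open>Greedy construction: from each boundary the longest interval of \<sigma> is taken, and
  \<theta> is the pattern of the first entries. A proper interval of \<theta> would lift to an
  interval longer than the greedy choice.\<close>

lemma exists_simple_blocks:
  assumes \<sigma>: "is_permutation \<sigma>" and n: "length \<sigma> \<ge> 2" and nocut: "\<And>b m. \<not> cut b \<sigma> m"
  shows "\<exists>\<theta> s. simple_permutation \<theta> \<and> blocks \<sigma> \<theta> s"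
proof -
  define n where "n = length \<sigma>"
  define J where "J i = {j. i < j \<and> j \<le> n \<and> \<not> (i = 0 \<and> j = n) \<and> block \<sigma> i j}" for i
  \<comment> \<open>Beyond the end the map is constant, so the iteration becomes stationary at n and
    the number of blocks is the first index at which it arrives there.\<close>
  define nxt where "nxt i = (if i < n then Max (J i) else i)" for i
  define s where "s k = (nxt ^^ k) 0" for k
  have fin: "finite (J i)" for i by (rule finite_subset[of _ "{..n}"]) (auto simp: J_def)
  have ne: "J i \<noteq> {}" if "i < n" for i
    using that block_singleton[of \<sigma> i] assms(2) by (auto simp: J_def n_def intro!: exI[of _ "Suc i"])
  have nxt: "nxt i \<in> J i" if "i < n" for i using Max_in[OF fin ne[OF that]] that by (simp add: nxt_def)
  have nxt_max: "j \<le> nxt i" if "i < n" "j \<in> J i" for i j using Max_ge[OF fin that(2)] that by (simp add: nxt_def)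
  have s_Suc: "s (Suc k) = nxt (s k)" for k by (simp add: s_def)
  have s0: "s 0 = 0" by (simp add: s_def)
  have s_le: "s k \<le> n" for k
  proof (induction k)
    case (Suc k) then show ?case using nxt[of "s k"] by (auto simp: s_Suc J_def nxt_def[of "s k"] split: if_splits)
  qed (simp add: s0)
  have s_less: "s k < s (Suc k)" if "s k < n" for k using nxt[OF that] by (auto simp: s_Suc J_def)
  have ge: "k \<le> s k \<or> s k = n" for k
  proof (induction k)
    case (Suc k) then show ?case using s_less[of k] s_le[of k] by (auto simp: s_Suc nxt_def)
  qed (simp add: s0)
  have ex: "\<exists>k. s k = n" using ge[of n] s_le[of n] by (intro exI[of _ n]) linarith
  define d where "d = (LEAST k. s k = n)"
  have sd: "s d = n" unfolding d_def by (rule LeastI_ex[OF ex])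
  have lt: "s k < n" if "k < d" for k
    using not_less_Least[of k "\<lambda>k. s k = n"] that s_le[of k] by (auto simp: d_def)
  have blk: "block \<sigma> (s k) (s (Suc k))" if "k < d" for k using nxt[OF lt[OF that]] by (auto simp: J_def s_Suc)
  have smono: "s i \<le> s j" if "i \<le> j" "j \<le> d" for i j
    using that
  proof (induction j)
    case (Suc j) then show ?case using s_less[OF lt[of j]] by (cases "i = Suc j") auto
  qed simp
  have smono': "s i < s j" if "i < j" "j \<le> d" for i j
    using smono[of "Suc i" j] s_less[OF lt[of i]] that by auto
  define xs where "xs = map (\<lambda>i. \<sigma> ! s i) [0..<d]"
  define \<theta> where "\<theta> = standardize xs"
  have dpos: "d > 0" using sd s0 n n_def by (cases d) auto
  have dlen: "length \<theta> = d" by (simp add: \<theta>_def xs_def)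
  have inj: "\<sigma> ! s i = \<sigma> ! s j \<longleftrightarrow> i = j" if "i < d" "j < d" for i j
    using permutation_nth_eq_iff[OF \<sigma>, of "s i" "s j"] lt[OF that(1)] lt[OF that(2)] smono'[of i j] smono'[of j i] that
    by (cases i j rule: linorder_cases) (auto simp: n_def)
  have permth: "is_permutation \<theta>" unfolding \<theta>_def
    using dpos inj by (intro is_permutation_standardize) (auto simp: xs_def distinct_map inj_on_def)
  have \<theta>_less: "\<theta> ! i < \<theta> ! j \<longleftrightarrow> \<sigma> ! s i < \<sigma> ! s j" if "i < d" "j < d" for i j
    using that by (simp add: \<theta>_def standardize_less_iff xs_def)
  have disj: "q \<notin> {s j..<s (Suc j)}" if "q \<in> {s i..<s (Suc i)}" "i \<noteq> j" "i < d" "j < d" for i j q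
    using smono[of "Suc i" j] smono[of "Suc j" i] that by (cases "i < j") auto
  have neq: "\<sigma> ! q \<noteq> \<sigma> ! q'" if "q < n" "q' < n" "q \<noteq> q'" for q q'
    using permutation_nth_eq_iff[OF \<sigma>] that by (auto simp: n_def)
  have bl: "blocks \<sigma> \<theta> s" unfolding blocks_def dlen
  proof (intro conjI allI impI ballI)
    fix i j q q' assume *: "i < d" "j < d" "i \<noteq> j" "q \<in> {s i..<s (Suc i)}" "q' \<in> {s j..<s (Suc j)}"
    have qn: "q < n" "q' < n" using * s_le[of "Suc i"] s_le[of "Suc j"] by auto
    have si: "s i \<in> {s i..<s (Suc i)}" "s j \<in> {s j..<s (Suc j)}" using s_less[OF lt] * by auto
    \<comment> \<open>The comparison is moved to the first entries in two steps: block i allows q to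
      be replaced by its start, then block j allows the same for q'.\<close>
    have a: "\<sigma> ! q' < \<sigma> ! q \<longleftrightarrow> \<sigma> ! q' < \<sigma> ! s i"
      using blockD[OF blk[OF *(1)], of q' q "s i"] qn disj[OF *(5) _ *(2,1)] * si by (auto simp: n_def)
    have b: "\<sigma> ! s i < \<sigma> ! q' \<longleftrightarrow> \<sigma> ! s i < \<sigma> ! s j"
      using blockD[OF blk[OF *(2)], of "s i" q' "s j"] lt[OF *(1)] disj[OF si(1) *(3,1,2)] * si by (auto simp: n_def)
    have "q \<noteq> q'" "q' \<noteq> s i" using disj[OF *(4) *(3,1,2)] disj[OF si(1) *(3,1,2)] * by auto
    then have "\<sigma> ! q \<noteq> \<sigma> ! q'" "\<sigma> ! q' \<noteq> \<sigma> ! s i" using neq qn lt[OF *(1)] by auto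
    then have "\<sigma> ! q < \<sigma> ! q' \<longleftrightarrow> \<sigma> ! s i < \<sigma> ! q'" using a by linarith
    then show "\<sigma> ! q < \<sigma> ! q' \<longleftrightarrow> \<theta> ! i < \<theta> ! j" using b \<theta>_less[OF *(1,2)] by blast
  qed (use s0 sd s_less lt in \<open>auto simp: n_def\<close>)
  have s1: "s 1 < n"
    using nxt[of 0] n by (auto simp: n_def[symmetric] s_Suc s0 J_def)
  have d2: "d \<ge> 2"
  proof (rule ccontr)
    assume "\<not> d \<ge> 2"
    then have "d = 1" using dpos by auto
    then show False using s1 sd by simp
  qed
  have "d \<noteq> 2"
  proof
    assume "d = 2"
    then have "length \<theta> = 2" by (simp add: dlen)
    moreover have "\<theta> ! 0 \<noteq> \<theta> ! 1" using permutation_nth_eq_iff[OF permth, of 0 1] \<open>length \<theta> = 2\<close> by auto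
    then have "dir_less (\<theta> ! 0 < \<theta> ! 1) (\<theta> ! 0) (\<theta> ! 1)" by (auto simp: dir_less_def)
    ultimately show False using blocks_cut[OF bl] nocut by blast
  qed
  \<comment> \<open>The lifted interval starts at the boundary \<open>s i\<close> and is not all of
    \<sigma>, so it competes in the choice of the next boundary and would have beaten it.\<close>
  moreover have "\<not> block \<theta> i j" if ij: "i < j" "j \<le> length \<theta>" "2 \<le> j - i" "j - i \<le> length \<theta> - 1" for i j
  proof
    assume "block \<theta> i j"
    then have b: "block \<sigma> (s i) (s j)" using blocks_block_iff[OF bl ij(1,2)] by simp
    have "\<not> (s i = 0 \<and> s j = n)"
    proof
      assume "s i = 0 \<and> s j = n"
      then have "\<not> s 0 < s i" "\<not> s j < s d" using s0 sd by auto
      then have "i = 0" "j = d" using smono'[of 0 i] smono'[of j d] ij dlen by linarith+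
      then show False using ij dlen dpos by linarith
    qed
    then have "s j \<in> J (s i)" using b s_le[of j] smono'[of i j] ij dlen by (auto simp: J_def)
    then have "s j \<le> s (Suc i)" using nxt_max[of "s i" "s j"] lt[of i] ij dlen by (auto simp: s_Suc)
    moreover have "s (Suc i) < s j" using smono'[of "Suc i" j] ij dlen by auto
    ultimately show False by simp
  qed
  ultimately have "simple_permutation \<theta>" using d2 permth dlen by (auto simp: simple_permutation_iff_block)
  then show ?thesis using bl by blast
qed

section \<open>The bijection between standard trees and permutations\<close>

lemma standard_label_permutation:
  "\<theta> = oplus \<or> \<theta> = ominus \<or> simple_permutation \<theta> \<Longrightarrow> is_permutation \<theta>"
  using is_permutation_dir_label[of True] is_permutation_dir_label[of False]
  by (auto simp: dir_label_def simple_permutation_iff_block)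

lemma is_permutation_tree_perm: "standard_tree t \<Longrightarrow> is_permutation (tree_perm t)"
proof (induction t)
  case Leaf then show ?case by (simp add: is_permutation_iff)
next
  case (Node \<theta> ts)
  have "is_permutation (inflate \<theta> (map tree_perm ts))"
  proof (rule inflate_blocks(1))
    show "is_permutation \<theta>" using Node.prems by (intro standard_label_permutation) auto
    show "is_permutation (map tree_perm ts ! i)" if "i < length \<theta>" for i
      using Node that by (auto simp: nth_map)
  qed (use Node.prems in auto)
  then show ?case by simp
qed

lemma blocks_cong:
  assumes bl: "blocks \<sigma> \<theta> s" and eq: "\<And>i. i \<le> length \<theta> \<Longrightarrow> s' i = s i"
  shows "blocks \<sigma> \<theta> s'"
  unfolding blocks_def
proof (intro conjI allI impI ballI)
  fix i j q q' assume "i < length \<theta>" "j < length \<theta>" "i \<noteq> j" "q \<in> {s' i..<s' (Suc i)}" "q' \<in> {s' j..<s' (Suc j)}"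
  then show "\<sigma> ! q < \<sigma> ! q' \<longleftrightarrow> \<theta> ! i < \<theta> ! j"
    using blocks_less_iff[OF bl, of i j q q'] eq[of i] eq[of "Suc i"] eq[of j] eq[of "Suc j"] by simp
next
  fix i assume "i < length \<theta>"
  then show "s' i < s' (Suc i)"
    using blocks_strict_mono[OF bl, of i "Suc i"] eq[of i] eq[of "Suc i"] by simp
qed (use bl eq[of 0] eq[of "length \<theta>"] in \<open>simp_all add: blocks_def\<close>)

lemma node_blocks:
  assumes "standard_tree (Node \<theta> ts)"
  defines "s \<equiv> \<lambda>i. \<Sum>j<i. length (tree_perm (ts ! j))"
  shows "blocks (tree_perm (Node \<theta> ts)) \<theta> s"
    "\<And>i p p'. i < length \<theta> \<Longrightarrow> p < length (tree_perm (ts ! i)) \<Longrightarrow> p' < length (tree_perm (ts ! i)) \<Longrightarrow>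
      tree_perm (Node \<theta> ts) ! (s i + p) < tree_perm (Node \<theta> ts) ! (s i + p') \<longleftrightarrow>
      tree_perm (ts ! i) ! p < tree_perm (ts ! i) ! p'"
proof -
  have len: "length ts = length \<theta>" using assms by auto
  have perm: "is_permutation \<theta>" using assms by (intro standard_label_permutation) auto
  have perms: "\<And>i. i < length \<theta> \<Longrightarrow> is_permutation (map tree_perm ts ! i)"
    using assms by (auto intro!: is_permutation_tree_perm)
  have "length (map tree_perm ts) = length \<theta>" using len by simp
  note * = inflate_blocks(2)[OF perm this perms] inflate_blocks(3)[OF perm this perms]
  have s: "(\<Sum>j<i. length (map tree_perm ts ! j)) = s i" if "i \<le> length \<theta>" for i
    unfolding s_def using that len by (intro sum.cong) auto
  show "blocks (tree_perm (Node \<theta> ts)) \<theta> s"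
    using blocks_cong[OF *(1), of s] s by simp
  show "tree_perm (Node \<theta> ts) ! (s i + p) < tree_perm (Node \<theta> ts) ! (s i + p') \<longleftrightarrow>
      tree_perm (ts ! i) ! p < tree_perm (ts ! i) ! p'"
    if "i < length \<theta>" "p < length (tree_perm (ts ! i))" "p' < length (tree_perm (ts ! i))" for i p p'
    using *(2)[of i p p'] that s[of i] len by simp
qed

lemma length_tree_perm_Node:
  assumes "length ts = length \<theta>"
  shows "length (tree_perm (Node \<theta> ts)) = (\<Sum>j<length \<theta>. length (tree_perm (ts ! j)))"
  using assms by (simp add: length_inflate)

lemma standard_root_cases:
  assumes "standard_tree (Node \<theta> ts)"
  obtains b where "\<theta> = dir_label b" | "simple_permutation \<theta>"
proof -
  have "\<theta> = dir_label True \<or> \<theta> = dir_label False \<or> simple_permutation \<theta>"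
    using assms by (simp add: dir_label_def)
  then show ?thesis using that by blast
qed

lemma cut_dir_node:
  assumes "standard_tree (Node (dir_label b) ts)"
  shows "cut b (tree_perm (Node (dir_label b) ts)) (length (tree_perm (hd ts)))"
proof -
  have "length ts = 2" using assms by simp
  then have "ts \<noteq> []" by auto
  then have "hd ts = ts ! 0" by (simp add: hd_conv_nth)
  then show ?thesis
    using blocks_cut[OF node_blocks(1)[OF assms], of b] by (auto simp: dir_less_def dir_label_nth)
qed

text \<open>A leaf is too short for a cut, a simple root excludes cuts, and a root \<oplus> or
  \<ominus> has a cut of its own, whose direction must be the given one.\<close>

lemma root_label_of_cut:
  assumes "standard_tree t" "cut b (tree_perm t) m"
  shows "root_label t = Some (dir_label b)"
proof (cases t)
  case Leaf then show ?thesis using assms by (auto simp: cut_def)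
next
  case (Node \<theta> ts)
  have st: "standard_tree (Node \<theta> ts)" using assms Node by simp
  then show ?thesis
  proof (cases rule: standard_root_cases)
    case (1 b')
    then show ?thesis using cut_unique_direction[OF assms(2)] cut_dir_node[of b' ts] st Node by auto
  next
    case 2
    then show ?thesis using simple_no_cut[OF node_blocks(1)[OF st] 2] assms Node by auto
  qed
qed

text \<open>A shorter cut would restrict to a cut of the left child in the same direction and force
  on it the label that standardness forbids. So the size of the left child is the least cut.\<close>

lemma first_child_minimal_cut:
  assumes st: "standard_tree (Node (dir_label b) ts)" and cut: "cut b (tree_perm (Node (dir_label b) ts)) m"
  shows "length (tree_perm (hd ts)) \<le> m"
proof (rule ccontr)
  assume less: "\<not> length (tree_perm (hd ts)) \<le> m"
  let ?\<sigma> = "tree_perm (Node (dir_label b) ts)"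
  have len: "length ts = 2" using st by auto
  then have hd: "hd ts = ts ! 0" "hd ts \<in> set ts" by (cases ts; simp)+
  have "length (tree_perm (ts ! 0)) \<le> length ?\<sigma>"
    using length_tree_perm_Node[of ts "dir_label b"] len by (simp add: numeral_2_eq_2 del: tree_perm.simps)
  then have "cut b (tree_perm (hd ts)) m" unfolding cut_def
  proof (intro conjI allI impI ballI)
    fix q q' assume *: "q < m" "q' \<in> {m..<length (tree_perm (hd ts))}"
      "length (tree_perm (ts ! 0)) \<le> length ?\<sigma>"
    have "dir_less b (?\<sigma> ! q) (?\<sigma> ! q')" using cutD[OF cut, of q q'] * hd by auto
    then show "dir_less b (tree_perm (hd ts) ! q) (tree_perm (hd ts) ! q')"
      using node_blocks(2)[OF st, of 0 q q'] node_blocks(2)[OF st, of 0 q' q] * hd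
      by (auto simp: dir_less_def simp del: tree_perm.simps split: if_splits)
  qed (use cut less in \<open>auto simp: cut_def\<close>)
  then have "root_label (hd ts) = Some (dir_label b)"
    using st hd by (intro root_label_of_cut) auto
  then show False using st by (auto simp: dir_label_def split: if_splits)
qed

text \<open>Label and sizes of the children are read off from the permutation: with a cut, its
  direction gives the label and the least cut the size of the left child; otherwise skeleton and
  boundaries are unique. Equal sizes make the inflation cancellable, and the induction passes to the
  children.\<close>

lemma tree_perm_inj:
  "standard_tree t \<Longrightarrow> standard_tree t' \<Longrightarrow> tree_perm t = tree_perm t' \<Longrightarrow> t = t'"
proof (induction t arbitrary: t')
  have big: "length (tree_perm (Node \<theta> ts)) \<ge> 2" if st: "standard_tree (Node \<theta> ts)" for \<theta> ts
  proof -
    have d: "length \<theta> \<ge> 2" using st by (auto simp: simple_permutation_iff_block)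
    note bl = node_blocks(1)[OF st]
    show ?thesis using blocks_strict_mono[OF bl, of 0 1] blocks_strict_mono[OF bl, of 1 2]
      blocks_le_length[OF bl, of 2] d by linarith
  qed
  {
    case Leaf
    show ?case
    proof (cases t')
      case (Node \<theta> ts)
      then have "length (tree_perm t') \<ge> 2" using big[of \<theta> ts] Leaf.prems by blast
      then show ?thesis unfolding Leaf.prems(3)[symmetric] by simp
    qed simp
  next
    case (Node \<theta> ts)
    obtain \<theta>' ts' where t': "t' = Node \<theta>' ts'" using big[OF Node.prems(1)] Node.prems(3) by (cases t') auto
    have st: "standard_tree (Node \<theta> ts)" "standard_tree (Node \<theta>' ts')" using Node.prems t' by auto
    have eq: "tree_perm (Node \<theta> ts) = tree_perm (Node \<theta>' ts')" using Node.prems t' by simp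
    have len: "length ts = length \<theta>" "length ts' = length \<theta>'" using st by auto
    have "\<theta> = \<theta>' \<and> (\<forall>i<length \<theta>. length (tree_perm (ts ! i)) = length (tree_perm (ts' ! i)))"
      using st(1)
    proof (cases rule: standard_root_cases)
      case (1 b)
      have c: "cut b (tree_perm (Node \<theta> ts)) (length (tree_perm (hd ts)))" using cut_dir_node st 1 by blast
      then have th: "\<theta>' = dir_label b" using root_label_of_cut[OF st(2)] eq by auto
      have c': "cut b (tree_perm (Node \<theta>' ts')) (length (tree_perm (hd ts')))" using cut_dir_node st th by blast
      have "length (tree_perm (hd ts)) = length (tree_perm (hd ts'))"
        using first_child_minimal_cut[of b ts] first_child_minimal_cut[of b ts'] st c c' eq 1 th
        by (metis le_antisym)
      moreover have "hd ts = ts ! 0" "hd ts' = ts' ! 0" using len 1 th by (cases ts; cases ts'; auto)+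
      moreover have "(\<Sum>j<2. length (tree_perm (ts ! j))) = (\<Sum>j<2. length (tree_perm (ts' ! j)))"
        using length_tree_perm_Node[of ts \<theta>] length_tree_perm_Node[of ts' \<theta>'] len 1 th eq by simp
      ultimately show ?thesis using 1 th by (auto simp: numeral_2_eq_2 less_Suc_eq)
    next
      case 2
      have "simple_permutation \<theta>'"
        using st(2)
      proof (cases rule: standard_root_cases)
        case (1 b)
        then show ?thesis using cut_dir_node[of b ts'] st(2) eq simple_no_cut[OF node_blocks(1)[OF st(1)] 2] by metis
      qed
      note u = blocks_unique[OF is_permutation_tree_perm[OF st(1)] node_blocks(1)[OF st(1)]
          node_blocks(1)[OF st(2), folded eq] 2 this]
      have "length (tree_perm (ts ! i)) = length (tree_perm (ts' ! i))" if "i < length \<theta>" for i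
        using u(2)[of i] u(2)[of "Suc i"] that by simp
      then show ?thesis using u(1) by blast
    qed
    then have th: "\<theta> = \<theta>'" and l: "\<And>i. i < length \<theta> \<Longrightarrow> length (tree_perm (ts ! i)) = length (tree_perm (ts' ! i))"
      by auto
    have "map tree_perm ts = map tree_perm ts'"
      using eq th l len by (intro inflate_inject[where \<theta> = \<theta>]) auto
    then have e: "tree_perm (ts ! i) = tree_perm (ts' ! i)" if "i < length ts" for i
      using that len th by (metis nth_map)
    have "ts = ts'"
    proof (rule nth_equalityI)
      fix i assume i: "i < length ts"
      show "ts ! i = ts' ! i"
        using Node.IH[OF nth_mem[OF i], of "ts' ! i"] e[OF i] i st len th by auto
    qed (use len th in simp)
    then show ?case using t' th by simp
  }
qed

text \<open>Induction on the size: a permutation with a cut is split there under \<oplus> or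
  \<ominus>, any other of size at least 2 along its simple skeleton, and the patterns of the blocks
  are handled recursively.\<close>

lemma exists_standard_tree:
  "is_permutation \<sigma> \<Longrightarrow> \<exists>t. standard_tree t \<and> tree_perm t = \<sigma>"
proof (induction "length \<sigma>" arbitrary: \<sigma> rule: less_induct)
  case less
  have build: "\<exists>ts. length ts = length \<theta> \<and> (\<forall>i<length \<theta>. standard_tree (ts ! i) \<and>
        length (tree_perm (ts ! i)) = s (Suc i) - s i) \<and> inflate \<theta> (map tree_perm ts) = \<sigma>"
    if th: "is_permutation \<theta>" "length \<theta> \<ge> 2" and bl: "blocks \<sigma> \<theta> s" for \<theta> s
  proof -
    define \<pi>s where "\<pi>s = map (\<lambda>i. standardize (take (s (Suc i) - s i) (drop (s i) \<sigma>))) [0..<length \<theta>]"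
    note p = inflate_of_blocks[OF less.prems th(1) bl, folded \<pi>s_def]
    have "\<exists>t. standard_tree t \<and> tree_perm t = \<pi>s ! i" if i: "i < length \<theta>" for i
    proof (rule less.hyps)
      show "is_permutation (\<pi>s ! i)" using p(2)[OF i] by simp
      have "s (Suc i) - s i < length \<sigma>"
      proof (cases "i = 0")
        case True
        then show ?thesis using blocks_strict_mono[OF bl, of 1 2] blocks_le_length[OF bl, of 2] th by auto
      next
        case False
        then show ?thesis using blocks_strict_mono[OF bl, of 0 i] blocks_le_length[OF bl, of "Suc i"]
          blocks_strict_mono[OF bl, of i "Suc i"] i by auto
      qed
      then show "length (\<pi>s ! i) < length \<sigma>" using p(2)[OF i] by simp
    qed
    then obtain f where f: "\<And>i. i < length \<theta> \<Longrightarrow> standard_tree (f i) \<and> tree_perm (f i) = \<pi>s ! i" by metis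
    have "map tree_perm (map f [0..<length \<theta>]) = \<pi>s"
      using f by (intro nth_equalityI) (auto simp: \<pi>s_def)
    then show ?thesis using f p by (intro exI[of _ "map f [0..<length \<theta>]"]) auto
  qed
  show ?case
  proof (cases "\<exists>b m. cut b \<sigma> m")
    case True
    then obtain b m0 where "cut b \<sigma> m0" by blast
    \<comment> \<open>Splitting at the least cut gives a standard tree: a left child with the same
      label would have a cut, and this would be a smaller cut of \<sigma>.\<close>
    define m where "m = (LEAST m. cut b \<sigma> m)"
    have m: "cut b \<sigma> m" unfolding m_def using \<open>cut b \<sigma> m0\<close> by (rule LeastI)
    have least: "m \<le> m'" if "cut b \<sigma> m'" for m' unfolding m_def using that by (rule Least_le)
    obtain ts where ts: "length ts = 2" "\<And>i. i < 2 \<Longrightarrow> standard_tree (ts ! i)"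
        "length (tree_perm (ts ! 0)) = m" "inflate (dir_label b) (map tree_perm ts) = \<sigma>"
      using build[OF is_permutation_dir_label _ cut_blocks[OF m]] by auto
    have "root_label (hd ts) \<noteq> Some (dir_label b)"
    proof
      assume r: "root_label (hd ts) = Some (dir_label b)"
      then obtain us where us: "hd ts = Node (dir_label b) us" by (cases "hd ts") auto
      have hd: "hd ts = ts ! 0" using ts by (cases ts) auto
      define m' where "m' = length (tree_perm (hd us))"
      have c: "cut b (tree_perm (ts ! 0)) m'"
        using cut_dir_node[of b us] us hd ts(2)[of 0] by (simp add: m'_def)
      have lt: "m' < m" using c ts(3) by (simp add: cut_def)
      have perms: "\<And>i. i < length (dir_label b) \<Longrightarrow> is_permutation (map tree_perm ts ! i)"
        using ts by (auto intro!: is_permutation_tree_perm)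
      have same: "\<sigma> ! p < \<sigma> ! p' \<longleftrightarrow> tree_perm (ts ! 0) ! p < tree_perm (ts ! 0) ! p'" if "p < m" "p' < m" for p p'
        using inflate_blocks(3)[OF is_permutation_dir_label[of b] _ perms, of 0 p p'] ts that by auto
      have "cut b \<sigma> m'" unfolding cut_def
      proof (intro conjI allI impI ballI)
        fix q q' assume *: "q < m'" "q' \<in> {m'..<length \<sigma>}"
        show "dir_less b (\<sigma> ! q) (\<sigma> ! q')"
        proof (cases "q' < m")
          case True
          then show ?thesis using cutD[OF c, of q q'] same[of q q'] same[of q' q] * lt ts
            by (auto simp: dir_less_def split: if_splits)
        next
          case False
          then show ?thesis using cutD[OF m, of q q'] * lt by auto
        qed
      qed (use c lt m in \<open>auto simp: cut_def\<close>)
      then show False using least lt by fastforce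
    qed
    then have "standard_tree (Node (dir_label b) ts)"
      using ts by (auto simp: dir_label_def in_set_conv_nth split: if_splits)
    then show ?thesis using ts(4) by (intro exI[of _ "Node (dir_label b) ts"]) auto
  next
    case False
    show ?thesis
    proof (cases "length \<sigma> \<ge> 2")
      case True
      then obtain \<theta> s where th: "simple_permutation \<theta>" "blocks \<sigma> \<theta> s"
        using exists_simple_blocks[OF less.prems] False by blast
      then have th': "is_permutation \<theta>" "length \<theta> > 2" by (auto simp: simple_permutation_iff_block)
      then obtain ts where "length ts = length \<theta>" "\<forall>i<length \<theta>. standard_tree (ts ! i)"
          "inflate \<theta> (map tree_perm ts) = \<sigma>" using build[OF th'(1) _ th(2)] by auto
      then show ?thesis using th th' by (intro exI[of _ "Node \<theta> ts"]) (auto simp: in_set_conv_nth)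
    next
      case False
      moreover have "\<sigma> \<noteq> []" using less.prems by (simp add: is_permutation_iff)
      ultimately have "length \<sigma> = 1" by (simp add: le_less_Suc_eq not_le less_Suc_eq numeral_2_eq_2)
      then obtain x where "\<sigma> = [x]" by (auto simp: length_Suc_conv)
      then have "\<sigma> = [1]" using less.prems by (simp add: is_permutation_iff)
      then show ?thesis by (intro exI[of _ Leaf]) simp
    qed
  qed
qed

section \<open>Nonnegative matrices\<close>

definition mat_vec :: "'a set \<Rightarrow> ('a \<Rightarrow> 'a \<Rightarrow> real) \<Rightarrow> ('a \<Rightarrow> real) \<Rightarrow> 'a \<Rightarrow> real" where
  "mat_vec I A x i = (\<Sum>j\<in>I. A i j * x j)"

definition irreducible_on :: "'a set \<Rightarrow> ('a \<Rightarrow> 'a \<Rightarrow> real) \<Rightarrow> bool" where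
  "irreducible_on I A \<longleftrightarrow> (\<forall>i\<in>I. \<forall>j\<in>I. (i, j) \<in> {(i, j). i \<in> I \<and> j \<in> I \<and> A i j > 0}\<^sup>*)"

lemma irreducible_on_transpose:
  assumes "irreducible_on I A"
  shows "irreducible_on I (\<lambda>i j. A j i)"
proof -
  have "{(i, j). i \<in> I \<and> j \<in> I \<and> A j i > 0} = {(i, j). i \<in> I \<and> j \<in> I \<and> A i j > 0}\<inverse>" by auto
  then show ?thesis using assms by (simp add: irreducible_on_def rtrancl_converse)
qed

text \<open>If x vanishes at a and (A x)_a \<le> 0, all terms of this nonnegative sum vanish, hence
  so does x at every b with A_ab > 0; irreducibility reaches all indices. Positivity and uniqueness
  of Perron vectors both rest on this.\<close>

lemma irreducible_zero_propagates:
  assumes fin: "finite I" and A: "\<And>i j. i \<in> I \<Longrightarrow> j \<in> I \<Longrightarrow> A i j \<ge> 0" and irr: "irreducible_on I A"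
    and x: "\<And>i. i \<in> I \<Longrightarrow> x i \<ge> 0" and sub: "\<And>i. i \<in> I \<Longrightarrow> x i = 0 \<Longrightarrow> mat_vec I A x i \<le> 0"
    and i: "i \<in> I" "x i = 0" and j: "j \<in> I"
  shows "x j = 0"
proof -
  have "(i, j) \<in> {(i, j). i \<in> I \<and> j \<in> I \<and> A i j > 0}\<^sup>*" using irr i j by (auto simp: irreducible_on_def)
  then show ?thesis
  proof (induction rule: rtrancl_induct)
    case (step a b)
    then have ab: "a \<in> I" "b \<in> I" "A a b > 0" by auto
    have "A a b * x b \<le> mat_vec I A x a" unfolding mat_vec_def
      using fin ab A x by (intro member_le_sum) auto
    also have "\<dots> \<le> 0" using sub[OF ab(1) step.IH] .
    finally have "x b \<le> 0" using ab by (simp add: mult_le_0_iff)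
    then show ?case using x[OF ab(2)] by simp
  qed (rule i(2))
qed

text \<open>Bolzano-Weierstrass for vectors over an arbitrary finite index set, one coordinate at a
  time.\<close>

lemma bounded_functions_convergent_subseq:
  fixes f :: "nat \<Rightarrow> 'a \<Rightarrow> real"
  assumes "finite I" "\<And>n i. i \<in> I \<Longrightarrow> \<bar>f n i\<bar> \<le> B"
  shows "\<exists>s l. strict_mono (s :: nat \<Rightarrow> nat) \<and> (\<forall>i\<in>I. (\<lambda>n. f (s n) i) \<longlonglongrightarrow> l i)"
  using assms
proof (induction I rule: finite_induct)
  case empty
  then show ?case by (auto intro!: exI[of _ id] simp: strict_mono_def)
next
  case (insert a I)
  then obtain s l where s: "strict_mono (s :: nat \<Rightarrow> nat)" "\<forall>i\<in>I. (\<lambda>n. f (s n) i) \<longlonglongrightarrow> l i" by auto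
  have "bounded (range (\<lambda>n. f (s n) a))" using insert.prems by (intro boundedI[of _ B]) auto
  then obtain m r where r: "strict_mono (r :: nat \<Rightarrow> nat)" "(\<lambda>n. f (s (r n)) a) \<longlonglongrightarrow> m"
    using bounded_imp_convergent_subsequence[of "\<lambda>n. f (s n) a"] by (auto simp: o_def)
  have "(\<lambda>n. f (s (r n)) i) \<longlonglongrightarrow> l i" if "i \<in> I" for i
    using LIMSEQ_subseq_LIMSEQ[OF s(2)[rule_format, OF that] r(1)] by (simp add: o_def)
  then show ?case using r s insert.hyps
    by (intro exI[of _ "s \<circ> r"] exI[of _ "l(a := m)"]) (auto simp: strict_mono_def)
qed

text \<open>Collatz-Wielandt: r is the largest l such that l x \<le> A x for some x in the simplex,
  attained by compactness. If equality failed somewhere, powers of 1 + A would make the gap positive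
  in every coordinate, and l could be increased.\<close>

lemma perron_frobenius:
  assumes fin: "finite I" and ne: "I \<noteq> {}" and A: "\<And>i j. i \<in> I \<Longrightarrow> j \<in> I \<Longrightarrow> A i j \<ge> 0"
    and irr: "irreducible_on I A"
  obtains r v where "r \<ge> 0" "\<And>i. i \<in> I \<Longrightarrow> v i > 0" "\<And>i. i \<in> I \<Longrightarrow> mat_vec I A v i = r * v i"
proof -
  define P where "P l x \<longleftrightarrow> l \<ge> 0 \<and> (\<forall>i\<in>I. x i \<ge> 0) \<and> (\<Sum>i\<in>I. x i) = 1 \<and> (\<forall>i\<in>I. l * x i \<le> mat_vec I A x i)" for l x
  define L where "L = {l. \<exists>x. P l x}"
  define K where "K = (\<Sum>i\<in>I. \<Sum>j\<in>I. A i j)"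
  have le1: "x i \<le> 1" if "P l x" "i \<in> I" for l x i
    using member_le_sum[of i I x] that fin by (auto simp: P_def)
  have bound: "l \<le> K" if P: "P l x" for l x
  proof -
    have "l = (\<Sum>i\<in>I. l * x i)" using P by (simp add: P_def sum_distrib_left[symmetric])
    also have "\<dots> \<le> (\<Sum>i\<in>I. \<Sum>j\<in>I. A i j * x j)" using P by (intro sum_mono) (auto simp: P_def mat_vec_def)
    also have "\<dots> \<le> K" unfolding K_def
      using le1[OF P] A by (intro sum_mono mult_left_le) auto
    finally show ?thesis .
  qed
  have "card I > 0" using fin ne by (simp add: card_gt_0_iff)
  then have "P 0 (\<lambda>i. 1 / card I)" using A by (auto simp: P_def mat_vec_def intro!: sum_nonneg)
  then have Lne: "L \<noteq> {}" by (auto simp: L_def)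
  have bdd: "bdd_above L" using bound by (auto simp: L_def bdd_above_def)
  define r where "r = Sup L"
  have "\<exists>l\<in>L. r - 1 / Suc n < l" for n
    using less_cSup_iff[OF Lne bdd, of "r - 1 / Suc n"] by (simp add: r_def)
  then have "\<exists>l x. P l x \<and> r - 1 / Suc n < l" for n by (auto simp: L_def)
  then obtain l X where lX: "\<And>n. P (l n) (X n)" "\<And>n. r - 1 / Suc n < l n" by metis
  have l_le: "l n \<le> r" for n unfolding r_def using lX(1)[of n] by (intro cSup_upper bdd) (auto simp: L_def)
  have "(\<lambda>n. r - 1 / Suc n) \<longlonglongrightarrow> r - 0" by (intro tendsto_intros LIMSEQ_Suc[OF lim_1_over_n])
  moreover have "\<forall>n. r - 1 / Suc n \<le> l n" using lX(2) by (simp add: less_imp_le)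
  ultimately have liml: "l \<longlonglongrightarrow> r" using l_le
    by (intro tendsto_sandwich[of "\<lambda>n. r - 1 / Suc n" l sequentially "\<lambda>_. r"] always_eventually) auto
  have "\<exists>s x. strict_mono (s :: nat \<Rightarrow> nat) \<and> (\<forall>i\<in>I. (\<lambda>n. X (s n) i) \<longlonglongrightarrow> x i)"
    using lX(1) le1[OF lX(1)] by (intro bounded_functions_convergent_subseq[OF fin, of X 1]) (auto simp: P_def)
  then obtain s x where s: "strict_mono (s :: nat \<Rightarrow> nat)" "\<And>i. i \<in> I \<Longrightarrow> (\<lambda>n. X (s n) i) \<longlonglongrightarrow> x i" by blast
  have ls: "(\<lambda>n. l (s n)) \<longlonglongrightarrow> r" using LIMSEQ_subseq_LIMSEQ[OF liml s(1)] by (simp add: o_def)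
  have r0: "r \<ge> 0" using LIMSEQ_le_const[OF liml, of 0] lX(1) by (auto simp: P_def)
  have x0: "x i \<ge> 0" if "i \<in> I" for i
    using LIMSEQ_le_const[OF s(2)[OF that], of 0] lX(1) that by (auto simp: P_def)
  have "(\<lambda>n. \<Sum>i\<in>I. X (s n) i) \<longlonglongrightarrow> (\<Sum>i\<in>I. x i)" using s by (intro tendsto_sum)
  moreover have "(\<lambda>n. \<Sum>i\<in>I. X (s n) i) = (\<lambda>n. 1)" using lX(1) by (simp add: P_def)
  ultimately have x1: "(\<Sum>i\<in>I. x i) = 1" by (simp add: LIMSEQ_const_iff)
  have Ax: "r * x i \<le> mat_vec I A x i" if i: "i \<in> I" for i
  proof (rule LIMSEQ_le[of "\<lambda>n. l (s n) * X (s n) i" _ "\<lambda>n. mat_vec I A (X (s n)) i"])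
    show "(\<lambda>n. l (s n) * X (s n) i) \<longlonglongrightarrow> r * x i" by (intro tendsto_mult ls s(2) i)
    show "(\<lambda>n. mat_vec I A (X (s n)) i) \<longlonglongrightarrow> mat_vec I A x i"
      unfolding mat_vec_def by (intro tendsto_sum tendsto_mult tendsto_const s(2))
    show "\<exists>N. \<forall>n\<ge>N. l (s n) * X (s n) i \<le> mat_vec I A (X (s n)) i" using lX(1) i by (auto simp: P_def)
  qed
  define g where "g i = mat_vec I A x i - r * x i" for i
  have g0: "g i \<ge> 0" if "i \<in> I" for i using Ax[OF that] by (simp add: g_def)
  have gz: "g i = 0" if "i \<in> I" for i
  proof (rule ccontr)
    assume "g i \<noteq> 0"
    then have gi: "g i > 0" using g0[OF that] by simp
    \<comment> \<open>This is 1 + A. The identity part preserves coordinates that are already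
      positive, so one common power works for all indices even if A is periodic.\<close>
    define B where "B y i = y i + mat_vec I A y i" for y i
    have Bnn: "(B ^^ n) y k \<ge> 0" if "\<And>i. i \<in> I \<Longrightarrow> y i \<ge> 0" "k \<in> I" for n y k
      using that(2)
    proof (induction n arbitrary: k)
      case (Suc n)
      then show ?case using A by (auto simp: B_def[of "(B ^^ n) y"] mat_vec_def intro!: add_nonneg_nonneg sum_nonneg)
    qed (use that in simp)
    have Binc: "(B ^^ m) y k \<le> (B ^^ n) y k" if "m \<le> n" "\<And>i. i \<in> I \<Longrightarrow> y i \<ge> 0" "k \<in> I" for m n y k
      using that(1)
    proof (induction n)
      case (Suc n)
      have "(B ^^ n) y k \<le> (B ^^ Suc n) y k" using Bnn[of y] that A
        by (auto simp: B_def[of "(B ^^ n) y"] mat_vec_def intro!: sum_nonneg)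
      then show ?case using Suc by (cases "m = Suc n") auto
    qed simp
    have reach: "\<exists>n. (B ^^ n) g k > 0" if "k \<in> I" for k
    proof -
      have "(k, i) \<in> {(i, j). i \<in> I \<and> j \<in> I \<and> A i j > 0}\<^sup>*" using irr that \<open>i \<in> I\<close> by (auto simp: irreducible_on_def)
      then show ?thesis
      proof (induction rule: converse_rtrancl_induct)
        case base
        then show ?case using gi by (intro exI[of _ 0]) simp
      next
        case (step a b)
        then obtain n where n: "(B ^^ n) g b > 0" by blast
        have ab: "a \<in> I" "b \<in> I" "A a b > 0" using step by auto
        have "A a b * (B ^^ n) g b \<le> mat_vec I A ((B ^^ n) g) a" unfolding mat_vec_def
          using ab fin A Bnn[of g] g0 by (intro member_le_sum) auto
        moreover have "A a b * (B ^^ n) g b > 0" using ab n by simp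
        moreover have "(B ^^ n) g a \<ge> 0" using Bnn[of g a n] g0 ab by simp
        ultimately have "(B ^^ Suc n) g a > 0" by (simp add: B_def[of "(B ^^ n) g"])
        then show ?case by blast
      qed
    qed
    then obtain N where N: "\<And>k. k \<in> I \<Longrightarrow> (B ^^ N k) g k > 0" by metis
    define M where "M = Max (N ` I)"
    have pos: "(B ^^ M) g k > 0" if "k \<in> I" for k
      using N[OF that] Binc[of "N k" M g k] g0 that fin by (fastforce simp: M_def)
    \<comment> \<open>As B commutes with A, the gap of the vector B^n x is B^n applied to the gap of
      x.\<close>
    have comm: "mat_vec I A ((B ^^ n) x) k - r * (B ^^ n) x k = (B ^^ n) g k" for n k
    proof (induction n arbitrary: k)
      case (Suc n)
      have lin: "mat_vec I A (B y) k = mat_vec I A y k + mat_vec I A (mat_vec I A y) k" for y k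
        by (simp add: mat_vec_def B_def[abs_def] distrib_left sum.distrib)
      have "(B ^^ Suc n) g k = (B ^^ n) g k + mat_vec I A ((B ^^ n) g) k" by (simp add: B_def[of "(B ^^ n) g"])
      also have "mat_vec I A ((B ^^ n) g) k =
          mat_vec I A (\<lambda>k. mat_vec I A ((B ^^ n) x) k - r * (B ^^ n) x k) k"
        using Suc.IH by simp
      also have "\<dots> = mat_vec I A (mat_vec I A ((B ^^ n) x)) k - r * mat_vec I A ((B ^^ n) x) k"
        by (simp add: mat_vec_def right_diff_distrib sum_subtractf sum_distrib_left mult_ac)
      finally show ?case using Suc.IH[of k, symmetric]
        by (simp add: lin) (simp add: B_def[of "(B ^^ n) x"] algebra_simps)
    qed (simp add: g_def)
    define y where "y = (B ^^ M) x"
    have y0: "y k \<ge> 0" if "k \<in> I" for k unfolding y_def using Bnn[of x] x0 that by simp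
    have yx: "x k \<le> y k" if "k \<in> I" for k unfolding y_def using Binc[of 0 M x k] x0 that by simp
    define Y where "Y = (\<Sum>k\<in>I. y k)"
    have "1 \<le> Y" unfolding Y_def x1[symmetric] using yx by (intro sum_mono)
    have yY: "y k \<le> Y" if "k \<in> I" for k unfolding Y_def using that y0 fin by (intro member_le_sum) auto
    define h where "h = Min ((B ^^ M) g ` I)"
    have h: "h > 0" unfolding h_def using fin ne pos by (subst Min_gr_iff) auto
    have hle: "h \<le> (B ^^ M) g k" if "k \<in> I" for k unfolding h_def using fin that by auto
    \<comment> \<open>Every coordinate of the new gap is at least h and no coordinate of y exceeds
      Y, so h / Y can be added to r, contrary to its choice as a supremum.\<close>
    have "P (r + h / Y) (\<lambda>k. y k / Y)" unfolding P_def
    proof (intro conjI ballI)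
      fix k assume k: "k \<in> I"
      have "h / Y * y k \<le> h" using yY[OF k] h \<open>1 \<le> Y\<close> by (simp add: field_simps)
      then have "(r + h / Y) * y k \<le> mat_vec I A y k"
        using comm[of M k] hle[OF k] by (simp add: y_def distrib_right)
      moreover have "mat_vec I A (\<lambda>k. y k / Y) k = mat_vec I A y k / Y"
        by (simp add: mat_vec_def sum_divide_distrib)
      ultimately show "(r + h / Y) * (y k / Y) \<le> mat_vec I A (\<lambda>k. y k / Y) k"
        using \<open>1 \<le> Y\<close> by (simp add: divide_right_mono)
    qed (use r0 h y0 \<open>1 \<le> Y\<close> in \<open>auto simp: sum_divide_distrib[symmetric] Y_def[symmetric]\<close>)
    then have "r + h / Y \<le> r" unfolding r_def by (intro cSup_upper bdd) (auto simp: L_def r_def)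
    then show False using h \<open>1 \<le> Y\<close> by (simp add: divide_le_0_iff)
  qed
  have eig: "mat_vec I A x i = r * x i" if "i \<in> I" for i using gz[OF that] by (simp add: g_def)
  have "x i > 0" if i: "i \<in> I" for i
  proof (rule ccontr)
    assume "\<not> x i > 0"
    then have "x i = 0" using x0[OF i] by simp
    have "x j = 0" if "j \<in> I" for j
      by (rule irreducible_zero_propagates[OF fin A irr _ _ i _ that, where x = x])
        (use x0 eig \<open>x i = 0\<close> in auto)
    then show False using x1 by simp
  qed
  then show ?thesis using that[of r x] r0 eig by blast
qed

text \<open>With c the least ratio x_i / v_i, the vector x - c v is a nonnegative eigenvector with a
  zero coordinate, hence 0. No sign is prescribed for x, so the lemma applies to an obstruction
  delivered by the Fredholm alternative.\<close>

lemma perron_eigenvector_unique: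
  assumes fin: "finite I" and ne: "I \<noteq> {}" and A: "\<And>i j. i \<in> I \<Longrightarrow> j \<in> I \<Longrightarrow> A i j \<ge> 0"
    and irr: "irreducible_on I A"
    and v: "\<And>i. i \<in> I \<Longrightarrow> v i > 0" "\<And>i. i \<in> I \<Longrightarrow> mat_vec I A v i = r * v i"
    and x: "\<And>i. i \<in> I \<Longrightarrow> mat_vec I A x i = r * x i"
  shows "\<exists>c. \<forall>i\<in>I. x i = c * v i"
proof -
  define c where "c = Min ((\<lambda>i. x i / v i) ` I)"
  have "c \<in> (\<lambda>i. x i / v i) ` I" unfolding c_def using fin ne by (intro Min_in) auto
  then obtain i where i: "i \<in> I" "c = x i / v i" by auto
  have c: "c * v j \<le> x j" if "j \<in> I" for j
  proof -
    have "c \<le> x j / v j" unfolding c_def using fin that by auto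
    then show ?thesis using v(1)[OF that] by (simp add: field_simps)
  qed
  have lin: "mat_vec I A (\<lambda>j. x j - c * v j) k = r * (x k - c * v k)" if "k \<in> I" for k
    using v(2)[OF that] x[OF that]
    by (simp add: mat_vec_def right_diff_distrib sum_subtractf mult.left_commute[of _ c]
        sum_distrib_left[symmetric])
  have "x j - c * v j = 0" if "j \<in> I" for j
    by (rule irreducible_zero_propagates[OF fin A irr _ _ i(1) _ that, of "\<lambda>j. x j - c * v j"])
      (use lin c i v(1)[OF i(1)] in auto)
  then show ?thesis by (intro exI[of _ c]) auto
qed

text \<open>For a complex eigenvector x, let i maximize |x_i| / v_i. The triangle inequality in row
  i bounds |c| |x_i| by this maximum times (A v)_i = r v_i.\<close>

lemma perron_eigenvalue_of_eigenvector:
  assumes fin: "finite I" and ne: "I \<noteq> {}" and A: "\<And>i j. i \<in> I \<Longrightarrow> j \<in> I \<Longrightarrow> A i j \<ge> 0"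
    and v: "\<And>i. i \<in> I \<Longrightarrow> v i > 0" "\<And>i. i \<in> I \<Longrightarrow> mat_vec I A v i = r * v i" and r: "r \<ge> 0"
  shows "perron_eigenvalue I A r"
  unfolding perron_eigenvalue_def
proof (intro conjI allI impI r)
  show "complex_eigenvalue I A (of_real r)" unfolding complex_eigenvalue_def
  proof (intro exI[of _ "\<lambda>i. complex_of_real (v i)"] conjI ballI)
    show "\<exists>i\<in>I. complex_of_real (v i) \<noteq> 0" using ne v(1) by fastforce
    fix i assume "i \<in> I"
    from v(2)[OF this] have "complex_of_real (mat_vec I A v i) = of_real (r * v i)" by simp
    then show "(\<Sum>j\<in>I. complex_of_real (A i j) * complex_of_real (v j)) = complex_of_real r * complex_of_real (v i)"
      by (simp add: mat_vec_def)
  qed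
next
  fix c assume "complex_eigenvalue I A c"
  then obtain x where x: "\<exists>i\<in>I. x i \<noteq> 0" "\<And>i. i \<in> I \<Longrightarrow> (\<Sum>j\<in>I. complex_of_real (A i j) * x j) = c * x i"
    by (auto simp: complex_eigenvalue_def)
  define m where "m = Max ((\<lambda>i. cmod (x i) / v i) ` I)"
  have "m \<in> (\<lambda>i. cmod (x i) / v i) ` I" unfolding m_def using fin ne by (intro Max_in) auto
  then obtain i where i: "i \<in> I" "m = cmod (x i) / v i" by auto
  have m: "cmod (x j) \<le> m * v j" if "j \<in> I" for j
  proof -
    have "cmod (x j) / v j \<le> m" unfolding m_def using fin that by auto
    then show ?thesis using v(1)[OF that] by (simp add: field_simps)
  qed
  have xi: "cmod (x i) > 0"
  proof (rule ccontr)
    assume "\<not> cmod (x i) > 0"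
    then have "m = 0" using i by simp
    then show False using m x(1) by force
  qed
  have "cmod c * cmod (x i) = cmod (\<Sum>j\<in>I. complex_of_real (A i j) * x j)"
    by (simp add: x(2)[OF i(1)] norm_mult)
  also have "\<dots> \<le> (\<Sum>j\<in>I. A i j * (m * v j))"
    using A[OF i(1)] mult_left_mono[OF m A[OF i(1)]]
    by (intro sum_norm_le) (simp add: norm_mult del: mult_le_cancel_left)
  also have "\<dots> = m * mat_vec I A v i" by (simp add: mat_vec_def sum_distrib_left mult_ac)
  also have "\<dots> = r * cmod (x i)" using v(2)[OF i(1)] v(1)[OF i(1)] i by simp
  finally show "cmod c \<le> r" using xi by simp
qed

text \<open>Induction on the columns. If the obstruction u for the smaller system does not
  annihilate the new column, a multiple of that column is subtracted from g so that u pairs to 0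
  with the rest, and the induction hypothesis is used a second time.\<close>

lemma fredholm_alternative:
  fixes A :: "'a \<Rightarrow> 'b \<Rightarrow> real"
  assumes "finite J" "finite I"
  shows "(\<exists>w. \<forall>i\<in>I. (\<Sum>j\<in>J. A i j * w j) = g i) \<or>
    (\<exists>u. (\<forall>j\<in>J. (\<Sum>i\<in>I. u i * A i j) = 0) \<and> (\<Sum>i\<in>I. u i * g i) = 1)"
  using assms(1)
proof (induction J arbitrary: g rule: finite_induct)
  case empty
  show ?case
  proof (cases "\<forall>i\<in>I. g i = 0")
    case False
    then obtain i where i: "i \<in> I" "g i \<noteq> 0" by blast
    have "(\<Sum>k\<in>I. (if k = i then 1 / g i else 0) * g k) = (\<Sum>k\<in>I. if k = i then 1 else 0)"
      using i by (intro sum.cong) auto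
    then show ?thesis using i assms(2) by (intro disjI2 exI[of _ "\<lambda>k. if k = i then 1 / g i else 0"]) auto
  qed simp
next
  case (insert b J)
  note IH = insert.IH
  have ext: "(\<Sum>j\<in>insert b J. A i j * (w(b := c)) j) = A i b * c + (\<Sum>j\<in>J. A i j * w j)" for i w c
  proof -
    have "(\<Sum>j\<in>J. A i j * (w(b := c)) j) = (\<Sum>j\<in>J. A i j * w j)"
      using insert.hyps by (intro sum.cong) auto
    then show ?thesis using insert.hyps by simp
  qed
  from IH[of g] show ?case
  proof
    assume "\<exists>w. \<forall>i\<in>I. (\<Sum>j\<in>J. A i j * w j) = g i"
    then obtain w where "\<forall>i\<in>I. (\<Sum>j\<in>J. A i j * w j) = g i" by blast
    then show ?thesis using ext[of _ w 0] by (intro disjI1 exI[of _ "w(b := 0)"]) auto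
  next
    assume "\<exists>u. (\<forall>j\<in>J. (\<Sum>i\<in>I. u i * A i j) = 0) \<and> (\<Sum>i\<in>I. u i * g i) = 1"
    then obtain u where u: "\<And>j. j \<in> J \<Longrightarrow> (\<Sum>i\<in>I. u i * A i j) = 0" "(\<Sum>i\<in>I. u i * g i) = 1" by blast
    define a where "a = (\<Sum>i\<in>I. u i * A i b)"
    show ?thesis
    proof (cases "a = 0")
      case True
      then show ?thesis using u by (intro disjI2 exI[of _ u]) (auto simp: a_def)
    next
      case False
      have ua: "(\<Sum>i\<in>I. u i * (A i b / a)) = 1"
        using sum_divide_distrib[of "\<lambda>i. u i * A i b" I a] False by (simp add: a_def[symmetric])
      define g' where "g' i = g i - A i b / a" for i
      have ug': "(\<Sum>i\<in>I. u i * g' i) = 0"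
        using u(2) ua unfolding g'_def right_diff_distrib sum_subtractf by simp
      from IH[of g'] show ?thesis
      proof
        assume "\<exists>w. \<forall>i\<in>I. (\<Sum>j\<in>J. A i j * w j) = g' i"
        then obtain w where "\<forall>i\<in>I. (\<Sum>j\<in>J. A i j * w j) = g' i" by blast
        then show ?thesis using ext[of _ w "1 / a"]
          by (intro disjI1 exI[of _ "w(b := 1 / a)"]) (auto simp: g'_def)
      next
        assume "\<exists>u. (\<forall>j\<in>J. (\<Sum>i\<in>I. u i * A i j) = 0) \<and> (\<Sum>i\<in>I. u i * g' i) = 1"
        then obtain w where w: "\<And>j. j \<in> J \<Longrightarrow> (\<Sum>i\<in>I. w i * A i j) = 0" "(\<Sum>i\<in>I. w i * g' i) = 1" by blast
        \<comment> \<open>Subtracting c u makes the second obstruction annihilate the new column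
          too. Its pairing with g stays 1: passing from g' back to g adds c, and c u pairs to c with
          g.\<close>
        define c where "c = (\<Sum>i\<in>I. w i * A i b) / a"
        have lin: "(\<Sum>i\<in>I. (w i - c * u i) * f i) = (\<Sum>i\<in>I. w i * f i) - c * (\<Sum>i\<in>I. u i * f i)" for f
          by (simp add: left_diff_distrib sum_subtractf sum_distrib_left mult.assoc)
        have gc: "(\<Sum>i\<in>I. w i * g i) = (\<Sum>i\<in>I. w i * g' i) + c"
          by (simp add: g'_def right_diff_distrib sum_subtractf c_def sum_divide_distrib)
        have cb: "(\<Sum>i\<in>I. (w i - c * u i) * A i b) = 0"
        proof -
          have "c * a = (\<Sum>i\<in>I. w i * A i b)" using False by (simp add: c_def)
          then show ?thesis using lin[of "\<lambda>i. A i b"] by (simp only: a_def[symmetric])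
        qed
        show ?thesis using w u gc cb
          by (intro disjI2 exI[of _ "\<lambda>i. w i - c * u i"]) (auto simp: lin)
      qed
    qed
  qed
qed

section \<open>Permutons\<close>

lemma emeasure_uniform_unit:
  assumes "B \<in> sets borel"
  shows "emeasure (uniform_measure lborel {0..1::real}) B = emeasure lborel ({0..1} \<inter> B)"
  using assms by (simp add: divide_ennreal_def)

lemma emeasure_ceiling_cell:
  fixes n :: nat and v :: int
  assumes "1 \<le> v" "v \<le> int n"
  shows "emeasure lborel {y \<in> {0..1}. \<lceil>y * real n\<rceil> = v} = ennreal (1 / n)"
proof -
  have n: "n > 0" using assms by (cases n) auto
  have "{y \<in> {0..1}. \<lceil>y * real n\<rceil> = v} = {(v - 1) / n<..v / n}"
  proof (intro set_eqI iffI)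
    fix y assume "y \<in> {(v - 1) / n<..v / n}"
    then have y: "real_of_int v - 1 < y * n" "y * n \<le> v" using n by (auto simp: field_simps)
    moreover have "real_of_int v \<le> n" "1 \<le> real_of_int v" using assms by linarith+
    ultimately have "0 < y * n" "y * n \<le> 1 * n" by linarith+
    then have "0 < y" "y \<le> 1" using n by (simp_all add: zero_less_mult_iff)
    then show "y \<in> {y \<in> {0..1}. \<lceil>y * real n\<rceil> = v}" using y by (simp add: ceiling_eq_iff)
  qed (use n in \<open>auto simp: ceiling_eq_iff field_simps\<close>)
  then show ?thesis using n by (simp add: field_simps)
qed

lemma emeasure_index_cell:
  fixes n q :: nat
  assumes "q < n"
  shows "emeasure lborel {x \<in> {0..1}. nat \<lceil>x * real n\<rceil> - 1 = q} = ennreal (1 / n)"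
proof -
  let ?A = "{x \<in> {0..1}. \<lceil>x * real n\<rceil> = int q + 1}"
  have "emeasure lborel {x \<in> {0..1}. nat \<lceil>x * real n\<rceil> - 1 = q} = emeasure lborel ?A"
  proof (rule emeasure_eq_AE)
    \<comment> \<open>The point 0 has truncated index 0 although its ceiling is 0, not 1; it is a
      null set.\<close>
    have iff: "x \<in> {x \<in> {0..1}. nat \<lceil>x * real n\<rceil> - 1 = q} \<longleftrightarrow> x \<in> ?A" if "x \<noteq> 0" for x
    proof (cases "x \<in> {0..1}")
      case True
      then have "\<lceil>x * real n\<rceil> > 0" using that assms by simp
      then have "nat \<lceil>x * real n\<rceil> - 1 = q \<longleftrightarrow> \<lceil>x * real n\<rceil> = int q + 1" by linarith
      then show ?thesis by simp
    qed auto
    show "AE x in lborel. x \<in> {x \<in> {0..1}. nat \<lceil>x * real n\<rceil> - 1 = q} \<longleftrightarrow> x \<in> ?A"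
      by (rule eventually_mono[OF AE_lborel_singleton[of 0]]) (rule iff)
  qed measurable
  then show ?thesis using emeasure_ceiling_cell[of "int q + 1" n] assms by simp
qed

lemma index_less:
  fixes n :: nat
  assumes "n > 0" "x \<le> 1"
  shows "nat \<lceil>x * real n\<rceil> - 1 < n"
proof -
  have "x * real n \<le> real n" using assms by (simp add: mult_left_le_one_le mult_right_le_one_le)
  then have "\<lceil>x * real n\<rceil> \<le> int n" by (simp add: ceiling_le_iff)
  then show ?thesis using assms by linarith
qed

lemma sets_unit_square: "unit_square \<in> sets (borel :: (real \<times> real) measure)"
  by (intro borel_closed closed_Times) auto

lemma space_permuton_of [simp]: "space (permuton_of \<sigma>) = unit_square"
  by (simp add: permuton_of_def space_restrict_space)

lemma sets_permuton_of: "sets (permuton_of \<sigma>) = sets square_borel"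
  by (simp add: permuton_of_def sets_restrict_space)

text \<open>The density of \<open>permuton_of\<close> as a function on the whole plane; Tonelli can
  then be applied to the product of two Lebesgue measures, with the square entering as an
  indicator.\<close>

definition permuton_density :: "permutation \<Rightarrow> real \<times> real \<Rightarrow> ennreal" where
  "permuton_density \<sigma> = (\<lambda>(x, y). ennreal (real (length \<sigma>) *
        of_bool (int (\<sigma> ! (nat \<lceil>x * real (length \<sigma>)\<rceil> - 1)) = \<lceil>y * real (length \<sigma>)\<rceil>)))"

lemma permuton_density_measurable [measurable]: "permuton_density \<sigma> \<in> borel_measurable borel"
proof -
  have [measurable]: "(\<lambda>x :: real. int (\<sigma> ! (nat \<lceil>x * real (length \<sigma>)\<rceil> - 1))) \<in> borel \<rightarrow>\<^sub>M count_space UNIV"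
    by (rule measurable_compose[of "\<lambda>x. \<lceil>x * real (length \<sigma>)\<rceil>" _ "count_space UNIV" "\<lambda>k. int (\<sigma> ! (nat k - 1))"]) measurable
  show ?thesis unfolding permuton_density_def borel_prod[symmetric] of_bool_def by measurable
qed

lemma emeasure_permuton_of:
  assumes "A \<in> sets borel"
  shows "emeasure (permuton_of \<sigma>) (A \<inter> unit_square) =
    (\<integral>\<^sup>+z. permuton_density \<sigma> z * indicator (A \<inter> unit_square) z \<partial>(lborel \<Otimes>\<^sub>M lborel))"
proof -
  have m: "permuton_density \<sigma> \<in> borel_measurable (restrict_space lborel unit_square)"
    by (rule measurable_restrict_space1) simp
  have sq: "unit_square \<in> sets (borel :: (real \<times> real) measure)" by (intro borel_closed closed_Times) auto
  then have A: "A \<inter> unit_square \<in> sets (restrict_space lborel unit_square)"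
    using assms by (simp add: sets_restrict_space_iff)
  have "emeasure (permuton_of \<sigma>) (A \<inter> unit_square) =
      (\<integral>\<^sup>+z. permuton_density \<sigma> z * indicator (A \<inter> unit_square) z \<partial>restrict_space lborel unit_square)"
    unfolding permuton_of_def permuton_density_def[symmetric] by (rule emeasure_density[OF m A])
  also have "\<dots> = (\<integral>\<^sup>+z. permuton_density \<sigma> z * indicator (A \<inter> unit_square) z * indicator unit_square z \<partial>lborel)"
    using sq by (subst nn_integral_restrict_space) auto
  also have "\<dots> = (\<integral>\<^sup>+z. permuton_density \<sigma> z * indicator (A \<inter> unit_square) z \<partial>lborel)"
    by (intro nn_integral_cong) (auto split: split_indicator)
  finally show ?thesis by (simp add: lborel_prod)
qed

lemma measurable_fst_square:
  assumes "sets \<mu> = sets square_borel"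
  shows "fst \<in> \<mu> \<rightarrow>\<^sub>M (borel :: real measure)"
proof -
  have "fst \<in> square_borel \<rightarrow>\<^sub>M (borel :: real measure)"
    by (intro measurable_restrict_space1 borel_measurable_continuous_onI continuous_intros)
  then show ?thesis using measurable_cong_sets[OF assms refl] by blast
qed

lemma measurable_snd_square:
  assumes "sets \<mu> = sets square_borel"
  shows "snd \<in> \<mu> \<rightarrow>\<^sub>M (borel :: real measure)"
proof -
  have "snd \<in> square_borel \<rightarrow>\<^sub>M (borel :: real measure)"
    by (intro measurable_restrict_space1 borel_measurable_continuous_onI continuous_intros)
  then show ?thesis using measurable_cong_sets[OF assms refl] by blast
qed

text \<open>Over a fixed x in [0, 1] the density equals n on a single cell of length 1/n, so every
  vertical section has mass 1.\<close>

lemma distr_fst_permuton_of: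
  assumes \<sigma>: "is_permutation \<sigma>"
  shows "distr (permuton_of \<sigma>) borel fst = uniform_measure lborel {0..1}"
proof (rule measure_eqI)
  let ?n = "length \<sigma>"
  have n: "?n > 0" using \<sigma> by (simp add: is_permutation_iff)
  fix B assume "B \<in> sets (distr (permuton_of \<sigma>) borel fst)"
  then have B: "B \<in> sets borel" by simp
  have pre: "fst -` B \<in> sets (borel :: (real \<times> real) measure)"
    using measurable_sets[OF borel_measurable_continuous_onI[OF continuous_on_fst[OF continuous_on_id]] B] by simp
  have fstm: "fst \<in> permuton_of \<sigma> \<rightarrow>\<^sub>M borel"
    by (rule measurable_fst_square[OF sets_permuton_of])
  have "emeasure (distr (permuton_of \<sigma>) borel fst) B = emeasure (permuton_of \<sigma>) (fst -` B \<inter> unit_square)"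
    using B fstm by (subst emeasure_distr) auto
  also have "\<dots> = (\<integral>\<^sup>+x. \<integral>\<^sup>+y. permuton_density \<sigma> (x, y) * indicator (fst -` B \<inter> unit_square) (x, y) \<partial>lborel \<partial>lborel)"
    unfolding emeasure_permuton_of[OF pre]
    using pre by (subst lborel.nn_integral_fst[symmetric])
      (auto simp: lborel_prod sets_unit_square
        intro!: borel_measurable_times_ennreal borel_measurable_indicator sets.Int)
  also have "\<dots> = (\<integral>\<^sup>+x. indicator ({0..1} \<inter> B) x \<partial>lborel)"
  proof (rule nn_integral_cong)
    fix x :: real
    show "(\<integral>\<^sup>+y. permuton_density \<sigma> (x, y) * indicator (fst -` B \<inter> unit_square) (x, y) \<partial>lborel) = indicator ({0..1} \<inter> B) x"
    proof (cases "x \<in> {0..1} \<inter> B")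
      case True
      define v where "v = int (\<sigma> ! (nat \<lceil>x * real ?n\<rceil> - 1))"
      have "nat \<lceil>x * real ?n\<rceil> - 1 < ?n" using index_less[OF n] True by simp
      then have "\<sigma> ! (nat \<lceil>x * real ?n\<rceil> - 1) \<in> {1..?n}" using \<sigma> nth_mem by (auto simp: is_permutation_iff)
      then have v: "1 \<le> v" "v \<le> int ?n" by (auto simp: v_def)
      have "(\<integral>\<^sup>+y. permuton_density \<sigma> (x, y) * indicator (fst -` B \<inter> unit_square) (x, y) \<partial>lborel) =
          (\<integral>\<^sup>+y. ennreal ?n * indicator {y \<in> {0..1}. \<lceil>y * real ?n\<rceil> = v} y \<partial>lborel)"
        using True by (intro nn_integral_cong) (auto simp: permuton_density_def v_def split: split_indicator)
      also have "\<dots> = ennreal ?n * emeasure lborel {y \<in> {0..1}. \<lceil>y * real ?n\<rceil> = v}"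
        by (subst nn_integral_cmult_indicator) auto
      also have "\<dots> = 1" using n unfolding emeasure_ceiling_cell[OF v] by (simp add: ennreal_mult'[symmetric])
      finally show ?thesis using True by simp
    next
      case False
      then have "indicator (fst -` B \<inter> unit_square) (x, y) = (0 :: ennreal)" for y
        by (auto split: split_indicator)
      then show ?thesis using False by simp
    qed
  qed
  also have "\<dots> = emeasure lborel ({0..1} \<inter> B)" using B by simp
  finally show "emeasure (distr (permuton_of \<sigma>) borel fst) B = emeasure (uniform_measure lborel {0..1}) B"
    using B emeasure_uniform_unit by simp
qed simp

text \<open>At a fixed y > 0 the ceiling of y n is a value taken at exactly one position, and the
  cell of this position has length 1/n. At y = 0 the ceiling is 0, which is no value; this null set
  is left out.\<close>

lemma distr_snd_permuton_of:
  assumes \<sigma>: "is_permutation \<sigma>"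
  shows "distr (permuton_of \<sigma>) borel snd = uniform_measure lborel {0..1}"
proof (rule measure_eqI)
  let ?n = "length \<sigma>"
  have n: "?n > 0" using \<sigma> by (simp add: is_permutation_iff)
  fix B assume "B \<in> sets (distr (permuton_of \<sigma>) borel snd)"
  then have B: "B \<in> sets borel" by simp
  have pre: "snd -` B \<in> sets (borel :: (real \<times> real) measure)"
    using measurable_sets[OF borel_measurable_continuous_onI[OF continuous_on_snd[OF continuous_on_id]] B] by simp
  have sndm: "snd \<in> permuton_of \<sigma> \<rightarrow>\<^sub>M borel"
    by (rule measurable_snd_square[OF sets_permuton_of])
  have "emeasure (distr (permuton_of \<sigma>) borel snd) B = emeasure (permuton_of \<sigma>) (snd -` B \<inter> unit_square)"
    using B sndm by (subst emeasure_distr) auto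
  also have "\<dots> = (\<integral>\<^sup>+y. \<integral>\<^sup>+x. permuton_density \<sigma> (x, y) * indicator (snd -` B \<inter> unit_square) (x, y) \<partial>lborel \<partial>lborel)"
    unfolding emeasure_permuton_of[OF pre]
    using pre by (subst lborel_pair.nn_integral_snd[symmetric])
      (auto simp: lborel_prod sets_unit_square
        intro!: borel_measurable_times_ennreal borel_measurable_indicator sets.Int)
  also have "\<dots> = (\<integral>\<^sup>+y. indicator ({0..1} \<inter> B) y \<partial>lborel)"
  proof (rule nn_integral_cong_AE, use AE_lborel_singleton[of 0] in eventually_elim)
    fix y :: real assume y0: "y \<noteq> 0"
    show "(\<integral>\<^sup>+x. permuton_density \<sigma> (x, y) * indicator (snd -` B \<inter> unit_square) (x, y) \<partial>lborel) = indicator ({0..1} \<inter> B) y"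
    proof (cases "y \<in> {0..1} \<inter> B")
      case True
      have "y * real ?n \<le> real ?n" using True by (simp add: mult_left_le_one_le)
      moreover have "0 < \<lceil>y * real ?n\<rceil>" using True y0 n by simp
      moreover have "set \<sigma> = {1..?n}" using \<sigma> by (simp add: is_permutation_iff)
      moreover have "\<lceil>y * real ?n\<rceil> \<le> int ?n" using calculation(1) by (simp add: ceiling_le_iff)
      ultimately have "1 \<le> nat \<lceil>y * real ?n\<rceil>" "nat \<lceil>y * real ?n\<rceil> \<le> ?n" "set \<sigma> = {1..?n}" by linarith+
      then have "nat \<lceil>y * real ?n\<rceil> \<in> set \<sigma>" by simp
      then obtain q where q: "q < ?n" "\<sigma> ! q = nat \<lceil>y * real ?n\<rceil>" by (auto simp: in_set_conv_nth)
      have iff: "int (\<sigma> ! (nat \<lceil>x * real ?n\<rceil> - 1)) = \<lceil>y * real ?n\<rceil> \<longleftrightarrow> nat \<lceil>x * real ?n\<rceil> - 1 = q"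
        if "x \<in> {0..1}" for x
        using permutation_nth_eq_iff[OF \<sigma> index_less[OF n] q(1), of x] that q(2) \<open>0 < \<lceil>y * real ?n\<rceil>\<close> by auto
      have "(\<integral>\<^sup>+x. permuton_density \<sigma> (x, y) * indicator (snd -` B \<inter> unit_square) (x, y) \<partial>lborel) =
          (\<integral>\<^sup>+x. ennreal ?n * indicator {x \<in> {0..1}. nat \<lceil>x * real ?n\<rceil> - 1 = q} x \<partial>lborel)"
        using True by (intro nn_integral_cong) (auto simp: permuton_density_def iff simp del: One_nat_def split: split_indicator)
      also have "\<dots> = ennreal ?n * emeasure lborel {x \<in> {0..1}. nat \<lceil>x * real ?n\<rceil> - 1 = q}"
        by (subst nn_integral_cmult_indicator) measurable
      also have "\<dots> = 1" using n unfolding emeasure_index_cell[OF q(1)] by (simp add: ennreal_mult'[symmetric])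
      finally show ?thesis using True by simp
    next
      case False
      then have "indicator (snd -` B \<inter> unit_square) (x, y) = (0 :: ennreal)" for x
        by (auto split: split_indicator)
      then show ?thesis using False by simp
    qed
  qed
  also have "\<dots> = emeasure lborel ({0..1} \<inter> B)" using B by simp
  finally show "emeasure (distr (permuton_of \<sigma>) borel snd) B = emeasure (uniform_measure lborel {0..1}) B"
    using B emeasure_uniform_unit by simp
qed simp

lemma permutonI:
  assumes sets: "sets \<mu> = sets square_borel"
    and "distr \<mu> borel fst = uniform_measure lborel {0..1}" "distr \<mu> borel snd = uniform_measure lborel {0..1}"
  shows "\<mu> \<in> permutons"
proof -
  have fstm: "fst \<in> \<mu> \<rightarrow>\<^sub>M borel"
    by (rule measurable_fst_square[OF sets])
  have "emeasure \<mu> (space \<mu>) = emeasure (distr \<mu> borel fst) UNIV"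
    using fstm by (subst emeasure_distr) auto
  also have "\<dots> = 1" unfolding assms(2) using emeasure_uniform_unit[of UNIV] by simp
  finally have "prob_space \<mu>" by (rule prob_spaceI)
  then show ?thesis using assms by (simp add: permutons_def)
qed

lemma permuton_of_in_permutons: "is_permutation \<sigma> \<Longrightarrow> permuton_of \<sigma> \<in> permutons"
  by (intro permutonI sets_permuton_of distr_fst_permuton_of distr_snd_permuton_of)

lemma continuous_on_square_measurable:
  fixes f :: "real \<times> real \<Rightarrow> real"
  assumes "continuous_on unit_square f" "sets \<mu> = sets square_borel"
  shows "f \<in> borel_measurable \<mu>"
  using borel_measurable_continuous_on_restrict[OF assms(1)] measurable_cong_sets[OF assms(2) refl] by blast

lemma compact_unit_square: "compact unit_square"
  by (intro compact_Times) auto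

lemma continuous_on_square_bounded:
  fixes f :: "real \<times> real \<Rightarrow> real"
  assumes "continuous_on unit_square f"
  obtains B where "B \<ge> 0" "\<And>z. z \<in> unit_square \<Longrightarrow> \<bar>f z\<bar> \<le> B"
proof -
  have "bounded (f ` unit_square)"
    using compact_continuous_image[OF assms compact_unit_square] by (rule compact_imp_bounded)
  then obtain B where "\<forall>x\<in>f ` unit_square. norm x \<le> B" by (auto simp: bounded_iff)
  then show ?thesis by (intro that[of "max 0 B"]) (auto simp: le_max_iff_disj)
qed

lemma integrable_permuton:
  fixes f :: "real \<times> real \<Rightarrow> real"
  assumes "continuous_on unit_square f" "\<mu> \<in> permutons"
  shows "integrable \<mu> f"
proof -
  obtain B where B: "\<And>z. z \<in> unit_square \<Longrightarrow> \<bar>f z\<bar> \<le> B" using continuous_on_square_bounded[OF assms(1)] by blast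
  interpret prob_space \<mu> using assms(2) by (simp add: permutons_def)
  have sets: "sets \<mu> = sets square_borel" using assms(2) by (simp add: permutons_def)
  then have "space \<mu> = unit_square" using sets_eq_imp_space_eq[OF sets] by (simp add: space_restrict_space)
  then show ?thesis using B continuous_on_square_measurable[OF assms(1) sets]
    by (intro integrable_const_bound[of _ B]) auto
qed

text \<open>The column of each position has mass 1/n, and almost every point of it in the support is
  within 1/n, in both coordinates, of the point (q/n, \<sigma>(q)/n) with q counted from 0. Hence
  the Lipschitz error 2 K / n.\<close>

lemma permuton_integral_approx:
  fixes f :: "real \<times> real \<Rightarrow> real"
  assumes \<sigma>: "is_permutation \<sigma>" and f: "continuous_on unit_square f"
    and lip: "\<And>x y x' y'. (x, y) \<in> unit_square \<Longrightarrow> (x', y') \<in> unit_square \<Longrightarrow>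
      \<bar>f (x, y) - f (x', y')\<bar> \<le> K * (\<bar>x - x'\<bar> + \<bar>y - y'\<bar>)" and K: "K \<ge> 0"
  shows "\<bar>(\<integral>z. f z \<partial>permuton_of \<sigma>) -
    (\<Sum>q<length \<sigma>. f (real q / length \<sigma>, real (\<sigma> ! q) / length \<sigma>)) / length \<sigma>\<bar> \<le> 2 * K / length \<sigma>"
proof -
  let ?n = "length \<sigma>" and ?\<mu> = "permuton_of \<sigma>"
  have n: "?n > 0" using \<sigma> by (simp add: is_permutation_iff)
  have perm: "?\<mu> \<in> permutons" using permuton_of_in_permutons[OF \<sigma>] .
  interpret prob_space ?\<mu> using perm by (simp add: permutons_def)
  define idx where "idx x = nat \<lceil>x * real ?n\<rceil> - 1" for x
  define pt where "pt q = (real q / ?n, real (\<sigma> ! q) / ?n)" for q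
  have val: "\<sigma> ! q \<in> {1..?n}" if "q < ?n" for q using \<sigma> nth_mem[OF that] by (auto simp: is_permutation_iff)
  define E where "E q = {z \<in> space ?\<mu>. idx (fst z) = q}" for q
  have fstm: "fst \<in> ?\<mu> \<rightarrow>\<^sub>M borel"
    by (rule measurable_fst_square[OF sets_permuton_of])
  have idxm: "{x. idx x = q} \<in> sets borel" for q unfolding idx_def by measurable
  have Eset: "E q = fst -` {x. idx x = q} \<inter> space ?\<mu>" for q by (auto simp: E_def)
  have Em: "E q \<in> sets ?\<mu>" for q unfolding Eset using measurable_sets[OF fstm idxm] .
  have mE: "measure ?\<mu> (E q) = 1 / ?n" if "q < ?n" for q
  proof -
    have "emeasure ?\<mu> (E q) = emeasure (distr ?\<mu> borel fst) {x. idx x = q}"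
      unfolding Eset using fstm idxm by (subst emeasure_distr) auto
    also have "\<dots> = emeasure lborel ({0..1} \<inter> {x. idx x = q})"
      unfolding distr_fst_permuton_of[OF \<sigma>] by (rule emeasure_uniform_unit[OF idxm])
    also have "{0..1} \<inter> {x. idx x = q} = {x \<in> {0..1}. nat \<lceil>x * real ?n\<rceil> - 1 = q}" by (auto simp: idx_def)
    finally show ?thesis using emeasure_index_cell[OF that] by (simp add: measure_def)
  qed
  define \<phi> where "\<phi> z = (\<Sum>q<?n. f (pt q) * indicator (E q) z)" for z
  have \<phi>_int: "integrable ?\<mu> \<phi>" unfolding \<phi>_def using Em
    by (intro Bochner_Integration.integrable_sum integrable_mult_right integrable_real_indicator) (auto simp: emeasure_eq_measure)
  have "(\<integral>z. \<phi> z \<partial>?\<mu>) = (\<Sum>q<?n. f (pt q) * measure ?\<mu> (E q))"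
  proof -
    have "E q \<inter> unit_square = E q" for q by (auto simp: E_def)
    then show ?thesis
      unfolding \<phi>_def using Em by (subst Bochner_Integration.integral_sum) (auto simp: emeasure_eq_measure)
  qed
  also have "\<dots> = (\<Sum>q<?n. f (pt q)) / ?n" by (simp add: mE sum_divide_distrib)
  finally have \<phi>: "(\<integral>z. \<phi> z \<partial>?\<mu>) = (\<Sum>q<?n. f (pt q)) / ?n" .
  have f_int: "integrable ?\<mu> f" by (rule integrable_permuton[OF f perm])
  \<comment> \<open>Almost every point has positive density, so its height belongs to the cell of
    the value at its column.\<close>
  have supp: "AE z in ?\<mu>. permuton_density \<sigma> z > 0"
    unfolding permuton_of_def permuton_density_def[symmetric]
    by (subst AE_density) (auto intro: measurable_restrict_space1)
  have close: "AE z in ?\<mu>. \<bar>f z - \<phi> z\<bar> \<le> 2 * K / ?n"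
    using supp AE_space
  proof eventually_elim
    case (elim z)
    obtain x y where z: "z = (x, y)" by (cases z)
    have xy: "0 \<le> x" "x \<le> 1" "0 \<le> y" "y \<le> 1" using elim z by auto
    define q where "q = idx x"
    have q: "q < ?n" unfolding q_def idx_def using index_less[OF n] xy by simp
    have "\<phi> z = (\<Sum>p<?n. if p = q then f (pt p) else 0)" unfolding \<phi>_def
      using elim z by (intro sum.cong) (auto simp: E_def q_def split: split_indicator)
    then have \<phi>z: "\<phi> z = f (pt q)" using q by simp
    have eq: "int (\<sigma> ! q) = \<lceil>y * real ?n\<rceil>"
      using elim(1) z by (auto simp: permuton_density_def q_def idx_def of_bool_def split: if_splits)
    have "\<bar>y * real ?n - real (\<sigma> ! q)\<bar> \<le> 1" using eq ceiling_correct[of "y * real ?n"] by linarith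
    then have dy: "\<bar>y - real (\<sigma> ! q) / ?n\<bar> \<le> 1 / ?n"
      using n by (simp add: field_simps abs_le_iff)
    \<comment> \<open>Positions count from 0 and values from 1: q/n is the left end of the column,
      \<sigma>(q)/n the upper end of the row. Both are within one cell; x = 0 is separate because of
      the truncated subtraction.\<close>
    have "\<bar>x * real ?n - real q\<bar> \<le> 1"
    proof (cases "x = 0")
      case False
      then have "0 < \<lceil>x * real ?n\<rceil>" using xy n by simp
      then have "int q = \<lceil>x * real ?n\<rceil> - 1" unfolding q_def idx_def by linarith
      then have "real q = of_int \<lceil>x * real ?n\<rceil> - 1" by (metis of_int_1 of_int_diff of_int_of_nat_eq)
      then show ?thesis using ceiling_correct[of "x * real ?n"] by linarith
    qed (simp add: q_def idx_def)
    then have dx: "\<bar>x - real q / ?n\<bar> \<le> 1 / ?n" using n by (simp add: field_simps abs_le_iff)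
    have pq: "pt q \<in> unit_square" using q val[OF q] n by (simp add: pt_def divide_le_eq_1)
    have "\<bar>f z - \<phi> z\<bar> \<le> K * (\<bar>x - real q / ?n\<bar> + \<bar>y - real (\<sigma> ! q) / ?n\<bar>)"
      using lip[of x y "real q / ?n" "real (\<sigma> ! q) / ?n"] xy pq \<phi>z unfolding z pt_def by simp
    also have "\<dots> \<le> K * (1 / ?n + 1 / ?n)" using dx dy K by (intro mult_left_mono add_mono) auto
    finally show ?case by (simp add: field_simps)
  qed
  have "\<bar>(\<integral>z. f z \<partial>?\<mu>) - (\<integral>z. \<phi> z \<partial>?\<mu>)\<bar> = \<bar>\<integral>z. f z - \<phi> z \<partial>?\<mu>\<bar>"
    using f_int \<phi>_int by (simp add: Bochner_Integration.integral_diff)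
  also have "\<dots> \<le> (\<integral>z. \<bar>f z - \<phi> z\<bar> \<partial>?\<mu>)" by (rule integral_abs_bound)
  also have "\<dots> \<le> (\<integral>z. 2 * K / ?n \<partial>?\<mu>)"
    using f_int \<phi>_int close by (intro integral_mono_AE) auto
  also have "\<dots> = 2 * K / ?n" using prob_space by simp
  finally show ?thesis unfolding \<phi> pt_def .
qed

section \<open>The X-permuton as a mixture of four segments\<close>

lemma UNIV_side: "(UNIV :: side set) = {LeftSide, RightSide}"
  using side.exhaust by auto

lemma UNIV_sign: "(UNIV :: sign set) = {Plus, Minus}"
  using sign.exhaust by auto

lemma emeasure_scaled_unit:
  fixes c d :: real
  assumes B: "B \<in> sets borel" and c: "c \<noteq> 0"
  shows "ennreal \<bar>c\<bar> * emeasure lborel {t \<in> {0..1}. d + c * t \<in> B} = emeasure lborel ((\<lambda>t. d + c * t) ` {0..1} \<inter> B)"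
proof -
  have m: "(\<lambda>t. d + c * t) ` {0..1} \<in> sets borel"
    by (intro borel_compact compact_continuous_image continuous_intros) auto
  have inj: "d + c * t \<in> (\<lambda>t. d + c * t) ` {0..1} \<longleftrightarrow> t \<in> {0..1}" for t
    using c by auto
  have "emeasure lborel ((\<lambda>t. d + c * t) ` {0..1} \<inter> B) = (\<integral>\<^sup>+x. indicator ((\<lambda>t. d + c * t) ` {0..1} \<inter> B) x \<partial>lborel)"
    using m B by simp
  also have "\<dots> = ennreal \<bar>c\<bar> * (\<integral>\<^sup>+t. indicator ((\<lambda>t. d + c * t) ` {0..1} \<inter> B) (d + c * t) \<partial>lborel)"
    using c m B by (intro nn_integral_real_affine) auto
  also have "(\<integral>\<^sup>+t. indicator ((\<lambda>t. d + c * t) ` {0..1} \<inter> B) (d + c * t) \<partial>lborel) =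
      (\<integral>\<^sup>+t. indicator {t \<in> {0..1}. d + c * t \<in> B} t \<partial>lborel)"
    using inj by (intro nn_integral_cong) (auto split: split_indicator)
  also have "\<dots> = emeasure lborel {t \<in> {0..1}. d + c * t \<in> B}"
  proof -
    have "(\<lambda>t. d + c * t) -` B \<inter> space borel \<in> sets borel"
      using B by (intro measurable_sets[of _ borel borel] borel_measurable_continuous_onI continuous_intros)
    then have "(\<lambda>t. d + c * t) -` B \<inter> {0..1} \<in> sets borel" by (intro sets.Int) auto
    moreover have "(\<lambda>t. d + c * t) -` B \<inter> {0..1} = {t \<in> {0..1}. d + c * t \<in> B}" by auto
    ultimately show ?thesis by (intro nn_integral_indicator) simp
  qed
  finally show ?thesis by simp
qed

text \<open>Each weight is the length of the interval onto which [0, 1] is mapped, so the images are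
  Lebesgue measure on [0, a] and [a, 1]. A degenerate interval has weight 0. Both marginals of the
  X-permuton reduce to this identity.\<close>

lemma emeasure_two_segments:
  fixes a :: real
  assumes B: "B \<in> sets borel" and a: "0 \<le> a" "a \<le> 1"
  shows "ennreal a * emeasure lborel {t \<in> {0..1}. a * t \<in> B} +
    ennreal (1 - a) * emeasure lborel {t \<in> {0..1}. 1 + (a - 1) * t \<in> B} = emeasure lborel ({0..1} \<inter> B)"
proof -
  have l: "ennreal a * emeasure lborel {t \<in> {0..1}. a * t \<in> B} = emeasure lborel ({0..a} \<inter> B)"
  proof (cases "a = 0")
    case True
    have "emeasure lborel ({0..0} \<inter> B) \<le> emeasure lborel {0..0::real}" using B by (intro emeasure_mono) auto
    then show ?thesis using True by simp
  next
    case False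
    have "(\<lambda>t. 0 + a * t) ` {0..1} = {0..a}"
      using a False by (auto simp: image_iff mult_left_le intro!: bexI[of _ "_ / a"])
    then show ?thesis using emeasure_scaled_unit[OF B False, of 0] a by simp
  qed
  have r: "ennreal (1 - a) * emeasure lborel {t \<in> {0..1}. 1 + (a - 1) * t \<in> B} = emeasure lborel ({a..1} \<inter> B)"
  proof (cases "a = 1")
    case True
    have "emeasure lborel ({1..1} \<inter> B) \<le> emeasure lborel {1..1::real}" using B by (intro emeasure_mono) auto
    then show ?thesis using True by simp
  next
    case False
    have "(\<lambda>t. 1 + (a - 1) * t) ` {0..1} = {a..1}"
    proof (intro set_eqI iffI)
      fix x assume "x \<in> {a..1}"
      then show "x \<in> (\<lambda>t. 1 + (a - 1) * t) ` {0..1}"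
        using a False by (intro image_eqI[of _ _ "(1 - x) / (1 - a)"]) (auto simp: field_simps)
    next
      fix x assume "x \<in> (\<lambda>t. 1 + (a - 1) * t) ` {0..1}"
      then obtain t where t: "0 \<le> t" "t \<le> 1" "x = 1 - (1 - a) * t" by (auto simp: algebra_simps)
      have "(1 - a) * t \<le> 1 - a" "0 \<le> (1 - a) * t" using t a by (auto simp: mult_left_le)
      then show "x \<in> {a..1}" using t by simp
    qed
    then show ?thesis using emeasure_scaled_unit[OF B, of "a - 1" 1] a False by (simp add: abs_if)
  qed
  have "emeasure lborel ({0..a} \<inter> B) + emeasure lborel ({a..1} \<inter> B) =
      emeasure lborel ({0..a} \<inter> B) + emeasure lborel ({a<..1} \<inter> B)"
  proof -
    have "emeasure lborel ({a..1} \<inter> B) = emeasure lborel ({a<..1} \<inter> B)"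
    proof (rule emeasure_eq_AE)
      have iff: "x \<in> {a..1} \<inter> B \<longleftrightarrow> x \<in> {a<..1} \<inter> B" if "x \<noteq> a" for x using that by auto
      show "AE x in lborel. x \<in> {a..1} \<inter> B \<longleftrightarrow> x \<in> {a<..1} \<inter> B"
        by (rule eventually_mono[OF AE_lborel_singleton[of a]]) (rule iff)
    qed (use B in auto)
    then show ?thesis by simp
  qed
  also have "\<dots> = emeasure lborel (({0..a} \<inter> B) \<union> ({a<..1} \<inter> B))"
    using B by (intro plus_emeasure) auto
  also have "({0..a} \<inter> B) \<union> ({a<..1} \<inter> B) = {0..1} \<inter> B" using a by auto
  finally show ?thesis using l r by simp
qed

lemma corner_in_square: "corner e s \<in> unit_square"
  by (cases e; cases s) auto

lemma linepath_in_square: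
  assumes "P \<in> unit_square" "Q \<in> unit_square" "t \<in> {0..1}"
  shows "linepath P Q t \<in> unit_square"
proof -
  have "convex unit_square" by (intro convex_Times) auto
  then have "closed_segment P Q \<subseteq> unit_square" using assms by (intro closed_segment_subset)
  then show ?thesis using assms(3) linepath_in_path[of t P Q] by blast
qed

context
  fixes p :: "side \<Rightarrow> sign \<Rightarrow> real" and a b :: real
  assumes p: "\<And>e s. p e s \<in> {0..1}"
    and sum_p: "p LeftSide Plus + p RightSide Plus + p LeftSide Minus + p RightSide Minus = 1"
  defines "a \<equiv> p LeftSide Plus + p LeftSide Minus" and "b \<equiv> p LeftSide Plus + p RightSide Minus"
begin

lemma X_center_in_square: "(a, b) \<in> unit_square"
proof -
  have "0 \<le> p LeftSide Plus" "0 \<le> p LeftSide Minus" "0 \<le> p RightSide Plus" "0 \<le> p RightSide Minus"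
    using p by auto
  then show ?thesis using sum_p by (auto simp: a_def b_def)
qed

lemma X_path_in_square: "t \<in> {0..1} \<Longrightarrow> linepath (corner e s) (a, b) t \<in> unit_square"
  by (intro linepath_in_square corner_in_square X_center_in_square)

lemma X_path_measurable:
  "linepath (corner e s) (a, b) \<in> restrict_space lborel {0..1} \<rightarrow>\<^sub>M square_borel"
proof (rule measurable_restrict_space2)
  show "linepath (corner e s) (a, b) \<in> space (restrict_space lborel {0..1}) \<rightarrow> unit_square"
    using X_path_in_square by (auto simp: space_restrict_space)
  show "linepath (corner e s) (a, b) \<in> borel_measurable (restrict_space lborel {0..1})"
    by (intro measurable_restrict_space1) (simp add: borel_measurable_continuous_onI continuous_on_linepath)
qed

text \<open>Law of a random arm of the X. A random point of the X-permuton is an arm chosen by this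
  law followed by a uniform point on it, which makes integrals accessible to Fubini.\<close>

definition X_mix :: "(side \<times> sign) measure" where
  "X_mix = density (count_space UNIV) (\<lambda>(e, s). ennreal (p e s))"

lemma nn_integral_X_mix: "(\<integral>\<^sup>+c. f c \<partial>X_mix) = (\<Sum>e\<in>{LeftSide, RightSide}. \<Sum>s\<in>{Plus, Minus}. ennreal (p e s) * f (e, s))"
proof -
  have fin: "finite (UNIV :: (side \<times> sign) set)" unfolding UNIV_Times_UNIV[symmetric] UNIV_side UNIV_sign by simp
  have "(\<integral>\<^sup>+c. f c \<partial>X_mix) = (\<Sum>c\<in>UNIV. (case c of (e, s) \<Rightarrow> ennreal (p e s)) * f c)"
    unfolding X_mix_def using fin by (subst nn_integral_density) (auto simp: nn_integral_count_space_finite)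
  then show ?thesis
    unfolding UNIV_Times_UNIV[symmetric] UNIV_side UNIV_sign by (simp add: sum.cartesian_product case_prod_beta')
qed

lemma X_mix_prob: "prob_space X_mix"
proof (rule prob_spaceI)
  have "emeasure X_mix (space X_mix) = (\<integral>\<^sup>+c. 1 \<partial>X_mix)" by simp
  also have "\<dots> = ennreal (p LeftSide Plus + p LeftSide Minus + p RightSide Plus + p RightSide Minus)"
    unfolding nn_integral_X_mix using p by (simp add: ennreal_plus[symmetric] add.assoc del: ennreal_plus)
  finally show "emeasure X_mix (space X_mix) = 1" using sum_p by (simp add: algebra_simps)
qed

definition X_map :: "(side \<times> sign) \<times> real \<Rightarrow> real \<times> real" where
  "X_map = (\<lambda>((e, s), t). linepath (corner e s) (a, b) t)"

lemma X_map_measurable: "X_map \<in> X_mix \<Otimes>\<^sub>M restrict_space lborel {0..1} \<rightarrow>\<^sub>M square_borel"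
proof -
  have fin: "countable (UNIV :: (side \<times> sign) set)" unfolding UNIV_Times_UNIV[symmetric] UNIV_side UNIV_sign by simp
  have "(\<lambda>z. linepath (corner (fst (fst z)) (snd (fst z))) (a, b) (snd z)) \<in>
      count_space UNIV \<Otimes>\<^sub>M restrict_space lborel {0..1} \<rightarrow>\<^sub>M square_borel"
    by (rule measurable_pair_measure_countable1[OF fin]) (simp add: X_path_measurable)
  moreover have "sets (X_mix \<Otimes>\<^sub>M restrict_space lborel {0..1}) = sets (count_space UNIV \<Otimes>\<^sub>M restrict_space lborel {0..1})"
    by (intro sets_pair_measure_cong) (auto simp: X_mix_def)
  ultimately have "(\<lambda>z. linepath (corner (fst (fst z)) (snd (fst z))) (a, b) (snd z)) \<in>
      X_mix \<Otimes>\<^sub>M restrict_space lborel {0..1} \<rightarrow>\<^sub>M square_borel"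
    using measurable_cong_sets[OF _ refl] by blast
  then show ?thesis by (simp add: X_map_def case_prod_beta')
qed

lemma unit_interval_prob: "prob_space (restrict_space lborel {0..1::real})"
  by (rule prob_spaceI) (simp add: space_restrict_space emeasure_restrict_space)

lemma emeasure_X_distr:
  assumes A: "A \<in> sets square_borel"
  shows "emeasure (distr (X_mix \<Otimes>\<^sub>M restrict_space lborel {0..1}) square_borel X_map) A =
    (\<Sum>e\<in>{LeftSide, RightSide}. \<Sum>s\<in>{Plus, Minus}. ennreal (p e s) *
      emeasure (restrict_space lborel {0..1}) (linepath (corner e s) (a, b) -` A \<inter> {0..1}))"
proof -
  let ?U = "restrict_space lborel {0..1::real}"
  interpret U: prob_space ?U by (rule unit_interval_prob)
  have "emeasure (distr (X_mix \<Otimes>\<^sub>M ?U) square_borel X_map) A =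
      emeasure (X_mix \<Otimes>\<^sub>M ?U) (X_map -` A \<inter> space (X_mix \<Otimes>\<^sub>M ?U))"
    using A by (intro emeasure_distr X_map_measurable)
  also have "\<dots> = (\<integral>\<^sup>+c. emeasure ?U (Pair c -` (X_map -` A \<inter> space (X_mix \<Otimes>\<^sub>M ?U))) \<partial>X_mix)"
    by (intro U.emeasure_pair_measure_alt measurable_sets[OF X_map_measurable A])
  also have "\<dots> = (\<integral>\<^sup>+c. emeasure ?U (linepath (corner (fst c) (snd c)) (a, b) -` A \<inter> {0..1}) \<partial>X_mix)"
    by (intro nn_integral_cong arg_cong[where f="emeasure ?U"])
      (auto simp: space_pair_measure space_restrict_space X_map_def X_mix_def)
  finally show ?thesis by (simp add: nn_integral_X_mix)
qed

text \<open>\<open>measure_of\<close> returns the intended values only for a set function that is a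
  measure; its agreement with the law of a random point supplies this.\<close>

lemma X_permuton_eq_distr:
  "X_permuton p = distr (X_mix \<Otimes>\<^sub>M restrict_space lborel {0..1}) square_borel X_map"
proof -
  let ?X = "distr (X_mix \<Otimes>\<^sub>M restrict_space lborel {0..1}) square_borel X_map"
  have space: "space ?X = unit_square" by (simp add: space_restrict_space)
  have "measure_of unit_square (sets square_borel)
       (\<lambda>B. \<Sum>e\<in>{LeftSide, RightSide}. \<Sum>s\<in>{Plus, Minus}.
              ennreal (p e s) * emeasure (segment_measure (corner e s) (a, b)) B)
     = measure_of unit_square (sets square_borel) (emeasure ?X)"
  proof (rule measure_of_eq)
    have *: "sets square_borel \<subseteq> Pow unit_square"
      using sets.space_closed[of square_borel] by (simp add: space_restrict_space)
    then show "sets square_borel \<subseteq> Pow unit_square" .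
    fix A assume "A \<in> sigma_sets unit_square (sets square_borel)"
    then have A: "A \<in> sets square_borel"
      using sets.sigma_sets_eq[of square_borel] by (simp add: space_restrict_space)
    have "emeasure (segment_measure (corner e s) (a, b)) A =
        emeasure (restrict_space lborel {0..1}) (linepath (corner e s) (a, b) -` A \<inter> {0..1})" for e s
      unfolding segment_measure_def using A X_path_measurable
      by (subst emeasure_distr) (auto simp: space_restrict_space)
    then show "(\<Sum>e\<in>{LeftSide, RightSide}. \<Sum>s\<in>{Plus, Minus}.
              ennreal (p e s) * emeasure (segment_measure (corner e s) (a, b)) A) = emeasure ?X A"
      using emeasure_X_distr[OF A] by simp
  qed
  also have "\<dots> = ?X" using measure_of_of_measure[of ?X] space by simp
  finally show ?thesis by (simp add: X_permuton_def a_def b_def)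
qed

lemma sets_X_permuton: "sets (X_permuton p) = sets square_borel"
  by (simp add: X_permuton_eq_distr)

lemma emeasure_X_permuton_preimage:
  assumes g: "g \<in> square_borel \<rightarrow>\<^sub>M borel" and B: "B \<in> sets (borel :: real measure)"
  shows "emeasure (distr (X_permuton p) borel g) B =
    (\<Sum>e\<in>{LeftSide, RightSide}. \<Sum>s\<in>{Plus, Minus}. ennreal (p e s) *
      emeasure lborel {t \<in> {0..1}. g (linepath (corner e s) (a, b) t) \<in> B})"
proof -
  have g': "g \<in> X_permuton p \<rightarrow>\<^sub>M borel" using g measurable_cong_sets[OF sets_X_permuton refl] by blast
  have space: "space (X_permuton p) = unit_square"
    using sets_eq_imp_space_eq[OF sets_X_permuton] by (simp add: space_restrict_space)
  have A: "g -` B \<inter> unit_square \<in> sets square_borel"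
    using measurable_sets[OF g B] by (simp add: space_restrict_space)
  have pre: "emeasure (restrict_space lborel {0..1}) (linepath (corner e s) (a, b) -` (g -` B \<inter> unit_square) \<inter> {0..1}) =
      emeasure lborel {t \<in> {0..1}. g (linepath (corner e s) (a, b) t) \<in> B}" for e s
    using X_path_in_square[of _ e s]
    by (subst emeasure_restrict_space) (auto intro!: arg_cong[where f="emeasure lborel"])
  have "emeasure (distr (X_permuton p) borel g) B = emeasure (X_permuton p) (g -` B \<inter> unit_square)"
    using emeasure_distr[OF g' B] space by simp
  also have "\<dots> = (\<Sum>e\<in>{LeftSide, RightSide}. \<Sum>s\<in>{Plus, Minus}. ennreal (p e s) *
      emeasure (restrict_space lborel {0..1}) (linepath (corner e s) (a, b) -` (g -` B \<inter> unit_square) \<inter> {0..1}))"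
    unfolding X_permuton_eq_distr by (rule emeasure_X_distr[OF A])
  finally show ?thesis by (simp only: pre)
qed

text \<open>Horizontally the two left arms run from 0 to a with total weight a, the two right arms
  from 1 to a with weight 1 - a. Vertically the arms from the lower corners have total weight b,
  those from the upper corners 1 - b.\<close>

lemma X_permuton_in_permutons: "X_permuton p \<in> permutons"
proof (rule permutonI[OF sets_X_permuton])
  have pn: "p e s \<ge> 0" for e s using p by auto
  have ab: "0 \<le> a" "a \<le> 1" "0 \<le> b" "b \<le> 1" using X_center_in_square by auto
  show "distr (X_permuton p) borel fst = uniform_measure lborel {0..1}"
  proof (rule measure_eqI)
    fix B assume "B \<in> sets (distr (X_permuton p) borel fst)"
    then have B: "B \<in> sets borel" by simp
    let ?l = "emeasure lborel {t \<in> {0..1}. a * t \<in> B}"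
    let ?r = "emeasure lborel {t \<in> {0..1}. 1 + (a - 1) * t \<in> B}"
    have c: "fst (linepath (corner LeftSide s) (a, b) t) = a * t" "fst (linepath (corner RightSide s) (a, b) t) = 1 + (a - 1) * t" for s t
      by (cases s; simp add: linepath_def algebra_simps)+
    have "emeasure (distr (X_permuton p) borel fst) B =
        (ennreal (p LeftSide Plus) + ennreal (p LeftSide Minus)) * ?l + (ennreal (p RightSide Plus) + ennreal (p RightSide Minus)) * ?r"
      unfolding emeasure_X_permuton_preimage[OF measurable_fst_square[OF refl] B] by (simp add: c distrib_right add_ac del: corner.simps)
    also have "\<dots> = ennreal a * ?l + ennreal (1 - a) * ?r"
    proof -
      have "1 - a = p RightSide Plus + p RightSide Minus" using sum_p by (simp add: a_def)
      then show ?thesis using pn by (simp add: a_def)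
    qed
    also have "\<dots> = emeasure (uniform_measure lborel {0..1}) B"
      using emeasure_two_segments[OF B ab(1,2)] emeasure_uniform_unit[OF B] by simp
    finally show "emeasure (distr (X_permuton p) borel fst) B = emeasure (uniform_measure lborel {0..1}) B" .
  qed simp
  show "distr (X_permuton p) borel snd = uniform_measure lborel {0..1}"
  proof (rule measure_eqI)
    fix B assume "B \<in> sets (distr (X_permuton p) borel snd)"
    then have B: "B \<in> sets borel" by simp
    let ?l = "emeasure lborel {t \<in> {0..1}. b * t \<in> B}"
    let ?r = "emeasure lborel {t \<in> {0..1}. 1 + (b - 1) * t \<in> B}"
    have c: "snd (linepath (corner LeftSide Plus) (a, b) t) = b * t" "snd (linepath (corner RightSide Minus) (a, b) t) = b * t"
      "snd (linepath (corner LeftSide Minus) (a, b) t) = 1 + (b - 1) * t" "snd (linepath (corner RightSide Plus) (a, b) t) = 1 + (b - 1) * t" for t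
      by (simp_all add: linepath_def algebra_simps)
    have "emeasure (distr (X_permuton p) borel snd) B =
        (\<Sum>e\<in>{LeftSide, RightSide}. \<Sum>s\<in>{Plus, Minus}. ennreal (p e s) *
      emeasure lborel {t \<in> {0..1}. snd (linepath (corner e s) (a, b) t) \<in> B})"
      by (rule emeasure_X_permuton_preimage[OF measurable_snd_square[OF refl] B])
    also have "\<dots> = (ennreal (p LeftSide Plus) + ennreal (p RightSide Minus)) * ?l + (ennreal (p RightSide Plus) + ennreal (p LeftSide Minus)) * ?r"
      by (simp add: c distrib_right add_ac del: corner.simps)
    also have "\<dots> = ennreal b * ?l + ennreal (1 - b) * ?r"
    proof -
      have "1 - b = p RightSide Plus + p LeftSide Minus" using sum_p by (simp add: b_def)
      then show ?thesis using pn by (simp add: b_def)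
    qed
    also have "\<dots> = emeasure (uniform_measure lborel {0..1}) B"
      using emeasure_two_segments[OF B ab(3,4)] emeasure_uniform_unit[OF B] by simp
    finally show "emeasure (distr (X_permuton p) borel snd) B = emeasure (uniform_measure lborel {0..1}) B" .
  qed simp
qed

lemma X_permuton_integral:
  fixes f :: "real \<times> real \<Rightarrow> real"
  assumes f: "continuous_on unit_square f"
  shows "(\<integral>z. f z \<partial>X_permuton p) = (\<Sum>e\<in>{LeftSide, RightSide}. \<Sum>s\<in>{Plus, Minus}.
    p e s * integral {0..1} (\<lambda>t. f (linepath (corner e s) (a, b) t)))"
proof -
  let ?U = "restrict_space lborel {0..1::real}"
  interpret M: prob_space X_mix by (rule X_mix_prob)
  interpret U: prob_space ?U by (rule unit_interval_prob)
  interpret pair_sigma_finite X_mix ?U ..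
  interpret P: prob_space "X_mix \<Otimes>\<^sub>M ?U" by (rule prob_space_pair[OF M.prob_space_axioms U.prob_space_axioms])
  obtain B where B: "\<And>z. z \<in> unit_square \<Longrightarrow> \<bar>f z\<bar> \<le> B" using continuous_on_square_bounded[OF f] by blast
  have fm: "f \<in> borel_measurable square_borel" by (rule continuous_on_square_measurable[OF f refl])
  have fX: "(\<lambda>z. f (X_map z)) \<in> borel_measurable (X_mix \<Otimes>\<^sub>M ?U)"
    by (rule measurable_compose[OF X_map_measurable fm])
  have "X_map z \<in> unit_square" if "z \<in> space (X_mix \<Otimes>\<^sub>M ?U)" for z
    using measurable_space[OF X_map_measurable that] by (simp add: space_restrict_space)
  then have int: "integrable (X_mix \<Otimes>\<^sub>M ?U) (\<lambda>z. f (X_map z))"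
    using fX B by (intro P.integrable_const_bound[of _ B]) auto
  have "(\<integral>z. f z \<partial>X_permuton p) = (\<integral>z. f (X_map z) \<partial>(X_mix \<Otimes>\<^sub>M ?U))"
    unfolding X_permuton_eq_distr by (rule integral_distr[OF X_map_measurable fm])
  also have "\<dots> = (\<integral>c. \<integral>t. f (X_map (c, t)) \<partial>?U \<partial>X_mix)"
    using integral_fst'[OF int] by simp
  also have "\<dots> = (\<integral>c. integral {0..1} (\<lambda>t. f (linepath (corner (fst c) (snd c)) (a, b) t)) \<partial>X_mix)"
  proof (rule Bochner_Integration.integral_cong[OF refl])
    fix c :: "side \<times> sign"
    let ?h = "\<lambda>t. f (linepath (corner (fst c) (snd c)) (a, b) t)"
    have cont: "continuous_on {0..1} ?h"
      by (rule continuous_on_compose2[OF f continuous_on_linepath]) (blast intro: X_path_in_square)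
    have "(\<integral>t. ?h t \<partial>?U) = (LINT t:{0..1}|lborel. ?h t)"
      by (subst integral_restrict_space) (auto simp: set_lebesgue_integral_def)
    also have "\<dots> = integral {0..1} ?h"
      using borel_integrable_atLeastAtMost'[OF cont] by (rule set_borel_integral_eq_integral(2))
    finally show "(\<integral>t. f (X_map (c, t)) \<partial>?U) = integral {0..1} ?h" by (simp add: X_map_def case_prod_beta')
  qed
  also have "\<dots> = (\<Sum>e\<in>{LeftSide, RightSide}. \<Sum>s\<in>{Plus, Minus}.
      p e s * integral {0..1} (\<lambda>t. f (linepath (corner e s) (a, b) t)))"
  proof -
    have fin: "finite (UNIV :: (side \<times> sign) set)" unfolding UNIV_Times_UNIV[symmetric] UNIV_side UNIV_sign by simp
    have "(\<integral>c. g c \<partial>X_mix) = (\<Sum>c\<in>UNIV. p (fst c) (snd c) * g c)" for g :: "_ \<Rightarrow> real"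
      unfolding X_mix_def case_prod_beta' using fin p
      by (subst integral_density) (auto simp: lebesgue_integral_count_space_finite)
    then show ?thesis
      unfolding UNIV_Times_UNIV[symmetric] UNIV_side UNIV_sign by (simp add: sum.cartesian_product case_prod_beta')
  qed
  finally show ?thesis .
qed

end

section \<open>Generating functions\<close>

text \<open>The weight is general because two cases occur: weight 1 gives \<open>genfun\<close>, and
  weight equal to the size gives z times its derivative, the series of trees with a marked
  leaf.\<close>

definition weighted_gf :: "'a set \<Rightarrow> ('a \<Rightarrow> real) \<Rightarrow> ('a \<Rightarrow> nat) \<Rightarrow> real fps" where
  "weighted_gf A w sz = Abs_fps (\<lambda>n. \<Sum>x | x \<in> A \<and> sz x = n. w x)"

lemma finite_PiE_size:
  fixes sz :: "'a \<Rightarrow> nat"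
  assumes "finite Q" "\<And>q n. q \<in> Q \<Longrightarrow> finite {x \<in> A q. sz x = n}"
  shows "finite {g \<in> PiE Q A. (\<Sum>q\<in>Q. sz (g q)) = n}"
proof (rule finite_subset)
  have "finite {x \<in> A q. sz x \<le> n}" if "q \<in> Q" for q
  proof -
    have "{x \<in> A q. sz x \<le> n} = (\<Union>m\<le>n. {x \<in> A q. sz x = m})" by auto
    then show ?thesis using assms(2)[OF that] by simp
  qed
  then show "finite (PiE Q (\<lambda>q. {x \<in> A q. sz x \<le> n}))" using assms(1) by (intro finite_PiE) auto
  show "{g \<in> PiE Q A. (\<Sum>q\<in>Q. sz (g q)) = n} \<subseteq> PiE Q (\<lambda>q. {x \<in> A q. sz x \<le> n})"
  proof
    fix g assume g: "g \<in> {g \<in> PiE Q A. (\<Sum>q\<in>Q. sz (g q)) = n}"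
    have "sz (g q) \<le> n" if "q \<in> Q" for q
      using member_le_sum[of q Q "\<lambda>q. sz (g q)"] that assms(1) g by auto
    then show "g \<in> PiE Q (\<lambda>q. {x \<in> A q. sz x \<le> n})" using g by (auto simp: PiE_iff)
  qed
qed

text \<open>The Cauchy product, iterated over the slots: sizes add and weights multiply. Splitting
  off one slot corresponds to restricting the choice function to the others.\<close>

lemma fps_nth_prod_weighted_gf:
  assumes fin: "finite Q" and slices: "\<And>q n. q \<in> Q \<Longrightarrow> finite {x \<in> A q. sz x = n}"
  shows "fps_nth (\<Prod>q\<in>Q. weighted_gf (A q) (w q) sz) n =
    (\<Sum>g | g \<in> PiE Q A \<and> (\<Sum>q\<in>Q. sz (g q)) = n. \<Prod>q\<in>Q. w q (g q))"
  using fin slices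
proof (induction Q arbitrary: n rule: finite_induct)
  case empty
  have "{g. g \<in> PiE {} A \<and> (\<Sum>q\<in>{}. sz (g q)) = n} = (if n = 0 then {\<lambda>_. undefined} else {})" by auto
  then show ?case by simp
next
  case (insert a Q)
  let ?S = "\<lambda>m. {g. g \<in> PiE Q A \<and> (\<Sum>q\<in>Q. sz (g q)) = m}"
  have finS: "finite (?S m)" for m using finite_PiE_size[of Q A sz m] insert by auto
  have fina: "finite {x. x \<in> A a \<and> sz x = m}" for m using insert.prems by auto
  have "fps_nth (\<Prod>q\<in>insert a Q. weighted_gf (A q) (w q) sz) n =
     (\<Sum>i\<in>{0..n}. (\<Sum>x | x \<in> A a \<and> sz x = i. w a x) * (\<Sum>g\<in>?S (n - i). \<Prod>q\<in>Q. w q (g q)))"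
    using insert by (simp add: fps_mult_nth weighted_gf_def)
  also have "\<dots> = (\<Sum>i\<in>{0..n}. \<Sum>(x, g)\<in>{x. x \<in> A a \<and> sz x = i} \<times> ?S (n - i). w a x * (\<Prod>q\<in>Q. w q (g q)))"
    by (simp add: sum_product sum.cartesian_product)
  also have "\<dots> = (\<Sum>(i, x, g)\<in>(SIGMA i:{0..n}. {x. x \<in> A a \<and> sz x = i} \<times> ?S (n - i)). w a x * (\<Prod>q\<in>Q. w q (g q)))"
    using finS fina by (subst sum.Sigma) (auto simp: case_prod_beta')
  also have "\<dots> = (\<Sum>g | g \<in> PiE (insert a Q) A \<and> (\<Sum>q\<in>insert a Q. sz (g q)) = n. \<Prod>q\<in>insert a Q. w q (g q))"
  proof (rule sum.reindex_bij_witness[where i = "\<lambda>h. (sz (h a), h a, restrict h Q)" and j = "\<lambda>(i, x, g). g(a := x)"])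
    fix z assume "z \<in> (SIGMA i:{0..n}. {x. x \<in> A a \<and> sz x = i} \<times> ?S (n - i))"
    then obtain x g where z: "z = (sz x, x, g)" and x: "x \<in> A a" "sz x \<le> n"
      and g: "g \<in> PiE Q A" "(\<Sum>q\<in>Q. sz (g q)) = n - sz x" by auto
    have neq: "q \<noteq> a" if "q \<in> Q" for q using that insert.hyps by auto
    show "(\<lambda>h. (sz (h a), h a, restrict h Q)) ((\<lambda>(i, x, g). g(a := x)) z) = z"
      using g(1) insert.hyps unfolding z by (auto simp: restrict_def PiE_def extensional_def fun_eq_iff)
    have s: "(\<Sum>q\<in>Q. sz ((g(a := x)) q)) = (\<Sum>q\<in>Q. sz (g q))" using neq by (intro sum.cong) auto
    show "(\<lambda>(i, x, g). g(a := x)) z \<in> {g. g \<in> PiE (insert a Q) A \<and> (\<Sum>q\<in>insert a Q. sz (g q)) = n}"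
      using insert.hyps g x s unfolding z by (auto simp: PiE_iff extensional_def)
    have "(\<Prod>q\<in>Q. w q ((g(a := x)) q)) = (\<Prod>q\<in>Q. w q (g q))" using neq by (intro prod.cong) auto
    then show "(\<Prod>q\<in>insert a Q. w q ((\<lambda>(i, x, g). g(a := x)) z q)) = (case z of (i, x, g) \<Rightarrow> w a x * (\<Prod>q\<in>Q. w q (g q)))"
      using insert.hyps unfolding z by simp
  next
    fix h assume "h \<in> {g. g \<in> PiE (insert a Q) A \<and> (\<Sum>q\<in>insert a Q. sz (g q)) = n}"
    then have h: "h \<in> PiE (insert a Q) A" "sz (h a) + (\<Sum>q\<in>Q. sz (h q)) = n" using insert.hyps by auto
    show "(\<lambda>(i, x, g). g(a := x)) (sz (h a), h a, restrict h Q) = h"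
      using h(1) by (auto simp: fun_eq_iff PiE_def extensional_def)
    show "(sz (h a), h a, restrict h Q) \<in> (SIGMA i:{0..n}. {x. x \<in> A a \<and> sz x = i} \<times> ?S (n - i))"
      using h by (auto simp: PiE_iff)
  qed
  finally show ?case .
qed

section \<open>Radii of convergence of real power series\<close>

lemma fps_conv_radius_geI:
  fixes f :: "real fps"
  assumes "x > 0" "\<And>n. \<bar>fps_nth f n\<bar> * x ^ n \<le> C"
  shows "fps_conv_radius f \<ge> ereal x"
  unfolding fps_conv_radius_def
proof (rule conv_radius_geI_ex)
  fix r :: real assume r: "0 < r" "ereal r < ereal x"
  have q: "r / x < 1" "0 \<le> r / x" using r assms(1) by auto
  have "summable (\<lambda>n. fps_nth f n * r ^ n)"
  proof (rule summable_comparison_test)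
    show "\<exists>N. \<forall>n\<ge>N. norm (fps_nth f n * r ^ n) \<le> C * (r / x) ^ n"
    proof (intro exI allI impI)
      fix n
      have "norm (fps_nth f n * r ^ n) = (\<bar>fps_nth f n\<bar> * x ^ n) * (r / x) ^ n"
        using r assms(1) by (simp add: abs_mult power_divide)
      also have "\<dots> \<le> C * (r / x) ^ n" using assms(2)[of n] q by (intro mult_right_mono) auto
      finally show "norm (fps_nth f n * r ^ n) \<le> C * (r / x) ^ n" .
    qed
    show "summable (\<lambda>n. C * (r / x) ^ n)" using q by (intro summable_mult summable_geometric) auto
  qed
  then show "\<exists>z. norm z = r \<and> summable (\<lambda>n. fps_nth f n * z ^ n)"
    using r by (intro exI[of _ r]) auto
qed

lemma fps_sums_eval:
  fixes f :: "real fps"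
  assumes "ereal \<bar>x\<bar> < fps_conv_radius f"
  shows "(\<lambda>n. fps_nth f n * x ^ n) sums eval_fps f x"
  using sums_eval_fps[of x f] assms by simp

lemma fps_bounded_in_radius:
  fixes f :: "real fps"
  assumes "ereal x < fps_conv_radius f" "x > 0"
  shows "\<exists>C. \<forall>n. \<bar>fps_nth f n\<bar> * x ^ n \<le> C"
proof -
  have "summable (\<lambda>n. norm (fps_nth f n * x ^ n))"
    using assms abs_summable_in_conv_radius[of x "fps_nth f"] by (simp add: fps_conv_radius_def)
  then have "(\<lambda>n. norm (fps_nth f n * x ^ n)) \<longlonglongrightarrow> 0" by (rule summable_LIMSEQ_zero)
  then have "Bseq (\<lambda>n. norm (fps_nth f n * x ^ n))" by (rule convergent_imp_Bseq[OF convergentI])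
  then obtain C where "\<And>n. norm (norm (fps_nth f n * x ^ n)) \<le> C" by (auto simp: Bseq_def)
  then show ?thesis using assms(2) by (intro exI[of _ C]) (simp add: abs_mult)
qed

lemma listset_iff: "xs \<in> listset As \<longleftrightarrow> length xs = length As \<and> (\<forall>q<length As. xs ! q \<in> As ! q)"
proof (induction As arbitrary: xs)
  case (Cons A As)
  show ?case
  proof (cases xs)
    case (Cons y ys)
    have "xs \<in> listset (A # As) \<longleftrightarrow> y \<in> A \<and> ys \<in> listset As" using Cons by (auto simp: set_Cons_def)
    also have "\<dots> \<longleftrightarrow> length xs = length (A # As) \<and> (\<forall>q<length (A # As). xs ! q \<in> (A # As) ! q)"
      unfolding Cons.IH Cons by (auto simp: nth_Cons less_Suc_eq_0_disj split: nat.splits)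
    finally show ?thesis .
  qed (auto simp: set_Cons_def)
qed simp

section \<open>Contexts\<close>

abbreviation tree_size :: "subst_tree \<Rightarrow> nat" where
  "tree_size t \<equiv> length (tree_perm t)"

text \<open>A tree whose root has a critical child is a context filled with that child: \<open>(\<pi>, k, l, g)\<close>
  consists of the root label, the term of the equation, the position \<open>l\<close> of the critical child and
  the remaining children.\<close>

type_synonym tree_context = "permutation \<times> nat list \<times> nat \<times> (nat \<Rightarrow> subst_tree)"

definition contexts :: "tree_system \<Rightarrow> nat \<Rightarrow> tree_context set" where
  "contexts S i = {(\<pi>, k, l, g). (\<pi>, k) \<in> equation_terms S i \<and> l < length \<pi> \<and> k ! l \<in> critical S \<and>
     g \<in> PiE ({..<length \<pi>} - {l}) (\<lambda>q. family_trees S (k ! q))}"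

definition context_size :: "tree_context \<Rightarrow> nat" where
  "context_size = (\<lambda>(\<pi>, k, l, g). \<Sum>q\<in>{..<length \<pi>} - {l}. tree_size (g q))"

definition context_target :: "tree_context \<Rightarrow> nat" where
  "context_target = (\<lambda>(\<pi>, k, l, g). k ! l)"

definition fill :: "tree_context \<Rightarrow> subst_tree \<Rightarrow> subst_tree" where
  "fill = (\<lambda>(\<pi>, k, l, g) t. Node \<pi> (map (g(l := t)) [0..<length \<pi>]))"

text \<open>The leaves that lie on side \<open>e\<close> of the hole and induce with it the sign
  \<open>s\<close>. Summed over all contexts of fixed type and size, this becomes a coefficient of
  \<open>D_star\<close>.\<close>

definition side_count :: "side \<Rightarrow> sign \<Rightarrow> tree_context \<Rightarrow> nat" where
  "side_count e s = (\<lambda>(\<pi>, k, l, g).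
     \<Sum>m | m < length \<pi> \<and> on_side e l m \<and> induces_sign s \<pi> l m. tree_size (g m))"

text \<open>The trees at which a spine ends. Apart from the leaf they are counted by F_i with all
  critical variables set to 0, one of the series assumed to converge beyond \<rho>.\<close>

definition terminal_trees :: "tree_system \<Rightarrow> nat \<Rightarrow> subst_tree set" where
  "terminal_trees S i = {t \<in> family_trees S i. t = Leaf \<or>
     (\<exists>(\<pi>, k)\<in>equation_terms S i. set k \<inter> critical S = {} \<and> t \<in> term_trees S (\<pi>, k))}"

lemma tree_size_pos: "standard_tree t \<Longrightarrow> tree_size t > 0"
  using is_permutation_tree_perm[of t] by (auto simp: is_permutation_iff)

text \<open>Injectivity of \<open>tree_perm\<close> embeds the trees of size n into the permutations
  of size n.\<close>

lemma finite_standard_trees: "finite {t. standard_tree t \<and> tree_size t = n}"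
proof (rule finite_imageD)
  have "tree_perm ` {t. standard_tree t \<and> tree_size t = n} \<subseteq> permutations_of_set {1..n}"
    using is_permutation_tree_perm by (auto simp: is_permutation_def)
  then show "finite (tree_perm ` {t. standard_tree t \<and> tree_size t = n})"
    by (rule finite_subset) simp
  show "inj_on tree_perm {t. standard_tree t \<and> tree_size t = n}"
    using tree_perm_inj by (auto simp: inj_on_def)
qed

lemma finite_standard_trees_le: "finite {t. standard_tree t \<and> tree_size t \<le> n}"
proof -
  have "{t. standard_tree t \<and> tree_size t \<le> n} = (\<Union>m\<le>n. {t. standard_tree t \<and> tree_size t = m})" by auto
  then show ?thesis using finite_standard_trees by simp
qed

text \<open>The purely combinatorial part: decomposition along spines and counting of contexts.
  Nonempty families are assumed because a context becomes a tree only when its hole can be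
  filled.\<close>

locale linear_specification =
  fixes S :: tree_system
  assumes spec: "tree_specification S"
    and nonempty: "\<forall>i\<le>last_index S. family S i \<noteq> {}"
    and linear: "essentially_linear S"
begin

abbreviation crit :: "nat set" where "crit \<equiv> critical S"
abbreviation fam :: "nat \<Rightarrow> subst_tree set" where "fam i \<equiv> family_trees S i"

definition sized :: "nat \<Rightarrow> nat \<Rightarrow> subst_tree set" where
  "sized i n = {t \<in> fam i. tree_size t = n}"

lemma crit_le: "i \<in> crit \<Longrightarrow> i \<le> last_index S"
  by (simp add: critical_def)

lemma finite_crit [simp]: "finite crit"
  by (rule finite_subset[of _ "{..last_index S}"]) (auto simp: critical_def)

lemma trees_standard: "t \<in> fam i \<Longrightarrow> standard_tree t"
  by (simp add: family_trees_def)

lemma finite_sized [simp]: "finite (sized i n)"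
  by (rule finite_subset[OF _ finite_standard_trees[of n]]) (auto simp: sized_def trees_standard)

text \<open>The bijection between standard trees and permutations enters here; from now on the
  families are counted as sets of trees.\<close>

lemma of_size_bij: "i \<le> last_index S \<Longrightarrow> bij_betw tree_perm (sized i n) (of_size S i n)"
proof (rule bij_betwI')
  assume i: "i \<le> last_index S"
  fix \<sigma> assume \<sigma>: "\<sigma> \<in> of_size S i n"
  then have "is_permutation \<sigma>" using spec i by (auto simp: tree_specification_def of_size_def)
  then obtain t where "standard_tree t" "tree_perm t = \<sigma>" using exists_standard_tree by blast
  then show "\<exists>t\<in>sized i n. \<sigma> = tree_perm t"
    using \<sigma> by (auto simp: sized_def family_trees_def of_size_def)
qed (auto simp: sized_def of_size_def family_trees_def intro: tree_perm_inj)

lemma card_of_size: "i \<le> last_index S \<Longrightarrow> card (of_size S i n) = card (sized i n)"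
  using bij_betw_same_card[OF of_size_bij] by simp

lemma fps_nth_genfun: "i \<le> last_index S \<Longrightarrow> fps_nth (genfun S i) n = card (sized i n)"
  by (simp add: genfun_def card_of_size)

lemma genfun_weighted: "i \<le> last_index S \<Longrightarrow> genfun S i = weighted_gf (fam i) (\<lambda>_. 1) tree_size"
  by (rule fps_ext) (simp add: fps_nth_genfun weighted_gf_def sized_def)

lemma trees_nonempty: "i \<le> last_index S \<Longrightarrow> fam i \<noteq> {}"
proof -
  assume i: "i \<le> last_index S"
  then obtain \<sigma> where \<sigma>: "\<sigma> \<in> family S i" using nonempty by blast
  then have "is_permutation \<sigma>" using spec i by (auto simp: tree_specification_def)
  then obtain t where "standard_tree t" "tree_perm t = \<sigma>" using exists_standard_tree by blast
  then show ?thesis using \<sigma> by (auto simp: family_trees_def)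
qed

lemma term_props:
  assumes "i \<le> last_index S" "(\<pi>, k) \<in> equation_terms S i"
  shows "is_permutation \<pi>" "length \<pi> \<ge> 2" "length k = length \<pi>" "set k \<subseteq> {..last_index S}"
proof -
  have lab: "\<pi> \<in> root_labels S i" "k \<in> index_tuples S i \<pi>" using assms(2) by (auto simp: equation_terms_def)
  then show "length k = length \<pi>" "set k \<subseteq> {..last_index S}"
    using spec assms(1) unfolding tree_specification_def by blast+
  have "\<pi> = oplus \<or> \<pi> = ominus \<or> simple_permutation \<pi>" using lab(1) by (auto simp: root_labels_def)
  then show "is_permutation \<pi>" "length \<pi> \<ge> 2"
    by (auto intro: standard_label_permutation simp: simple_permutation_iff_block is_permutation_iff)
qed

lemma trees_equation:
  "i \<le> last_index S \<Longrightarrow> fam i = (if leaf_coeff S i = 1 then {Leaf} else {}) \<union> (\<Union>x\<in>equation_terms S i. term_trees S x)"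
  using spec by (simp add: tree_specification_def)

lemma term_trees_iff:
  assumes "length k = length \<pi>"
  shows "t \<in> term_trees S (\<pi>, k) \<longleftrightarrow> (\<exists>ts. t = Node \<pi> ts \<and> length ts = length \<pi> \<and> (\<forall>q<length \<pi>. ts ! q \<in> fam (k ! q)))"
  using assms by (auto simp: term_trees_def listset_iff)

lemma terms_disjoint:
  assumes "i \<le> last_index S" "x \<in> equation_terms S i" "y \<in> equation_terms S i" "t \<in> term_trees S x" "t \<in> term_trees S y"
  shows "x = y"
  using assms spec unfolding tree_specification_def disjoint_family_on_def by blast

lemma context_props:
  assumes "i \<in> crit" "(\<pi>, k, l, g) \<in> contexts S i"
  shows "(\<pi>, k) \<in> equation_terms S i" "l < length \<pi>" "length k = length \<pi>"
    "k ! l \<in> crit" "g \<in> PiE ({..<length \<pi>} - {l}) (\<lambda>q. fam (k ! q))" "is_permutation \<pi>" "length \<pi> \<ge> 2"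
    "\<And>q. q < length \<pi> \<Longrightarrow> k ! q \<le> last_index S"
proof -
  show *: "(\<pi>, k) \<in> equation_terms S i" "l < length \<pi>" "k ! l \<in> crit"
    "g \<in> PiE ({..<length \<pi>} - {l}) (\<lambda>q. fam (k ! q))" using assms(2) by (auto simp: contexts_def)
  note tp = term_props[OF crit_le[OF assms(1)] *(1)]
  show "k ! q \<le> last_index S" if "q < length \<pi>" for q
    using tp(3,4) that by (metis atMost_iff nth_mem subsetD)
  show "length k = length \<pi>" "is_permutation \<pi>" "length \<pi> \<ge> 2" using tp by blast+
qed

lemma context_target_crit: "i \<in> crit \<Longrightarrow> c \<in> contexts S i \<Longrightarrow> context_target c \<in> crit"
  by (auto simp: contexts_def context_target_def)

lemma fill_in_term:
  assumes "i \<in> crit" "(\<pi>, k, l, g) \<in> contexts S i" "t \<in> fam (k ! l)"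
  shows "fill (\<pi>, k, l, g) t \<in> term_trees S (\<pi>, k)"
  using context_props[OF assms(1,2)] assms(3)
  by (auto simp: term_trees_iff fill_def PiE_iff)

lemma fill_in_trees:
  assumes i: "i \<in> crit" and c: "c \<in> contexts S i" and t: "t \<in> fam (context_target c)"
  shows "fill c t \<in> fam i" "tree_size (fill c t) = context_size c + tree_size t"
proof -
  obtain \<pi> k l g where c': "c = (\<pi>, k, l, g)" by (cases c)
  note tm = context_props(1)[OF i c[unfolded c']] and l = context_props(2)[OF i c[unfolded c']]
  have t': "t \<in> fam (k ! l)" using t c' by (simp add: context_target_def)
  have "fill c t \<in> term_trees S (\<pi>, k)" using fill_in_term[OF i _ t'] c c' by simp
  then show "fill c t \<in> fam i" using trees_equation[OF crit_le[OF i]] tm by blast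
  have "tree_size (fill c t) = (\<Sum>q<length \<pi>. tree_size ((g(l := t)) q))"
    unfolding c' fill_def prod.case by (subst length_tree_perm_Node) auto
  also have "\<dots> = tree_size t + (\<Sum>q\<in>{..<length \<pi>} - {l}. tree_size ((g(l := t)) q))"
    using l by (subst sum.remove[of _ l]) auto
  also have "(\<Sum>q\<in>{..<length \<pi>} - {l}. tree_size ((g(l := t)) q)) = context_size c"
    unfolding c' context_size_def prod.case by (intro sum.cong) auto
  finally show "tree_size (fill c t) = context_size c + tree_size t" by simp
qed

text \<open>Disjointness of the terms returns the label and the index tuple, and two different holes
  would be two critical positions of one term, against essential linearity.\<close>

lemma fill_inj:
  assumes i: "i \<in> crit" and c: "c \<in> contexts S i" "t \<in> fam (context_target c)"
    and c': "c' \<in> contexts S i" "t' \<in> fam (context_target c')" and eq: "fill c t = fill c' t'"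
  shows "c = c' \<and> t = t'"
proof -
  obtain \<pi> k l g where e: "c = (\<pi>, k, l, g)" by (cases c)
  obtain \<pi>' k' l' g' where e': "c' = (\<pi>', k', l', g')" by (cases c')
  note d = e context_props(1-5)[OF i c(1)[unfolded e]] and d' = e' context_props(1-5)[OF i c'(1)[unfolded e']]
  have "fill c t \<in> term_trees S (\<pi>, k)" using fill_in_term[OF i, of \<pi> k l g t] c d by (simp add: context_target_def)
  moreover have "fill c t \<in> term_trees S (\<pi>', k')" using fill_in_term[OF i, of \<pi>' k' l' g' t'] c' d' eq
    by (simp add: context_target_def)
  ultimately have pk: "\<pi>' = \<pi>" "k' = k" using terms_disjoint[OF crit_le[OF i] d(2) d'(2)] by auto
  have "l' = l"
  proof (rule ccontr)
    assume "l' \<noteq> l"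
    then have "\<exists>p q. p < q \<and> q < length k \<and> k ! p \<in> crit \<and> k ! q \<in> crit"
      using d d' pk by (cases "l < l'") (auto intro: exI[of _ l] exI[of _ l'] simp: not_less le_less)
    then have "essentially_branching S" unfolding essentially_branching_def using i d(2) by blast
    then show False using linear by simp
  qed
  moreover have *: "(g(l := t)) q = (g'(l' := t')) q" if "q < length \<pi>" for q
    using eq that unfolding d d' fill_def pk by (simp del: fun_upd_apply)
  ultimately have "t = t'" using d(3) *[of l] by simp
  have "g = g'"
  proof
    fix q
    show "g q = g' q"
    proof (cases "q \<in> {..<length \<pi>} - {l}")
      case True
      then show ?thesis using *[of q] \<open>l' = l\<close> by auto
    next
      case False
      then show ?thesis using d(6) d'(6) \<open>l' = l\<close> pk by (auto simp: PiE_def extensional_def)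
    qed
  qed
  then show ?thesis using \<open>t = t'\<close> \<open>l' = l\<close> d d' pk by simp
qed

lemma trees_cases:
  assumes i: "i \<in> crit" and t: "t \<in> fam i"
  shows "t \<in> terminal_trees S i \<or> (\<exists>c\<in>contexts S i. \<exists>t'\<in>fam (context_target c). t = fill c t')"
proof -
  consider "t = Leaf" | \<pi> k where "(\<pi>, k) \<in> equation_terms S i" "t \<in> term_trees S (\<pi>, k)"
    using t unfolding trees_equation[OF crit_le[OF i]] by (auto split: if_splits)
  then show ?thesis
  proof cases
    case 1
    then show ?thesis using t by (simp add: terminal_trees_def)
  next
    case 2
    note tp = term_props[OF crit_le[OF i] 2(1)]
    show ?thesis
    proof (cases "set k \<inter> crit = {}")
      case True
      then show ?thesis using 2 t by (auto simp: terminal_trees_def)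
    next
      case False
      then obtain l where l: "l < length \<pi>" "k ! l \<in> crit" using tp(3) by (auto simp: in_set_conv_nth)
      obtain ts where ts: "t = Node \<pi> ts" "length ts = length \<pi>" "\<And>q. q < length \<pi> \<Longrightarrow> ts ! q \<in> fam (k ! q)"
        using 2(2) term_trees_iff[OF tp(3)] by blast
      define g where "g = restrict (\<lambda>q. ts ! q) ({..<length \<pi>} - {l})"
      have c: "(\<pi>, k, l, g) \<in> contexts S i" using 2 l ts by (auto simp: contexts_def g_def)
      have "t = fill (\<pi>, k, l, g) (ts ! l)"
        unfolding fill_def prod.case ts(1) using ts(2) by (auto simp: g_def intro!: nth_equalityI)
      then show ?thesis using c ts(3)[OF l(1)] by (auto simp: context_target_def intro!: bexI[of _ "(\<pi>, k, l, g)"] bexI[of _ "ts ! l"])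
    qed
  qed
qed

text \<open>Labels have length at least 2, so some child is left besides the hole. This bounds the
  length of a spine by its size.\<close>

lemma context_size_pos:
  assumes "i \<in> crit" "c \<in> contexts S i"
  shows "context_size c > 0"
proof -
  obtain \<pi> k l g where e: "c = (\<pi>, k, l, g)" by (cases c)
  note d = e context_props(2,7,5)[OF assms(1) assms(2)[unfolded e]]
  define q where "q = (if l = 0 then 1 else 0 :: nat)"
  have q: "q \<in> {..<length \<pi>} - {l}" using d(2,3) by (auto simp: q_def)
  then have "0 < tree_size (g q)" using tree_size_pos trees_standard PiE_mem[OF d(4) q] by blast
  also have "\<dots> \<le> context_size c" unfolding d(1) context_size_def prod.case
    using q member_le_sum[of q "{..<length \<pi>} - {l}" "\<lambda>q. tree_size (g q)"] by auto
  finally show ?thesis .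
qed

text \<open>Filling each hole with one fixed tree of its type embeds the contexts into the trees of
  bounded size.\<close>

lemma finite_contexts [simp]:
  assumes i: "i \<in> crit"
  shows "finite {c \<in> contexts S i. context_size c \<le> n}"
proof -
  have "\<forall>j. \<exists>t. j \<le> last_index S \<longrightarrow> t \<in> fam j" using trees_nonempty by blast
  then obtain t0 where t0: "\<And>j. j \<le> last_index S \<Longrightarrow> t0 j \<in> fam j" by metis
  define N where "N = n + (\<Sum>j\<le>last_index S. tree_size (t0 j))"
  have tgt: "t0 (context_target c) \<in> fam (context_target c)" if "c \<in> contexts S i" for c
    using t0 context_target_crit[OF i that] crit_le by blast
  show ?thesis
  proof (rule finite_imageD)
    show "inj_on (\<lambda>c. fill c (t0 (context_target c))) {c \<in> contexts S i. context_size c \<le> n}"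
    proof (rule inj_onI)
      fix c c' assume "c \<in> {c \<in> contexts S i. context_size c \<le> n}" "c' \<in> {c \<in> contexts S i. context_size c \<le> n}"
        "fill c (t0 (context_target c)) = fill c' (t0 (context_target c'))"
      then show "c = c'" using fill_inj[OF i _ tgt _ tgt] by blast
    qed
    have "(\<lambda>c. fill c (t0 (context_target c))) ` {c \<in> contexts S i. context_size c \<le> n} \<subseteq> {t. standard_tree t \<and> tree_size t \<le> N}"
    proof
      fix t assume "t \<in> (\<lambda>c. fill c (t0 (context_target c))) ` {c \<in> contexts S i. context_size c \<le> n}"
      then obtain c where c: "c \<in> contexts S i" "context_size c \<le> n" "t = fill c (t0 (context_target c))" by auto
      have "context_target c \<le> last_index S" using context_target_crit[OF i c(1)] crit_le by blast
      then have "tree_size (t0 (context_target c)) \<le> (\<Sum>j\<le>last_index S. tree_size (t0 j))"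
        by (intro member_le_sum) auto
      then show "t \<in> {t. standard_tree t \<and> tree_size t \<le> N}"
        using fill_in_trees[OF i c(1) tgt[OF c(1)]] c trees_standard by (auto simp: N_def)
    qed
    then show "finite ((\<lambda>c. fill c (t0 (context_target c))) ` {c \<in> contexts S i. context_size c \<le> n})"
      by (rule finite_subset[OF _ finite_standard_trees_le])
  qed
qed

text \<open>The contexts counted by the coefficient of z^n in the entry (i, j) of the critical
  matrix.\<close>

definition slice :: "nat \<Rightarrow> nat \<Rightarrow> nat \<Rightarrow> tree_context set" where
  "slice i j n = {c \<in> contexts S i. context_target c = j \<and> context_size c = n}"

lemma finite_slice [simp]: "i \<in> crit \<Longrightarrow> finite (slice i j n)"
  by (rule finite_subset[OF _ finite_contexts[of i n]]) (auto simp: slice_def)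

end

section \<open>Convergence of permutons\<close>

text \<open>A bound is carried along with the Lipschitz constant because the product of two
  Lipschitz functions is controlled only when both are bounded.\<close>

lemma real_polynomial_function_lipschitz:
  assumes "real_polynomial_function f" "bounded S"
  shows "\<exists>K B. 0 \<le> K \<and> 0 \<le> B \<and> (\<forall>x\<in>S. \<bar>f x\<bar> \<le> B) \<and> (\<forall>x\<in>S. \<forall>y\<in>S. \<bar>f x - f y\<bar> \<le> K * dist x y)"
  using assms(1)
proof (induction rule: real_polynomial_function.induct)
  case (linear f)
  obtain K where K: "0 \<le> K" "\<And>x. norm (f x) \<le> norm x * K" using bounded_linear.nonneg_bounded[OF linear] by blast
  obtain M where M: "\<And>x. x \<in> S \<Longrightarrow> norm x \<le> M" "0 < M" using assms(2) by (auto simp: bounded_pos)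
  have "\<bar>f x\<bar> \<le> M * K" if "x \<in> S" for x using K(2)[of x] mult_right_mono[OF M(1)[OF that] K(1)] by simp
  moreover have "\<bar>f x - f y\<bar> \<le> K * dist x y" for x y
    using K(2)[of "x - y"] by (simp add: linear_diff bounded_linear.linear[OF linear] dist_norm mult.commute)
  ultimately show ?case using K M by (intro exI[of _ K] exI[of _ "M * K"]) auto
next
  case (const c)
  then show ?case by (intro exI[of _ 0] exI[of _ "\<bar>c\<bar>"]) auto
next
  case (add f g)
  obtain K B where f: "0 \<le> K" "0 \<le> B" "\<forall>x\<in>S. \<bar>f x\<bar> \<le> B" "\<forall>x\<in>S. \<forall>y\<in>S. \<bar>f x - f y\<bar> \<le> K * dist x y"
    using add.IH(1) by blast
  obtain K' B' where g: "0 \<le> K'" "0 \<le> B'" "\<forall>x\<in>S. \<bar>g x\<bar> \<le> B'" "\<forall>x\<in>S. \<forall>y\<in>S. \<bar>g x - g y\<bar> \<le> K' * dist x y"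
    using add.IH(2) by blast
  note * = f(1,2) g(1,2) f(3)[rule_format] g(3)[rule_format] f(4)[rule_format] g(4)[rule_format]
  have "\<bar>f x + g x\<bar> \<le> B + B'" if "x \<in> S" for x using *(5,6)[OF that] by linarith
  moreover have "\<bar>f x + g x - (f y + g y)\<bar> \<le> (K + K') * dist x y" if "x \<in> S" "y \<in> S" for x y
    using *(7,8)[OF that] unfolding distrib_right by linarith
  ultimately show ?case using * by (intro exI[of _ "K + K'"] exI[of _ "B + B'"]) auto
next
  case (mult f g)
  obtain K B where f: "0 \<le> K" "0 \<le> B" "\<forall>x\<in>S. \<bar>f x\<bar> \<le> B" "\<forall>x\<in>S. \<forall>y\<in>S. \<bar>f x - f y\<bar> \<le> K * dist x y"
    using mult.IH(1) by blast
  obtain K' B' where g: "0 \<le> K'" "0 \<le> B'" "\<forall>x\<in>S. \<bar>g x\<bar> \<le> B'" "\<forall>x\<in>S. \<forall>y\<in>S. \<bar>g x - g y\<bar> \<le> K' * dist x y"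
    using mult.IH(2) by blast
  note * = f(1,2) g(1,2) f(3)[rule_format] g(3)[rule_format] f(4)[rule_format] g(4)[rule_format]
  have "\<bar>f x * g x\<bar> \<le> B * B'" if "x \<in> S" for x
    unfolding abs_mult using *(2,4) *(5,6)[OF that] by (intro mult_mono) auto
  moreover have "\<bar>f x * g x - f y * g y\<bar> \<le> (B * K' + K * B') * dist x y" if "x \<in> S" "y \<in> S" for x y
  proof -
    have "f x * g x - f y * g y = f x * (g x - g y) + (f x - f y) * g y" by (simp add: algebra_simps)
    then have "\<bar>f x * g x - f y * g y\<bar> \<le> \<bar>f x\<bar> * \<bar>g x - g y\<bar> + \<bar>f x - f y\<bar> * \<bar>g y\<bar>"
      by (metis abs_mult abs_triangle_ineq)
    also have "\<dots> \<le> B * (K' * dist x y) + (K * dist x y) * B'"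
      using * that by (intro add_mono mult_mono) auto
    finally show ?thesis by (simp add: algebra_simps)
  qed
  ultimately show ?case using * by (intro exI[of _ "B * K' + K * B'"] exI[of _ "B * B'"]) auto
qed

text \<open>Stone-Weierstrass gives a polynomial, which is Lipschitz on the compact square. The sum
  of the coordinate distances is the form in which leaf positions are estimated later.\<close>

lemma lipschitz_approximation_on_square:
  fixes f :: "real \<times> real \<Rightarrow> real"
  assumes "continuous_on unit_square f" "e > 0"
  obtains g K where "K \<ge> 0" "continuous_on unit_square g" "\<And>z. z \<in> unit_square \<Longrightarrow> \<bar>f z - g z\<bar> < e"
    "\<And>x y x' y'. (x, y) \<in> unit_square \<Longrightarrow> (x', y') \<in> unit_square \<Longrightarrow>
      \<bar>g (x, y) - g (x', y')\<bar> \<le> K * (\<bar>x - x'\<bar> + \<bar>y - y'\<bar>)"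
proof -
  obtain g where g: "real_polynomial_function g" "\<And>z. z \<in> unit_square \<Longrightarrow> \<bar>f z - g z\<bar> < e"
    using Stone_Weierstrass_real_polynomial_function[OF compact_unit_square assms] by blast
  obtain K where K: "0 \<le> K" "\<And>x y. x \<in> unit_square \<Longrightarrow> y \<in> unit_square \<Longrightarrow> \<bar>g x - g y\<bar> \<le> K * dist x y"
    using real_polynomial_function_lipschitz[OF g(1) compact_imp_bounded[OF compact_unit_square]] by blast
  have "dist (x, y) (x', y') \<le> \<bar>x - x'\<bar> + \<bar>y - y'\<bar>" for x y x' y' :: real
    by (simp add: dist_Pair_Pair dist_real_def sqrt_sum_squares_le_sum_abs)
  then have "\<bar>g (x, y) - g (x', y')\<bar> \<le> K * (\<bar>x - x'\<bar> + \<bar>y - y'\<bar>)"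
    if "(x, y) \<in> unit_square" "(x', y') \<in> unit_square" for x y x' y'
    using K(2)[OF that] K(1) by (meson mult_left_mono order_trans)
  moreover have "continuous_on unit_square g"
    using g(1) by (intro continuous_at_imp_continuous_on ballI) (simp add: continuous_real_polymonial_function)
  ultimately show ?thesis using that[of K g] K(1) g(2) by blast
qed

lemma topspace_weak_topology_permutons: "topspace weak_topology_permutons = permutons"
proof -
  have "permutons \<in> {{\<mu> \<in> permutons. (\<integral>x. f x \<partial>\<mu>) \<in> U} | (f :: real \<times> real \<Rightarrow> real) U.
        continuous_on unit_square f \<and> open U}"
    by (auto intro!: exI[of _ "\<lambda>_. 0"] exI[of _ UNIV])
  then show ?thesis unfolding weak_topology_permutons_def topology_generated_by_topspace by blast
qed

lemma tendsto_zero_upper_bound: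
  fixes f g :: "'i \<Rightarrow> real"
  assumes "\<forall>\<^sub>F n in G. f n \<le> g n" "(g \<longlongrightarrow> 0) G" "\<And>n. 0 \<le> f n"
  shows "(f \<longlongrightarrow> 0) G"
  by (rule tendsto_sandwich[OF _ assms(1) tendsto_const assms(2)]) (simp add: assms(3))

text \<open>For a deterministic limit it suffices that every neighbourhood of X has probability
  tending to 1. This is checked on the generators of the weak topology, and a continuous integrand
  is uniformly close to a Lipschitz one.\<close>

lemma converges_in_distribution_return_pmfI:
  fixes P :: "'i \<Rightarrow> (real \<times> real) measure pmf"
  assumes X: "X \<in> permutons"
    and supp: "\<forall>\<^sub>F n in G. finite (set_pmf (P n)) \<and> set_pmf (P n) \<subseteq> permutons"
    and lip: "\<And>f K e. continuous_on unit_square f \<Longrightarrow> 0 \<le> K \<Longrightarrow>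
      (\<And>x y x' y'. (x, y) \<in> unit_square \<Longrightarrow> (x', y') \<in> unit_square \<Longrightarrow>
      \<bar>f (x, y) - f (x', y')\<bar> \<le> K * (\<bar>x - x'\<bar> + \<bar>y - y'\<bar>)) \<Longrightarrow> e > 0 \<Longrightarrow>
      ((\<lambda>n. measure_pmf.prob (P n) {\<mu>. \<bar>(\<integral>z. f z \<partial>\<mu>) - (\<integral>z. f z \<partial>X)\<bar> > e}) \<longlongrightarrow> 0) G"
  shows "converges_in_distribution weak_topology_permutons P (return_pmf X) G"
proof -
  have cont: "((\<lambda>n. measure_pmf.prob (P n) {\<mu>. \<bar>(\<integral>z. f z \<partial>\<mu>) - (\<integral>z. f z \<partial>X)\<bar> > e}) \<longlongrightarrow> 0) G"
    if f: "continuous_on unit_square f" and e: "e > 0" for f :: "real \<times> real \<Rightarrow> real" and e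
  proof -
    \<comment> \<open>One third is spent on replacing f by g under \<mu>, one third under X, and one
      third remains for the deviation of the integrals of g.\<close>
    have e3: "e / 3 > 0" using e by simp
    obtain g K where g: "K \<ge> 0" "continuous_on unit_square g" "\<And>z. z \<in> unit_square \<Longrightarrow> \<bar>f z - g z\<bar> < e / 3"
    and gl: "\<And>x y x' y'. (x, y) \<in> unit_square \<Longrightarrow> (x', y') \<in> unit_square \<Longrightarrow>
      \<bar>g (x, y) - g (x', y')\<bar> \<le> K * (\<bar>x - x'\<bar> + \<bar>y - y'\<bar>)"
      by (rule lipschitz_approximation_on_square[OF f e3]) (rule that; assumption)
    have close: "\<bar>(\<integral>z. f z \<partial>\<mu>) - (\<integral>z. g z \<partial>\<mu>)\<bar> \<le> e / 3" if \<mu>: "\<mu> \<in> permutons" for \<mu>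
    proof -
      interpret prob_space \<mu> using \<mu> by (simp add: permutons_def)
      have sp: "space \<mu> = unit_square"
        using \<mu> sets_eq_imp_space_eq[of \<mu> square_borel] by (simp add: permutons_def space_restrict_space)
      note int = integrable_permuton[OF f \<mu>] integrable_permuton[OF g(2) \<mu>]
      have "\<bar>(\<integral>z. f z \<partial>\<mu>) - (\<integral>z. g z \<partial>\<mu>)\<bar> = \<bar>\<integral>z. f z - g z \<partial>\<mu>\<bar>"
        using int by simp
      also have "\<dots> \<le> (\<integral>z. \<bar>f z - g z\<bar> \<partial>\<mu>)" by (rule integral_abs_bound)
      also have "\<dots> \<le> (\<integral>z. e / 3 \<partial>\<mu>)"
      proof (rule integral_mono)
        fix z assume "z \<in> space \<mu>"
        then show "\<bar>f z - g z\<bar> \<le> e / 3" using g(3)[of z] unfolding sp by simp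
      qed (use int in auto)
      finally show ?thesis by (simp add: prob_space)
    qed
    have "\<forall>\<^sub>F n in G. measure_pmf.prob (P n) {\<mu>. \<bar>(\<integral>z. f z \<partial>\<mu>) - (\<integral>z. f z \<partial>X)\<bar> > e} \<le>
        measure_pmf.prob (P n) {\<mu>. \<bar>(\<integral>z. g z \<partial>\<mu>) - (\<integral>z. g z \<partial>X)\<bar> > e / 3}"
      using supp
    proof eventually_elim
      case (elim n)
      have "measure_pmf.prob (P n) {\<mu>. \<bar>(\<integral>z. f z \<partial>\<mu>) - (\<integral>z. f z \<partial>X)\<bar> > e} =
          measure_pmf.prob (P n) ({\<mu>. \<bar>(\<integral>z. f z \<partial>\<mu>) - (\<integral>z. f z \<partial>X)\<bar> > e} \<inter> set_pmf (P n))"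
        by (rule measure_Int_set_pmf[symmetric])
      also have "\<dots> \<le> measure_pmf.prob (P n) {\<mu>. \<bar>(\<integral>z. g z \<partial>\<mu>) - (\<integral>z. g z \<partial>X)\<bar> > e / 3}"
      proof (rule measure_pmf.finite_measure_mono)
        show "{\<mu>. \<bar>(\<integral>z. f z \<partial>\<mu>) - (\<integral>z. f z \<partial>X)\<bar> > e} \<inter> set_pmf (P n) \<subseteq>
          {\<mu>. \<bar>(\<integral>z. g z \<partial>\<mu>) - (\<integral>z. g z \<partial>X)\<bar> > e / 3}"
        proof
          fix \<mu> assume \<mu>: "\<mu> \<in> {\<mu>. \<bar>(\<integral>z. f z \<partial>\<mu>) - (\<integral>z. f z \<partial>X)\<bar> > e} \<inter> set_pmf (P n)"
          then have "\<mu> \<in> permutons" using elim by blast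
          then show "\<mu> \<in> {\<mu>. \<bar>(\<integral>z. g z \<partial>\<mu>) - (\<integral>z. g z \<partial>X)\<bar> > e / 3}"
            using close[of \<mu>] close[OF X] \<mu> by (auto simp: abs_if split: if_splits)
        qed
      qed simp
      finally show ?case .
    qed
    moreover have "((\<lambda>n. measure_pmf.prob (P n) {\<mu>. \<bar>(\<integral>z. g z \<partial>\<mu>) - (\<integral>z. g z \<partial>X)\<bar> > e / 3}) \<longlongrightarrow> 0) G"
      by (rule lip[OF g(2,1) gl e3])
    ultimately show ?thesis
      by (rule tendsto_zero_upper_bound) simp
  qed
  \<comment> \<open>Induction over the generation of the open set: an intersection costs a union
    bound, in a union one member containing X suffices, and a generator is a condition on a single
    integral.\<close>
  have nbhd: "((\<lambda>n. measure_pmf.prob (P n) (- V)) \<longlongrightarrow> 0) G" if "openin weak_topology_permutons V" "X \<in> V" for V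
  proof -
    have "generate_topology_on {{\<mu> \<in> permutons. (\<integral>x. f x \<partial>\<mu>) \<in> U} | (f :: real \<times> real \<Rightarrow> real) U.
        continuous_on unit_square f \<and> open U} V"
      using that(1) unfolding weak_topology_permutons_def openin_topology_generated_by_iff .
    then show ?thesis using that(2)
    proof (induction V rule: generate_topology_on.induct)
      case Empty
      then show ?case by simp
    next
      case (Int A B)
      have sub: "measure_pmf.prob (P n) (- (A \<inter> B)) \<le> measure_pmf.prob (P n) (- A) + measure_pmf.prob (P n) (- B)" for n
        unfolding Compl_Int by (rule measure_Un_le) auto
      have lim: "((\<lambda>n. measure_pmf.prob (P n) (- A) + measure_pmf.prob (P n) (- B)) \<longlongrightarrow> 0) G"
        using tendsto_add[OF Int.IH] Int.prems by simp
      show ?case by (rule tendsto_zero_upper_bound[OF always_eventually[OF allI[OF sub]] lim]) simp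
    next
      case (UN K)
      then obtain k where k: "k \<in> K" "X \<in> k" by blast
      have sub: "measure_pmf.prob (P n) (- \<Union> K) \<le> measure_pmf.prob (P n) (- k)" for n
        using k by (intro measure_pmf.finite_measure_mono) auto
      show ?case by (rule tendsto_zero_upper_bound[OF always_eventually[OF allI[OF sub]] UN.IH[OF k]]) simp
    next
      case (Basis V)
      from Basis.hyps obtain f :: "real \<times> real \<Rightarrow> real" and U where V: "V = {\<mu> \<in> permutons. (\<integral>x. f x \<partial>\<mu>) \<in> U}" and f: "continuous_on unit_square f" and U: "open U"
        by blast
      have "(\<integral>x. f x \<partial>X) \<in> U" using Basis V by simp
      then obtain e where e: "e > 0" "\<And>y. \<bar>y - (\<integral>x. f x \<partial>X)\<bar> < e \<Longrightarrow> y \<in> U"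
        using U by (auto simp: open_dist dist_real_def)
      have "\<forall>\<^sub>F n in G. measure_pmf.prob (P n) (- V) \<le>
          measure_pmf.prob (P n) {\<mu>. \<bar>(\<integral>z. f z \<partial>\<mu>) - (\<integral>z. f z \<partial>X)\<bar> > e / 2}"
        using supp
      proof eventually_elim
        case (elim n)
        have "measure_pmf.prob (P n) (- V) = measure_pmf.prob (P n) (- V \<inter> set_pmf (P n))"
          by (rule measure_Int_set_pmf[symmetric])
        also have "\<dots> \<le> measure_pmf.prob (P n) {\<mu>. \<bar>(\<integral>z. f z \<partial>\<mu>) - (\<integral>z. f z \<partial>X)\<bar> > e / 2}"
        proof (rule measure_pmf.finite_measure_mono)
          show "- V \<inter> set_pmf (P n) \<subseteq> {\<mu>. \<bar>(\<integral>z. f z \<partial>\<mu>) - (\<integral>z. f z \<partial>X)\<bar> > e / 2}"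
          proof
            fix \<mu> assume \<mu>: "\<mu> \<in> - V \<inter> set_pmf (P n)"
            then have "\<mu> \<in> permutons" using elim by blast
            then have "(\<integral>z. f z \<partial>\<mu>) \<notin> U" using \<mu> V by simp
            then have "\<not> \<bar>(\<integral>z. f z \<partial>\<mu>) - (\<integral>z. f z \<partial>X)\<bar> < e" using e(2) by blast
            then show "\<mu> \<in> {\<mu>. \<bar>(\<integral>z. f z \<partial>\<mu>) - (\<integral>z. f z \<partial>X)\<bar> > e / 2}" using e(1) by simp
          qed
        qed simp
        finally show ?case .
      qed
      moreover have "((\<lambda>n. measure_pmf.prob (P n) {\<mu>. \<bar>(\<integral>z. f z \<partial>\<mu>) - (\<integral>z. f z \<partial>X)\<bar> > e / 2}) \<longlongrightarrow> 0) G"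
        using e(1) by (intro cont[OF f]) simp
      ultimately show ?case by (rule tendsto_zero_upper_bound) simp
    qed
  qed
  show ?thesis unfolding converges_in_distribution_def
  proof (intro allI impI, elim conjE)
    fix \<Phi> :: "(real \<times> real) measure \<Rightarrow> real"
    assume \<Phi>: "continuous_map weak_topology_permutons euclideanreal \<Phi>"
      and bdd: "bounded (\<Phi> ` topspace weak_topology_permutons)"
    obtain B where B: "B > 0" "\<And>\<mu>. \<mu> \<in> permutons \<Longrightarrow> \<bar>\<Phi> \<mu>\<bar> \<le> B"
      using bdd unfolding topspace_weak_topology_permutons bounded_pos by auto
    have "((\<lambda>n. measure_pmf.expectation (P n) \<Phi>) \<longlongrightarrow> \<Phi> X) G"
    proof (rule tendstoI)
      fix e :: real assume e: "e > 0"
      \<comment> \<open>On V the test function is within e/3 of its value at X. Off V the error is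
        at most 2 B, which a probability below e / (6 B) reduces to another third.\<close>
      define V where "V = {\<mu> \<in> topspace weak_topology_permutons. \<Phi> \<mu> \<in> {\<Phi> X - e / 3<..<\<Phi> X + e / 3}}"
      have V: "openin weak_topology_permutons V"
        unfolding V_def by (rule openin_continuous_map_preimage[OF \<Phi>]) simp
      have XV: "X \<in> V" using X e by (simp add: V_def topspace_weak_topology_permutons)
      have "\<forall>\<^sub>F n in G. measure_pmf.prob (P n) (- V) < e / (6 * B)"
        using order_tendstoD(2)[OF nbhd[OF V XV], of "e / (6 * B)"] e B by simp
      then show "\<forall>\<^sub>F n in G. dist (measure_pmf.expectation (P n) \<Phi>) (\<Phi> X) < e"
        using supp
      proof eventually_elim
        case (elim n)
        have fin: "finite (set_pmf (P n))" using elim by simp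
        note int = integrable_measure_pmf_finite[OF fin]
        have "\<bar>measure_pmf.expectation (P n) \<Phi> - \<Phi> X\<bar> = \<bar>measure_pmf.expectation (P n) (\<lambda>\<mu>. \<Phi> \<mu> - \<Phi> X)\<bar>"
          by (simp add: int)
        also have "\<dots> \<le> measure_pmf.expectation (P n) (\<lambda>\<mu>. \<bar>\<Phi> \<mu> - \<Phi> X\<bar>)" by (rule integral_abs_bound)
        also have "\<dots> \<le> measure_pmf.expectation (P n) (\<lambda>\<mu>. e / 3 + 2 * B * indicator (- V) \<mu>)"
        proof (rule integral_mono_AE)
          show "AE \<mu> in measure_pmf (P n). \<bar>\<Phi> \<mu> - \<Phi> X\<bar> \<le> e / 3 + 2 * B * indicator (- V) \<mu>"
          proof (rule AE_pmfI)
            fix \<mu> assume "\<mu> \<in> set_pmf (P n)"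
            then have \<mu>: "\<mu> \<in> permutons" using elim by blast
            show "\<bar>\<Phi> \<mu> - \<Phi> X\<bar> \<le> e / 3 + 2 * B * indicator (- V) \<mu>"
            proof (cases "\<mu> \<in> V")
              case True
              then have "\<Phi> X - e / 3 < \<Phi> \<mu>" "\<Phi> \<mu> < \<Phi> X + e / 3" by (simp_all add: V_def)
              then have "\<bar>\<Phi> \<mu> - \<Phi> X\<bar> \<le> e / 3" by linarith
              then show ?thesis using True by simp
            next
              case False
              then show ?thesis using B(2)[OF \<mu>] B(2)[OF X] e by simp
            qed
          qed
        qed (use int in auto)
        also have "\<dots> = e / 3 + 2 * B * measure_pmf.prob (P n) (- V)"
          by (simp add: int)
        also have "\<dots> < e / 3 + 2 * B * (e / (6 * B))"
          using elim B by (intro add_strict_left_mono mult_strict_left_mono) auto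
        also have "\<dots> \<le> e" using B e by simp
        finally show ?case by (simp add: dist_real_def)
      qed
    qed
    then show "((\<lambda>n. measure_pmf.expectation (P n) \<Phi>) \<longlongrightarrow> measure_pmf.expectation (return_pmf X) \<Phi>) G"
      by simp
  qed
qed

section \<open>Coefficients of the matrices\<close>

text \<open>For a fixed coefficient the infinite sum over the terms of an equation has finite
  support: each summand counts a fibre of a finite set of objects, and terms without objects
  contribute 0.\<close>

lemma infsum_fibers:
  fixes h :: "'b \<Rightarrow> real"
  assumes fin: "finite A" and sub: "f ` A \<subseteq> E"
    and h: "\<And>x. x \<in> E \<Longrightarrow> h x = (\<Sum>a | a \<in> A \<and> f a = x. W a)"
  shows "infsum h E = (\<Sum>a\<in>A. W a)"
proof -
  have "infsum h E = infsum h (f ` A)"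
  proof (rule infsum_cong_neutral)
    fix x assume x: "x \<in> E - f ` A"
    then have "{a. a \<in> A \<and> f a = x} = {}" by auto
    then have "h x = sum W {}" using h[of x] x by (metis DiffD1)
    then show "h x = 0" by simp
  qed (use sub in auto)
  also have "\<dots> = (\<Sum>x\<in>f ` A. h x)" using fin by simp
  also have "\<dots> = (\<Sum>x\<in>f ` A. \<Sum>a | a \<in> A \<and> f a = x. W a)" using h sub by (intro sum.cong) auto
  also have "\<dots> = (\<Sum>a\<in>A. W a)" using sum.image_gen[OF fin, of W f] by simp
  finally show ?thesis .
qed

context linear_specification
begin

lemma finite_fam_size: "finite {t \<in> fam i. tree_size t = n}"
  using finite_sized[of i n] by (simp add: sized_def)

definition context_term :: "tree_context \<Rightarrow> permutation \<times> nat list" where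
  "context_term = (\<lambda>(\<pi>, k, l, g). (\<pi>, k))"

text \<open>Contexts over a fixed term are pairs of a hole position and a choice of the other
  children. The sum over the differentiated factors thus becomes a sum over contexts.\<close>

lemma slice_fiber_sum:
  assumes i: "i \<in> crit" and j: "j \<in> crit" and tm: "(\<pi>, k) \<in> equation_terms S i"
  shows "(\<Sum>l | l < length \<pi> \<and> k ! l = j. \<Sum>g | g \<in> PiE ({..<length \<pi>} - {l}) (\<lambda>q. fam (k ! q)) \<and>
      (\<Sum>q\<in>{..<length \<pi>} - {l}. tree_size (g q)) = n. W (\<pi>, k, l, g)) =
    (\<Sum>c | c \<in> slice i j n \<and> context_term c = (\<pi>, k). W c)"
proof -
  let ?L = "{l. l < length \<pi> \<and> k ! l = j}"
  let ?G = "\<lambda>l. {g. g \<in> PiE ({..<length \<pi>} - {l}) (\<lambda>q. fam (k ! q)) \<and>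
      (\<Sum>q\<in>{..<length \<pi>} - {l}. tree_size (g q)) = n}"
  have finG: "finite (?G l)" for l
    using finite_PiE_size[of "{..<length \<pi>} - {l}" "\<lambda>q. fam (k ! q)" tree_size n] finite_fam_size by auto
  have "(\<Sum>l\<in>?L. \<Sum>g\<in>?G l. W (\<pi>, k, l, g)) = (\<Sum>(l, g)\<in>(SIGMA l:?L. ?G l). W (\<pi>, k, l, g))"
    by (rule sum.Sigma) (simp_all add: finG)
  also have "\<dots> = (\<Sum>c | c \<in> slice i j n \<and> context_term c = (\<pi>, k). W c)"
  proof -
    have im: "{c. c \<in> slice i j n \<and> context_term c = (\<pi>, k)} = (\<lambda>(l, g). (\<pi>, k, l, g)) ` (SIGMA l:?L. ?G l)"
    proof (intro set_eqI iffI)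
      fix c assume c: "c \<in> {c. c \<in> slice i j n \<and> context_term c = (\<pi>, k)}"
      obtain \<pi>' k' l g where e': "c = (\<pi>', k', l, g)" by (cases c)
      have "\<pi>' = \<pi>" "k' = k" using c unfolding e' context_term_def by simp_all
      then have e: "c = (\<pi>, k, l, g)" using e' by simp
      have "l \<in> ?L" "g \<in> ?G l" using c unfolding e slice_def contexts_def context_target_def context_size_def
        by simp_all
      then show "c \<in> (\<lambda>(l, g). (\<pi>, k, l, g)) ` (SIGMA l:?L. ?G l)"
        unfolding e by (intro image_eqI[of _ _ "(l, g)"] SigmaI) simp_all
    next
      fix c assume "c \<in> (\<lambda>(l, g). (\<pi>, k, l, g)) ` (SIGMA l:?L. ?G l)"
      then obtain z where z: "c = (\<lambda>(l, g). (\<pi>, k, l, g)) z" "z \<in> (SIGMA l:?L. ?G l)" by (elim imageE)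
      obtain l g where "z = (l, g)" by (cases z)
      then have "c = (\<pi>, k, l, g)" "l \<in> ?L" "g \<in> ?G l" using z by simp_all
      then show "c \<in> {c. c \<in> slice i j n \<and> context_term c = (\<pi>, k)}"
        using tm j by (simp add: slice_def contexts_def context_term_def context_target_def context_size_def)
    qed
    show ?thesis unfolding im by (subst sum.reindex) (simp_all add: inj_on_def case_prod_beta')
  qed
  finally show ?thesis .
qed

lemma context_term_image: "context_term ` slice i j n \<subseteq> equation_terms S i"
  by (auto simp: slice_def contexts_def context_term_def)

text \<open>Differentiating with respect to y_j removes one factor of type j, that is, opens a hole;
  the remaining product enumerates the side trees.\<close>

lemma fps_nth_M_star:
  assumes i: "i \<in> crit" and j: "j \<in> crit"
  shows "fps_nth (M_star S i j) n = card (slice i j n)"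
proof -
  have "fps_nth (M_star S i j) n = infsum (\<lambda>x. fps_nth (case x of (\<pi>, k) \<Rightarrow>
      \<Sum>l | l < length \<pi> \<and> k ! l = j. \<Prod>q\<in>{..<length \<pi>} - {l}. genfun S (k ! q)) n) (equation_terms S i)"
    by (simp add: M_star_def dF_subst_def fps_infsum_def)
  also have "\<dots> = (\<Sum>c\<in>slice i j n. 1)"
  proof (rule infsum_fibers[OF finite_slice[OF i] context_term_image])
    fix x assume x: "x \<in> equation_terms S i"
    obtain \<pi> k where xp: "x = (\<pi>, k)" by (cases x)
    note tp = term_props[OF crit_le[OF i] x[unfolded xp]]
    have kq: "k ! q \<le> last_index S" if "q < length \<pi>" for q using tp(3,4) that by (metis atMost_iff nth_mem subsetD)
    have "fps_nth (\<Prod>q\<in>{..<length \<pi>} - {l}. genfun S (k ! q)) n =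
        (\<Sum>g | g \<in> PiE ({..<length \<pi>} - {l}) (\<lambda>q. fam (k ! q)) \<and>
          (\<Sum>q\<in>{..<length \<pi>} - {l}. tree_size (g q)) = n. 1)" for l
    proof -
      have "(\<Prod>q\<in>{..<length \<pi>} - {l}. genfun S (k ! q)) =
          (\<Prod>q\<in>{..<length \<pi>} - {l}. weighted_gf (fam (k ! q)) (\<lambda>_. 1) tree_size)"
        using kq by (intro prod.cong) (auto simp: genfun_weighted)
      then show ?thesis
        using fps_nth_prod_weighted_gf[of "{..<length \<pi>} - {l}" "\<lambda>q. fam (k ! q)" tree_size "\<lambda>_ _. 1" n] finite_fam_size
        by simp
    qed
    then show "fps_nth (case x of (\<pi>, k) \<Rightarrow>
      \<Sum>l | l < length \<pi> \<and> k ! l = j. \<Prod>q\<in>{..<length \<pi>} - {l}. genfun S (k ! q)) n =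
      (\<Sum>c | c \<in> slice i j n \<and> context_term c = x. 1)"
      using slice_fiber_sum[OF i j x[unfolded xp], where n = n and W = "\<lambda>_. 1 :: real"] by (simp add: xp fps_sum_nth del: sum_constant)
  qed
  finally show ?thesis by simp
qed

text \<open>Multiplication by z turns the derivative into the series in which a tree is weighted by
  its size, so the product formula applies. This is why coefficient n corresponds to total size n +
  1.\<close>

lemma fps_nth_deriv_prod:
  assumes m: "m \<in> Q" and Q: "finite Q" and k: "\<And>q. q \<in> Q \<Longrightarrow> k q \<le> last_index S"
  shows "fps_nth (fps_deriv (genfun S (k m)) * (\<Prod>q\<in>Q - {m}. genfun S (k q))) n =
    (\<Sum>g | g \<in> PiE Q (\<lambda>q. fam (k q)) \<and> (\<Sum>q\<in>Q. tree_size (g q)) = Suc n. real (tree_size (g m)))"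
proof -
  define w where "w q t = (if q = m then real (tree_size t) else 1)" for q t
  have Xd: "fps_X * fps_deriv (genfun S (k m)) = weighted_gf (fam (k m)) (w m) tree_size"
  proof (rule fps_ext)
    fix n
    show "fps_nth (fps_X * fps_deriv (genfun S (k m))) n = fps_nth (weighted_gf (fam (k m)) (w m) tree_size) n"
    proof (cases n)
      case 0
      have "fps_nth (weighted_gf (fam (k m)) (w m) tree_size) 0 = 0"
        unfolding weighted_gf_def w_def by simp
      then show ?thesis using 0 by simp
    next
      case (Suc n')
      have "(\<Sum>t | t \<in> fam (k m) \<and> tree_size t = n. w m t) = (\<Sum>t\<in>sized (k m) n. real n)"
        by (intro sum.cong) (auto simp: sized_def w_def)
      then show ?thesis using Suc m k fps_nth_genfun[of "k m"] by (simp add: weighted_gf_def)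
    qed
  qed
  have "fps_X * (fps_deriv (genfun S (k m)) * (\<Prod>q\<in>Q - {m}. genfun S (k q))) =
      weighted_gf (fam (k m)) (w m) tree_size * (\<Prod>q\<in>Q - {m}. weighted_gf (fam (k q)) (w q) tree_size)"
    unfolding mult.assoc[symmetric] Xd using k
    by (intro arg_cong2[of _ _ _ _ "(*)"] prod.cong refl) (auto simp: genfun_weighted w_def[abs_def])
  also have "\<dots> = (\<Prod>q\<in>Q. weighted_gf (fam (k q)) (w q) tree_size)" using m Q by (simp add: prod.remove)
  finally have *: "fps_X * (fps_deriv (genfun S (k m)) * (\<Prod>q\<in>Q - {m}. genfun S (k q))) =
     (\<Prod>q\<in>Q. weighted_gf (fam (k q)) (w q) tree_size)" .
  have "fps_nth (fps_deriv (genfun S (k m)) * (\<Prod>q\<in>Q - {m}. genfun S (k q))) n =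
      fps_nth (fps_X * (fps_deriv (genfun S (k m)) * (\<Prod>q\<in>Q - {m}. genfun S (k q)))) (Suc n)"
    by (subst fps_X_mult_nth) simp
  also have "\<dots> = (\<Sum>g | g \<in> PiE Q (\<lambda>q. fam (k q)) \<and> (\<Sum>q\<in>Q. tree_size (g q)) = Suc n. \<Prod>q\<in>Q. w q (g q))"
    unfolding * using Q finite_fam_size by (intro fps_nth_prod_weighted_gf) auto
  also have "\<dots> = (\<Sum>g | g \<in> PiE Q (\<lambda>q. fam (k q)) \<and> (\<Sum>q\<in>Q. tree_size (g q)) = Suc n. real (tree_size (g m)))"
  proof (intro sum.cong refl)
    fix g
    have "(\<Prod>q\<in>Q. w q (g q)) = w m (g m) * (\<Prod>q\<in>Q - {m}. w q (g q))" using m Q by (rule prod.remove[rotated])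
    also have "(\<Prod>q\<in>Q - {m}. w q (g q)) = 1" by (intro prod.neutral) (auto simp: w_def)
    finally show "(\<Prod>q\<in>Q. w q (g q)) = real (tree_size (g m))" by (simp add: w_def)
  qed
  finally show ?thesis .
qed

text \<open>The marked leaf belongs to the context but is not counted by \<open>D_star\<close>;
  hence contexts of size n + 1, each weighted by its number of leaves of the given type.\<close>

lemma fps_nth_D_star:
  assumes i: "i \<in> crit" and j: "j \<in> crit"
  shows "fps_nth (D_star S e s i j) n = (\<Sum>c\<in>slice i j (Suc n). real (side_count e s c))"
proof -
  have "fps_nth (D_star S e s i j) n = infsum (\<lambda>x. fps_nth (case x of (\<pi>, k) \<Rightarrow>
      \<Sum>l | l < length \<pi> \<and> k ! l = j. \<Sum>m | m < length \<pi> \<and> on_side e l m \<and> induces_sign s \<pi> l m.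
         fps_deriv (genfun S (k ! m)) * (\<Prod>q\<in>{..<length \<pi>} - {l, m}. genfun S (k ! q))) n) (equation_terms S i)"
    by (simp add: D_star_def fps_infsum_def)
  also have "\<dots> = (\<Sum>c\<in>slice i j (Suc n). real (side_count e s c))"
  proof (rule infsum_fibers[OF finite_slice[OF i] context_term_image])
    fix x assume x: "x \<in> equation_terms S i"
    obtain \<pi> k where xp: "x = (\<pi>, k)" by (cases x)
    note tp = term_props[OF crit_le[OF i] x[unfolded xp]]
    have kq: "k ! q \<le> last_index S" if "q < length \<pi>" for q using tp(3,4) that by (metis atMost_iff nth_mem subsetD)
    have "(\<Sum>m | m < length \<pi> \<and> on_side e l m \<and> induces_sign s \<pi> l m.
         fps_nth (fps_deriv (genfun S (k ! m)) * (\<Prod>q\<in>{..<length \<pi>} - {l, m}. genfun S (k ! q))) n) =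
        (\<Sum>g | g \<in> PiE ({..<length \<pi>} - {l}) (\<lambda>q. fam (k ! q)) \<and>
          (\<Sum>q\<in>{..<length \<pi>} - {l}. tree_size (g q)) = Suc n. real (side_count e s (\<pi>, k, l, g)))" for l
    proof -
      have "fps_nth (fps_deriv (genfun S (k ! m)) * (\<Prod>q\<in>{..<length \<pi>} - {l, m}. genfun S (k ! q))) n =
          (\<Sum>g | g \<in> PiE ({..<length \<pi>} - {l}) (\<lambda>q. fam (k ! q)) \<and>
          (\<Sum>q\<in>{..<length \<pi>} - {l}. tree_size (g q)) = Suc n. real (tree_size (g m)))"
        if m: "m < length \<pi>" "on_side e l m" for m
      proof -
        have "m \<noteq> l" using m(2) by (auto simp: on_side_def split: side.splits)
        moreover have "{..<length \<pi>} - {l, m} = {..<length \<pi>} - {l} - {m}" by auto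
        ultimately show ?thesis
          using fps_nth_deriv_prod[of m "{..<length \<pi>} - {l}" "\<lambda>q. k ! q" n] m kq by simp
      qed
      then have "(\<Sum>m | m < length \<pi> \<and> on_side e l m \<and> induces_sign s \<pi> l m.
         fps_nth (fps_deriv (genfun S (k ! m)) * (\<Prod>q\<in>{..<length \<pi>} - {l, m}. genfun S (k ! q))) n) =
        (\<Sum>m | m < length \<pi> \<and> on_side e l m \<and> induces_sign s \<pi> l m.
          \<Sum>g | g \<in> PiE ({..<length \<pi>} - {l}) (\<lambda>q. fam (k ! q)) \<and>
          (\<Sum>q\<in>{..<length \<pi>} - {l}. tree_size (g q)) = Suc n. real (tree_size (g m)))"
        by (intro sum.cong) auto
      also have "\<dots> = (\<Sum>g | g \<in> PiE ({..<length \<pi>} - {l}) (\<lambda>q. fam (k ! q)) \<and>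
          (\<Sum>q\<in>{..<length \<pi>} - {l}. tree_size (g q)) = Suc n.
          \<Sum>m | m < length \<pi> \<and> on_side e l m \<and> induces_sign s \<pi> l m. real (tree_size (g m)))"
        by (rule sum.swap)
      finally show ?thesis by (simp add: side_count_def)
    qed
    then show "fps_nth (case x of (\<pi>, k) \<Rightarrow>
      \<Sum>l | l < length \<pi> \<and> k ! l = j. \<Sum>m | m < length \<pi> \<and> on_side e l m \<and> induces_sign s \<pi> l m.
         fps_deriv (genfun S (k ! m)) * (\<Prod>q\<in>{..<length \<pi>} - {l, m}. genfun S (k ! q))) n =
      (\<Sum>c | c \<in> slice i j (Suc n) \<and> context_term c = x. real (side_count e s c))"
      using slice_fiber_sum[OF i j x[unfolded xp], where n = "Suc n" and W = "\<lambda>c. real (side_count e s c)"]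
      by (simp add: xp fps_sum_nth)
  qed
  finally show ?thesis .
qed

section \<open>Counting terminal trees\<close>

definition terminal_sized :: "nat \<Rightarrow> nat \<Rightarrow> subst_tree set" where
  "terminal_sized i n = {t \<in> terminal_trees S i. tree_size t = n}"

lemma terminal_sized_subset: "terminal_sized i n \<subseteq> sized i n"
  by (auto simp: terminal_sized_def terminal_trees_def sized_def)

lemma finite_terminal_sized [simp]: "finite (terminal_sized i n)"
  by (rule finite_subset[OF terminal_sized_subset]) simp

text \<open>A term with a critical index acquires a factor 0, every other term enumerates its own
  trees. The leaf comes from no term and is accounted for by the correction at n = 1.\<close>

lemma card_terminal_le:
  assumes i: "i \<in> crit"
  shows "real (card (terminal_sized i n)) \<le>
    fps_nth (F_subst S i (\<lambda>l. if l \<in> crit then 0 else genfun S l)) n + (if n = 1 then 1 else 0)"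
proof -
  let ?Y = "\<lambda>l. if l \<in> crit then 0 else genfun S l"
  define A where "A = terminal_sized i n - {Leaf}"
  \<comment> \<open>The term of the equation from which t arises, unique because the terms are
    disjoint; it sorts the terminal trees into the summands of F.\<close>
  define f where "f t = (SOME x. x \<in> equation_terms S i \<and> t \<in> term_trees S x)" for t
  have f: "f t = x" if "x \<in> equation_terms S i" "t \<in> term_trees S x" for t x
    unfolding f_def
    by (rule some_equality) (use that terms_disjoint[OF crit_le[OF i]] in blast)+
  have A: "t \<in> A \<longleftrightarrow> tree_size t = n \<and> (\<exists>(\<pi>, k)\<in>equation_terms S i. set k \<inter> crit = {} \<and> t \<in> term_trees S (\<pi>, k))" for t
  proof -
    have "t \<in> fam i" if "x \<in> equation_terms S i" "t \<in> term_trees S x" for x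
      by (subst trees_equation[OF crit_le[OF i]]) (use that in blast)
    moreover have "t \<noteq> Leaf" if "t \<in> term_trees S (\<pi>, k)" for \<pi> k
      using that by (auto simp: term_trees_def)
    ultimately show ?thesis unfolding A_def terminal_sized_def terminal_trees_def by blast
  qed
  have "infsum (\<lambda>x. fps_nth (case x of (\<pi>, k) \<Rightarrow> \<Prod>q<length \<pi>. ?Y (k ! q)) n) (equation_terms S i) = (\<Sum>t\<in>A. 1)"
  proof (rule infsum_fibers[where f = f])
    show "finite A" by (simp add: A_def)
    show "f ` A \<subseteq> equation_terms S i" using f by (auto simp: A)
    fix x assume x: "x \<in> equation_terms S i"
    obtain \<pi> k where xp: "x = (\<pi>, k)" by (cases x)
    note tp = term_props[OF crit_le[OF i] x[unfolded xp]]
    have kq: "k ! q \<le> last_index S" if "q < length \<pi>" for q using tp(3,4) that by (metis atMost_iff nth_mem subsetD)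
    have fib: "{t. t \<in> A \<and> f t = x} = (if set k \<inter> crit = {} then {t \<in> term_trees S x. tree_size t = n} else {})"
    proof (intro set_eqI iffI)
      fix t assume t: "t \<in> {t. t \<in> A \<and> f t = x}"
      then obtain \<pi>' k' where t': "tree_size t = n" "(\<pi>', k') \<in> equation_terms S i" "set k' \<inter> crit = {}"
        "t \<in> term_trees S (\<pi>', k')" using A[of t] by auto
      have "(\<pi>', k') = (\<pi>, k)" using f[OF t'(2,4)] t xp by simp
      then show "t \<in> (if set k \<inter> crit = {} then {t \<in> term_trees S x. tree_size t = n} else {})"
        using t' xp by simp
    next
      fix t assume "t \<in> (if set k \<inter> crit = {} then {t \<in> term_trees S x. tree_size t = n} else {})"
      then have t: "set k \<inter> crit = {}" "t \<in> term_trees S x" "tree_size t = n" by (simp_all split: if_splits)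
      have "t \<in> A" using A[of t] t x xp by blast
      then show "t \<in> {t. t \<in> A \<and> f t = x}" using f[OF x t(2)] by simp
    qed
    show "fps_nth (case x of (\<pi>, k) \<Rightarrow> \<Prod>q<length \<pi>. ?Y (k ! q)) n = (\<Sum>t | t \<in> A \<and> f t = x. 1)"
    proof (cases "set k \<inter> crit = {}")
      case False
      then obtain q where "q < length \<pi>" "k ! q \<in> crit" using tp(3) by (auto simp: in_set_conv_nth)
      then have "(\<Prod>q<length \<pi>. ?Y (k ! q)) = 0" by (intro prod_zero) auto
      then have "fps_nth (\<Prod>q<length \<pi>. ?Y (k ! q)) n = 0" by (simp only: fps_zero_nth)
      then show ?thesis unfolding fib using False by (simp only: xp prod.case if_False sum.empty)
    next
      case True
      have nc: "k ! q \<notin> crit" if "q < length \<pi>" for q using True that tp(3) nth_mem[of q k] by (metis disjoint_iff)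
      have "(\<Prod>q<length \<pi>. ?Y (k ! q)) = (\<Prod>q\<in>{..<length \<pi>}. weighted_gf (fam (k ! q)) (\<lambda>_. 1) tree_size)"
        using kq nc by (intro prod.cong) (auto simp: genfun_weighted)
      then have "fps_nth (\<Prod>q<length \<pi>. ?Y (k ! q)) n =
          (\<Sum>g | g \<in> PiE {..<length \<pi>} (\<lambda>q. fam (k ! q)) \<and> (\<Sum>q\<in>{..<length \<pi>}. tree_size (g q)) = n. 1)"
        using fps_nth_prod_weighted_gf[of "{..<length \<pi>}" "\<lambda>q. fam (k ! q)" tree_size "\<lambda>_ _. 1" n] finite_fam_size
        by simp
      also have "\<dots> = (\<Sum>t\<in>{t \<in> term_trees S x. tree_size t = n}. 1)"
      proof (rule sum.reindex_bij_witness[where j = "\<lambda>g. Node \<pi> (map g [0..<length \<pi>])" and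
            i = "\<lambda>t. case t of Node _ ts \<Rightarrow> restrict (\<lambda>q. ts ! q) {..<length \<pi>}"])
        fix g assume g: "g \<in> {g. g \<in> PiE {..<length \<pi>} (\<lambda>q. fam (k ! q)) \<and> (\<Sum>q\<in>{..<length \<pi>}. tree_size (g q)) = n}"
        then show "(case Node \<pi> (map g [0..<length \<pi>]) of Node _ ts \<Rightarrow> restrict (\<lambda>q. ts ! q) {..<length \<pi>}) = g"
          by (auto simp: fun_eq_iff PiE_def extensional_def)
        show "Node \<pi> (map g [0..<length \<pi>]) \<in> {t \<in> term_trees S x. tree_size t = n}"
          using g tp(3) by (auto simp: xp term_trees_iff length_tree_perm_Node simp del: tree_perm.simps)
      next
        fix t assume "t \<in> {t \<in> term_trees S x. tree_size t = n}"
        then obtain ts where ts: "t = Node \<pi> ts" "length ts = length \<pi>" "\<And>q. q < length \<pi> \<Longrightarrow> ts ! q \<in> fam (k ! q)"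
          "tree_size t = n" using tp(3) by (auto simp: xp term_trees_iff)
        show "Node \<pi> (map (case t of Node _ ts \<Rightarrow> restrict (\<lambda>q. ts ! q) {..<length \<pi>}) [0..<length \<pi>]) = t"
          using ts(1,2) by (auto intro: nth_equalityI)
        have "(\<Sum>q<length \<pi>. tree_size (ts ! q)) = n" using ts(4) length_tree_perm_Node[OF ts(2)] ts(1) by simp
        then show "(case t of Node _ ts \<Rightarrow> restrict (\<lambda>q. ts ! q) {..<length \<pi>}) \<in>
            {g. g \<in> PiE {..<length \<pi>} (\<lambda>q. fam (k ! q)) \<and> (\<Sum>q\<in>{..<length \<pi>}. tree_size (g q)) = n}"
          using ts(1,3) by auto
      qed simp
      finally show ?thesis unfolding fib using True by (simp only: xp prod.case if_True) simp
    qed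
  qed
  then have "fps_nth (F_subst S i ?Y) n = card A" by (simp add: F_subst_def fps_infsum_def)
  moreover have "card (terminal_sized i n) \<le> card A + (if n = 1 then 1 else 0)"
  proof (cases "Leaf \<in> terminal_sized i n")
    case True
    then have "n = 1" by (simp add: terminal_sized_def)
    moreover have "card (terminal_sized i n) \<le> card (insert Leaf A)" by (intro card_mono) (auto simp: A_def)
    ultimately show ?thesis using card_insert_le_m1[of "Suc (card A)" A Leaf] by (simp add: card_insert_if A_def)
  next
    case False
    then show ?thesis by (simp add: A_def)
  qed
  ultimately show ?thesis by (simp add: of_nat_le_iff[symmetric] del: of_nat_le_iff split: if_splits)
qed

end

section \<open>Chains of contexts\<close>

context linear_specification
begin

fun chain :: "nat \<Rightarrow> tree_context list \<Rightarrow> bool" where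
  "chain i [] \<longleftrightarrow> True"
| "chain i (c # cs) \<longleftrightarrow> c \<in> contexts S i \<and> chain (context_target c) cs"

end

fun chain_end :: "nat \<Rightarrow> tree_context list \<Rightarrow> nat" where
  "chain_end i [] = i"
| "chain_end i (c # cs) = chain_end (context_target c) cs"

definition chain_size :: "tree_context list \<Rightarrow> nat" where
  "chain_size cs = sum_list (map context_size cs)"

definition plug :: "tree_context list \<Rightarrow> subst_tree \<Rightarrow> subst_tree" where
  "plug cs t = foldr fill cs t"

lemma chain_size_simps [simp]:
  "chain_size [] = 0" "chain_size (c # cs) = context_size c + chain_size cs"
  "chain_size (cs @ cs') = chain_size cs + chain_size cs'"
  by (simp_all add: chain_size_def)

lemma plug_simps [simp]:
  "plug [] t = t" "plug (c # cs) t = fill c (plug cs t)" "plug (cs @ cs') t = plug cs (plug cs' t)"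
  by (simp_all add: plug_def)

lemma chain_end_append: "chain_end i (cs @ cs') = chain_end (chain_end i cs) cs'"
  by (induction cs arbitrary: i) auto

context linear_specification
begin

lemma chain_append: "chain i (cs @ cs') \<longleftrightarrow> chain i cs \<and> chain (chain_end i cs) cs'"
  by (induction cs arbitrary: i) auto

lemma chain_end_crit: "i \<in> crit \<Longrightarrow> chain i cs \<Longrightarrow> chain_end i cs \<in> crit"
  by (induction cs arbitrary: i) (auto simp: context_target_crit)

lemma plug_in_fam:
  assumes "i \<in> crit" "chain i cs" "t \<in> fam (chain_end i cs)"
  shows "plug cs t \<in> fam i \<and> tree_size (plug cs t) = chain_size cs + tree_size t"
  using assms
proof (induction cs arbitrary: i)
  case (Cons c cs)
  have c: "c \<in> contexts S i" and cs: "chain (context_target c) cs" "t \<in> fam (chain_end (context_target c) cs)"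
    using Cons.prems by auto
  note IH = Cons.IH[OF context_target_crit[OF Cons.prems(1) c] cs]
  then show ?case using fill_in_trees[OF Cons.prems(1) c, of "plug cs t"] by simp
qed simp

lemma length_le_chain_size:
  assumes "i \<in> crit" "chain i cs"
  shows "length cs \<le> chain_size cs"
  using assms
proof (induction cs arbitrary: i)
  case (Cons c cs)
  have c: "c \<in> contexts S i" and cs: "chain (context_target c) cs" using Cons.prems by auto
  show ?case
    using Cons.IH[OF context_target_crit[OF Cons.prems(1) c] cs] context_size_pos[OF Cons.prems(1) c] by simp
qed simp

text \<open>Without equal sizes one spine could continue inside the other tree. Since every context
  has positive size, equal total sizes force the two spines to end together.\<close>

lemma plug_inj:
  assumes "i \<in> crit" "chain i cs" "chain i cs'" "chain_size cs = chain_size cs'"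
    "t \<in> fam (chain_end i cs)" "t' \<in> fam (chain_end i cs')" "plug cs t = plug cs' t'"
  shows "cs = cs' \<and> t = t'"
  using assms
proof (induction cs arbitrary: i cs')
  case Nil
  then have "length cs' \<le> 0" using length_le_chain_size[of i cs'] by simp
  then show ?case using Nil by simp
next
  case (Cons c cs)
  have "cs' \<noteq> []"
  proof
    assume "cs' = []"
    then have "length (c # cs) \<le> 0" using length_le_chain_size[of i "c # cs"] Cons.prems by simp
    then show False by simp
  qed
  then obtain d ds where d: "cs' = d # ds" by (cases cs') auto
  have c: "c \<in> contexts S i" "chain (context_target c) cs" "t \<in> fam (chain_end (context_target c) cs)" using Cons.prems by auto
  have d': "d \<in> contexts S i" "chain (context_target d) ds" "t' \<in> fam (chain_end (context_target d) ds)"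
    using Cons.prems d by auto
  have tc: "context_target c \<in> crit" "context_target d \<in> crit" using context_target_crit Cons.prems(1) c d' by auto
  have "plug cs t \<in> fam (context_target c)" "plug ds t' \<in> fam (context_target d)"
    using plug_in_fam[OF tc(1) c(2,3)] plug_in_fam[OF tc(2) d'(2,3)] by simp_all
  then have "c = d \<and> plug cs t = plug ds t'"
    using fill_inj[OF Cons.prems(1) c(1) _ d'(1)] Cons.prems(7) d by simp
  then show ?case using Cons.IH[OF tc(1) c(2), of ds] c d d' Cons.prems(4) by simp
qed

lemma terminal_in_fam: "t \<in> terminal_trees S i \<Longrightarrow> t \<in> fam i"
  by (simp add: terminal_trees_def)

lemma chain_decomposition:
  assumes "i \<in> crit" "t \<in> fam i"
  shows "\<exists>cs t0. chain i cs \<and> t0 \<in> terminal_trees S (chain_end i cs) \<and> t = plug cs t0"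
  using assms
proof (induction "tree_size t" arbitrary: i t rule: less_induct)
  case less
  show ?case
  proof (cases "t \<in> terminal_trees S i")
    case True
    then show ?thesis by (intro exI[of _ "[]"] exI[of _ t]) simp
  next
    case False
    then obtain c t' where c: "c \<in> contexts S i" "t' \<in> fam (context_target c)" "t = fill c t'"
      using trees_cases[OF less.prems] by blast
    have "tree_size t' < tree_size t"
      using fill_in_trees(2)[OF less.prems(1) c(1,2)] context_size_pos[OF less.prems(1) c(1)] c(3) by simp
    then obtain cs t0 where "chain (context_target c) cs" "t0 \<in> terminal_trees S (chain_end (context_target c) cs)" "t' = plug cs t0"
      using less.hyps[OF _ context_target_crit[OF less.prems(1) c(1)] c(2)] by blast
    then show ?thesis using c by (intro exI[of _ "c # cs"] exI[of _ t0]) simp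
  qed
qed

text \<open>The size is bounded only to keep the set finite; the weight estimates below are uniform
  in this bound.\<close>

definition chains :: "nat \<Rightarrow> nat \<Rightarrow> nat \<Rightarrow> tree_context list set" where
  "chains i h n = {cs. chain i cs \<and> length cs = h \<and> chain_size cs \<le> n}"

lemma chains_0: "chains i 0 n = {[]}"
  by (auto simp: chains_def)

lemma chains_Suc:
  "chains i (Suc h) n = (\<lambda>(c, cs). c # cs) `
    (SIGMA c:{c \<in> contexts S i. context_size c \<le> n}. chains (context_target c) h (n - context_size c))"
proof (intro set_eqI iffI)
  fix ds assume ds: "ds \<in> chains i (Suc h) n"
  then obtain c cs where e: "ds = c # cs" by (cases ds) (auto simp: chains_def)
  then have "c \<in> {c \<in> contexts S i. context_size c \<le> n}" "cs \<in> chains (context_target c) h (n - context_size c)"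
    using ds by (auto simp: chains_def)
  then show "ds \<in> (\<lambda>(c, cs). c # cs) `
    (SIGMA c:{c \<in> contexts S i. context_size c \<le> n}. chains (context_target c) h (n - context_size c))"
    using e by (intro image_eqI[of _ _ "(c, cs)"] SigmaI) simp_all
qed (auto simp: chains_def)

lemma finite_chains: "i \<in> crit \<Longrightarrow> finite (chains i h n)"
proof (induction h arbitrary: i n)
  case (Suc h)
  have "finite (SIGMA c:{c \<in> contexts S i. context_size c \<le> n}. chains (context_target c) h (n - context_size c))"
    using Suc context_target_crit by (intro finite_SigmaI finite_contexts) auto
  then show ?case unfolding chains_Suc by (rule finite_imageI)
qed (simp add: chains_0)

lemma sum_chains_Suc:
  assumes "i \<in> crit"
  shows "(\<Sum>cs\<in>chains i (Suc h) n. f cs) =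
    (\<Sum>c | c \<in> contexts S i \<and> context_size c \<le> n. \<Sum>cs\<in>chains (context_target c) h (n - context_size c). f (c # cs))"
proof -
  have "(\<Sum>cs\<in>chains i (Suc h) n. f cs) =
      (\<Sum>z\<in>(SIGMA c:{c \<in> contexts S i. context_size c \<le> n}. chains (context_target c) h (n - context_size c)).
        f ((\<lambda>(c, cs). c # cs) z))"
    unfolding chains_Suc by (subst sum.reindex) (simp_all add: inj_on_def o_def)
  also have "\<dots> = (\<Sum>(c, cs)\<in>(SIGMA c:{c \<in> contexts S i. context_size c \<le> n}. chains (context_target c) h (n - context_size c)).
        f (c # cs))" by (simp add: case_prod_beta')
  also have "\<dots> = (\<Sum>c | c \<in> contexts S i \<and> context_size c \<le> n. \<Sum>cs\<in>chains (context_target c) h (n - context_size c). f (c # cs))"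
    using assms finite_chains context_target_crit by (subst sum.Sigma) (auto simp: finite_contexts)
  finally show ?thesis .
qed

text \<open>The matrix of weighted contexts acts as a transfer operator along the spine; a positive
  vector \<open>y\<close> which it multiplies by at most \<open>a\<close> controls the weights of all chains.\<close>

lemma chain_weight_bound:
  assumes x: "x > 0" and \<omega>: "\<And>c. \<omega> c \<ge> (0::real)" and a: "a \<ge> 0"
    and step: "\<And>i n. i \<in> crit \<Longrightarrow>
      (\<Sum>c | c \<in> contexts S i \<and> context_size c \<le> n. x ^ context_size c * \<omega> c * y (context_target c)) \<le> a * y i"
    and i: "i \<in> crit"
  shows "(\<Sum>cs\<in>chains i h n. x ^ chain_size cs * prod_list (map \<omega> cs) * y (chain_end i cs)) \<le> a ^ h * y i"
  using i
proof (induction h arbitrary: i n)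
  case 0
  then show ?case by (simp add: chains_0)
next
  case (Suc h)
  have "(\<Sum>cs\<in>chains i (Suc h) n. x ^ chain_size cs * prod_list (map \<omega> cs) * y (chain_end i cs)) =
    (\<Sum>c | c \<in> contexts S i \<and> context_size c \<le> n. x ^ context_size c * \<omega> c *
      (\<Sum>cs\<in>chains (context_target c) h (n - context_size c).
        x ^ chain_size cs * prod_list (map \<omega> cs) * y (chain_end (context_target c) cs)))"
    unfolding sum_chains_Suc[OF Suc.prems] by (simp add: sum_distrib_left power_add mult_ac)
  also have "\<dots> \<le> (\<Sum>c | c \<in> contexts S i \<and> context_size c \<le> n. x ^ context_size c * \<omega> c * (a ^ h * y (context_target c)))"
    using Suc.IH context_target_crit[OF Suc.prems] x \<omega> by (intro sum_mono mult_left_mono) auto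
  also have "\<dots> = a ^ h * (\<Sum>c | c \<in> contexts S i \<and> context_size c \<le> n. x ^ context_size c * \<omega> c * y (context_target c))"
    by (simp add: sum_distrib_left mult_ac)
  also have "\<dots> \<le> a ^ h * (a * y i)" using step[OF Suc.prems] a by (intro mult_left_mono) auto
  finally show ?case by (simp add: mult_ac)
qed

lemma card_plug_le:
  assumes i: "i \<in> crit" and B: "\<And>t. t \<in> B \<Longrightarrow> \<exists>cs t'. t = plug cs t' \<and> cs \<in> chains i h n \<and> P cs \<and> t' \<in> U cs"
    and fin: "\<And>cs. finite (U cs)"
  shows "real (card B) \<le> (\<Sum>cs | cs \<in> chains i h n \<and> P cs. real (card (U cs)))"
proof -
  have fc: "finite {cs. cs \<in> chains i h n \<and> P cs}" using finite_chains[OF i] by simp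
  have "B \<subseteq> (\<Union>cs\<in>{cs. cs \<in> chains i h n \<and> P cs}. plug cs ` U cs)" using B by fast
  then have "card B \<le> card (\<Union>cs\<in>{cs. cs \<in> chains i h n \<and> P cs}. plug cs ` U cs)"
    using fc fin by (intro card_mono) auto
  also have "\<dots> \<le> (\<Sum>cs | cs \<in> chains i h n \<and> P cs. card (plug cs ` U cs))" by (rule card_UN_le[OF fc])
  also have "\<dots> \<le> (\<Sum>cs | cs \<in> chains i h n \<and> P cs. card (U cs))" using fin by (intro sum_mono card_image_le)
  finally have "card B \<le> (\<Sum>cs | cs \<in> chains i h n \<and> P cs. card (U cs))" .
  then have "real (card B) \<le> real (\<Sum>cs | cs \<in> chains i h n \<and> P cs. card (U cs))" by (simp only: of_nat_le_iff)
  then show ?thesis by simp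
qed

lemma card_sized_le_chains:
  assumes i: "i \<in> crit"
  shows "real (card (sized i n)) \<le>
    (\<Sum>h\<le>n. \<Sum>cs\<in>chains i h n. real (card (terminal_sized (chain_end i cs) (n - chain_size cs))))"
proof -
  define B where "B h = {t \<in> sized i n. \<exists>cs t'. t = plug cs t' \<and> cs \<in> chains i h n \<and> True \<and> t' \<in> terminal_sized (chain_end i cs) (n - chain_size cs)}" for h
  have "sized i n \<subseteq> (\<Union>h\<le>n. B h)"
  proof
    fix t assume t: "t \<in> sized i n"
    then have tf: "t \<in> fam i" "tree_size t = n" by (auto simp: sized_def)
    obtain cs t0 where cs: "chain i cs" "t0 \<in> terminal_trees S (chain_end i cs)" "t = plug cs t0"
      using chain_decomposition[OF i tf(1)] by blast
    have "tree_size t = chain_size cs + tree_size t0" using plug_in_fam[OF i cs(1) terminal_in_fam[OF cs(2)]] cs(3) by simp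
    then have "length cs \<le> n" "chain_size cs \<le> n" "tree_size t0 = n - chain_size cs"
      using length_le_chain_size[OF i cs(1)] tf by auto
    then show "t \<in> (\<Union>h\<le>n. B h)" using t cs by (auto simp: B_def chains_def terminal_sized_def)
  qed
  then have "card (sized i n) \<le> card (\<Union>h\<le>n. B h)" by (intro card_mono) (auto simp: B_def)
  also have "\<dots> \<le> (\<Sum>h\<le>n. card (B h))" by (rule card_UN_le) simp
  finally have "real (card (sized i n)) \<le> (\<Sum>h\<le>n. real (card (B h)))" by (simp only: of_nat_le_iff of_nat_sum[symmetric])
  also have "\<dots> \<le> (\<Sum>h\<le>n. \<Sum>cs | cs \<in> chains i h n \<and> True. real (card (terminal_sized (chain_end i cs) (n - chain_size cs))))"
    by (intro sum_mono card_plug_le[OF i]) (auto simp: B_def)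
  finally show ?thesis by simp
qed

text \<open>Grouping contexts by hole type and size expresses one transfer step through truncated
  matrix entries; the weight \<omega> leaves room for the exponential tilt.\<close>

lemma sum_contexts_split:
  assumes i: "i \<in> crit"
  shows "(\<Sum>c | c \<in> contexts S i \<and> context_size c \<le> n. x ^ context_size c * \<omega> c * y (context_target c)) =
    (\<Sum>j\<in>crit. (\<Sum>m\<le>n. (\<Sum>c\<in>slice i j m. \<omega> c) * x ^ m) * (y j :: real))"
proof -
  let ?A = "{c. c \<in> contexts S i \<and> context_size c \<le> n}"
  let ?f = "\<lambda>c. x ^ context_size c * \<omega> c * y (context_target c)"
  have fin: "finite ?A" using finite_contexts[OF i] by simp
  have "sum ?f ?A = (\<Sum>z\<in>crit \<times> {..n}. \<Sum>c | c \<in> ?A \<and> (context_target c, context_size c) = z. ?f c)"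
    by (rule sum.group[symmetric, OF fin]) (auto simp: context_target_crit[OF i])
  also have "\<dots> = (\<Sum>(j, m)\<in>crit \<times> {..n}. (\<Sum>c\<in>slice i j m. \<omega> c) * x ^ m * y j)"
  proof (rule sum.cong[OF refl])
    fix z assume z: "z \<in> crit \<times> {..n}"
    obtain j m where e: "z = (j, m)" by (cases z)
    have "{c. c \<in> ?A \<and> (context_target c, context_size c) = z} = slice i j m" using z e by (auto simp: slice_def)
    then have "(\<Sum>c | c \<in> ?A \<and> (context_target c, context_size c) = z. ?f c) = (\<Sum>c\<in>slice i j m. ?f c)" by simp
    also have "\<dots> = (\<Sum>c\<in>slice i j m. \<omega> c * (x ^ m * y j))" by (intro sum.cong) (auto simp: slice_def)
    finally show "(\<Sum>c | c \<in> ?A \<and> (context_target c, context_size c) = z. ?f c) =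
        (case z of (j, m) \<Rightarrow> (\<Sum>c\<in>slice i j m. \<omega> c) * x ^ m * y j)"
      by (simp add: e sum_distrib_right[symmetric] mult_ac)
  qed
  also have "\<dots> = (\<Sum>j\<in>crit. \<Sum>m\<le>n. (\<Sum>c\<in>slice i j m. \<omega> c) * x ^ m * y j)" by (simp add: sum.cartesian_product)
  finally show ?thesis by (simp add: sum_distrib_right)
qed

lemma sum_contexts_le_eval:
  assumes i: "i \<in> crit" and x: "x > 0" and y: "\<And>j. j \<in> crit \<Longrightarrow> y j \<ge> 0"
    and rad: "\<And>j. j \<in> crit \<Longrightarrow> ereal x < fps_conv_radius (M_star S i j)"
  shows "(\<Sum>c | c \<in> contexts S i \<and> context_size c \<le> n. x ^ context_size c * 1 * y (context_target c)) \<le>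
    (\<Sum>j\<in>crit. eval_fps (M_star S i j) x * y j)"
  unfolding sum_contexts_split[OF i, where \<omega> = "\<lambda>_. 1"]
proof (intro sum_mono mult_right_mono y)
  fix j assume j: "j \<in> crit"
  have s: "(\<lambda>m. fps_nth (M_star S i j) m * x ^ m) sums eval_fps (M_star S i j) x"
    using fps_sums_eval[of x "M_star S i j"] rad[OF j] x by simp
  have "(\<Sum>m\<le>n. (\<Sum>c\<in>slice i j m. 1) * x ^ m) = (\<Sum>m\<le>n. fps_nth (M_star S i j) m * x ^ m)"
    using fps_nth_M_star[OF i j] by simp
  also have "\<dots> \<le> eval_fps (M_star S i j) x"
    unfolding sums_unique[OF s] using x fps_nth_M_star[OF i j] by (intro sum_le_suminf sums_summable[OF s]) auto
  finally show "(\<Sum>m\<le>n. (\<Sum>c\<in>slice i j m. 1) * x ^ m) \<le> eval_fps (M_star S i j) x" .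
qed

text \<open>If the matrix at x contracts a positive vector y by the factor \<theta> < 1, spines of
  length h weigh at most a constant times \<theta>^h. Terminal trees have bounded weight at x, so
  summing over h bounds all coefficients times x^n.\<close>

lemma genfun_radius_criterion:
  assumes x: "x > 0" and y: "\<And>j. j \<in> crit \<Longrightarrow> y j > 0" and \<theta>: "0 \<le> \<theta>" "\<theta> < 1"
    and rad: "\<And>i j. i \<in> crit \<Longrightarrow> j \<in> crit \<Longrightarrow> ereal x < fps_conv_radius (M_star S i j)"
    and sub: "\<And>i. i \<in> crit \<Longrightarrow> (\<Sum>j\<in>crit. eval_fps (M_star S i j) x * y j) \<le> \<theta> * y i"
    and radF: "\<And>i. i \<in> crit \<Longrightarrow> ereal x < fps_conv_radius (F_subst S i (\<lambda>l. if l \<in> crit then 0 else genfun S l))"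
    and i: "i \<in> crit"
  shows "fps_conv_radius (genfun S i) \<ge> ereal x"
proof -
  have "\<exists>C. \<forall>n. real (card (terminal_sized j n)) * x ^ n \<le> C" if j: "j \<in> crit" for j
  proof -
    obtain C where C: "\<And>n. \<bar>fps_nth (F_subst S j (\<lambda>l. if l \<in> crit then 0 else genfun S l)) n\<bar> * x ^ n \<le> C"
      using fps_bounded_in_radius[OF radF[OF j] x] by blast
    have "real (card (terminal_sized j n)) * x ^ n \<le> C + x" for n
    proof -
      have "real (card (terminal_sized j n)) * x ^ n \<le>
          (fps_nth (F_subst S j (\<lambda>l. if l \<in> crit then 0 else genfun S l)) n + (if n = 1 then 1 else 0)) * x ^ n"
        using card_terminal_le[OF j] x by (intro mult_right_mono) auto
      also have "\<dots> \<le> \<bar>fps_nth (F_subst S j (\<lambda>l. if l \<in> crit then 0 else genfun S l)) n\<bar> * x ^ n + x"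
      proof -
        have "f * x ^ n \<le> \<bar>f\<bar> * x ^ n" for f using x by (intro mult_right_mono) auto
        then show ?thesis using x by (simp add: distrib_right add_increasing2)
      qed
      finally show ?thesis using C[of n] by linarith
    qed
    then show ?thesis by blast
  qed
  then obtain C where C: "\<And>j n. j \<in> crit \<Longrightarrow> real (card (terminal_sized j n)) * x ^ n \<le> C j" by metis
  \<comment> \<open>Chosen so that K y dominates the bounds on terminal trees; the terminal weight
    can then be replaced by K y at the end of the spine, as the transfer estimate requires.\<close>
  define K where "K = (\<Sum>j\<in>crit. C j / y j)"
  have C0: "0 \<le> C j" if "j \<in> crit" for j
    using C[OF that, of 0] x by (meson mult_nonneg_nonneg of_nat_0_le_iff order_trans zero_le_power less_imp_le)
  have CK: "C j \<le> K * y j" if "j \<in> crit" for j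
  proof -
    have "C j / y j \<le> K" unfolding K_def using that C0 y by (intro member_le_sum) (auto simp: less_imp_le)
    then show ?thesis using y[OF that] by (simp add: field_simps)
  qed
  have K0: "K \<ge> 0" unfolding K_def using C0 y by (intro sum_nonneg divide_nonneg_nonneg) (auto simp: less_imp_le)
  show ?thesis
  proof (rule fps_conv_radius_geI[OF x])
    fix n
    have "\<bar>fps_nth (genfun S i) n\<bar> * x ^ n = real (card (sized i n)) * x ^ n"
      using fps_nth_genfun[OF crit_le[OF i]] by simp
    also have "\<dots> \<le> (\<Sum>h\<le>n. \<Sum>cs\<in>chains i h n. real (card (terminal_sized (chain_end i cs) (n - chain_size cs)))) * x ^ n"
      using card_sized_le_chains[OF i] x by (intro mult_right_mono) auto
    also have "\<dots> = (\<Sum>h\<le>n. \<Sum>cs\<in>chains i h n. real (card (terminal_sized (chain_end i cs) (n - chain_size cs))) * x ^ n)"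
      by (simp add: sum_distrib_right)
    also have "\<dots> \<le> (\<Sum>h\<le>n. \<Sum>cs\<in>chains i h n. K * (x ^ chain_size cs * prod_list (map (\<lambda>_. 1) cs) * y (chain_end i cs)))"
    proof (intro sum_mono)
      fix h cs assume "cs \<in> chains i h n"
      then have cs: "chain i cs" "chain_size cs \<le> n" by (auto simp: chains_def)
      note e = chain_end_crit[OF i cs(1)]
      have "real (card (terminal_sized (chain_end i cs) (n - chain_size cs))) * x ^ n =
        x ^ chain_size cs * (real (card (terminal_sized (chain_end i cs) (n - chain_size cs))) * x ^ (n - chain_size cs))"
        using cs(2) by (simp add: power_add[symmetric])
      also have "\<dots> \<le> x ^ chain_size cs * (K * y (chain_end i cs))"
        using C[OF e, of "n - chain_size cs"] CK[OF e] x by (intro mult_left_mono) auto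
      finally show "real (card (terminal_sized (chain_end i cs) (n - chain_size cs))) * x ^ n \<le>
          K * (x ^ chain_size cs * prod_list (map (\<lambda>_. 1) cs) * y (chain_end i cs))"
        by (simp add: mult_ac map_replicate_const prod_list_replicate)
    qed
    also have "\<dots> = (\<Sum>h\<le>n. K * (\<Sum>cs\<in>chains i h n. x ^ chain_size cs * prod_list (map (\<lambda>_. 1) cs) * y (chain_end i cs)))"
      by (simp add: sum_distrib_left)
    also have "\<dots> \<le> (\<Sum>h\<le>n. K * (\<theta> ^ h * y i))"
    proof (intro sum_mono mult_left_mono K0 chain_weight_bound[OF x _ \<theta>(1) _ i])
      fix i n assume i: "i \<in> crit"
      have "(\<Sum>c | c \<in> contexts S i \<and> context_size c \<le> n. x ^ context_size c * 1 * y (context_target c)) \<le>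
          (\<Sum>j\<in>crit. eval_fps (M_star S i j) x * y j)"
        using y by (intro sum_contexts_le_eval i x rad) (auto simp: less_imp_le)
      also have "\<dots> \<le> \<theta> * y i" by (rule sub[OF i])
      finally show "(\<Sum>c | c \<in> contexts S i \<and> context_size c \<le> n. x ^ context_size c * 1 * y (context_target c)) \<le> \<theta> * y i" .
    qed simp
    also have "\<dots> = K * y i * (\<Sum>h\<le>n. \<theta> ^ h)" by (simp add: sum_distrib_left mult_ac)
    also have "\<dots> \<le> K * y i * (1 / (1 - \<theta>))"
    proof (intro mult_left_mono)
      have "(\<Sum>h\<le>n. \<theta> ^ h) \<le> (\<Sum>h. \<theta> ^ h)" using \<theta> by (intro sum_le_suminf summable_geometric) auto
      then show "(\<Sum>h\<le>n. \<theta> ^ h) \<le> 1 / (1 - \<theta>)" using \<theta> by (simp add: suminf_geometric)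
    qed (use K0 y[OF i] in auto)
    finally show "\<bar>fps_nth (genfun S i) n\<bar> * x ^ n \<le> K * y i * (1 / (1 - \<theta>))" .
  qed
qed

end

section \<open>The critical matrix\<close>

locale linear_critical_specification = linear_specification +
  assumes some_infinite: "\<exists>i\<le>last_index S. infinite (family S i)"
    and G_star: "induced_strongly_connected (dependency S) (critical S)"
    and radius_F: "\<forall>i\<in>critical S.
      fps_conv_radius (F_subst S i (\<lambda>l. if l \<in> critical S then 0 else genfun S l)) > rho S"
    and radius_dF: "\<forall>i\<in>critical S. \<forall>j\<in>critical S.
      fps_conv_radius (dF_subst S i j (genfun S)) > rho S"
begin

section \<open>The radius is positive and at most 1\<close>

lemma radius_M: "i \<in> crit \<Longrightarrow> j \<in> crit \<Longrightarrow> rho S < fps_conv_radius (M_star S i j)"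
  using radius_dF by (simp add: M_star_def)

lemma crit_nonempty: "crit \<noteq> {}"
proof -
  have "rho S \<in> (\<lambda>i. fps_conv_radius (genfun S i)) ` {..last_index S}"
    unfolding rho_def by (intro Min_in) auto
  then show ?thesis by (auto simp: critical_def)
qed

lemma rho_le_radius: "i \<le> last_index S \<Longrightarrow> rho S \<le> fps_conv_radius (genfun S i)"
  unfolding rho_def by (intro Min_le) auto

text \<open>Convergence at 1 forces integer coefficients to vanish eventually, hence the family to
  be finite. In particular \<rho> is a finite number.\<close>

lemma rho_le_1: "rho S \<le> 1"
proof (rule ccontr)
  assume "\<not> rho S \<le> 1"
  obtain i where i: "i \<le> last_index S" "infinite (family S i)" using some_infinite by blast
  have "ereal 1 < fps_conv_radius (genfun S i)"
    using \<open>\<not> rho S \<le> 1\<close> rho_le_radius[OF i(1)] by (simp add: one_ereal_def)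
  then have "(\<lambda>n. fps_nth (genfun S i) n * 1 ^ n) sums eval_fps (genfun S i) 1"
    by (intro fps_sums_eval) simp
  then have "(\<lambda>n. fps_nth (genfun S i) n * 1 ^ n) \<longlonglongrightarrow> 0"
    by (intro summable_LIMSEQ_zero sums_summable)
  then have "(\<lambda>n. real (card (of_size S i n))) \<longlonglongrightarrow> 0" by (simp add: genfun_def)
  then have "\<forall>\<^sub>F n in sequentially. real (card (of_size S i n)) < 1" by (rule order_tendstoD(2)) simp
  then obtain N where N: "\<And>n. n \<ge> N \<Longrightarrow> card (of_size S i n) = 0" by (auto simp: eventually_sequentially)
  have fin: "finite (of_size S i n)" for n
    using bij_betw_finite[OF of_size_bij[OF i(1)]] finite_sized by blast
  have "family S i \<subseteq> (\<Union>n<N. of_size S i n)"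
  proof
    fix \<sigma> assume \<sigma>: "\<sigma> \<in> family S i"
    have "\<sigma> \<in> of_size S i (length \<sigma>)" using \<sigma> by (simp add: of_size_def)
    then have "card (of_size S i (length \<sigma>)) \<noteq> 0" using fin by auto
    then have "length \<sigma> < N" using N[of "length \<sigma>"] by (meson not_less)
    then show "\<sigma> \<in> (\<Union>n<N. of_size S i n)" using \<open>\<sigma> \<in> of_size S i (length \<sigma>)\<close> by blast
  qed
  then have "finite (family S i)" using fin by (meson finite_UN finite_lessThan finite_subset)
  then show False using i by simp
qed

lemma eventually_within_radius:
  fixes r :: real
  assumes "ereal \<bar>r\<bar> < R"
  shows "\<forall>\<^sub>F x in at r. ereal x < R"
proof -
  obtain q where q: "\<bar>r\<bar> < q" "ereal q < R" using ereal_dense2[OF assms] by auto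
  have "\<forall>\<^sub>F x in at r. x < q" using q by (intro order_tendstoD(2)[OF tendsto_ident_at]) linarith
  then show ?thesis
  proof eventually_elim
    case (elim x)
    then have "ereal x < ereal q" by simp
    then show ?case using q(2) by (rule less_trans)
  qed
qed

lemma tendsto_M:
  assumes "ereal \<bar>r\<bar> < fps_conv_radius (M_star S i j)"
  shows "((\<lambda>x. eval_fps (M_star S i j) x) \<longlongrightarrow> eval_fps (M_star S i j) r) (at r)"
  using continuous_eval_fps[of r "M_star S i j" UNIV] assms by (simp add: continuous_within)

lemma eventually_rho_neighbourhood:
  fixes r :: real
  assumes "ereal \<bar>r\<bar> \<le> rho S"
  shows "\<forall>\<^sub>F x in at r. \<forall>i\<in>crit. \<forall>j\<in>crit. ereal x < fps_conv_radius (M_star S i j)"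
    "\<forall>\<^sub>F x in at r. \<forall>i\<in>crit. ereal x < fps_conv_radius (F_subst S i (\<lambda>l. if l \<in> crit then 0 else genfun S l))"
proof -
  show "\<forall>\<^sub>F x in at r. \<forall>i\<in>crit. \<forall>j\<in>crit. ereal x < fps_conv_radius (M_star S i j)"
    using radius_M assms
    by (intro eventually_ball_finite ballI finite_crit eventually_within_radius) (meson le_less_trans)
  show "\<forall>\<^sub>F x in at r. \<forall>i\<in>crit. ereal x < fps_conv_radius (F_subst S i (\<lambda>l. if l \<in> crit then 0 else genfun S l))"
    using radius_F assms
    by (intro eventually_ball_finite ballI finite_crit eventually_within_radius) (meson le_less_trans)
qed

text \<open>If the matrix contracts a positive vector at a point of the closed disc of radius \<open>\<rho>\<close>, then
  it still does so slightly beyond, where the critical series would converge.\<close>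

lemma no_contraction:
  fixes r :: real
  assumes r: "0 \<le> r" "ereal r = rho S" and y: "\<And>j. j \<in> crit \<Longrightarrow> y j > 0" and a: "0 \<le> a" "a < 1"
    and sub: "\<And>i. i \<in> crit \<Longrightarrow> (\<Sum>j\<in>crit. eval_fps (M_star S i j) r * y j) \<le> a * y i"
  shows False
proof -
  \<comment> \<open>The margin between a and 1 is halved: the contraction with factor b survives, by
    continuity, slightly to the right of r.\<close>
  define b where "b = (1 + a) / 2"
  have b: "0 \<le> b" "b < 1" "a < b" using a by (auto simp: b_def)
  have "\<forall>\<^sub>F x in at r. (\<Sum>j\<in>crit. eval_fps (M_star S i j) x * y j) < b * y i" if i: "i \<in> crit" for i
  proof (rule order_tendstoD(2))
    show "((\<lambda>x. \<Sum>j\<in>crit. eval_fps (M_star S i j) x * y j) \<longlongrightarrow> (\<Sum>j\<in>crit. eval_fps (M_star S i j) r * y j)) (at r)"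
      using radius_M[OF i] r by (intro tendsto_sum tendsto_mult tendsto_M tendsto_const) auto
    show "(\<Sum>j\<in>crit. eval_fps (M_star S i j) r * y j) < b * y i"
      using sub[OF i] y[OF i] b by (meson le_less_trans mult_strict_right_mono)
  qed
  then have "\<forall>\<^sub>F x in at r. \<forall>i\<in>crit. (\<Sum>j\<in>crit. eval_fps (M_star S i j) x * y j) < b * y i"
    by (intro eventually_ball_finite) auto
  moreover have "\<forall>\<^sub>F x in at r. \<forall>i\<in>crit. \<forall>j\<in>crit. ereal x < fps_conv_radius (M_star S i j)"
    "\<forall>\<^sub>F x in at r. \<forall>i\<in>crit. ereal x < fps_conv_radius (F_subst S i (\<lambda>l. if l \<in> crit then 0 else genfun S l))"
    using eventually_rho_neighbourhood[of r] r by auto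
  ultimately have "\<forall>\<^sub>F x in at r. (\<forall>i\<in>crit. (\<Sum>j\<in>crit. eval_fps (M_star S i j) x * y j) < b * y i) \<and>
      (\<forall>i\<in>crit. \<forall>j\<in>crit. ereal x < fps_conv_radius (M_star S i j)) \<and>
      (\<forall>i\<in>crit. ereal x < fps_conv_radius (F_subst S i (\<lambda>l. if l \<in> crit then 0 else genfun S l)))"
    by (intro eventually_conj)
  then have "\<forall>\<^sub>F x in at_right r. (\<forall>i\<in>crit. (\<Sum>j\<in>crit. eval_fps (M_star S i j) x * y j) < b * y i) \<and>
      (\<forall>i\<in>crit. \<forall>j\<in>crit. ereal x < fps_conv_radius (M_star S i j)) \<and>
      (\<forall>i\<in>crit. ereal x < fps_conv_radius (F_subst S i (\<lambda>l. if l \<in> crit then 0 else genfun S l)))"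
    by (rule filter_leD[OF at_le[OF subset_UNIV]])
  moreover have "\<forall>\<^sub>F x in at_right r. x > r" by (rule eventually_at_right_less)
  ultimately have "\<exists>x. x > r \<and> (\<forall>i\<in>crit. (\<Sum>j\<in>crit. eval_fps (M_star S i j) x * y j) < b * y i) \<and>
      (\<forall>i\<in>crit. \<forall>j\<in>crit. ereal x < fps_conv_radius (M_star S i j)) \<and>
      (\<forall>i\<in>crit. ereal x < fps_conv_radius (F_subst S i (\<lambda>l. if l \<in> crit then 0 else genfun S l)))"
    using eventually_happens'[OF trivial_limit_at_right_real] eventually_conj by blast
  then obtain x where x: "x > r" "\<And>i. i \<in> crit \<Longrightarrow> (\<Sum>j\<in>crit. eval_fps (M_star S i j) x * y j) < b * y i"
      "\<And>i j. i \<in> crit \<Longrightarrow> j \<in> crit \<Longrightarrow> ereal x < fps_conv_radius (M_star S i j)"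
      "\<And>i. i \<in> crit \<Longrightarrow> ereal x < fps_conv_radius (F_subst S i (\<lambda>l. if l \<in> crit then 0 else genfun S l))"
    by blast
  obtain i where i: "i \<in> crit" using crit_nonempty by blast
  have x0: "0 < x" using x(1) r by simp
  have "ereal x \<le> fps_conv_radius (genfun S i)"
    using genfun_radius_criterion[OF x0 y b(1,2) x(3) less_imp_le[OF x(2)] x(4) i] by blast
  moreover have "fps_conv_radius (genfun S i) = ereal r" using i r by (simp add: critical_def)
  ultimately show False using x(1) by simp
qed

text \<open>Contexts have positive size, so the critical matrix vanishes at 0 and contracts every
  vector there; a radius 0 is therefore impossible.\<close>

lemma rho_pos: "rho S > 0"
proof (rule ccontr)
  assume "\<not> rho S > 0"
  moreover have "rho S \<ge> 0"
    unfolding rho_def by (subst Min_ge_iff) (auto simp: fps_conv_radius_def conv_radius_nonneg)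
  ultimately have "ereal 0 = rho S" by (simp add: zero_ereal_def)
  moreover have "eval_fps (M_star S i j) 0 = 0" if "i \<in> crit" "j \<in> crit" for i j
  proof -
    have "slice i j 0 = {}" using context_size_pos[OF that(1)] by (auto simp: slice_def)
    then show ?thesis using fps_nth_M_star[OF that, of 0] by (simp add: eval_fps_at_0)
  qed
  ultimately show False using no_contraction[of 0 "\<lambda>_. 1" 0] by simp
qed

section \<open>The Perron eigenvalue of the critical matrix\<close>

definition \<rho> :: real where "\<rho> = real_of_ereal (rho S)"

lemma rho_eq: "rho S = ereal \<rho>"
  using rho_pos rho_le_1 unfolding \<rho>_def by (cases "rho S") auto

lemma \<rho>_pos: "\<rho> > 0"
  using rho_pos rho_eq by simp

abbreviation M :: "nat \<Rightarrow> nat \<Rightarrow> real" where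
  "M \<equiv> at_rho S (M_star S)"

lemma M_eq: "M i j = eval_fps (M_star S i j) \<rho>"
  by (simp add: at_rho_def \<rho>_def)

lemma M_sums:
  assumes "i \<in> crit" "j \<in> crit"
  shows "(\<lambda>n. real (card (slice i j n)) * \<rho> ^ n) sums M i j"
  using fps_sums_eval[of \<rho> "M_star S i j"] radius_M[OF assms] \<rho>_pos
  by (simp add: M_eq rho_eq fps_nth_M_star[OF assms])

lemma M_nonneg: "i \<in> crit \<Longrightarrow> j \<in> crit \<Longrightarrow> M i j \<ge> 0"
  using sums_le[OF _ sums_zero M_sums] \<rho>_pos by simp

lemma M_pos:
  assumes i: "i \<in> crit" and j: "j \<in> crit" and c: "c \<in> contexts S i" "context_target c = j"
  shows "M i j > 0"
proof -
  let ?n = "context_size c"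
  have "c \<in> slice i j ?n" using c by (simp add: slice_def)
  then have "card (slice i j ?n) > 0" using i by (auto simp: card_gt_0_iff)
  then have "0 < real (card (slice i j ?n)) * \<rho> ^ ?n" using \<rho>_pos by simp
  also have "\<dots> \<le> (\<Sum>n. real (card (slice i j n)) * \<rho> ^ n)"
    using sum_le_suminf[OF sums_summable[OF M_sums[OF i j]], of "{?n}"] \<rho>_pos by simp
  finally show ?thesis using sums_unique[OF M_sums[OF i j]] by simp
qed

text \<open>The other children may be taken arbitrarily from their nonempty families.\<close>

lemma context_of_dependency:
  assumes i: "i \<in> crit" and j: "j \<in> crit" and dep: "(j, i) \<in> dependency S"
  shows "\<exists>c\<in>contexts S i. context_target c = j"
proof -
  obtain \<pi> k where k: "(\<pi>, k) \<in> equation_terms S i" "j \<in> set k" using dep by (auto simp: dependency_def)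
  note tp = term_props[OF crit_le[OF i] k(1)]
  obtain l where l: "l < length \<pi>" "k ! l = j" using k(2) tp(3) by (auto simp: in_set_conv_nth)
  have kq: "k ! q \<le> last_index S" if "q < length \<pi>" for q using tp(3,4) that by (metis atMost_iff nth_mem subsetD)
  define g where "g = restrict (\<lambda>q. SOME t. t \<in> fam (k ! q)) ({..<length \<pi>} - {l})"
  have "(SOME t. t \<in> fam (k ! q)) \<in> fam (k ! q)" if "q < length \<pi>" for q
    using trees_nonempty[OF kq[OF that]] by (simp add: some_in_eq)
  then have "g \<in> PiE ({..<length \<pi>} - {l}) (\<lambda>q. fam (k ! q))" by (auto simp: g_def)
  then have "(\<pi>, k, l, g) \<in> contexts S i" using k l j by (simp add: contexts_def)
  then show ?thesis using l by (intro bexI[of _ "(\<pi>, k, l, g)"]) (simp_all add: context_target_def)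
qed

text \<open>Edges of the dependency graph lead from the child type to the parent type, positive
  entries from parent to child; hence the converse relation.\<close>

lemma M_irreducible: "irreducible_on crit M"
  unfolding irreducible_on_def
proof (intro ballI)
  fix i j assume ij: "i \<in> crit" "j \<in> crit"
  have "(j, i) \<in> (Restr (dependency S) crit)\<^sup>*" using G_star ij by (auto simp: induced_strongly_connected_def)
  then have "(i, j) \<in> ((Restr (dependency S) crit)\<inverse>)\<^sup>*" by (simp add: rtrancl_converse)
  moreover have "(Restr (dependency S) crit)\<inverse> \<subseteq> {(i, j). i \<in> crit \<and> j \<in> crit \<and> M i j > 0}"
    using context_of_dependency M_pos by blast
  ultimately show "(i, j) \<in> {(i, j). i \<in> crit \<and> j \<in> crit \<and> M i j > 0}\<^sup>*"
    using rtrancl_mono by blast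
qed

text \<open>Filling is injective, so M T \<le> T holds coefficientwise, with the terminal trees as
  the missing part. Left of \<rho> all series converge and the inequality can be evaluated.\<close>

lemma genfun_lower:
  assumes i: "i \<in> crit" and x: "0 < x" "x < \<rho>"
  shows "(\<Sum>j\<in>crit. eval_fps (M_star S i j) x * eval_fps (genfun S j) x) \<le> eval_fps (genfun S i) x"
proof -
  have rM: "ereal \<bar>x\<bar> < fps_conv_radius (M_star S i j)" if "j \<in> crit" for j
    using radius_M[OF i that] x rho_eq by (metis abs_of_pos ereal_less_eq(3) less_imp_le order_le_less_trans)
  have rG: "ereal \<bar>x\<bar> < fps_conv_radius (genfun S j)" if "j \<in> crit" for j
    using that x rho_eq by (simp add: critical_def)
  have s1: "(\<lambda>n. fps_nth (M_star S i j * genfun S j) n * x ^ n) sums (eval_fps (M_star S i j) x * eval_fps (genfun S j) x)"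
    if j: "j \<in> crit" for j
  proof -
    have "ereal \<bar>x\<bar> < fps_conv_radius (M_star S i j * genfun S j)"
      using rM[OF j] rG[OF j] fps_conv_radius_mult[of "M_star S i j" "genfun S j"] by (meson less_le_trans min_less_iff_conj)
    then show ?thesis using fps_sums_eval eval_fps_mult[of x "M_star S i j" "genfun S j"] rM[OF j] rG[OF j] by fastforce
  qed
  have s: "(\<lambda>n. \<Sum>j\<in>crit. fps_nth (M_star S i j * genfun S j) n * x ^ n) sums
      (\<Sum>j\<in>crit. eval_fps (M_star S i j) x * eval_fps (genfun S j) x)"
    by (intro sums_sum s1)
  show ?thesis
  proof (rule sums_le[OF _ s fps_sums_eval[OF rG[OF i]]])
    fix n
    have "(\<Sum>j\<in>crit. fps_nth (M_star S i j * genfun S j) n) =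
        real (\<Sum>j\<in>crit. \<Sum>m=0..n. card (slice i j m \<times> sized j (n - m)))"
      using i by (simp add: fps_mult_nth fps_nth_M_star fps_nth_genfun crit_le card_cartesian_product)
    also have "(\<Sum>j\<in>crit. \<Sum>m=0..n. card (slice i j m \<times> sized j (n - m))) =
        card (SIGMA z:crit \<times> {0..n}. slice i (fst z) (snd z) \<times> sized (fst z) (n - snd z))"
      using i by (simp add: sum.cartesian_product case_prod_beta')
    also have "\<dots> = card ((\<lambda>(z, c, t). fill c t) ` (SIGMA z:crit \<times> {0..n}. slice i (fst z) (snd z) \<times> sized (fst z) (n - snd z)))"
    proof (rule card_image[symmetric], rule inj_onI)
      fix a b assume a: "a \<in> (SIGMA z:crit \<times> {0..n}. slice i (fst z) (snd z) \<times> sized (fst z) (n - snd z))"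
        and b: "b \<in> (SIGMA z:crit \<times> {0..n}. slice i (fst z) (snd z) \<times> sized (fst z) (n - snd z))"
        and eq: "(\<lambda>(z, c, t). fill c t) a = (\<lambda>(z, c, t). fill c t) b"
      obtain j m c t where a': "a = ((j, m), c, t)" by (metis surj_pair)
      obtain j' m' c' t' where b': "b = ((j', m'), c', t')" by (metis surj_pair)
      have *: "c \<in> contexts S i" "context_target c = j" "context_size c = m" "t \<in> fam j"
         "c' \<in> contexts S i" "context_target c' = j'" "context_size c' = m'" "t' \<in> fam j'"
        using a b a' b' by (auto simp: slice_def sized_def)
      then have "c = c' \<and> t = t'" using fill_inj[OF i, of c t c' t'] eq a' b' by simp
      then show "a = b" using * a' b' by simp
    qed
    also have "\<dots> \<le> card (sized i n)"
    proof (rule card_mono)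
      show "(\<lambda>(z, c, t). fill c t) ` (SIGMA z:crit \<times> {0..n}. slice i (fst z) (snd z) \<times> sized (fst z) (n - snd z)) \<subseteq> sized i n"
        using fill_in_trees[OF i] by (fastforce simp: slice_def sized_def)
    qed simp
    finally have "(\<Sum>j\<in>crit. fps_nth (M_star S i j * genfun S j) n) \<le> fps_nth (genfun S i) n"
      using fps_nth_genfun[OF crit_le[OF i]] by simp
    then show "(\<Sum>j\<in>crit. fps_nth (M_star S i j * genfun S j) n * x ^ n) \<le> fps_nth (genfun S i) n * x ^ n"
      unfolding sum_distrib_right[symmetric] using x by (intro mult_right_mono) auto
  qed
qed

lemma genfun_eval_pos:
  assumes i: "i \<in> crit" and x: "0 < x" "x < \<rho>"
  shows "eval_fps (genfun S i) x > 0"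
proof -
  have "ereal \<bar>x\<bar> < fps_conv_radius (genfun S i)" using i x rho_eq by (simp add: critical_def)
  note s = fps_sums_eval[OF this]
  obtain t where t: "t \<in> fam i" using trees_nonempty[OF crit_le[OF i]] by blast
  have "t \<in> sized i (tree_size t)" using t by (simp add: sized_def)
  then have "card (sized i (tree_size t)) > 0" by (auto simp: card_gt_0_iff)
  then have "0 < fps_nth (genfun S i) (tree_size t) * x ^ tree_size t"
    using fps_nth_genfun[OF crit_le[OF i]] x by simp
  also have "\<dots> \<le> (\<Sum>n. fps_nth (genfun S i) n * x ^ n)"
    using sum_le_suminf[OF sums_summable[OF s], of "{tree_size t}"] x fps_nth_genfun[OF crit_le[OF i]] by simp
  finally show ?thesis using sums_unique[OF s] by simp
qed

text \<open>A value below 1 is a contraction at \<rho>. For a value above 1, continuity gives x <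
  \<rho> at which M(x) v > v in every coordinate, and this contradicts M(x) T(x) \<le> T(x) for the
  finite positive vector T(x).\<close>

lemma perron_eigenvalue_1:
  assumes v: "\<And>i. i \<in> crit \<Longrightarrow> v i > 0" "\<And>i. i \<in> crit \<Longrightarrow> mat_vec crit M v i = r * v i"
  shows "r = 1"
proof (rule ccontr)
  assume "r \<noteq> 1"
  obtain i0 where i0: "i0 \<in> crit" using crit_nonempty by blast
  have "0 \<le> mat_vec crit M v i0" unfolding mat_vec_def
    using M_nonneg i0 v(1) by (intro sum_nonneg mult_nonneg_nonneg) (auto simp: less_imp_le)
  then have r0: "r \<ge> 0" using v(2)[OF i0] v(1)[OF i0] by (simp add: zero_le_mult_iff)
  show False
  proof (cases "r < 1")
    case True
    show False
      by (rule no_contraction[of \<rho> v r])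
        (use \<rho>_pos rho_eq v r0 True in \<open>auto simp: mat_vec_def M_eq[symmetric] less_imp_le\<close>)
  next
    case False
    then have r1: "r > 1" using \<open>r \<noteq> 1\<close> by simp
    have "\<forall>\<^sub>F x in at \<rho>. (\<Sum>j\<in>crit. eval_fps (M_star S i j) x * v j) > v i" if i: "i \<in> crit" for i
    proof (rule order_tendstoD(1))
      show "((\<lambda>x. \<Sum>j\<in>crit. eval_fps (M_star S i j) x * v j) \<longlongrightarrow> (\<Sum>j\<in>crit. eval_fps (M_star S i j) \<rho> * v j)) (at \<rho>)"
        using radius_M[OF i] rho_eq \<rho>_pos by (intro tendsto_sum tendsto_mult tendsto_M tendsto_const) auto
      have "v i < r * v i" using r1 v(1)[OF i] by simp
      then show "v i < (\<Sum>j\<in>crit. eval_fps (M_star S i j) \<rho> * v j)"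
        using v(2)[OF i] by (simp add: mat_vec_def M_eq)
    qed
    then have "\<forall>\<^sub>F x in at \<rho>. \<forall>i\<in>crit. (\<Sum>j\<in>crit. eval_fps (M_star S i j) x * v j) > v i"
      by (intro eventually_ball_finite) auto
    then have "\<forall>\<^sub>F x in at_left \<rho>. \<forall>i\<in>crit. (\<Sum>j\<in>crit. eval_fps (M_star S i j) x * v j) > v i"
      by (rule filter_leD[OF at_le[OF subset_UNIV]])
    moreover have "\<forall>\<^sub>F x in at_left \<rho>. x \<in> {0<..<\<rho>}" using \<rho>_pos by (rule eventually_at_left_real)
    ultimately have "\<exists>x. (\<forall>i\<in>crit. (\<Sum>j\<in>crit. eval_fps (M_star S i j) x * v j) > v i) \<and> x \<in> {0<..<\<rho>}"
      using eventually_happens'[OF trivial_limit_at_left_real] eventually_conj by blast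
    then obtain x where x: "0 < x" "x < \<rho>" "\<And>i. i \<in> crit \<Longrightarrow> (\<Sum>j\<in>crit. eval_fps (M_star S i j) x * v j) > v i"
      by auto
    define T where "T j = eval_fps (genfun S j) x" for j
    \<comment> \<open>The largest multiple of v below T(x), touching it at some index i. There T_i =
      c v_i < c (M v)_i \<le> (M T)_i \<le> T_i.\<close>
    define c where "c = Min ((\<lambda>i. T i / v i) ` crit)"
    have "c \<in> (\<lambda>i. T i / v i) ` crit" unfolding c_def using crit_nonempty by (intro Min_in) auto
    then obtain i where i: "i \<in> crit" "c = T i / v i" by auto
    have c: "c * v j \<le> T j" if "j \<in> crit" for j
    proof -
      have "c \<le> T j / v j" unfolding c_def using that by auto
      then show ?thesis using v(1)[OF that] by (simp add: field_simps)
    qed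
    have c0: "c > 0" using i genfun_eval_pos[OF i(1) x(1,2)] v(1)[OF i(1)] by (simp add: T_def)
    have Mx: "eval_fps (M_star S i j) x \<ge> 0" if "j \<in> crit" for j
    proof -
      have "ereal \<bar>x\<bar> < fps_conv_radius (M_star S i j)"
        using radius_M[OF i(1) that] x rho_eq by (metis abs_of_pos ereal_less_eq(3) less_imp_le order_le_less_trans)
      from fps_sums_eval[OF this] show ?thesis
        by (rule sums_le[OF _ sums_zero, rotated]) (use x fps_nth_M_star[OF i(1) that] in simp)
    qed
    have "T i = c * v i" using i v(1)[OF i(1)] by simp
    also have "\<dots> < c * (\<Sum>j\<in>crit. eval_fps (M_star S i j) x * v j)" using x(3)[OF i(1)] c0 by simp
    also have "\<dots> = (\<Sum>j\<in>crit. eval_fps (M_star S i j) x * (c * v j))" by (simp add: sum_distrib_left mult_ac)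
    also have "\<dots> \<le> (\<Sum>j\<in>crit. eval_fps (M_star S i j) x * T j)" using c Mx by (intro sum_mono mult_left_mono)
    also have "\<dots> \<le> T i" unfolding T_def by (rule genfun_lower[OF i(1) x(1,2)])
    finally show False by simp
  qed
qed

lemma exists_right_eigenvector:
  obtains v where "\<And>i. i \<in> crit \<Longrightarrow> v i > 0" "\<And>i. i \<in> crit \<Longrightarrow> mat_vec crit M v i = v i"
proof -
  obtain r v where v: "\<And>i. i \<in> crit \<Longrightarrow> v i > 0" "\<And>i. i \<in> crit \<Longrightarrow> mat_vec crit M v i = r * v i"
    using perron_frobenius[OF finite_crit crit_nonempty M_nonneg M_irreducible] by metis
  then have "r = 1" by (rule perron_eigenvalue_1)
  then have "mat_vec crit M v i = v i" if "i \<in> crit" for i using v(2)[OF that] by simp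
  with v(1) show ?thesis by (rule that)
qed

text \<open>The Perron vector of the transpose belongs to some eigenvalue r; pairing it with the
  positive right eigenvector v shows r = 1.\<close>

lemma exists_left_eigenvector:
  obtains u where "\<And>i. i \<in> crit \<Longrightarrow> u i > 0" "\<And>i. i \<in> crit \<Longrightarrow> mat_vec crit (\<lambda>i j. M j i) u i = u i"
proof -
  obtain v where v: "\<And>i. i \<in> crit \<Longrightarrow> v i > 0" "\<And>i. i \<in> crit \<Longrightarrow> mat_vec crit M v i = v i"
    using exists_right_eigenvector by blast
  obtain r u where u: "\<And>i. i \<in> crit \<Longrightarrow> u i > 0" "\<And>i. i \<in> crit \<Longrightarrow> mat_vec crit (\<lambda>i j. M j i) u i = r * u i"
    using perron_frobenius[OF finite_crit crit_nonempty, of "\<lambda>i j. M j i"] M_nonneg irreducible_on_transpose[OF M_irreducible]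
    by metis
  have pos: "(\<Sum>i\<in>crit. u i * v i) > 0" using u(1) v(1) crit_nonempty by (intro sum_pos) auto
  have "(\<Sum>i\<in>crit. u i * v i) = (\<Sum>i\<in>crit. \<Sum>j\<in>crit. u i * M i j * v j)"
  proof (rule sum.cong[OF refl])
    fix i assume "i \<in> crit"
    then show "u i * v i = (\<Sum>j\<in>crit. u i * M i j * v j)"
      using v(2)[of i] by (simp add: mat_vec_def sum_distrib_left[symmetric] mult.assoc)
  qed
  also have "\<dots> = (\<Sum>j\<in>crit. mat_vec crit (\<lambda>i j. M j i) u j * v j)"
    by (subst sum.swap) (simp add: mat_vec_def sum_distrib_left mult_ac)
  also have "\<dots> = r * (\<Sum>i\<in>crit. u i * v i)" using u(2) by (simp add: sum_distrib_left mult.assoc)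
  finally have "r = 1" using pos by simp
  then have "mat_vec crit (\<lambda>i j. M j i) u i = u i" if "i \<in> crit" for i using u(2)[OF that] by simp
  with u(1) show ?thesis by (rule that)
qed

end

section \<open>Growth of the critical families\<close>

text \<open>A radius strictly larger than x leaves room for some r in between, and the rate is q = x
  / r. This is where strictness in the radius assumptions turns into exponential tails.\<close>

lemma geometric_decay_in_radius:
  fixes f :: "real fps"
  assumes "ereal x < fps_conv_radius f" "x > 0"
  shows "\<exists>C q. 0 < q \<and> q < 1 \<and> (\<forall>n. \<bar>fps_nth f n\<bar> * x ^ n \<le> C * q ^ n)"
proof -
  obtain r where r: "x < r" "ereal r < fps_conv_radius f" using ereal_dense2[OF assms(1)] by auto
  then obtain C where C: "\<And>n. \<bar>fps_nth f n\<bar> * r ^ n \<le> C" using fps_bounded_in_radius[of r f] assms(2) by auto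
  have "\<bar>fps_nth f n\<bar> * x ^ n \<le> C * (x / r) ^ n" for n
  proof -
    have "\<bar>fps_nth f n\<bar> * x ^ n = (\<bar>fps_nth f n\<bar> * r ^ n) * (x / r) ^ n" using r assms(2) by (simp add: power_divide)
    also have "\<dots> \<le> C * (x / r) ^ n" using C[of n] r assms(2) by (intro mult_right_mono) auto
    finally show ?thesis .
  qed
  then show ?thesis using r assms(2) by (intro exI[of _ C] exI[of _ "x / r"]) auto
qed

lemma finite_uniform_geometric_decay:
  fixes f :: "'a \<Rightarrow> nat \<Rightarrow> real"
  assumes "finite A" "\<And>a. a \<in> A \<Longrightarrow> \<exists>C q. 0 < q \<and> q < 1 \<and> (\<forall>n. f a n \<le> C * q ^ n)"
  shows "\<exists>C q. 0 < q \<and> q < 1 \<and> 0 < C \<and> (\<forall>a\<in>A. \<forall>n. f a n \<le> C * q ^ n)"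
  using assms
proof (induction A rule: finite_induct)
  case empty
  show ?case by (intro exI[of _ 1] exI[of _ "1/2"]) simp
next
  case (insert a A)
  then obtain C q where 1: "0 < q" "q < 1" "0 < C" "\<And>b n. b \<in> A \<Longrightarrow> f b n \<le> C * q ^ n" by auto
  obtain C' q' where 2: "0 < q'" "q' < 1" "\<And>n. f a n \<le> C' * q' ^ n" using insert.prems by blast
  have "C * q ^ n \<le> max C \<bar>C'\<bar> * max q q' ^ n" for n
    using 1 2 by (intro mult_mono power_mono) auto
  moreover have "C' * q' ^ n \<le> max C \<bar>C'\<bar> * max q q' ^ n" for n
    using 1 2 by (intro mult_mono power_mono) auto
  ultimately have "f b n \<le> max C \<bar>C'\<bar> * max q q' ^ n" if "b \<in> insert a A" for b n
    using that 1(4)[of b n] 2(3)[of n] by (cases "b = a") (auto intro: order_trans)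
  then show ?case using 1 2 by (intro exI[of _ "max C \<bar>C'\<bar>"] exI[of _ "max q q'"]) auto
qed

lemma bounded_linear_times_geometric:
  fixes q :: real
  assumes "0 \<le> q" "q < 1"
  shows "\<exists>B. \<forall>n. (real n + 1) * q ^ n \<le> B"
proof -
  have "(\<lambda>n. real n * q ^ n) \<longlonglongrightarrow> 0" using assms by (intro powser_times_n_limit_0) simp
  then have "Bseq (\<lambda>n. real n * q ^ n)" by (intro convergent_imp_Bseq convergentI)
  then obtain B where B: "\<And>n. norm (real n * q ^ n) \<le> B" by (auto simp: Bseq_def)
  have "(real n + 1) * q ^ n \<le> B + 1" for n
    using B[of n] power_le_one[of q n] assms by (simp add: distrib_right)
  then show ?thesis by blast
qed

context linear_critical_specification
begin

lemma terminal_decay: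
  obtains C q where "0 < q" "q < 1" "0 < C"
    "\<And>j n. j \<in> crit \<Longrightarrow> real (card (terminal_sized j n)) * \<rho> ^ n \<le> C * q ^ n"
proof -
  have "\<exists>C q. 0 < q \<and> q < 1 \<and> (\<forall>n. real (card (terminal_sized j n)) * \<rho> ^ n \<le> C * q ^ n)" if j: "j \<in> crit" for j
  proof -
    let ?F = "F_subst S j (\<lambda>l. if l \<in> crit then 0 else genfun S l)"
    have "ereal \<rho> < fps_conv_radius (?F + fps_X)"
    proof -
      have "ereal \<rho> < min (fps_conv_radius ?F) (fps_conv_radius fps_X)" using radius_F j rho_eq by simp
      then show ?thesis using fps_conv_radius_add[of ?F fps_X] by (rule less_le_trans)
    qed
    then obtain C q where q: "0 < q" "q < 1" "\<And>n. \<bar>fps_nth (?F + fps_X) n\<bar> * \<rho> ^ n \<le> C * q ^ n"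
      using geometric_decay_in_radius[OF _ \<rho>_pos] by blast
    have "real (card (terminal_sized j n)) * \<rho> ^ n \<le> C * q ^ n" for n
    proof -
      have "real (card (terminal_sized j n)) \<le> \<bar>fps_nth (?F + fps_X) n\<bar>" using card_terminal_le[OF j, of n] by simp
      then have "real (card (terminal_sized j n)) * \<rho> ^ n \<le> \<bar>fps_nth (?F + fps_X) n\<bar> * \<rho> ^ n"
        using \<rho>_pos by (intro mult_right_mono) auto
      then show ?thesis using q(3)[of n] by linarith
    qed
    then show ?thesis using q by blast
  qed
  then have "\<exists>C q. 0 < q \<and> q < 1 \<and> 0 < C \<and> (\<forall>j\<in>crit. \<forall>n. real (card (terminal_sized j n)) * \<rho> ^ n \<le> C * q ^ n)"
    by (rule finite_uniform_geometric_decay[OF finite_crit])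
  then show ?thesis using that by blast
qed

lemma slice_decay:
  obtains C q where "0 < q" "q < 1" "0 < C"
    "\<And>i j n. i \<in> crit \<Longrightarrow> j \<in> crit \<Longrightarrow> real (card (slice i j n)) * \<rho> ^ n \<le> C * q ^ n"
proof -
  have "\<exists>C q. 0 < q \<and> q < 1 \<and> (\<forall>n. real (card (slice (fst z) (snd z) n)) * \<rho> ^ n \<le> C * q ^ n)"
    if z: "z \<in> crit \<times> crit" for z
  proof -
    have "ereal \<rho> < fps_conv_radius (M_star S (fst z) (snd z))" using radius_M[of "fst z" "snd z"] z rho_eq by auto
    then obtain C q where "0 < q" "q < 1"
        "\<And>n. \<bar>fps_nth (M_star S (fst z) (snd z)) n\<bar> * \<rho> ^ n \<le> C * q ^ n"
      using geometric_decay_in_radius[OF _ \<rho>_pos] by blast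
    then show ?thesis using z fps_nth_M_star[of "fst z" "snd z"]
      by (intro exI[of _ C] exI[of _ q]) (simp add: mem_Times_iff)
  qed
  then have "\<exists>C q. 0 < q \<and> q < 1 \<and> 0 < C \<and> (\<forall>z\<in>crit \<times> crit. \<forall>n. real (card (slice (fst z) (snd z) n)) * \<rho> ^ n \<le> C * q ^ n)"
    by (intro finite_uniform_geometric_decay) auto
  then show ?thesis using that by fastforce
qed

text \<open>The right eigenvector is preserved by the transfer operator, so the mass of spines of
  length h, weighted by v at their end, is at most v at their start. The ratio of the sum of v to
  its minimum is a uniform bound.\<close>

lemma chains_mass_bound:
  obtains K where "0 < K" "\<And>i h n. i \<in> crit \<Longrightarrow> (\<Sum>cs\<in>chains i h n. \<rho> ^ chain_size cs) \<le> K"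
proof -
  obtain v where v: "\<And>i. i \<in> crit \<Longrightarrow> v i > 0" "\<And>i. i \<in> crit \<Longrightarrow> mat_vec crit M v i = v i"
    using exists_right_eigenvector by blast
  define m where "m = Min (v ` crit)"
  define V where "V = (\<Sum>i\<in>crit. v i)"
  have m: "m > 0" unfolding m_def using crit_nonempty v(1) by (subst Min_gr_iff) auto
  have mle: "m \<le> v i" if "i \<in> crit" for i unfolding m_def using that by auto
  have Vge: "v i \<le> V" if "i \<in> crit" for i unfolding V_def using that v(1) by (intro member_le_sum) (auto simp: less_imp_le)
  have V0: "V > 0" unfolding V_def using crit_nonempty v(1) by (intro sum_pos) auto
  have "(\<Sum>cs\<in>chains i h n. \<rho> ^ chain_size cs) \<le> V / m" if i: "i \<in> crit" for i h n
  proof -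
    have "m * (\<Sum>cs\<in>chains i h n. \<rho> ^ chain_size cs) =
        (\<Sum>cs\<in>chains i h n. \<rho> ^ chain_size cs * prod_list (map (\<lambda>_. 1) cs) * m)"
      by (simp add: sum_distrib_left mult_ac map_replicate_const prod_list_replicate)
    also have "\<dots> \<le> (\<Sum>cs\<in>chains i h n. \<rho> ^ chain_size cs * prod_list (map (\<lambda>_. 1) cs) * v (chain_end i cs))"
      using \<rho>_pos chain_end_crit[OF i] mle
      by (intro sum_mono mult_left_mono) (auto simp: chains_def map_replicate_const prod_list_replicate)
    also have "\<dots> \<le> 1 ^ h * v i"
    proof (rule chain_weight_bound[OF \<rho>_pos _ _ _ i])
      fix i n assume i: "i \<in> crit"
      have "(\<Sum>c | c \<in> contexts S i \<and> context_size c \<le> n. \<rho> ^ context_size c * 1 * v (context_target c)) \<le>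
          (\<Sum>j\<in>crit. eval_fps (M_star S i j) \<rho> * v j)"
        using v radius_M[OF i] rho_eq by (intro sum_contexts_le_eval i \<rho>_pos) (auto simp: less_imp_le)
      also have "\<dots> = 1 * v i" using v(2)[OF i] by (simp add: mat_vec_def M_eq)
      finally show "(\<Sum>c | c \<in> contexts S i \<and> context_size c \<le> n. \<rho> ^ context_size c * 1 * v (context_target c)) \<le> 1 * v i" .
    qed simp_all
    also have "\<dots> \<le> V" using Vge[OF i] by simp
    finally show ?thesis using m by (simp add: field_simps)
  qed
  then show ?thesis using that[of "V / m"] m V0 by simp
qed

text \<open>The factor \<rho>^n is split between the spine and the tree below it. The union bound
  runs over all spines up to length n, and b bounds the weight of what may hang below.\<close>

lemma weighted_card_plug_le:
  assumes i: "i \<in> crit" and B: "\<And>t. t \<in> B \<Longrightarrow> \<exists>h cs t'. h \<le> n \<and> t = plug cs t' \<and> cs \<in> chains i h n \<and> P cs \<and> t' \<in> U cs"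
    and fin: "\<And>cs. finite (U cs)" and b: "0 \<le> b" "\<And>h cs. cs \<in> chains i h n \<Longrightarrow> P cs \<Longrightarrow> real (card (U cs)) * \<rho> ^ (n - chain_size cs) \<le> b"
    and finB: "finite B"
  shows "real (card B) * \<rho> ^ n \<le> b * (\<Sum>h\<le>n. \<Sum>cs | cs \<in> chains i h n \<and> P cs. \<rho> ^ chain_size cs)"
proof -
  define Bh where "Bh h = {t \<in> B. \<exists>cs t'. t = plug cs t' \<and> cs \<in> chains i h n \<and> P cs \<and> t' \<in> U cs}" for h
  have "B \<subseteq> (\<Union>h\<le>n. Bh h)"
  proof
    fix t assume t: "t \<in> B"
    then obtain h cs t' where "h \<le> n" "t = plug cs t' \<and> cs \<in> chains i h n \<and> P cs \<and> t' \<in> U cs" using B by blast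
    then show "t \<in> (\<Union>h\<le>n. Bh h)" using t unfolding Bh_def by blast
  qed
  then have "card B \<le> card (\<Union>h\<le>n. Bh h)" using finB by (intro card_mono) (auto simp: Bh_def)
  also have "\<dots> \<le> (\<Sum>h\<le>n. card (Bh h))" by (rule card_UN_le) simp
  finally have "real (card B) \<le> (\<Sum>h\<le>n. real (card (Bh h)))" by (simp only: of_nat_le_iff of_nat_sum[symmetric])
  also have "\<dots> \<le> (\<Sum>h\<le>n. \<Sum>cs | cs \<in> chains i h n \<and> P cs. real (card (U cs)))"
    by (intro sum_mono card_plug_le[OF i _ fin]) (simp add: Bh_def)
  finally have "real (card B) * \<rho> ^ n \<le> (\<Sum>h\<le>n. \<Sum>cs | cs \<in> chains i h n \<and> P cs. real (card (U cs))) * \<rho> ^ n"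
    using \<rho>_pos by (intro mult_right_mono) auto
  also have "\<dots> = (\<Sum>h\<le>n. \<Sum>cs | cs \<in> chains i h n \<and> P cs. real (card (U cs)) * \<rho> ^ n)" by (simp add: sum_distrib_right)
  also have "\<dots> \<le> (\<Sum>h\<le>n. \<Sum>cs | cs \<in> chains i h n \<and> P cs. b * \<rho> ^ chain_size cs)"
  proof (intro sum_mono)
    fix h cs assume "cs \<in> {cs. cs \<in> chains i h n \<and> P cs}"
    then have cs: "cs \<in> chains i h n" "P cs" by auto
    have "real (card (U cs)) * \<rho> ^ n = (real (card (U cs)) * \<rho> ^ (n - chain_size cs)) * \<rho> ^ chain_size cs"
      using cs(1) by (simp add: chains_def mult.assoc power_add[symmetric])
    also have "\<dots> \<le> b * \<rho> ^ chain_size cs" using b(2)[OF cs] \<rho>_pos by (intro mult_right_mono) auto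
    finally show "real (card (U cs)) * \<rho> ^ n \<le> b * \<rho> ^ chain_size cs" .
  qed
  finally show ?thesis by (simp add: sum_distrib_left)
qed

lemma sized_decomposition:
  assumes i: "i \<in> crit" and t: "t \<in> sized i n"
  obtains cs t0 where "chain i cs" "cs \<in> chains i (length cs) n" "length cs \<le> n" "t = plug cs t0"
    "t0 \<in> terminal_sized (chain_end i cs) (n - chain_size cs)" "chain_size cs \<le> n"
proof -
  have tf: "t \<in> fam i" "tree_size t = n" using t by (auto simp: sized_def)
  obtain cs t0 where cs: "chain i cs" "t0 \<in> terminal_trees S (chain_end i cs)" "t = plug cs t0"
    using chain_decomposition[OF i tf(1)] by blast
  have "tree_size t = chain_size cs + tree_size t0" using plug_in_fam[OF i cs(1) terminal_in_fam[OF cs(2)]] cs(3) by simp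
  then have "length cs \<le> n" "chain_size cs \<le> n" "tree_size t0 = n - chain_size cs"
    using length_le_chain_size[OF i cs(1)] tf by auto
  then show ?thesis using that[of cs t0] cs by (simp add: chains_def terminal_sized_def)
qed

text \<open>Spines of each of the n + 1 possible lengths have bounded mass, and terminal trees have
  bounded weight.\<close>

lemma sized_upper_bound:
  obtains K where "0 < K" "\<And>i n. i \<in> crit \<Longrightarrow> real (card (sized i n)) * \<rho> ^ n \<le> K * (real n + 1)"
proof -
  obtain C q where q: "0 < q" "q < 1" "0 < C"
    "\<And>j n. j \<in> crit \<Longrightarrow> real (card (terminal_sized j n)) * \<rho> ^ n \<le> C * q ^ n" by (rule terminal_decay) (rule that)
  obtain K where K: "0 < K" "\<And>i h n. i \<in> crit \<Longrightarrow> (\<Sum>cs\<in>chains i h n. \<rho> ^ chain_size cs) \<le> K"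
    by (rule chains_mass_bound) (rule that)
  have "real (card (sized i n)) * \<rho> ^ n \<le> C * K * (real n + 1)" if i: "i \<in> crit" for i n
  proof -
    have "real (card (sized i n)) * \<rho> ^ n \<le> C * (\<Sum>h\<le>n. \<Sum>cs | cs \<in> chains i h n \<and> True. \<rho> ^ chain_size cs)"
    proof (rule weighted_card_plug_le[OF i, where U = "\<lambda>cs. terminal_sized (chain_end i cs) (n - chain_size cs)"])
      fix t assume t: "t \<in> sized i n"
      obtain cs t0 where cs: "chain i cs" "cs \<in> chains i (length cs) n" "length cs \<le> n" "t = plug cs t0"
        "t0 \<in> terminal_sized (chain_end i cs) (n - chain_size cs)" "chain_size cs \<le> n"
        by (rule sized_decomposition[OF i t]) (rule that)
      then show "\<exists>h cs t'. h \<le> n \<and> t = plug cs t' \<and> cs \<in> chains i h n \<and> True \<and> t' \<in> terminal_sized (chain_end i cs) (n - chain_size cs)"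
        by (intro exI[of _ "length cs"] exI[of _ cs] exI[of _ t0]) simp
    next
      fix h cs assume "cs \<in> chains i h n"
      then have "chain i cs" by (simp add: chains_def)
      note q(4)[OF chain_end_crit[OF i this], of "n - chain_size cs"]
      also have "C * q ^ (n - chain_size cs) \<le> C" using q by (simp add: mult_left_le power_le_one)
      finally show "real (card (terminal_sized (chain_end i cs) (n - chain_size cs))) * \<rho> ^ (n - chain_size cs) \<le> C" .
    qed (use q in auto)
    also have "\<dots> \<le> C * (\<Sum>h\<le>n. K)" using K(2)[OF i] q by (intro mult_left_mono sum_mono) auto
    finally show ?thesis by (simp add: algebra_simps)
  qed
  then show ?thesis using that[of "C * K"] q K by simp
qed

section \<open>Closed spines and the subexponential lower bound\<close>

definition loops :: "nat \<Rightarrow> nat \<Rightarrow> nat \<Rightarrow> tree_context list set" where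
  "loops i j m = {cs. chain i cs \<and> chain_end i cs = j \<and> chain_size cs = m}"

lemma finite_loops [simp]: "i \<in> crit \<Longrightarrow> finite (loops i j m)"
proof (rule finite_subset)
  assume i: "i \<in> crit"
  show "finite (\<Union>h\<le>m. chains i h m)" using finite_chains[OF i] by simp
  show "loops i j m \<subseteq> (\<Union>h\<le>m. chains i h m)"
    using length_le_chain_size[OF i] by (auto simp: loops_def chains_def)
qed

lemma exists_chain_between:
  assumes i: "i \<in> crit" and j: "j \<in> crit"
  shows "\<exists>cs. chain i cs \<and> chain_end i cs = j"
proof -
  have "(j, i) \<in> (Restr (dependency S) crit)\<^sup>*" using G_star i j by (auto simp: induced_strongly_connected_def)
  then show ?thesis
  proof (induction rule: rtrancl_induct)
    case base
    show ?case by (intro exI[of _ "[]"]) simp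
  next
    case (step a b)
    then obtain c where c: "c \<in> contexts S b" "context_target c = a" using context_of_dependency[of b a] by auto
    obtain cs where "chain a cs" "chain_end a cs = j" using step.IH by blast
    then show ?case using c by (intro exI[of _ "c # cs"]) simp
  qed
qed

text \<open>Putting a closed spine on top of a tree is injective because the size m of the spine is
  fixed.\<close>

lemma card_loops_sized_le:
  assumes i: "i \<in> crit"
  shows "card (loops i i m) * card (sized i n) \<le> card (sized i (m + n))"
proof -
  have "inj_on (\<lambda>(cs, t). plug cs t) (loops i i m \<times> sized i n)"
  proof (rule inj_onI)
    fix a b assume a: "a \<in> loops i i m \<times> sized i n" and b: "b \<in> loops i i m \<times> sized i n"
      and eq: "(\<lambda>(cs, t). plug cs t) a = (\<lambda>(cs, t). plug cs t) b"
    obtain cs t cs' t' where e: "a = (cs, t)" "b = (cs', t')" by (metis surj_pair)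
    have "cs = cs' \<and> t = t'"
      by (rule plug_inj[OF i]) (use a b eq e in \<open>auto simp: loops_def sized_def\<close>)
    then show "a = b" using e by simp
  qed
  then have "card (loops i i m \<times> sized i n) \<le> card (sized i (m + n))"
  proof (rule card_inj_on_le)
    show "(\<lambda>(cs, t). plug cs t) ` (loops i i m \<times> sized i n) \<subseteq> sized i (m + n)"
      using plug_in_fam[OF i] by (fastforce simp: loops_def sized_def)
  qed simp
  then show ?thesis by (simp add: card_cartesian_product)
qed

text \<open>Otherwise closed spines decay exponentially. A fixed return path closes any spine from i
  to j, so all spines would decay, and together with the tails of terminal trees this would push the
  radius of T_i beyond \<rho>.\<close>

lemma loops_growth:
  assumes i: "i \<in> crit" and \<epsilon>: "\<epsilon> > 0"
  shows "\<exists>m\<ge>1. real (card (loops i i m)) * \<rho> ^ m \<ge> exp (- \<epsilon> * real m)"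
proof (rule ccontr)
  assume "\<not> ?thesis"
  then have small: "real (card (loops i i m)) * \<rho> ^ m < exp (- \<epsilon> * real m)" if "m \<ge> 1" for m
    using that by (meson not_le)
  obtain ds where ds: "\<And>j. j \<in> crit \<Longrightarrow> chain j (ds j) \<and> chain_end j (ds j) = i"
    using exists_chain_between[OF _ i] by metis
  define s where "s j = chain_size (ds j)" for j
  define Q where "Q = exp (- \<epsilon>)"
  have Q: "0 < Q" "Q < 1" using \<epsilon> by (auto simp: Q_def)
  have expQ: "exp (- \<epsilon> * real m) = Q ^ m" for m by (simp add: Q_def exp_of_nat_mult[symmetric] mult.commute)
  define K where "K = 1 + (\<Sum>j\<in>crit. 1 / \<rho> ^ s j)"
  have Kj: "1 / \<rho> ^ s j \<le> K - 1" if "j \<in> crit" for j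
    unfolding K_def using that \<rho>_pos member_le_sum[of j crit "\<lambda>j. 1 / \<rho> ^ s j"] by (auto simp: less_imp_le)
  have K1: "K \<ge> 1" unfolding K_def using \<rho>_pos by (auto intro!: sum_nonneg simp: less_imp_le)
  have between: "real (card (loops i j w)) * \<rho> ^ w \<le> K * Q ^ w" if j: "j \<in> crit" for j w
  proof (cases "w + s j = 0")
    case True
    \<comment> \<open>The assumed smallness concerns closed spines of size at least 1 only; at size
      0 nothing but the empty spine exists, and K \<ge> 1 covers it.\<close>
    then have "loops i j w \<subseteq> {[]}" using length_le_chain_size[OF i] by (fastforce simp: loops_def)
    then have "card (loops i j w) \<le> card {[] :: tree_context list}" by (intro card_mono) auto
    then show ?thesis using True K1 by simp
  next
    case False
    have "card (loops i j w) \<le> card (loops i i (w + s j))"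
    proof (rule card_inj_on_le)
      show "inj_on (\<lambda>cs. cs @ ds j) (loops i j w)" by (simp add: inj_on_def)
      show "(\<lambda>cs. cs @ ds j) ` loops i j w \<subseteq> loops i i (w + s j)"
        using ds[OF j] by (auto simp: loops_def chain_append chain_end_append s_def)
    qed (use i in simp)
    then have "real (card (loops i j w)) * \<rho> ^ (w + s j) \<le> real (card (loops i i (w + s j))) * \<rho> ^ (w + s j)"
      using \<rho>_pos by (intro mult_right_mono) auto
    also have "\<dots> \<le> Q ^ (w + s j)"
      unfolding expQ[symmetric] using False by (intro less_imp_le[OF small]) linarith
    also have "\<dots> \<le> Q ^ w" using Q by (simp add: power_decreasing)
    finally have "real (card (loops i j w)) * \<rho> ^ w * \<rho> ^ s j \<le> Q ^ w" by (simp add: power_add mult.assoc)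
    then have "real (card (loops i j w)) * \<rho> ^ w \<le> (1 / \<rho> ^ s j) * Q ^ w" using \<rho>_pos by (simp add: field_simps)
    also have "\<dots> \<le> K * Q ^ w" using Kj[OF j] Q by (intro mult_right_mono) auto
    finally show ?thesis .
  qed
  obtain C q where q: "0 < q" "q < 1" "0 < C"
    "\<And>j n. j \<in> crit \<Longrightarrow> real (card (terminal_sized j n)) * \<rho> ^ n \<le> C * q ^ n" by (rule terminal_decay) (rule that)
  \<comment> \<open>A common rate for spines and terminal trees: their convolution at size n is then
    at most (n + 1) a^n up to a constant.\<close>
  define a where "a = max q Q"
  have a: "0 < a" "a < 1" "q \<le> a" "Q \<le> a" using q Q by (auto simp: a_def)
  have upper: "real (card (sized i n)) * \<rho> ^ n \<le> real (card crit) * K * C * ((real n + 1) * a ^ n)" for n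
  proof -
    have "sized i n \<subseteq> (\<Union>z\<in>crit \<times> {..n}. (\<lambda>(cs, t). plug cs t) ` (loops i (fst z) (snd z) \<times> terminal_sized (fst z) (n - snd z)))"
    proof
      fix t assume t: "t \<in> sized i n"
      obtain cs t0 where cs: "chain i cs" "cs \<in> chains i (length cs) n" "length cs \<le> n" "t = plug cs t0"
        "t0 \<in> terminal_sized (chain_end i cs) (n - chain_size cs)" "chain_size cs \<le> n"
        by (rule sized_decomposition[OF i t]) (rule that)
      then show "t \<in> (\<Union>z\<in>crit \<times> {..n}. (\<lambda>(cs, t). plug cs t) ` (loops i (fst z) (snd z) \<times> terminal_sized (fst z) (n - snd z)))"
        using chain_end_crit[OF i cs(1)]
        by (intro UN_I[of "(chain_end i cs, chain_size cs)"] image_eqI[of _ _ "(cs, t0)"]) (auto simp: loops_def)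
    qed
    then have "card (sized i n) \<le> card (\<Union>z\<in>crit \<times> {..n}. (\<lambda>(cs, t). plug cs t) ` (loops i (fst z) (snd z) \<times> terminal_sized (fst z) (n - snd z)))"
      using i by (intro card_mono) auto
    also have "\<dots> \<le> (\<Sum>z\<in>crit \<times> {..n}. card ((\<lambda>(cs, t). plug cs t) ` (loops i (fst z) (snd z) \<times> terminal_sized (fst z) (n - snd z))))"
      by (rule card_UN_le) simp
    also have "\<dots> \<le> (\<Sum>z\<in>crit \<times> {..n}. card (loops i (fst z) (snd z) \<times> terminal_sized (fst z) (n - snd z)))"
      using i by (intro sum_mono card_image_le) simp
    finally have "real (card (sized i n)) \<le> (\<Sum>z\<in>crit \<times> {..n}. real (card (loops i (fst z) (snd z)) * card (terminal_sized (fst z) (n - snd z))))"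
      unfolding card_cartesian_product by (simp only: of_nat_le_iff of_nat_sum[symmetric])
    then have "real (card (sized i n)) * \<rho> ^ n \<le>
        (\<Sum>z\<in>crit \<times> {..n}. real (card (loops i (fst z) (snd z)) * card (terminal_sized (fst z) (n - snd z)))) * \<rho> ^ n"
      using \<rho>_pos by (intro mult_right_mono) auto
    also have "\<dots> \<le> (\<Sum>z\<in>crit \<times> {..n}. K * C * a ^ n)"
      unfolding sum_distrib_right
    proof (rule sum_mono)
      fix z assume z: "z \<in> crit \<times> {..n}"
      obtain j w where e: "z = (j, w)" by (cases z)
      have jw: "j \<in> crit" "w \<le> n" using z e by auto
      have "real (card (loops i j w) * card (terminal_sized j (n - w))) * \<rho> ^ n =
          (real (card (loops i j w)) * \<rho> ^ w) * (real (card (terminal_sized j (n - w))) * \<rho> ^ (n - w))"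
        using jw(2) by (simp add: mult_ac power_add[symmetric])
      also have "\<dots> \<le> (K * Q ^ w) * (C * q ^ (n - w))"
        by (rule mult_mono[OF between[OF jw(1), of w] q(4)[OF jw(1), of "n - w"]]) (use K1 Q \<rho>_pos in auto)
      also have "\<dots> \<le> (K * a ^ w) * (C * a ^ (n - w))"
        using a Q q K1 by (intro mult_mono mult_left_mono power_mono) auto
      also have "\<dots> = K * C * a ^ n" using jw(2) by (simp add: mult_ac power_add[symmetric])
      finally show "real (card (loops i (fst z) (snd z)) * card (terminal_sized (fst z) (n - snd z))) * \<rho> ^ n \<le> K * C * a ^ n"
        by (simp add: e)
    qed
    also have "\<dots> = real (card crit) * K * C * ((real n + 1) * a ^ n)" by (simp add: algebra_simps)
    finally show ?thesis .
  qed
  \<comment> \<open>Lies strictly between a and 1: the quotient a / b absorbs the factor n + 1,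
    while \<rho> / b still exceeds \<rho>.\<close>
  define b where "b = (1 + a) / 2"
  have b: "0 < b" "b < 1" "a < b" using a by (auto simp: b_def)
  obtain B where B: "\<And>n. (real n + 1) * (a / b) ^ n \<le> B"
    using bounded_linear_times_geometric[of "a / b"] a b by auto
  have "fps_conv_radius (genfun S i) \<ge> ereal (\<rho> / b)"
  proof (rule fps_conv_radius_geI)
    fix n
    have "\<bar>fps_nth (genfun S i) n\<bar> * (\<rho> / b) ^ n = real (card (sized i n)) * \<rho> ^ n * (1 / b ^ n)"
      using fps_nth_genfun[OF crit_le[OF i]] by (simp add: power_divide)
    also have "\<dots> \<le> real (card crit) * K * C * ((real n + 1) * a ^ n) * (1 / b ^ n)"
      using upper[of n] b by (intro mult_right_mono) auto
    also have "\<dots> = real (card crit) * K * C * ((real n + 1) * (a / b) ^ n)" by (simp add: power_divide)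
    also have "\<dots> \<le> real (card crit) * K * C * B" using B[of n] K1 q by (intro mult_left_mono) auto
    finally show "\<bar>fps_nth (genfun S i) n\<bar> * (\<rho> / b) ^ n \<le> real (card crit) * K * C * B" .
  qed (use \<rho>_pos b in simp)
  moreover have "fps_conv_radius (genfun S i) = ereal \<rho>" using i rho_eq by (simp add: critical_def)
  moreover have "\<rho> / b > \<rho>" using \<rho>_pos b by (simp add: field_simps)
  ultimately show False by simp
qed

text \<open>A size n that occurs differs from the smallest occurring size in its residue class
  modulo m by a multiple of m; that many closed spines of size m are inserted. Finitely many classes
  give one constant.\<close>

lemma sized_lower_bound:
  assumes i: "i \<in> crit" and \<epsilon>: "\<epsilon> > 0"
  obtains \<kappa> where "\<kappa> > 0" "\<And>n. sized i n \<noteq> {} \<Longrightarrow> real (card (sized i n)) * \<rho> ^ n \<ge> \<kappa> * exp (- \<epsilon> * real n)"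
proof -
  obtain m where m: "m \<ge> 1" "real (card (loops i i m)) * \<rho> ^ m \<ge> exp (- \<epsilon> * real m)"
    using loops_growth[OF i \<epsilon>] by blast
  \<comment> \<open>For a class in which no size occurs this is some unspecified number; the
    constant remains positive since every power of \<rho> is.\<close>
  define r where "r a = (LEAST n. sized i n \<noteq> {} \<and> n mod m = a)" for a
  define \<kappa> where "\<kappa> = Min ((\<lambda>a. \<rho> ^ r a) ` {..<m})"
  have \<kappa>: "\<kappa> > 0" unfolding \<kappa>_def using m(1) \<rho>_pos by (subst Min_gr_iff) (auto simp: lessThan_empty_iff)
  have iter: "real (card (loops i i m)) ^ q * real (card (sized i n)) \<le> real (card (sized i (q * m + n)))" for q n
  proof (induction q)
    case (Suc q)
    have "real (card (loops i i m)) ^ Suc q * real (card (sized i n)) \<le> real (card (loops i i m)) * real (card (sized i (q * m + n)))"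
      using mult_left_mono[OF Suc, of "real (card (loops i i m))"] by (simp add: mult.assoc)
    also have "\<dots> \<le> real (card (sized i (m + (q * m + n))))"
      using card_loops_sized_le[OF i, of m "q * m + n"] by (simp only: of_nat_le_iff of_nat_mult[symmetric])
    finally show ?case by (simp add: add_ac)
  qed simp
  have "real (card (sized i n)) * \<rho> ^ n \<ge> \<kappa> * exp (- \<epsilon> * real n)" if n: "sized i n \<noteq> {}" for n
  proof -
    define a where "a = n mod m"
    have am: "a < m" using m(1) by (simp add: a_def)
    have ra: "sized i (r a) \<noteq> {} \<and> r a mod m = a" unfolding r_def by (rule LeastI[of _ n]) (use n a_def in simp)
    have "r a \<le> n" unfolding r_def by (rule Least_le) (use n a_def in simp)
    moreover have "n mod m = r a mod m" using ra by (simp add: a_def)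
    ultimately have "m dvd n - r a" by (simp add: mod_eq_dvd_iff_nat)
    then obtain q where "n - r a = m * q" by (auto elim: dvdE)
    then have q: "n = r a + m * q" using \<open>r a \<le> n\<close> by linarith
    have "card (sized i (r a)) \<ge> 1" using ra by (simp add: Suc_le_eq card_gt_0_iff)
    then have "real (card (loops i i m)) ^ q * 1 \<le> real (card (loops i i m)) ^ q * real (card (sized i (r a)))"
      by (intro mult_left_mono) auto
    also have "\<dots> \<le> real (card (sized i n))" using iter[of q "r a"] q by (simp add: ac_simps)
    finally have "real (card (loops i i m)) ^ q \<le> real (card (sized i n))" by simp
    then have "real (card (loops i i m)) ^ q * \<rho> ^ n \<le> real (card (sized i n)) * \<rho> ^ n"
      using \<rho>_pos by (intro mult_right_mono) auto
    moreover have "real (card (loops i i m)) ^ q * \<rho> ^ n = (real (card (loops i i m)) * \<rho> ^ m) ^ q * \<rho> ^ r a"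
      unfolding q by (simp add: power_add power_mult power_mult_distrib)
    moreover have "(exp (- \<epsilon> * real m)) ^ q * \<kappa> \<le> (real (card (loops i i m)) * \<rho> ^ m) ^ q * \<rho> ^ r a"
    proof (intro mult_mono power_mono m(2))
      show "\<kappa> \<le> \<rho> ^ r a" unfolding \<kappa>_def using am by (intro Min_le) auto
    qed (use \<kappa> \<rho>_pos in auto)
    moreover have "exp (- \<epsilon> * real n) \<le> (exp (- \<epsilon> * real m)) ^ q"
      using \<epsilon> unfolding q by (simp add: exp_of_nat_mult[symmetric] algebra_simps)
    then have "\<kappa> * exp (- \<epsilon> * real n) \<le> (exp (- \<epsilon> * real m)) ^ q * \<kappa>" using \<kappa> by (simp add: mult.commute)
    ultimately show ?thesis by linarith
  qed
  then show ?thesis using that \<kappa> by blast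
qed

end

section \<open>Concentration along the spine\<close>

text \<open>Lagrange remainder of second order. Its factor exp |z| is integrable against the context
  weights as long as the tilt is small compared with their exponential decay.\<close>

lemma exp_le_quadratic: "exp z \<le> 1 + z + z\<^sup>2 * exp \<bar>z\<bar>" for z :: real
proof -
  obtain t where t: "\<bar>t\<bar> \<le> \<bar>z\<bar>" "exp z = (\<Sum>m<2. z ^ m / fact m) + exp t / fact 2 * z ^ 2"
    using Maclaurin_exp_le by blast
  have "exp t / fact 2 * z ^ 2 \<le> exp \<bar>z\<bar> * z ^ 2"
  proof (rule mult_right_mono)
    have "exp t \<le> exp \<bar>z\<bar>" using t(1) by simp
    then have "exp t / 2 \<le> exp \<bar>z\<bar>" using exp_gt_zero[of t] by linarith
    then show "exp t / fact 2 \<le> exp \<bar>z\<bar>" by (simp only: fact_2)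
  qed simp
  then show ?thesis using t(2) by (simp add: numeral_2_eq_2 mult.commute)
qed

lemma square_le_exp:
  fixes a :: real
  assumes "a > 0"
  shows "(real n)\<^sup>2 \<le> 2 / a\<^sup>2 * exp (a * real n)"
proof -
  have "(a * real n)\<^sup>2 / 2 \<le> exp (a * real n)"
  proof -
    have "0 \<le> a * real n" using assms by simp
    then show ?thesis using exp_lower_Taylor_quadratic[of "a * real n"] by linarith
  qed
  then show ?thesis using assms by (simp add: field_simps power_mult_distrib)
qed

context linear_critical_specification
begin

text \<open>Exponential Markov inequality with the weights \<rho>^size in place of probabilities.
  The assumption \<open>zero\<close> says that X is centred for the weights u_i \<rho>^size v_j, so
  tilting by s costs a factor 1 + O(s^2) per level, against the gain exp (- s \<delta> n) over at
  most n levels.\<close>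

lemma chain_concentration:
  fixes X :: "tree_context \<Rightarrow> real"
  assumes Xb: "\<And>i c. i \<in> crit \<Longrightarrow> c \<in> contexts S i \<Longrightarrow> \<bar>X c\<bar> \<le> real (context_size c)"
    and u: "\<And>i. i \<in> crit \<Longrightarrow> u i > 0" "\<And>i. i \<in> crit \<Longrightarrow> mat_vec crit (\<lambda>i j. M j i) u i = u i"
    and v: "\<And>i. i \<in> crit \<Longrightarrow> v i > 0" "\<And>i. i \<in> crit \<Longrightarrow> mat_vec crit M v i = v i"
    and zero: "bilinear_value crit u (\<lambda>i j. \<Sum>n. (\<Sum>c\<in>slice i j n. X c) * \<rho> ^ n) v = 0"
    and \<delta>: "\<delta> > 0"
  obtains C \<eta> where "0 < C" "0 < \<eta>" "\<And>i h n. i \<in> crit \<Longrightarrow> h \<le> n \<Longrightarrow>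
    (\<Sum>cs | cs \<in> chains i h n \<and> sum_list (map X cs) > \<delta> * real n. \<rho> ^ chain_size cs) \<le> C * exp (- \<eta> * real n)"
proof -
  obtain C0 q where q: "0 < q" "q < 1" "0 < C0"
    and dec: "\<And>i j n. i \<in> crit \<Longrightarrow> j \<in> crit \<Longrightarrow> real (card (slice i j n)) * \<rho> ^ n \<le> C0 * q ^ n"
    by (rule slice_decay) (rule that)
  \<comment> \<open>A third of the decay rate of the contexts: one exp (s0 n) pays for the tilt, a
    second one for the factor n^2, and b q = q^(1/3) is still below 1.\<close>
  define s0 where "s0 = - ln q / 3"
  have s0: "s0 > 0" using q by (simp add: s0_def)
  define b where "b = exp (2 * s0)"
  have b: "b \<ge> 1" "b > 0" using s0 by (auto simp: b_def)
  have bq: "0 \<le> b * q" "b * q < 1"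
  proof -
    have "b * q = exp (2 * s0 + ln q)" using q by (simp add: b_def exp_add)
    also have "2 * s0 + ln q = ln q / 3" by (simp add: s0_def)
    finally show "b * q < 1" using q by simp
  qed (use b q in auto)
  define L where "L = 2 / s0\<^sup>2"
  have L: "L > 0" using s0 by (simp add: L_def)
  have sq: "(real n)\<^sup>2 * exp (s0 * real n) \<le> L * b ^ n" for n
  proof -
    have "(real n)\<^sup>2 * exp (s0 * real n) \<le> (L * exp (s0 * real n)) * exp (s0 * real n)"
      using square_le_exp[OF s0, of n] by (intro mult_right_mono) (auto simp: L_def)
    also have "\<dots> = L * b ^ n" by (simp add: b_def exp_of_nat_mult[symmetric] exp_add[symmetric] algebra_simps)
    finally show ?thesis .
  qed
  have lin: "real n \<le> L * b ^ n" for n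
  proof -
    have "real n \<le> (real n)\<^sup>2" by (cases n) (simp_all add: power2_eq_square)
    also have "\<dots> \<le> (real n)\<^sup>2 * exp (s0 * real n)" using s0 by (simp add: mult_le_cancel_left1)
    finally show ?thesis using sq[of n] by linarith
  qed
  \<comment> \<open>First moment of X over the contexts of an entry, followed by a majorant of the
    second order term, uniform for all tilts up to s0.\<close>
  define X1 where "X1 i j = (\<Sum>n. (\<Sum>c\<in>slice i j n. X c) * \<rho> ^ n)" for i j
  define Q where "Q i j = (\<Sum>n. L * b ^ n * real (card (slice i j n)) * \<rho> ^ n)" for i j
  have geo: "summable (\<lambda>n. L * C0 * (b * q) ^ n)" using bq by (intro summable_mult summable_geometric) simp
  have Qterm: "L * b ^ n * real (card (slice i j n)) * \<rho> ^ n \<le> L * C0 * (b * q) ^ n" if "i \<in> crit" "j \<in> crit" for i j n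
    using mult_left_mono[OF dec[OF that, of n], of "L * b ^ n"] L b by (simp add: mult_ac power_mult_distrib)
  have Qsum: "summable (\<lambda>n. L * b ^ n * real (card (slice i j n)) * \<rho> ^ n)" if "i \<in> crit" "j \<in> crit" for i j
    by (rule summable_comparison_test[OF _ geo]) (use Qterm[OF that] L b \<rho>_pos in \<open>auto simp: abs_mult\<close>)
  have Xsl: "\<bar>\<Sum>c\<in>slice i j n. X c\<bar> \<le> real n * real (card (slice i j n))" if "i \<in> crit" "j \<in> crit" for i j n
  proof -
    have "\<bar>\<Sum>c\<in>slice i j n. X c\<bar> \<le> (\<Sum>c\<in>slice i j n. real n)"
      using Xb[OF that(1)] by (intro order_trans[OF sum_abs] sum_mono) (auto simp: slice_def)
    then show ?thesis by (simp add: mult.commute)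
  qed
  have Xsum: "summable (\<lambda>n. (\<Sum>c\<in>slice i j n. X c) * \<rho> ^ n)" if ij: "i \<in> crit" "j \<in> crit" for i j
  proof (rule summable_comparison_test[OF _ geo], intro exI allI impI)
    fix n
    have "norm ((\<Sum>c\<in>slice i j n. X c) * \<rho> ^ n) \<le> real n * real (card (slice i j n)) * \<rho> ^ n"
      using Xsl[OF ij, of n] \<rho>_pos by (simp add: abs_mult mult_right_mono)
    also have "\<dots> \<le> L * b ^ n * real (card (slice i j n)) * \<rho> ^ n"
      using lin[of n] \<rho>_pos by (intro mult_right_mono) auto
    finally show "norm ((\<Sum>c\<in>slice i j n. X c) * \<rho> ^ n) \<le> L * C0 * (b * q) ^ n" using Qterm[OF ij, of n] by linarith
  qed
  have Q0: "Q i j \<ge> 0" if "i \<in> crit" "j \<in> crit" for i j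
    unfolding Q_def using L b \<rho>_pos by (intro suminf_nonneg Qsum that) auto
  have expand: "(\<Sum>m\<le>n. (\<Sum>c\<in>slice i j m. exp (s * X c)) * \<rho> ^ m) \<le> M i j + s * X1 i j + s\<^sup>2 * Q i j"
    if ij: "i \<in> crit" "j \<in> crit" and s: "0 < s" "s \<le> s0" for i j n s
  proof -
    define up where "up m = real (card (slice i j m)) * \<rho> ^ m + s * ((\<Sum>c\<in>slice i j m. X c) * \<rho> ^ m) +
        s\<^sup>2 * (L * b ^ m * real (card (slice i j m)) * \<rho> ^ m)" for m
    have pt: "exp (s * X c) \<le> 1 + s * X c + s\<^sup>2 * (L * b ^ m)" if c: "c \<in> slice i j m" for c m
    proof -
      have Xm: "\<bar>X c\<bar> \<le> real m" using Xb[OF ij(1), of c] c by (auto simp: slice_def)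
      have "(s * X c)\<^sup>2 * exp \<bar>s * X c\<bar> \<le> (s\<^sup>2 * (real m)\<^sup>2) * exp (s0 * real m)"
      proof (rule mult_mono)
        show "(s * X c)\<^sup>2 \<le> s\<^sup>2 * (real m)\<^sup>2"
          using power_mono[OF Xm, of 2] by (simp add: power_mult_distrib mult_left_mono)
        have "\<bar>s * X c\<bar> \<le> s0 * real m" using s Xm by (simp add: abs_mult mult_mono)
        then show "exp \<bar>s * X c\<bar> \<le> exp (s0 * real m)" by simp
      qed auto
      also have "\<dots> \<le> s\<^sup>2 * (L * b ^ m)" using mult_left_mono[OF sq[of m], of "s\<^sup>2"] by (simp add: mult.assoc)
      finally show ?thesis using exp_le_quadratic[of "s * X c"] by linarith
    qed
    have le: "(\<Sum>c\<in>slice i j m. exp (s * X c)) * \<rho> ^ m \<le> up m" for m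
    proof -
      have "(\<Sum>c\<in>slice i j m. exp (s * X c)) \<le> (\<Sum>c\<in>slice i j m. 1 + s * X c + s\<^sup>2 * (L * b ^ m))"
        using pt by (intro sum_mono) auto
      also have "\<dots> = real (card (slice i j m)) + s * (\<Sum>c\<in>slice i j m. X c) + s\<^sup>2 * (L * b ^ m * real (card (slice i j m)))"
        by (simp add: sum.distrib sum_distrib_left)
      finally have "(\<Sum>c\<in>slice i j m. exp (s * X c)) * \<rho> ^ m \<le>
        (real (card (slice i j m)) + s * (\<Sum>c\<in>slice i j m. X c) + s\<^sup>2 * (L * b ^ m * real (card (slice i j m)))) * \<rho> ^ m"
        using \<rho>_pos by (intro mult_right_mono) auto
      then show ?thesis by (simp add: up_def algebra_simps)
    qed
    have sums: "up sums (M i j + s * X1 i j + s\<^sup>2 * Q i j)"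
      unfolding up_def X1_def Q_def
      by (intro sums_add sums_mult M_sums[OF ij] summable_sums[OF Xsum[OF ij]] summable_sums[OF Qsum[OF ij]])
    \<comment> \<open>X may be negative, so the sign of \<open>up m\<close> cannot be seen from its
      terms; it dominates a sum of exponentials.\<close>
    have nn: "0 \<le> up m" for m
      by (rule order_trans[OF _ le[of m]]) (use \<rho>_pos in \<open>auto intro!: mult_nonneg_nonneg sum_nonneg\<close>)
    have "(\<Sum>m\<le>n. (\<Sum>c\<in>slice i j m. exp (s * X c)) * \<rho> ^ m) \<le> (\<Sum>m\<le>n. up m)" using le by (rule sum_mono)
    also have "\<dots> \<le> suminf up" using nn by (intro sum_le_suminf sums_summable[OF sums]) auto
    also have "\<dots> = M i j + s * X1 i j + s\<^sup>2 * Q i j" using sums_unique[OF sums] by simp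
    finally show ?thesis .
  qed
  define g where "g i = (\<Sum>j\<in>crit. X1 i j * v j)" for i
  have ug: "(\<Sum>i\<in>crit. u i * g i) = 0"
    using zero unfolding bilinear_value_def X1_def[symmetric] g_def by (simp add: sum_distrib_left mult.assoc)
  \<comment> \<open>First order perturbation of the eigenvector \<open>v\<close> under exponential tilting by \<open>s X\<close>: since
    \<open>u\<close> annihilates \<open>g\<close>, \<open>v + s w\<close> is multiplied by at most \<open>1 + O(s\<^sup>2)\<close>.\<close>
  have "\<exists>w. \<forall>i\<in>crit. w i - mat_vec crit M w i = g i"
  proof -
    let ?A = "\<lambda>i j. (if i = j then 1 else 0) - M i j"
    have Aw: "(\<Sum>j\<in>crit. ?A i j * w j) = w i - mat_vec crit M w i" if "i \<in> crit" for i and w :: "nat \<Rightarrow> real"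
    proof -
      have "(\<Sum>j\<in>crit. (if i = j then 1 else 0) * w j) = (\<Sum>j\<in>crit. if i = j then w j else 0)" by (intro sum.cong) auto
      then show ?thesis using that by (simp add: mat_vec_def left_diff_distrib sum_subtractf)
    qed
    have uA: "(\<Sum>i\<in>crit. \<phi> i * ?A i j) = \<phi> j - mat_vec crit (\<lambda>i j. M j i) \<phi> j" if "j \<in> crit" for j and \<phi> :: "nat \<Rightarrow> real"
    proof -
      have "(\<Sum>i\<in>crit. \<phi> i * (if i = j then 1 else 0)) = (\<Sum>i\<in>crit. if i = j then \<phi> i else 0)" by (intro sum.cong) auto
      then show ?thesis using that by (simp add: mat_vec_def right_diff_distrib sum_subtractf mult.commute)
    qed
    \<comment> \<open>An obstruction would be a left eigenvector for the eigenvalue 1, hence a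
      multiple of u, and u annihilates g.\<close>
    have no: "\<not> ((\<forall>j\<in>crit. (\<Sum>i\<in>crit. \<phi> i * ?A i j) = 0) \<and> (\<Sum>i\<in>crit. \<phi> i * g i) = 1)" for \<phi>
    proof
      assume *: "(\<forall>j\<in>crit. (\<Sum>i\<in>crit. \<phi> i * ?A i j) = 0) \<and> (\<Sum>i\<in>crit. \<phi> i * g i) = 1"
      have fixp: "mat_vec crit (\<lambda>i j. M j i) \<phi> j = 1 * \<phi> j" if "j \<in> crit" for j using * uA[OF that, of \<phi>] that by simp
      have uf: "mat_vec crit (\<lambda>i j. M j i) u j = 1 * u j" if "j \<in> crit" for j using u(2)[OF that] by simp
      have "\<exists>c. \<forall>i\<in>crit. \<phi> i = c * u i"
        by (rule perron_eigenvector_unique[OF finite_crit crit_nonempty _ irreducible_on_transpose[OF M_irreducible] u(1) uf fixp])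
          (use M_nonneg in auto)
      then obtain c where c: "\<And>i. i \<in> crit \<Longrightarrow> \<phi> i = c * u i" by blast
      have "(\<Sum>i\<in>crit. \<phi> i * g i) = c * (\<Sum>i\<in>crit. u i * g i)" by (simp add: c sum_distrib_left mult.assoc)
      then show False using ug * by simp
    qed
    have "\<exists>w. \<forall>i\<in>crit. (\<Sum>j\<in>crit. ?A i j * w j) = g i"
      using fredholm_alternative[OF finite_crit finite_crit, of ?A g] no by blast
    then obtain w where "\<forall>i\<in>crit. (\<Sum>j\<in>crit. ?A i j * w j) = g i" by blast
    then show ?thesis using Aw[of _ w] by (intro exI[of _ w]) simp
  qed
  then obtain w where w0: "\<forall>i\<in>crit. w i - mat_vec crit M w i = g i" by blast
  have w: "mat_vec crit M w i = w i - g i" if "i \<in> crit" for i using bspec[OF w0 that] by linarith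
  define W where "W = (\<Sum>i\<in>crit. \<bar>w i\<bar> / v i)"
  have W: "\<bar>w i\<bar> \<le> W * v i" if "i \<in> crit" for i
  proof -
    have "\<bar>w i\<bar> / v i \<le> W" unfolding W_def using that v(1) by (intro member_le_sum) (auto simp: less_imp_le)
    then show ?thesis using v(1)[OF that] by (simp add: field_simps)
  qed
  have W0: "W \<ge> 0" unfolding W_def using v(1) by (intro sum_nonneg) (auto simp: less_imp_le)
  define R where "R i = \<bar>\<Sum>j\<in>crit. X1 i j * w j\<bar> + (\<Sum>j\<in>crit. Q i j * v j) + \<bar>\<Sum>j\<in>crit. Q i j * w j\<bar>" for i
  have R0: "R i \<ge> 0" if "i \<in> crit" for i
    unfolding R_def using Q0[OF that] v(1) by (intro add_nonneg_nonneg sum_nonneg mult_nonneg_nonneg) (auto simp: less_imp_le)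
  define E where "E = (\<Sum>i\<in>crit. R i / v i)"
  have E: "R i \<le> E * v i" if "i \<in> crit" for i
  proof -
    have "R i / v i \<le> E" unfolding E_def using that v(1) R0 by (intro member_le_sum) (auto simp: less_imp_le)
    then show ?thesis using v(1)[OF that] by (simp add: field_simps)
  qed
  have E0: "E \<ge> 0" unfolding E_def using v(1) R0 by (intro sum_nonneg) (auto simp: less_imp_le)
  \<comment> \<open>The bound s0 gives summability and 1 absorbs the third order term. The bound 1 /
    (2 W + 2) keeps |s w| \<le> v / 2, hence y positive, and \<delta> / (4 E + 1) makes the growth 2
    E s^2 per level at most half of s \<delta>.\<close>
  define s where "s = min (min s0 1) (min (1 / (2 * W + 2)) (\<delta> / (4 * E + 1)))"
  have s: "0 < s" "s \<le> s0" "s \<le> 1" "s \<le> 1 / (2 * W + 2)" "s \<le> \<delta> / (4 * E + 1)"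
    using s0 \<delta> W0 E0 by (auto simp: s_def)
  define y where "y i = v i + s * w i" for i
  have sw: "\<bar>s * w i\<bar> \<le> v i / 2" if "i \<in> crit" for i
  proof -
    have "s * W \<le> 1 / (2 * W + 2) * W" using s(4) W0 by (rule mult_right_mono)
    also have "\<dots> \<le> 1 / 2" using W0 by (simp add: field_simps)
    finally have "s * W \<le> 1 / 2" .
    then have "(s * W) * v i \<le> 1 / 2 * v i" using v(1)[OF that] by (intro mult_right_mono) auto
    moreover have "\<bar>s * w i\<bar> \<le> s * (W * v i)" using W[OF that] s by (simp add: abs_mult)
    ultimately show ?thesis by (simp add: mult.assoc)
  qed
  have ylow: "v i / 2 \<le> y i" and yup: "y i \<le> 2 * v i" if "i \<in> crit" for i
    using sw[OF that] v(1)[OF that] by (auto simp: y_def abs_le_iff)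
  have y0: "0 \<le> y i" if "i \<in> crit" for i using ylow[OF that] v(1)[OF that] by linarith
  define a where "a = 1 + 2 * E * s\<^sup>2"
  have a: "a \<ge> 0" "a \<le> exp (2 * E * s\<^sup>2)" using E0 by (auto simp: a_def)
  have step: "(\<Sum>c | c \<in> contexts S i \<and> context_size c \<le> n. \<rho> ^ context_size c * exp (s * X c) * y (context_target c)) \<le> a * y i"
    if i: "i \<in> crit" for i n
  proof -
    have "(\<Sum>c | c \<in> contexts S i \<and> context_size c \<le> n. \<rho> ^ context_size c * exp (s * X c) * y (context_target c)) =
        (\<Sum>j\<in>crit. (\<Sum>m\<le>n. (\<Sum>c\<in>slice i j m. exp (s * X c)) * \<rho> ^ m) * y j)"
      by (rule sum_contexts_split[OF i])
    also have "\<dots> \<le> (\<Sum>j\<in>crit. (M i j + s * X1 i j + s\<^sup>2 * Q i j) * y j)"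
      using expand[OF i _ s(1,2)] y0 by (intro sum_mono mult_right_mono) auto
    also have "\<dots> = (\<Sum>j\<in>crit. M i j * v j + s * (M i j * w j) + s * (X1 i j * v j) + s\<^sup>2 * (X1 i j * w j) +
        s\<^sup>2 * (Q i j * v j) + s\<^sup>2 * s * (Q i j * w j))"
      by (intro sum.cong) (auto simp: y_def algebra_simps power2_eq_square)
    also have "\<dots> = mat_vec crit M v i + s * mat_vec crit M w i + s * g i + s\<^sup>2 * (\<Sum>j\<in>crit. X1 i j * w j) +
        s\<^sup>2 * (\<Sum>j\<in>crit. Q i j * v j) + s\<^sup>2 * (s * (\<Sum>j\<in>crit. Q i j * w j))"
      by (simp add: sum.distrib sum_distrib_left mat_vec_def g_def mult.assoc)
    \<comment> \<open>The first order terms combine by the equation for w: M w + g = w, so v + s (M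
      w + g) is y itself.\<close>
    also have "\<dots> = y i + s\<^sup>2 * ((\<Sum>j\<in>crit. X1 i j * w j) + (\<Sum>j\<in>crit. Q i j * v j) + s * (\<Sum>j\<in>crit. Q i j * w j))"
      unfolding v(2)[OF i] w[OF i] y_def by (simp add: algebra_simps)
    also have "\<dots> \<le> y i + s\<^sup>2 * R i"
    proof -
      have "s * z \<le> \<bar>z\<bar>" for z :: real
      proof -
        have "s * z \<le> s * \<bar>z\<bar>" using s by (intro mult_left_mono) auto
        moreover have "s * \<bar>z\<bar> \<le> 1 * \<bar>z\<bar>" using s by (intro mult_right_mono) auto
        ultimately show ?thesis by linarith
      qed
      then have "s * (\<Sum>j\<in>crit. Q i j * w j) \<le> \<bar>\<Sum>j\<in>crit. Q i j * w j\<bar>" by blast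
      then have "(\<Sum>j\<in>crit. X1 i j * w j) + (\<Sum>j\<in>crit. Q i j * v j) + s * (\<Sum>j\<in>crit. Q i j * w j) \<le> R i"
        unfolding R_def by linarith
      then show ?thesis by (simp add: mult_left_mono)
    qed
    \<comment> \<open>E compares R with v, and v \<le> 2 y turns this into a comparison with
      y.\<close>
    also have "\<dots> \<le> y i + s\<^sup>2 * (E * (2 * y i))"
    proof -
      have "R i \<le> E * (2 * y i)" using E[OF i] mult_left_mono[of "v i" "2 * y i" E] ylow[OF i] E0 by linarith
      then show ?thesis by (simp add: mult_left_mono)
    qed
    also have "\<dots> = a * y i" by (simp add: a_def algebra_simps)
    finally show ?thesis .
  qed
  define m where "m = Min (v ` crit) / 2"
  define V where "V = 2 * (\<Sum>i\<in>crit. v i)"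
  have m: "m > 0" unfolding m_def using crit_nonempty v(1) by (simp add: Min_gr_iff)
  have my: "m \<le> y i" if "i \<in> crit" for i
  proof -
    have "Min (v ` crit) \<le> v i" using that by auto
    then show ?thesis using ylow[OF that] by (simp add: m_def)
  qed
  have yV: "y i \<le> V" if "i \<in> crit" for i
  proof -
    have "v i \<le> (\<Sum>i\<in>crit. v i)" using that v(1) by (intro member_le_sum) (auto simp: less_imp_le)
    then show ?thesis using yup[OF that] by (simp add: V_def)
  qed
  have V0: "V > 0" unfolding V_def using crit_nonempty v(1) by (simp add: sum_pos)
  have main: "(\<Sum>cs | cs \<in> chains i h n \<and> sum_list (map X cs) > \<delta> * real n. \<rho> ^ chain_size cs) \<le>
      V / m * exp (- (s * \<delta> / 2) * real n)" if i: "i \<in> crit" and h: "h \<le> n" for i h n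
  proof -
    have prodexp: "prod_list (map (\<lambda>c. exp (s * X c)) cs) = exp (s * sum_list (map X cs))" for cs
      by (induction cs) (simp_all add: exp_add distrib_left)
    let ?B = "{cs. cs \<in> chains i h n \<and> sum_list (map X cs) > \<delta> * real n}"
    have "exp (s * (\<delta> * real n)) * m * (\<Sum>cs\<in>?B. \<rho> ^ chain_size cs) =
        (\<Sum>cs\<in>?B. \<rho> ^ chain_size cs * exp (s * (\<delta> * real n)) * m)" by (simp add: sum_distrib_left mult_ac)
    also have "\<dots> \<le> (\<Sum>cs\<in>?B. \<rho> ^ chain_size cs * prod_list (map (\<lambda>c. exp (s * X c)) cs) * y (chain_end i cs))"
    proof (rule sum_mono)
      fix cs assume cs: "cs \<in> ?B"
      have "exp (s * (\<delta> * real n)) \<le> prod_list (map (\<lambda>c. exp (s * X c)) cs)"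
        unfolding prodexp using cs s by simp
      moreover have "m \<le> y (chain_end i cs)" using cs chain_end_crit[OF i] my by (auto simp: chains_def)
      ultimately show "\<rho> ^ chain_size cs * exp (s * (\<delta> * real n)) * m \<le>
          \<rho> ^ chain_size cs * prod_list (map (\<lambda>c. exp (s * X c)) cs) * y (chain_end i cs)"
        using m \<rho>_pos by (intro mult_mono mult_left_mono) (auto simp: prodexp)
    qed
    also have "\<dots> \<le> (\<Sum>cs\<in>chains i h n. \<rho> ^ chain_size cs * prod_list (map (\<lambda>c. exp (s * X c)) cs) * y (chain_end i cs))"
    proof (rule sum_mono2[OF finite_chains[OF i]])
      fix cs assume "cs \<in> chains i h n - ?B"
      then have "y (chain_end i cs) \<ge> 0" using chain_end_crit[OF i] my m by (fastforce simp: chains_def)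
      then show "0 \<le> \<rho> ^ chain_size cs * prod_list (map (\<lambda>c. exp (s * X c)) cs) * y (chain_end i cs)"
        using \<rho>_pos by (simp add: prodexp)
    qed auto
    also have "\<dots> \<le> a ^ h * y i"
      by (rule chain_weight_bound[OF \<rho>_pos _ a(1) step i]) simp
    also have "\<dots> \<le> exp (s * \<delta> / 2 * real n) * V"
    proof (rule mult_mono)
      have "a ^ h \<le> exp (2 * E * s\<^sup>2) ^ h" using a by (intro power_mono)
      also have "\<dots> = exp (real h * (2 * E * s\<^sup>2))" by (simp add: exp_of_nat_mult)
      also have "\<dots> \<le> exp (s * \<delta> / 2 * real n)"
      proof -
        have "s * (4 * E) \<le> s * (4 * E + 1)" using s by simp
        also have "\<dots> \<le> \<delta>" using s(5) E0 by (simp add: field_simps)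
        finally have "s * (s * (4 * E)) \<le> s * \<delta>" using s by (intro mult_left_mono) auto
        then have "2 * E * s\<^sup>2 \<le> s * \<delta> / 2" by (simp add: power2_eq_square algebra_simps)
        then have "real h * (2 * E * s\<^sup>2) \<le> real n * (s * \<delta> / 2)" using h E0 by (intro mult_mono) auto
        then show ?thesis by (simp add: mult.commute)
      qed
      finally show "a ^ h \<le> exp (s * \<delta> / 2 * real n)" .
    qed (use yV[OF i] ylow[OF i] v(1)[OF i] in auto)
    finally have "exp (s * (\<delta> * real n)) * m * (\<Sum>cs\<in>?B. \<rho> ^ chain_size cs) \<le> exp (s * \<delta> / 2 * real n) * V" .
    then have "(\<Sum>cs\<in>?B. \<rho> ^ chain_size cs) \<le> exp (s * \<delta> / 2 * real n) * V / (exp (s * (\<delta> * real n)) * m)"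
      using m by (simp add: field_simps)
    also have "\<dots> = V / m * (exp (s * \<delta> / 2 * real n) / exp (s * (\<delta> * real n)))"
      by (simp only: times_divide_eq_left times_divide_eq_right divide_divide_eq_left mult_ac)
    also have "exp (s * \<delta> / 2 * real n) / exp (s * (\<delta> * real n)) = exp (- (s * \<delta> / 2) * real n)"
      unfolding exp_diff[symmetric] by (simp add: field_simps)
    finally show ?thesis .
  qed
  show ?thesis
    by (rule that[of "V / m" "s * \<delta> / 2"]) (use V0 m s \<delta> main in auto)
qed

end

section \<open>Location of the points\<close>

lemma sum_nat_blocks:
  fixes f :: "nat \<Rightarrow> real" and l :: "nat \<Rightarrow> nat"
  shows "(\<Sum>q<(\<Sum>j<d. l j). f q) = (\<Sum>j<d. \<Sum>p<l j. f ((\<Sum>i<j. l i) + p))"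
proof (induction d)
  case (Suc d)
  have "(\<Sum>q<m + n. f q) = (\<Sum>q<m. f q) + (\<Sum>p<n. f (m + p))" for m n
    by (induction n) (simp_all add: add.assoc)
  then show ?case using Suc by simp
qed simp

text \<open>The types of leaves that lie below the spine: to the left with sign +, or to the right
  with sign -.\<close>

definition below :: "side \<Rightarrow> sign \<Rightarrow> bool" where
  "below e s \<longleftrightarrow> (e = LeftSide) = (s = Plus)"

text \<open>Where the leaves of type \<open>(e, s)\<close> attached to a spine vertex can be, if \<open>l1\<close> (\<open>r1\<close>, \<open>d1\<close>,
  \<open>u1\<close>) leaves lie to the left (to the right, below, above) of the spine strictly above this vertex,
  \<open>l2\<close>, \<dots> when this vertex is included, and \<open>n\<close> is the total number of leaves.\<close>

definition in_region :: "nat \<Rightarrow> side \<Rightarrow> sign \<Rightarrow> nat \<Rightarrow> nat \<Rightarrow> nat \<Rightarrow> nat \<Rightarrow> nat \<Rightarrow> nat \<Rightarrow> nat \<Rightarrow> nat \<Rightarrow> nat \<Rightarrow> nat \<Rightarrow> bool" where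
  "in_region n e s l1 l2 r1 r2 d1 d2 u1 u2 x y \<longleftrightarrow>
    (case e of LeftSide \<Rightarrow> l1 \<le> x \<and> x < l2 | RightSide \<Rightarrow> n \<le> x + r2 \<and> x + r1 < n) \<and>
    (if below e s then d1 < y \<and> y \<le> d2 else n < y + u2 \<and> y + u1 \<le> n)"

definition left_count :: "tree_context \<Rightarrow> nat" where
  "left_count c = side_count LeftSide Plus c + side_count LeftSide Minus c"
definition right_count :: "tree_context \<Rightarrow> nat" where
  "right_count c = side_count RightSide Plus c + side_count RightSide Minus c"
definition below_count :: "tree_context \<Rightarrow> nat" where
  "below_count c = side_count LeftSide Plus c + side_count RightSide Minus c"
definition above_count :: "tree_context \<Rightarrow> nat" where
  "above_count c = side_count LeftSide Minus c + side_count RightSide Plus c"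

definition side_of :: "nat \<Rightarrow> nat \<Rightarrow> side" where
  "side_of l m = (if m < l then LeftSide else RightSide)"
definition sign_of :: "permutation \<Rightarrow> nat \<Rightarrow> nat \<Rightarrow> sign" where
  "sign_of \<pi> l m = (if (m < l) = (\<pi> ! m < \<pi> ! l) then Plus else Minus)"

lemma on_side_sign_iff:
  assumes "is_permutation \<pi>" "l < length \<pi>" "m < length \<pi>" "m \<noteq> l"
  shows "on_side e l m \<and> induces_sign s \<pi> l m \<longleftrightarrow> e = side_of l m \<and> s = sign_of \<pi> l m"
proof -
  have ne: "\<pi> ! m \<noteq> \<pi> ! l" using permutation_nth_eq_iff assms by blast
  have *: "(int m - int l) * (int (\<pi> ! m) - int (\<pi> ! l)) > 0 \<longleftrightarrow> (m < l) = (\<pi> ! m < \<pi> ! l)"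
    using ne assms(4) by (auto simp: zero_less_mult_iff)
  have **: "(int m - int l) * (int (\<pi> ! m) - int (\<pi> ! l)) < 0 \<longleftrightarrow> (m < l) \<noteq> (\<pi> ! m < \<pi> ! l)"
    using ne assms(4) by (auto simp: mult_less_0_iff)
  show ?thesis
    using assms(4) by (cases e; cases s) (auto simp: on_side_def induces_sign_def Let_def * ** side_of_def sign_of_def)
qed

lemma side_count_eq:
  assumes "is_permutation \<pi>" "l < length \<pi>"
  shows "side_count e s (\<pi>, k, l, g) = (\<Sum>m\<in>{..<length \<pi>} - {l}. if e = side_of l m \<and> s = sign_of \<pi> l m then tree_size (g m) else 0)"
proof -
  have "m < length \<pi> \<and> on_side e l m \<and> induces_sign s \<pi> l m \<longleftrightarrow>
      m \<in> {..<length \<pi>} - {l} \<and> (e = side_of l m \<and> s = sign_of \<pi> l m)" for m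
  proof (cases "m = l")
    case True
    then show ?thesis by (cases e) (auto simp: on_side_def)
  next
    case False
    then show ?thesis using on_side_sign_iff[OF assms _ False] by auto
  qed
  then have "side_count e s (\<pi>, k, l, g) = (\<Sum>m | m \<in> {..<length \<pi>} - {l} \<and> (e = side_of l m \<and> s = sign_of \<pi> l m). tree_size (g m))"
    unfolding side_count_def prod.case by simp
  also have "\<dots> = (\<Sum>m\<in>{..<length \<pi>} - {l}. if e = side_of l m \<and> s = sign_of \<pi> l m then tree_size (g m) else 0)"
    by (subst sum.inter_filter[symmetric]) simp_all
  finally show ?thesis .
qed

lemma sum_side_count_weighted:
  fixes G :: "side \<Rightarrow> sign \<Rightarrow> real"
  assumes "is_permutation \<pi>" "l < length \<pi>"
  shows "(\<Sum>e\<in>{LeftSide, RightSide}. \<Sum>s\<in>{Plus, Minus}. real (side_count e s (\<pi>, k, l, g)) * G e s) =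
    (\<Sum>m\<in>{..<length \<pi>} - {l}. real (tree_size (g m)) * G (side_of l m) (sign_of \<pi> l m))"
proof -
  have "(\<Sum>e\<in>{LeftSide, RightSide}. \<Sum>s\<in>{Plus, Minus}. real (side_count e s (\<pi>, k, l, g)) * G e s) =
    (\<Sum>e\<in>{LeftSide, RightSide}. \<Sum>s\<in>{Plus, Minus}. \<Sum>m\<in>{..<length \<pi>} - {l}.
      if e = side_of l m \<and> s = sign_of \<pi> l m then real (tree_size (g m)) * G e s else 0)"
    unfolding side_count_eq[OF assms] of_nat_sum sum_distrib_right
    by (intro sum.cong refl) simp
  also have "\<dots> = (\<Sum>m\<in>{..<length \<pi>} - {l}. \<Sum>e\<in>{LeftSide, RightSide}. \<Sum>s\<in>{Plus, Minus}.
      if e = side_of l m \<and> s = sign_of \<pi> l m then real (tree_size (g m)) * G e s else 0)"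
    by (simp only: sum.swap[of _ "{Plus, Minus}"] sum.swap[of _ "{LeftSide, RightSide}" "{..<length \<pi>} - {l}"])
  also have "\<dots> = (\<Sum>m\<in>{..<length \<pi>} - {l}. real (tree_size (g m)) * G (side_of l m) (sign_of \<pi> l m))"
    by (intro sum.cong refl) (auto simp: side_of_def sign_of_def)
  finally show ?thesis .
qed

text \<open>These two counts are the position and the value offset by which inflation shifts the
  subtree put into the hole.\<close>

lemma direction_counts:
  assumes \<pi>: "is_permutation \<pi>" and l: "l < length \<pi>"
  shows "left_count (\<pi>, k, l, g) = (\<Sum>m<l. tree_size (g m))"
    "below_count (\<pi>, k, l, g) = (\<Sum>m | m < length \<pi> \<and> \<pi> ! m < \<pi> ! l. tree_size (g m))"
proof -
  have ne: "\<pi> ! m \<noteq> \<pi> ! l" if "m < length \<pi>" "m \<noteq> l" for m using permutation_nth_eq_iff[OF \<pi> that(1) l] that(2) by simp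
  have "left_count (\<pi>, k, l, g) = (\<Sum>m\<in>{..<length \<pi>} - {l}. if m < l then tree_size (g m) else 0)"
    unfolding left_count_def side_count_eq[OF assms] sum.distrib[symmetric]
    by (intro sum.cong refl) (auto simp: side_of_def sign_of_def)
  also have "\<dots> = (\<Sum>m | m \<in> {..<length \<pi>} - {l} \<and> m < l. tree_size (g m))" by (subst sum.inter_filter[symmetric]) simp_all
  also have "{m. m \<in> {..<length \<pi>} - {l} \<and> m < l} = {..<l}" using l by auto
  finally show "left_count (\<pi>, k, l, g) = (\<Sum>m<l. tree_size (g m))" .
  have "below_count (\<pi>, k, l, g) = (\<Sum>m\<in>{..<length \<pi>} - {l}. if \<pi> ! m < \<pi> ! l then tree_size (g m) else 0)"
    unfolding below_count_def side_count_eq[OF assms] sum.distrib[symmetric]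
    by (intro sum.cong refl) (auto simp: side_of_def sign_of_def)
  also have "\<dots> = (\<Sum>m | m \<in> {..<length \<pi>} - {l} \<and> \<pi> ! m < \<pi> ! l. tree_size (g m))" by (subst sum.inter_filter[symmetric]) simp_all
  also have "{m. m \<in> {..<length \<pi>} - {l} \<and> \<pi> ! m < \<pi> ! l} = {m. m < length \<pi> \<and> \<pi> ! m < \<pi> ! l}" by auto
  finally show "below_count (\<pi>, k, l, g) = (\<Sum>m | m < length \<pi> \<and> \<pi> ! m < \<pi> ! l. tree_size (g m))" .
qed

context linear_specification
begin

lemma context_size_counts:
  assumes "i \<in> crit" "c \<in> contexts S i"
  shows "context_size c = left_count c + right_count c" "context_size c = below_count c + above_count c"
proof -
  obtain \<pi> k l g where e: "c = (\<pi>, k, l, g)" by (cases c)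
  note p = context_props[OF assms(1) assms(2)[unfolded e]]
  have "real (context_size c) = (\<Sum>e\<in>{LeftSide, RightSide}. \<Sum>s\<in>{Plus, Minus}. real (side_count e s c))"
    using sum_side_count_weighted[OF p(6,2), of k g "\<lambda>_ _. 1"] by (simp add: e context_size_def)
  then have "context_size c = (\<Sum>e\<in>{LeftSide, RightSide}. \<Sum>s\<in>{Plus, Minus}. side_count e s c)" by simp
  then show "context_size c = left_count c + right_count c" "context_size c = below_count c + above_count c"
    by (simp_all add: left_count_def right_count_def below_count_def above_count_def)
qed

text \<open>The block of the hole is shifted by the left and below counts and its sum is kept, ready
  for iteration. Each of the other leaves lies in the region of its type, where F differs from G by
  at most \<omega>, so the error is \<omega> per leaf of the context.\<close>

lemma fill_points:
  fixes F :: "nat \<Rightarrow> nat \<Rightarrow> real"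
  assumes i: "i \<in> crit" and c: "c \<in> contexts S i" and t: "t \<in> fam (context_target c)"
    and n: "n = context_size c + tree_size t"
    and close: "\<And>e s x y. in_region n e s 0 (left_count c) 0 (right_count c) 0 (below_count c) 0 (above_count c) x y \<Longrightarrow>
      \<bar>F x y - G e s\<bar> \<le> \<omega>"
  shows "\<bar>(\<Sum>q<n. F q (tree_perm (fill c t) ! q)) -
      (\<Sum>q<tree_size t. F (left_count c + q) (below_count c + tree_perm t ! q)) -
      (\<Sum>e\<in>{LeftSide, RightSide}. \<Sum>s\<in>{Plus, Minus}. real (side_count e s c) * G e s)\<bar> \<le> \<omega> * real (context_size c)"
proof -
  obtain \<pi> k l g where e: "c = (\<pi>, k, l, g)" by (cases c)
  note p = context_props[OF i c[unfolded e]]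
  let ?d = "length \<pi>"
  define ts where "ts = map (g(l := t)) [0..<?d]"
  define len where "len m = tree_size (ts ! m)" for m
  define st where "st m = (\<Sum>j<m. len j)" for m
  define off where "off m = (\<Sum>j | j < ?d \<and> \<pi> ! j < \<pi> ! m. len j)" for m
  have node: "fill c t = Node \<pi> ts" by (simp add: e fill_def ts_def)
  have lts: "length ts = ?d" by (simp add: ts_def)
  have len_l: "len l = tree_size t" and tsl: "ts ! l = t" using p(2) by (simp_all add: len_def ts_def)
  have len_m: "len m = tree_size (g m)" if "m < ?d" "m \<noteq> l" for m using that by (simp add: len_def ts_def)
  have stdt: "standard_tree (ts ! m)" if "m < ?d" for m
  proof (cases "m = l")
    case True
    then show ?thesis using t p(2) trees_standard by (simp add: ts_def)
  next
    case False
    then have "g m \<in> fam (k ! m)" using p(5) that by (intro PiE_mem[OF p(5)]) auto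
    then show ?thesis using False that trees_standard by (simp add: ts_def)
  qed
  have st_l: "st l = left_count c"
    unfolding st_def e direction_counts(1)[OF p(6,2)] using p(2) by (intro sum.cong) (auto simp: len_m)
  have off_l: "off l = below_count c"
    unfolding off_def e direction_counts(2)[OF p(6,2)] by (intro sum.cong) (auto intro!: len_m)
  have size: "tree_size (fill c t) = n" using fill_in_trees(2)[OF i c t] n by simp
  have n_sum: "n = (\<Sum>j<?d. len j)"
    using length_tree_perm_Node[OF lts] size by (simp add: node len_def)
  have val: "tree_perm (fill c t) ! (st m + q) = tree_perm (ts ! m) ! q + off m" if "m < ?d" "q < len m" for m q
  proof -
    have a: "(\<Sum>j<m. length (map tree_perm ts ! j)) = st m" unfolding st_def len_def using that lts by (intro sum.cong) auto
    have b: "(\<Sum>j | j < ?d \<and> \<pi> ! j < \<pi> ! m. length (map tree_perm ts ! j)) = off m"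
      unfolding off_def len_def using lts by (intro sum.cong) auto
    show ?thesis using nth_inflate[of m \<pi> q "map tree_perm ts"] that lts unfolding a b by (simp add: node len_def)
  qed
  have rng: "1 \<le> tree_perm (ts ! m) ! q" "tree_perm (ts ! m) ! q \<le> len m" if "m < ?d" "q < len m" for m q
  proof -
    have "is_permutation (tree_perm (ts ! m))" using is_permutation_tree_perm[OF stdt[OF that(1)]] .
    moreover have "tree_perm (ts ! m) ! q \<in> set (tree_perm (ts ! m))" using that by (simp add: len_def)
    ultimately show "1 \<le> tree_perm (ts ! m) ! q" "tree_perm (ts ! m) ! q \<le> len m" by (simp_all add: is_permutation_iff len_def)
  qed
  have off_mono: "off m + len m \<le> off m'" if "m < ?d" "\<pi> ! m < \<pi> ! m'" for m m'
  proof -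
    have "off m + len m = (\<Sum>j\<in>insert m {j. j < ?d \<and> \<pi> ! j < \<pi> ! m}. len j)" by (simp add: off_def)
    also have "\<dots> \<le> off m'" unfolding off_def using that by (intro sum_mono2) auto
    finally show ?thesis .
  qed
  have off_n: "off m + len m \<le> n" if "m < ?d" for m
  proof -
    have "off m + len m = (\<Sum>j\<in>insert m {j. j < ?d \<and> \<pi> ! j < \<pi> ! m}. len j)" by (simp add: off_def)
    also have "\<dots> \<le> n" unfolding n_sum using that by (intro sum_mono2) auto
    finally show ?thesis .
  qed
  have st_mono: "st m + len m \<le> st m'" if "m < m'" for m m'
  proof -
    have "st m + len m = st (Suc m)" by (simp add: st_def)
    also have "\<dots> \<le> st m'" unfolding st_def using that by (intro sum_mono2) auto
    finally show ?thesis .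
  qed
  have st_n: "st m + len m \<le> n" if "m < ?d" for m using st_mono[OF that] n_sum by (simp add: st_def)
  note cc = context_size_counts[OF i c]
  \<comment> \<open>Nothing of the spine precedes this context, hence the zeros. Leaves to the right
    of the hole or above it are located from the far end, since the size of the filling comes before
    them.\<close>
  have region: "in_region n (side_of l m) (sign_of \<pi> l m) 0 (left_count c) 0 (right_count c) 0 (below_count c) 0 (above_count c)
      (st m + q) (tree_perm (ts ! m) ! q + off m)" if m: "m < ?d" "m \<noteq> l" "q < len m" for m q
  proof -
    have ne: "\<pi> ! m \<noteq> \<pi> ! l" using permutation_nth_eq_iff[OF p(6) m(1) p(2)] m(2) by simp
    have x: "(case side_of l m of LeftSide \<Rightarrow> 0 \<le> st m + q \<and> st m + q < left_count c
        | RightSide \<Rightarrow> n \<le> st m + q + right_count c \<and> st m + q + 0 < n)"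
    proof (cases "m < l")
      case True
      then show ?thesis using st_mono[OF True] st_l m by (simp add: side_of_def)
    next
      case False
      then have "l < m" using m by simp
      then show ?thesis using st_mono[of l m] st_l len_l st_n[OF m(1)] m n cc(1) False by (simp add: side_of_def)
    qed
    have b: "below (side_of l m) (sign_of \<pi> l m) \<longleftrightarrow> \<pi> ! m < \<pi> ! l"
      using m by (auto simp: below_def side_of_def sign_of_def)
    have y: "if \<pi> ! m < \<pi> ! l then 0 < tree_perm (ts ! m) ! q + off m \<and> tree_perm (ts ! m) ! q + off m \<le> below_count c
        else n < tree_perm (ts ! m) ! q + off m + above_count c \<and> tree_perm (ts ! m) ! q + off m + 0 \<le> n"
    proof (cases "\<pi> ! m < \<pi> ! l")
      case True
      then show ?thesis using off_mono[OF m(1) True] rng[OF m(1,3)] off_l by simp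
    next
      case False
      then have "\<pi> ! l < \<pi> ! m" using ne by simp
      then show ?thesis using off_mono[OF p(2), of m] rng[OF m(1,3)] off_l off_n[OF m(1)] len_l n cc(2) False by simp
    qed
    show ?thesis unfolding in_region_def b using x y by simp
  qed
  let ?F = "\<lambda>m q. F (st m + q) (tree_perm (ts ! m) ! q + off m)"
  have "(\<Sum>q<n. F q (tree_perm (fill c t) ! q)) = (\<Sum>m<?d. \<Sum>q<len m. F (st m + q) (tree_perm (fill c t) ! (st m + q)))"
    unfolding n_sum st_def by (rule sum_nat_blocks)
  also have "\<dots> = (\<Sum>m<?d. \<Sum>q<len m. ?F m q)" using val by (intro sum.cong) auto
  also have "\<dots> = (\<Sum>q<len l. ?F l q) + (\<Sum>m\<in>{..<?d} - {l}. \<Sum>q<len m. ?F m q)"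
    using p(2) by (intro sum.remove) auto
  also have "(\<Sum>q<len l. ?F l q) = (\<Sum>q<tree_size t. F (left_count c + q) (below_count c + tree_perm t ! q))"
    unfolding len_l tsl st_l off_l by (simp add: add.commute)
  finally have split: "(\<Sum>q<n. F q (tree_perm (fill c t) ! q)) =
      (\<Sum>q<tree_size t. F (left_count c + q) (below_count c + tree_perm t ! q)) + (\<Sum>m\<in>{..<?d} - {l}. \<Sum>q<len m. ?F m q)" .
  have "(\<Sum>e\<in>{LeftSide, RightSide}. \<Sum>s\<in>{Plus, Minus}. real (side_count e s c) * G e s) =
      (\<Sum>m\<in>{..<?d} - {l}. \<Sum>q<len m. G (side_of l m) (sign_of \<pi> l m))"
    unfolding e sum_side_count_weighted[OF p(6,2)] by (intro sum.cong refl) (simp add: len_m)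
  then have "\<bar>(\<Sum>m\<in>{..<?d} - {l}. \<Sum>q<len m. ?F m q) -
      (\<Sum>e\<in>{LeftSide, RightSide}. \<Sum>s\<in>{Plus, Minus}. real (side_count e s c) * G e s)\<bar> =
    \<bar>\<Sum>m\<in>{..<?d} - {l}. \<Sum>q<len m. ?F m q - G (side_of l m) (sign_of \<pi> l m)\<bar>"
    by (simp add: sum_subtractf)
  also have "\<dots> \<le> (\<Sum>m\<in>{..<?d} - {l}. \<Sum>q<len m. \<omega>)"
    using close region by (intro order_trans[OF sum_abs] sum_mono) auto
  also have "\<dots> = \<omega> * real (context_size c)"
    unfolding e context_size_def prod.case by (simp add: len_m sum_distrib_left mult.commute)
  finally show ?thesis unfolding split by (simp add: algebra_simps)
qed

end

section \<open>Positions of all leaves along a spine\<close>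

definition prefix_count :: "(tree_context \<Rightarrow> nat) \<Rightarrow> tree_context list \<Rightarrow> nat \<Rightarrow> nat" where
  "prefix_count f cs h = sum_list (map f (take h cs))"

lemma prefix_count_simps [simp]:
  "prefix_count f cs 0 = 0" "prefix_count f (c # cs) (Suc h) = f c + prefix_count f cs h"
  by (simp_all add: prefix_count_def)

lemma prefix_count_Suc: "h < length cs \<Longrightarrow> prefix_count f cs (Suc h) = prefix_count f cs h + f (cs ! h)"
  by (simp add: prefix_count_def take_Suc_conv_app_nth)

context linear_specification
begin

text \<open>Induction along the spine: the tree below the first context is treated with F translated
  by the left and below counts of that context, and with the values of G shifted by one
  level.\<close>

lemma plug_points:
  fixes F :: "nat \<Rightarrow> nat \<Rightarrow> real"
  assumes "i \<in> crit" "chain i cs" "t \<in> fam (chain_end i cs)" "n = chain_size cs + tree_size t"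
    and "\<And>h e s x y. h < length cs \<Longrightarrow>
      in_region n e s (prefix_count left_count cs h) (prefix_count left_count cs (Suc h))
        (prefix_count right_count cs h) (prefix_count right_count cs (Suc h))
        (prefix_count below_count cs h) (prefix_count below_count cs (Suc h))
        (prefix_count above_count cs h) (prefix_count above_count cs (Suc h)) x y \<Longrightarrow>
      \<bar>F x y - G h e s\<bar> \<le> \<omega>"
  shows "\<bar>(\<Sum>q<n. F q (tree_perm (plug cs t) ! q)) -
      (\<Sum>q<tree_size t. F (sum_list (map left_count cs) + q) (sum_list (map below_count cs) + tree_perm t ! q)) -
      (\<Sum>h<length cs. \<Sum>e\<in>{LeftSide, RightSide}. \<Sum>s\<in>{Plus, Minus}. real (side_count e s (cs ! h)) * G h e s)\<bar>
    \<le> \<omega> * real (chain_size cs)"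
  using assms
proof (induction cs arbitrary: i n F G)
  case Nil
  then show ?case by simp
next
  case (Cons c cs)
  have c: "c \<in> contexts S i" and cs: "chain (context_target c) cs" "t \<in> fam (chain_end (context_target c) cs)"
    using Cons.prems by auto
  define n' where "n' = chain_size cs + tree_size t"
  note tc = context_target_crit[OF Cons.prems(1) c]
  note pf = plug_in_fam[OF tc cs]
  have n: "n = context_size c + n'" using Cons.prems(4) by (simp add: n'_def)
  note cc = context_size_counts[OF Cons.prems(1) c]
  let ?t = "plug cs t"
  let ?SG = "\<Sum>h<length cs. \<Sum>e\<in>{LeftSide, RightSide}. \<Sum>s\<in>{Plus, Minus}. real (side_count e s (cs ! h)) * G (Suc h) e s"
  let ?G0 = "\<Sum>e\<in>{LeftSide, RightSide}. \<Sum>s\<in>{Plus, Minus}. real (side_count e s c) * G 0 e s"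
  have 1: "\<bar>(\<Sum>q<n. F q (tree_perm (fill c ?t) ! q)) -
      (\<Sum>q<tree_size ?t. F (left_count c + q) (below_count c + tree_perm ?t ! q)) - ?G0\<bar> \<le> \<omega> * real (context_size c)"
  proof (rule fill_points[OF Cons.prems(1) c])
    show "?t \<in> fam (context_target c)" "n = context_size c + tree_size ?t" using pf n by (simp_all add: n'_def)
    show "\<bar>F x y - G 0 e s\<bar> \<le> \<omega>"
      if "in_region n e s 0 (left_count c) 0 (right_count c) 0 (below_count c) 0 (above_count c) x y" for e s x y
      using Cons.prems(5)[of 0 e s x y] that by simp
  qed
  have 2: "\<bar>(\<Sum>q<n'. F (left_count c + q) (below_count c + tree_perm ?t ! q)) -
      (\<Sum>q<tree_size t. F (left_count c + (sum_list (map left_count cs) + q)) (below_count c + (sum_list (map below_count cs) + tree_perm t ! q))) -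
      ?SG\<bar> \<le> \<omega> * real (chain_size cs)"
  proof (rule Cons.IH[OF tc cs n'_def])
    fix h e s x y assume h: "h < length cs" and r: "in_region n' e s (prefix_count left_count cs h) (prefix_count left_count cs (Suc h))
        (prefix_count right_count cs h) (prefix_count right_count cs (Suc h))
        (prefix_count below_count cs h) (prefix_count below_count cs (Suc h))
        (prefix_count above_count cs h) (prefix_count above_count cs (Suc h)) x y"
    \<comment> \<open>The translation moves left and lower boundaries; by these identities the
      distances to the right and upper ends grow by exactly the right and above counts.\<close>
    have a: "n = left_count c + right_count c + n'" "n = below_count c + above_count c + n'" using n cc by simp_all
    show "\<bar>F (left_count c + x) (below_count c + y) - G (Suc h) e s\<bar> \<le> \<omega>"
    proof (rule Cons.prems(5))
      show "in_region n e s (prefix_count left_count (c # cs) (Suc h)) (prefix_count left_count (c # cs) (Suc (Suc h)))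
        (prefix_count right_count (c # cs) (Suc h)) (prefix_count right_count (c # cs) (Suc (Suc h)))
        (prefix_count below_count (c # cs) (Suc h)) (prefix_count below_count (c # cs) (Suc (Suc h)))
        (prefix_count above_count (c # cs) (Suc h)) (prefix_count above_count (c # cs) (Suc (Suc h)))
        (left_count c + x) (below_count c + y)"
      proof (cases e)
        case LeftSide
        show ?thesis
        proof (cases "below e s")
          case True
          then show ?thesis using r LeftSide by (simp add: in_region_def)
        next
          case False
          then show ?thesis using r LeftSide a by (simp add: in_region_def)
        qed
      next
        case RightSide
        have x: "n \<le> left_count c + x + prefix_count right_count (c # cs) (Suc (Suc h)) \<and> left_count c + x + prefix_count right_count (c # cs) (Suc h) < n"
          using r RightSide a(1) by (simp add: in_region_def)
        show ?thesis
        proof (cases "below e s")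
          case True
          then show ?thesis using r RightSide x by (simp add: in_region_def)
        next
          case False
          then have "n < below_count c + y + prefix_count above_count (c # cs) (Suc (Suc h)) \<and> below_count c + y + prefix_count above_count (c # cs) (Suc h) \<le> n"
            using r RightSide a(2) by (simp add: in_region_def)
          then show ?thesis using RightSide x False by (simp add: in_region_def)
        qed
      qed
    qed (use h in simp)
  qed
  have SG: "(\<Sum>h<length (c # cs). \<Sum>e\<in>{LeftSide, RightSide}. \<Sum>s\<in>{Plus, Minus}. real (side_count e s ((c # cs) ! h)) * G h e s) =
      ?G0 + ?SG"
    unfolding length_Cons sum.lessThan_Suc_shift by (simp only: nth_Cons_0 nth_Cons_Suc)
  have T: "tree_size ?t = n'" using pf by (simp add: n'_def)
  have "\<omega> * real (chain_size (c # cs)) = \<omega> * real (context_size c) + \<omega> * real (chain_size cs)" by (simp add: distrib_left)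
  moreover have "(\<Sum>q<tree_size t. F (sum_list (map left_count (c # cs)) + q) (sum_list (map below_count (c # cs)) + tree_perm t ! q)) =
    (\<Sum>q<tree_size t. F (left_count c + (sum_list (map left_count cs) + q)) (below_count c + (sum_list (map below_count cs) + tree_perm t ! q)))"
    by (simp add: add.assoc)
  ultimately show ?case using 1 2 unfolding SG T plug_simps by linarith
qed

end

section \<open>Leaf sums compared with integrals along the arms\<close>

lemma integral_abs_le_integral:
  fixes f g :: "real \<Rightarrow> real"
  assumes "f integrable_on T" "g integrable_on T" "\<And>x. x \<in> T \<Longrightarrow> \<bar>f x\<bar> \<le> g x"
  shows "\<bar>integral T f\<bar> \<le> integral T g"
  using integral_norm_bound_integral[of f T g] assms by simp

text \<open>N follows p W up to \<delta> in value, but nothing is known about increments of the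
  difference. Its contribution is therefore summed by parts against the Lipschitz function; the W
  part is a Riemann sum of mesh \<delta>, and the missing end has length at most \<delta>.\<close>

lemma riemann_stieltjes_estimate:
  fixes N W :: "nat \<Rightarrow> real" and \<phi> :: "real \<Rightarrow> real"
  assumes N0: "N 0 = 0" and W0: "W 0 = 0" and mono: "\<And>h. h < H \<Longrightarrow> W h \<le> W (Suc h)"
    and step: "\<And>h. h < H \<Longrightarrow> W (Suc h) - W h \<le> \<delta>" and top: "1 - \<delta> \<le> W H" "W H \<le> 1"
    and dev: "\<And>h. h \<le> H \<Longrightarrow> \<bar>N h - p * W h\<bar> \<le> \<delta>"
    and B: "\<And>t. t \<in> {0..1} \<Longrightarrow> \<bar>\<phi> t\<bar> \<le> B"
    and lip: "\<And>t t'. t \<in> {0..1} \<Longrightarrow> t' \<in> {0..1} \<Longrightarrow> \<bar>\<phi> t - \<phi> t'\<bar> \<le> K * \<bar>t - t'\<bar>"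
    and p: "0 \<le> p" "p \<le> 1" and \<delta>: "0 \<le> \<delta>" and K: "0 \<le> K"
  shows "\<bar>(\<Sum>h<H. (N (Suc h) - N h) * \<phi> (W h)) - p * integral {0..1} \<phi>\<bar> \<le> \<delta> * (2 * B + 2 * K)"
proof -
  have Wmono: "W h \<le> W h'" if "h \<le> h'" "h' \<le> H" for h h'
    using that
  proof (induction h')
    case (Suc h')
    then show ?case using mono[of h'] by (cases "h = Suc h'") auto
  qed simp
  have W01: "W h \<in> {0..1}" if "h \<le> H" for h using Wmono[of 0 h] Wmono[of h H] that W0 top by auto
  have cont: "continuous_on {0..1} \<phi>"
  proof (rule continuous_on_iff[THEN iffD2], intro ballI allI impI)
    fix x e :: real assume x: "x \<in> {0..1}" and e: "0 < e"
    show "\<exists>d>0. \<forall>x'\<in>{0..1}. dist x' x < d \<longrightarrow> dist (\<phi> x') (\<phi> x) < e"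
    proof (intro exI[of _ "e / (K + 1)"] conjI ballI impI)
      fix x' assume x': "x' \<in> {0..1}" "dist x' x < e / (K + 1)"
      have "\<bar>\<phi> x' - \<phi> x\<bar> \<le> K * \<bar>x' - x\<bar>" by (rule lip[OF x'(1) x])
      also have "\<dots> \<le> (K + 1) * \<bar>x' - x\<bar>" using K by (intro mult_right_mono) auto
      also have "\<dots> < e" using x'(2) K by (simp add: dist_real_def field_simps)
      finally show "dist (\<phi> x') (\<phi> x) < e" by (simp add: dist_real_def)
    qed (use e K in simp)
  qed
  have int: "\<phi> integrable_on {a..b}" if "0 \<le> a" "b \<le> 1" for a b
    by (rule integrable_continuous_real, rule continuous_on_subset[OF cont]) (use that in auto)
  define Z where "Z h = N h - p * W h" for h
  \<comment> \<open>Abel summation, by induction: the boundary term is split off, and the variation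
    of \<phi> along W is at most K times the total increase of W.\<close>
  have abel: "\<bar>(\<Sum>h<m. (Z (Suc h) - Z h) * \<phi> (W h)) - Z m * \<phi> (W m)\<bar> \<le> \<delta> * K * W m" if "m \<le> H" for m
    using that
  proof (induction m)
    case 0
    then show ?case using N0 W0 by (simp add: Z_def)
  next
    case (Suc m)
    have "\<bar>Z (Suc m) * (\<phi> (W m) - \<phi> (W (Suc m)))\<bar> \<le> \<delta> * (K * (W (Suc m) - W m))"
      unfolding abs_mult
    proof (rule mult_mono)
      show "\<bar>Z (Suc m)\<bar> \<le> \<delta>" using dev[OF Suc.prems] by (simp add: Z_def)
      show "\<bar>\<phi> (W m) - \<phi> (W (Suc m))\<bar> \<le> K * (W (Suc m) - W m)"
        using lip[OF W01[of m] W01[of "Suc m"]] mono[of m] Suc.prems by simp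
    qed (use \<delta> in auto)
    then show ?case using Suc by (simp add: algebra_simps)
  qed
  have riem: "\<bar>(\<Sum>h<m. (W (Suc h) - W h) * \<phi> (W h)) - integral {0..W m} \<phi>\<bar> \<le> \<delta> * K * W m" if "m \<le> H" for m
    using that
  proof (induction m)
    case 0
    then show ?case using W0 by simp
  next
    case (Suc m)
    have w: "0 \<le> W m" "W m \<le> W (Suc m)" "W (Suc m) \<le> 1" using W01[of m] W01[of "Suc m"] mono[of m] Suc.prems by auto
    have comb: "integral {0..W m} \<phi> + integral {W m..W (Suc m)} \<phi> = integral {0..W (Suc m)} \<phi>"
      using w by (intro Henstock_Kurzweil_Integration.integral_combine int) auto
    have "\<bar>(W (Suc m) - W m) * \<phi> (W m) - integral {W m..W (Suc m)} \<phi>\<bar> =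
        \<bar>integral {W m..W (Suc m)} (\<lambda>t. \<phi> (W m) - \<phi> t)\<bar>"
      using w int[of "W m" "W (Suc m)"] by (subst Henstock_Kurzweil_Integration.integral_diff) auto
    also have "\<dots> \<le> integral {W m..W (Suc m)} (\<lambda>t. K * (W (Suc m) - W m))"
    proof (rule integral_abs_le_integral)
      show "(\<lambda>t. \<phi> (W m) - \<phi> t) integrable_on {W m..W (Suc m)}"
        using w int[of "W m" "W (Suc m)"] by (intro integrable_diff) auto
      fix t assume t: "t \<in> {W m..W (Suc m)}"
      have "\<bar>\<phi> (W m) - \<phi> t\<bar> \<le> K * \<bar>W m - t\<bar>" using lip[of "W m" t] w t by auto
      also have "\<dots> \<le> K * (W (Suc m) - W m)" using t K by (intro mult_left_mono) auto
      finally show "\<bar>\<phi> (W m) - \<phi> t\<bar> \<le> K * (W (Suc m) - W m)" .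
    qed (intro integrable_continuous_real continuous_intros)
    also have "\<dots> = K * (W (Suc m) - W m) * (W (Suc m) - W m)" using w by simp
    also have "\<dots> \<le> K * \<delta> * (W (Suc m) - W m)"
      using step[of m] Suc.prems w K by (intro mult_right_mono mult_left_mono) auto
    finally have "\<bar>(W (Suc m) - W m) * \<phi> (W m) - integral {W m..W (Suc m)} \<phi>\<bar> \<le> K * \<delta> * (W (Suc m) - W m)" .
    then show ?case using Suc comb by (simp add: algebra_simps)
  qed
  have tail: "\<bar>integral {W H..1} \<phi>\<bar> \<le> B * \<delta>"
  proof -
    have w: "0 \<le> W H" "W H \<le> 1" using W01[of H] by auto
    have "\<bar>integral {W H..1} \<phi>\<bar> \<le> integral {W H..1} (\<lambda>t. B)"
      using w B by (intro integral_abs_le_integral int) auto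
    also have "\<dots> = B * (1 - W H)" using w by simp
    also have "\<dots> \<le> B * \<delta>" using top B[of 0] by (intro mult_left_mono) auto
    finally show ?thesis .
  qed
  have comb: "integral {0..W H} \<phi> + integral {W H..1} \<phi> = integral {0..1} \<phi>"
    using W01[of H] by (intro Henstock_Kurzweil_Integration.integral_combine int) auto
  have B0: "B \<ge> 0" using B[of 0] by auto
  have split: "(\<Sum>h<H. (N (Suc h) - N h) * \<phi> (W h)) =
      (\<Sum>h<H. (Z (Suc h) - Z h) * \<phi> (W h)) + p * (\<Sum>h<H. (W (Suc h) - W h) * \<phi> (W h))"
    unfolding sum_distrib_left sum.distrib[symmetric] by (intro sum.cong refl) (simp add: Z_def algebra_simps)
  have "\<bar>Z H * \<phi> (W H)\<bar> \<le> \<delta> * B"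
    unfolding abs_mult using dev[of H] B[OF W01[of H]] \<delta> by (intro mult_mono) (auto simp: Z_def)
  moreover have "\<delta> * K * W H \<le> \<delta> * K" using W01[of H] \<delta> K by (simp add: mult_left_le)
  ultimately have 1: "\<bar>\<Sum>h<H. (Z (Suc h) - Z h) * \<phi> (W h)\<bar> \<le> \<delta> * K + \<delta> * B" using abel[of H] by linarith
  have 2: "\<bar>(\<Sum>h<H. (W (Suc h) - W h) * \<phi> (W h)) - integral {0..1} \<phi>\<bar> \<le> \<delta> * K + B * \<delta>"
    using riem[of H] tail comb \<open>\<delta> * K * W H \<le> \<delta> * K\<close> by linarith
  have "\<bar>p * ((\<Sum>h<H. (W (Suc h) - W h) * \<phi> (W h)) - integral {0..1} \<phi>)\<bar> \<le> 1 * (\<delta> * K + B * \<delta>)"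
    unfolding abs_mult using 2 p by (intro mult_mono) auto
  then show ?thesis unfolding split using 1 by (simp add: algebra_simps)
qed

lemma prefix_count_add: "prefix_count (\<lambda>c. f c + g c) cs h = prefix_count f cs h + prefix_count g cs h"
  by (simp add: prefix_count_def sum_list_addf)

lemma prefix_count_le_total: "prefix_count f cs h \<le> sum_list (map f cs)"
proof -
  have "sum_list (map f cs) = sum_list (map f (take h cs)) + sum_list (map f (drop h cs))"
    by (metis append_take_drop_id map_append sum_list_append)
  then show ?thesis by (simp add: prefix_count_def)
qed

lemma prefix_count_length: "prefix_count f cs (length cs) = sum_list (map f cs)"
  by (simp add: prefix_count_def)

context linear_specification
begin

lemma prefix_context_size:
  assumes "i \<in> crit" "chain i cs"
  shows "prefix_count context_size cs h = prefix_count left_count cs h + prefix_count right_count cs h \<and>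
    prefix_count context_size cs h = prefix_count below_count cs h + prefix_count above_count cs h"
  using assms
proof (induction cs arbitrary: i h)
  case (Cons c cs)
  then have c: "c \<in> contexts S i" "chain (context_target c) cs" by auto
  show ?case
  proof (cases h)
    case (Suc h')
    then show ?thesis
      using Cons.IH[OF context_target_crit[OF Cons.prems(1) c(1)] c(2), of h'] context_size_counts[OF Cons.prems(1) c(1)]
      by simp
  qed simp
qed (simp add: prefix_count_def)

text \<open>The deterministic part of the limit theorem: the proportions of the leaf types hold
  along every prefix, and neither a single context nor the terminal tree has macroscopic
  size.\<close>

definition good_chain :: "(side \<Rightarrow> sign \<Rightarrow> real) \<Rightarrow> real \<Rightarrow> nat \<Rightarrow> tree_context list \<Rightarrow> subst_tree \<Rightarrow> bool" where
  "good_chain p \<delta> n cs t \<longleftrightarrow>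
    (\<forall>h\<le>length cs. \<forall>e s. \<bar>real (prefix_count (side_count e s) cs h) - p e s * real (prefix_count context_size cs h)\<bar> \<le> \<delta> * real n) \<and>
    (\<forall>c\<in>set cs. real (context_size c) \<le> \<delta> * real n) \<and> real (tree_size t) \<le> \<delta> * real n"

text \<open>The share W h of leaves attached above height h serves as the parameter on the arms. All
  boundaries of the regions at height h are linear in W h up to O(\<delta>), so a leaf of type (e,
  s) attached there is close to the point with parameter W h on the arm of that type.\<close>

lemma good_chain_estimate:
  fixes f :: "real \<times> real \<Rightarrow> real" and p :: "side \<Rightarrow> sign \<Rightarrow> real"
  assumes i: "i \<in> crit" and cs: "chain i cs" and t: "t \<in> fam (chain_end i cs)"
    and n: "n = chain_size cs + tree_size t" and good: "good_chain p \<delta> n cs t" and \<delta>: "0 \<le> \<delta>"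
    and p: "\<And>e s. p e s \<in> {0..1}"
    and sum_p: "p LeftSide Plus + p RightSide Plus + p LeftSide Minus + p RightSide Minus = 1"
    and B: "\<And>z. z \<in> unit_square \<Longrightarrow> \<bar>f z\<bar> \<le> B"
    and lip: "\<And>x y x' y'. (x, y) \<in> unit_square \<Longrightarrow> (x', y') \<in> unit_square \<Longrightarrow>
      \<bar>f (x, y) - f (x', y')\<bar> \<le> K * (\<bar>x - x'\<bar> + \<bar>y - y'\<bar>)" and K: "0 \<le> K"
  defines "a \<equiv> p LeftSide Plus + p LeftSide Minus" and "b \<equiv> p LeftSide Plus + p RightSide Minus"
  shows "\<bar>(\<Sum>q<n. f (real q / real n, real (tree_perm (plug cs t) ! q) / real n)) / real n -
    (\<Sum>e\<in>{LeftSide, RightSide}. \<Sum>s\<in>{Plus, Minus}.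
      p e s * integral {0..1} (\<lambda>t. f (linepath (corner e s) (a, b) t)))\<bar> \<le> \<delta> * (22 * (B + K))"
proof -
  have tpos: "tree_size t > 0" using tree_size_pos trees_standard[OF t] by blast
  have npos: "real n > 0" using tpos n by linarith
  define H where "H = length cs"
  define W where "W h = real (prefix_count context_size cs h) / real n" for h
  define N where "N e s h = real (prefix_count (side_count e s) cs h) / real n" for e s h
  define P where "P e s = linepath (corner e s) (a, b)" for e s
  have ab01: "0 \<le> a" "a \<le> 1" "0 \<le> b" "b \<le> 1"
    using X_center_in_square[OF p sum_p] by (auto simp: a_def b_def)
  have a': "1 - a = p RightSide Plus + p RightSide Minus" and b': "1 - b = p LeftSide Minus + p RightSide Plus"
    using sum_p by (simp_all add: a_def b_def)
  have Psq: "P e s \<tau> \<in> unit_square" if "\<tau> \<in> {0..1}" for e s \<tau>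
    unfolding P_def a_def b_def using X_path_in_square[OF p sum_p that] .
  have fstP: "fst (P e s \<tau>) = (case e of LeftSide \<Rightarrow> a * \<tau> | RightSide \<Rightarrow> 1 - (1 - a) * \<tau>)" for e s \<tau>
    by (cases e; cases s) (simp_all add: P_def linepath_def algebra_simps)
  have sndP: "snd (P e s \<tau>) = (if below e s then b * \<tau> else 1 - (1 - b) * \<tau>)" for e s \<tau>
    by (cases e; cases s) (simp_all add: P_def below_def linepath_def algebra_simps)
  have dev: "\<bar>real (prefix_count (side_count e s) cs h) - p e s * real (prefix_count context_size cs h)\<bar> \<le> \<delta> * real n"
    if "h \<le> H" for h e s using good that by (auto simp: good_chain_def H_def)
  have blk: "real (context_size (cs ! h)) \<le> \<delta> * real n" if "h < H" for h
    using good that by (auto simp: good_chain_def H_def)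
  note pcs = prefix_context_size[OF i cs]
  have wn: "prefix_count context_size cs h \<le> chain_size cs" for h
    using prefix_count_le_total[of context_size cs h] by (simp add: chain_size_def)
  have W01: "W h \<in> {0..1}" for h using wn[of h] n npos by (simp add: W_def)
  have Wsuc: "W (Suc h) - W h = real (context_size (cs ! h)) / real n" if "h < H" for h
    using that prefix_count_Suc[of h cs context_size] by (simp add: W_def H_def diff_divide_distrib[symmetric])
  let ?pc = "\<lambda>f h. real (prefix_count f cs h)"
  \<comment> \<open>Each direction merges two leaf types, hence twice \<delta> n. The context at
    height h itself adds one more \<delta> n in the location of a leaf.\<close>
  have devL: "\<bar>?pc left_count h - a * ?pc context_size h\<bar> \<le> 2 * (\<delta> * real n)"
    and devR: "\<bar>?pc right_count h - (1 - a) * ?pc context_size h\<bar> \<le> 2 * (\<delta> * real n)"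
    and devD: "\<bar>?pc below_count h - b * ?pc context_size h\<bar> \<le> 2 * (\<delta> * real n)"
    and devU: "\<bar>?pc above_count h - (1 - b) * ?pc context_size h\<bar> \<le> 2 * (\<delta> * real n)" if h: "h \<le> H" for h
  proof -
    note d = dev[OF h]
    show "\<bar>?pc left_count h - a * ?pc context_size h\<bar> \<le> 2 * (\<delta> * real n)"
      using d[of LeftSide Plus] d[of LeftSide Minus]
      unfolding left_count_def[abs_def] prefix_count_add a_def of_nat_add distrib_right by linarith
    show "\<bar>?pc right_count h - (1 - a) * ?pc context_size h\<bar> \<le> 2 * (\<delta> * real n)"
      using d[of RightSide Plus] d[of RightSide Minus]
      unfolding right_count_def[abs_def] prefix_count_add a' of_nat_add distrib_right by linarith
    show "\<bar>?pc below_count h - b * ?pc context_size h\<bar> \<le> 2 * (\<delta> * real n)"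
      using d[of LeftSide Plus] d[of RightSide Minus]
      unfolding below_count_def[abs_def] prefix_count_add b_def of_nat_add distrib_right by linarith
    show "\<bar>?pc above_count h - (1 - b) * ?pc context_size h\<bar> \<le> 2 * (\<delta> * real n)"
      using d[of LeftSide Minus] d[of RightSide Plus]
      unfolding above_count_def[abs_def] prefix_count_add b' of_nat_add distrib_right by linarith
  qed
  have region: "\<bar>f (real x / real n, real y / real n) - f (P e s (W h))\<bar> \<le> 6 * K * \<delta>"
    if h: "h < length cs" and r: "in_region n e s (prefix_count left_count cs h) (prefix_count left_count cs (Suc h))
        (prefix_count right_count cs h) (prefix_count right_count cs (Suc h))
        (prefix_count below_count cs h) (prefix_count below_count cs (Suc h))
        (prefix_count above_count cs h) (prefix_count above_count cs (Suc h)) x y" for h e s x y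
  proof -
    have hH: "h < H" "h \<le> H" using h by (simp_all add: H_def)
    have S: "prefix_count f cs (Suc h) = prefix_count f cs h + f (cs ! h)" for f by (rule prefix_count_Suc[OF h])
    have ws: "prefix_count context_size cs (Suc h) \<le> n" using wn[of "Suc h"] n by simp
    have c1: "context_size (cs ! h) = left_count (cs ! h) + right_count (cs ! h)"
      "context_size (cs ! h) = below_count (cs ! h) + above_count (cs ! h)"
      using pcs[of h] pcs[of "Suc h"] by (simp_all add: S)
    define w where "w = ?pc context_size h"
    have Wn: "W h * real n = w" using npos by (simp add: W_def w_def)
    note bl = blk[OF hH(1)]
    have x: "x \<le> n \<and> \<bar>real x - fst (P e s (W h)) * real n\<bar> \<le> 3 * (\<delta> * real n)"
    proof (cases e)
      case LeftSide
      have "prefix_count left_count cs h \<le> x" "x < prefix_count left_count cs h + left_count (cs ! h)"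
        using r LeftSide by (simp_all add: in_region_def S)
      moreover have "fst (P e s (W h)) * real n = a * w" using LeftSide Wn by (simp add: fstP mult.assoc)
      moreover have "prefix_count left_count cs h + left_count (cs ! h) \<le> n" using ws pcs[of h] c1 by (simp add: S)
      moreover have "real (left_count (cs ! h)) \<le> \<delta> * real n" using bl c1 by simp
      ultimately show ?thesis using devL[OF hH(2)] unfolding w_def by linarith
    next
      case RightSide
      have "n \<le> x + (prefix_count right_count cs h + right_count (cs ! h))" "x + prefix_count right_count cs h < n"
        using r RightSide by (simp_all add: in_region_def S)
      moreover have "fst (P e s (W h)) * real n = real n - (1 - a) * w"
        using RightSide Wn by (simp add: fstP left_diff_distrib mult.assoc)
      moreover have "real (right_count (cs ! h)) \<le> \<delta> * real n" using bl c1 by simp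
      ultimately show ?thesis using devR[OF hH(2)] unfolding w_def by linarith
    qed
    have y: "y \<le> n \<and> \<bar>real y - snd (P e s (W h)) * real n\<bar> \<le> 3 * (\<delta> * real n)"
    proof (cases "below e s")
      case True
      have "prefix_count below_count cs h < y" "y \<le> prefix_count below_count cs h + below_count (cs ! h)"
        using r True by (simp_all add: in_region_def S)
      moreover have "snd (P e s (W h)) * real n = b * w" using True Wn by (simp add: sndP mult.assoc)
      moreover have "prefix_count below_count cs h + below_count (cs ! h) \<le> n" using ws pcs[of h] c1(2) by (simp add: S)
      moreover have "real (below_count (cs ! h)) \<le> \<delta> * real n" using bl c1(2) by simp
      ultimately show ?thesis using devD[OF hH(2)] unfolding w_def by linarith
    next
      case False
      have "n < y + (prefix_count above_count cs h + above_count (cs ! h))" "y + prefix_count above_count cs h \<le> n"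
        using r False by (simp_all add: in_region_def S)
      moreover have "snd (P e s (W h)) * real n = real n - (1 - b) * w"
        using False Wn by (simp add: sndP left_diff_distrib mult.assoc)
      moreover have "real (above_count (cs ! h)) \<le> \<delta> * real n" using bl c1(2) by simp
      ultimately show ?thesis using devU[OF hH(2)] unfolding w_def by linarith
    qed
    have sc: "\<bar>real z / real n - v\<bar> \<le> 3 * \<delta>" if "\<bar>real z - v * real n\<bar> \<le> 3 * (\<delta> * real n)" for z v
    proof -
      have "real z / real n - v = (real z - v * real n) / real n" using npos by (simp add: field_simps)
      then have "\<bar>real z / real n - v\<bar> = \<bar>real z - v * real n\<bar> / real n" by (simp add: abs_divide)
      also have "\<dots> \<le> 3 * (\<delta> * real n) / real n" using that npos by (intro divide_right_mono) auto
      finally show ?thesis using npos by simp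
    qed
    have xy: "(real x / real n, real y / real n) \<in> unit_square" using x y npos by simp
    have "\<bar>f (real x / real n, real y / real n) - f (P e s (W h))\<bar> \<le>
        K * (\<bar>real x / real n - fst (P e s (W h))\<bar> + \<bar>real y / real n - snd (P e s (W h))\<bar>)"
      using lip[OF xy, of "fst (P e s (W h))" "snd (P e s (W h))"] Psq[OF W01, of e s h] by simp
    also have "\<dots> \<le> K * (3 * \<delta> + 3 * \<delta>)" using sc x y K by (intro mult_left_mono add_mono) auto
    finally show ?thesis by (simp add: algebra_simps)
  qed
  define F where "F x y = f (real x / real n, real y / real n)" for x y :: nat
  define T where "T = (\<Sum>q<tree_size t. F (sum_list (map left_count cs) + q) (sum_list (map below_count cs) + tree_perm t ! q))"
  define A where "A = (\<Sum>h<length cs. \<Sum>e\<in>{LeftSide, RightSide}. \<Sum>s\<in>{Plus, Minus}. real (side_count e s (cs ! h)) * f (P e s (W h)))"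
  have main: "\<bar>(\<Sum>q<n. F q (tree_perm (plug cs t) ! q)) - T - A\<bar> \<le> 6 * K * \<delta> * real (chain_size cs)"
    unfolding T_def A_def using region by (intro plug_points[OF i cs t n]) (auto simp: F_def)
  have B0: "B \<ge> 0" using B[of "(0, 0)"] by auto
  have "\<bar>T\<bar> \<le> (\<Sum>q<tree_size t. B)" unfolding T_def
  proof (intro order_trans[OF sum_abs] sum_mono)
    fix q assume q: "q \<in> {..<tree_size t}"
    have "is_permutation (tree_perm t)" by (rule is_permutation_tree_perm[OF trees_standard[OF t]])
    then have "tree_perm t ! q \<le> tree_size t" using q nth_mem[of q "tree_perm t"] by (auto simp: is_permutation_iff)
    moreover have "sum_list (map left_count cs) \<le> chain_size cs" "sum_list (map below_count cs) \<le> chain_size cs"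
      using pcs[of "length cs"] unfolding prefix_count_length by (simp_all add: chain_size_def)
    ultimately have "sum_list (map left_count cs) + q \<le> n" "sum_list (map below_count cs) + tree_perm t ! q \<le> n"
      using q n by auto
    then show "\<bar>F (sum_list (map left_count cs) + q) (sum_list (map below_count cs) + tree_perm t ! q)\<bar> \<le> B"
      unfolding F_def using npos by (intro B) (simp del: of_nat_add)
  qed
  also have "\<dots> = B * real (tree_size t)" by simp
  also have "\<dots> \<le> B * (\<delta> * real n)" using good B0 by (intro mult_left_mono) (auto simp: good_chain_def)
  finally have T: "\<bar>T\<bar> \<le> B * (\<delta> * real n)" .
  have "6 * K * \<delta> * real (chain_size cs) \<le> 6 * K * \<delta> * real n" using K \<delta> n by (intro mult_left_mono) auto
  then have 1: "\<bar>(\<Sum>q<n. F q (tree_perm (plug cs t) ! q)) - A\<bar> \<le> (\<delta> * (6 * K + B)) * real n"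
    using main T by (simp add: algebra_simps)
  have 2: "\<bar>(\<Sum>q<n. F q (tree_perm (plug cs t) ! q)) / real n - A / real n\<bar> \<le> \<delta> * (6 * K + B)"
  proof -
    have "\<bar>(\<Sum>q<n. F q (tree_perm (plug cs t) ! q)) / real n - A / real n\<bar> =
        \<bar>(\<Sum>q<n. F q (tree_perm (plug cs t) ! q)) - A\<bar> / real n"
      using npos by (simp add: diff_divide_distrib[symmetric])
    also have "\<dots> \<le> (\<delta> * (6 * K + B)) * real n / real n" using 1 npos by (intro divide_right_mono) auto
    finally show ?thesis using npos by simp
  qed
  have A: "A / real n = (\<Sum>e\<in>{LeftSide, RightSide}. \<Sum>s\<in>{Plus, Minus}. \<Sum>h<H. (N e s (Suc h) - N e s h) * f (P e s (W h)))"
  proof -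
    have "N e s (Suc h) - N e s h = real (side_count e s (cs ! h)) / real n" if "h < H" for e s h
      using that prefix_count_Suc[of h cs "side_count e s"] by (simp add: N_def H_def diff_divide_distrib[symmetric])
    then have "(\<Sum>h<H. (N e s (Suc h) - N e s h) * f (P e s (W h))) = (\<Sum>h<H. real (side_count e s (cs ! h)) * f (P e s (W h))) / real n" for e s
      unfolding sum_divide_distrib by (intro sum.cong) auto
    moreover have "A = (\<Sum>e\<in>{LeftSide, RightSide}. \<Sum>s\<in>{Plus, Minus}. \<Sum>h<H. real (side_count e s (cs ! h)) * f (P e s (W h)))"
      unfolding A_def H_def by (simp add: sum.distrib)
    ultimately show ?thesis by (simp add: add_divide_distrib)
  qed
  have RS: "\<bar>(\<Sum>h<H. (N e s (Suc h) - N e s h) * f (P e s (W h))) - p e s * integral {0..1} (\<lambda>\<tau>. f (P e s \<tau>))\<bar> \<le>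
      \<delta> * (2 * B + 2 * (2 * K))" for e s
  proof (rule riemann_stieltjes_estimate)
    show "N e s 0 = 0" "W 0 = 0" by (simp_all add: N_def W_def)
    show "W h \<le> W (Suc h)" if "h < H" for h
    proof -
      have "0 \<le> real (context_size (cs ! h)) / real n" by simp
      then show ?thesis using Wsuc[OF that] by linarith
    qed
    show "W (Suc h) - W h \<le> \<delta>" if "h < H" for h
      unfolding Wsuc[OF that] using blk[OF that] npos by (simp add: divide_le_eq)
    have WH: "W H * real n = real (chain_size cs)"
      using npos by (simp add: W_def H_def prefix_count_length chain_size_def)
    have "real n - \<delta> * real n \<le> real (chain_size cs)" using good n by (simp add: good_chain_def)
    then have "(1 - \<delta>) * real n \<le> W H * real n" unfolding WH by (simp add: left_diff_distrib)
    then show "1 - \<delta> \<le> W H" using npos by simp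
    show "W H \<le> 1" using W01[of H] by simp
    show "\<bar>N e s h - p e s * W h\<bar> \<le> \<delta>" if "h \<le> H" for h
    proof -
      have "\<bar>N e s h - p e s * W h\<bar> = \<bar>real (prefix_count (side_count e s) cs h) - p e s * real (prefix_count context_size cs h)\<bar> / real n"
        using npos by (simp add: N_def W_def diff_divide_distrib[symmetric])
      also have "\<dots> \<le> \<delta> * real n / real n" using dev[OF that] npos by (intro divide_right_mono) auto
      finally show ?thesis using npos by simp
    qed
    show "\<bar>f (P e s \<tau>)\<bar> \<le> B" if "\<tau> \<in> {0..1}" for \<tau> using B[OF Psq[OF that]] .
    \<comment> \<open>Both coordinates of an arm move with speed at most 1, which doubles the
      Lipschitz constant of f.\<close>
    show "\<bar>f (P e s \<tau>) - f (P e s \<tau>')\<bar> \<le> 2 * K * \<bar>\<tau> - \<tau>'\<bar>" if \<tau>: "\<tau> \<in> {0..1}" "\<tau>' \<in> {0..1}" for \<tau> \<tau>'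
    proof -
      have lin: "\<bar>c * \<tau> - c * \<tau>'\<bar> \<le> \<bar>\<tau> - \<tau>'\<bar>" if "0 \<le> c" "c \<le> 1" for c
        unfolding right_diff_distrib[symmetric] abs_mult using that by (simp add: mult_left_le_one_le)
      have 1: "\<bar>fst (P e s \<tau>) - fst (P e s \<tau>')\<bar> \<le> \<bar>\<tau> - \<tau>'\<bar>"
        using lin[of a] lin[of "1 - a"] ab01 by (cases e) (simp_all add: fstP abs_minus_commute)
      have 2: "\<bar>snd (P e s \<tau>) - snd (P e s \<tau>')\<bar> \<le> \<bar>\<tau> - \<tau>'\<bar>"
        using lin[of b] lin[of "1 - b"] ab01 by (simp add: sndP abs_minus_commute)
      have "\<bar>f (P e s \<tau>) - f (P e s \<tau>')\<bar> \<le>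
          K * (\<bar>fst (P e s \<tau>) - fst (P e s \<tau>')\<bar> + \<bar>snd (P e s \<tau>) - snd (P e s \<tau>')\<bar>)"
        using lip[of "fst (P e s \<tau>)" "snd (P e s \<tau>)" "fst (P e s \<tau>')" "snd (P e s \<tau>')"] Psq[OF \<tau>(1), of e s] Psq[OF \<tau>(2), of e s]
        by simp
      also have "\<dots> \<le> K * (\<bar>\<tau> - \<tau>'\<bar> + \<bar>\<tau> - \<tau>'\<bar>)" using 1 2 K by (intro mult_left_mono add_mono)
      finally show ?thesis by (simp add: algebra_simps)
    qed
  qed (use p[of e s] \<delta> K in auto)
  have 3: "\<bar>A / real n - (\<Sum>e\<in>{LeftSide, RightSide}. \<Sum>s\<in>{Plus, Minus}. p e s * integral {0..1} (\<lambda>\<tau>. f (P e s \<tau>)))\<bar> \<le>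
      4 * (\<delta> * (2 * B + 2 * (2 * K)))"
    unfolding A using RS[of LeftSide Plus] RS[of LeftSide Minus] RS[of RightSide Plus] RS[of RightSide Minus] by simp
  have "\<bar>(\<Sum>q<n. F q (tree_perm (plug cs t) ! q)) / real n -
      (\<Sum>e\<in>{LeftSide, RightSide}. \<Sum>s\<in>{Plus, Minus}. p e s * integral {0..1} (\<lambda>\<tau>. f (P e s \<tau>)))\<bar> \<le>
    \<delta> * (6 * K + B) + 4 * (\<delta> * (2 * B + 2 * (2 * K)))" using 2 3 by linarith
  \<comment> \<open>The constants add up to 6 K + 16 K for the Lipschitz part and B + 8 B for the
    bound of f; 22 covers both.\<close>
  also have "\<dots> \<le> \<delta> * (22 * (B + K))"
  proof -
    have "0 \<le> \<delta> * B" using \<delta> B0 by simp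
    then show ?thesis by (simp add: algebra_simps)
  qed
  finally show ?thesis by (simp add: F_def P_def)
qed

end

section \<open>Negligible sets of trees\<close>

lemma linear_power_le_exp:
  assumes "a > 0"
  shows "\<exists>C. \<forall>n. (real n + 1) ^ k \<le> C * exp (a * real n)"
proof -
  define b where "b = a / (real k + 1)"
  have b: "b > 0" using assms by (simp add: b_def)
  have "(real n + 1) ^ k \<le> (1 / b + 1) ^ k * exp (a * real n)" for n
  proof -
    have "b * real n \<le> exp (b * real n)" using exp_ge_add_one_self[of "b * real n"] by linarith
    then have "real n \<le> 1 / b * exp (b * real n)" using b by (simp add: field_simps)
    moreover have "1 \<le> exp (b * real n)" using b by simp
    ultimately have "real n + 1 \<le> (1 / b + 1) * exp (b * real n)" unfolding distrib_right by linarith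
    then have "(real n + 1) ^ k \<le> ((1 / b + 1) * exp (b * real n)) ^ k" by (intro power_mono) auto
    also have "\<dots> = (1 / b + 1) ^ k * exp (real k * (b * real n))" by (simp add: power_mult_distrib exp_of_nat_mult)
    also have "\<dots> \<le> (1 / b + 1) ^ k * exp (a * real n)"
    proof -
      have "real k * b \<le> a" using assms by (simp add: b_def field_simps)
      then have "real k * b * real n \<le> a * real n" by (rule mult_right_mono) simp
      then show ?thesis using b by (intro mult_left_mono) (auto simp: mult.assoc)
    qed
    finally show ?thesis .
  qed
  then show ?thesis by blast
qed

lemma power_le_exp:
  assumes "0 < q" "q < 1" "x \<le> real m"
  shows "q ^ m \<le> exp (- (- ln q) * x)"
proof -
  have "q ^ m = exp (real m * ln q)" using assms by (simp add: exp_of_nat_mult)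
  also have "real m * ln q \<le> x * ln q" using assms by (intro mult_right_mono_neg) auto
  finally show ?thesis by (simp add: mult.commute)
qed

context linear_critical_specification
begin

text \<open>Exponentially small on the scale \<rho>^(-n). The scale is absolute, so that unions and
  spine decompositions are easy; the lower bound on the family turns it into a probability at the
  very end.\<close>

definition negligible :: "nat \<Rightarrow> (nat \<Rightarrow> subst_tree \<Rightarrow> bool) \<Rightarrow> bool" where
  "negligible i P \<longleftrightarrow> (\<exists>C \<eta>. 0 < \<eta> \<and>
    (\<forall>n. real (card {t \<in> sized i n. P n t}) * \<rho> ^ n \<le> C * exp (- \<eta> * real n)))"

text \<open>A polynomial factor is absorbed by half of the exponential rate.\<close>

lemma negligibleI:
  assumes \<eta>: "0 < \<eta>"
    and le: "\<And>n. real (card {t \<in> sized i n. P n t}) * \<rho> ^ n \<le> C * (real n + 1) ^ k * exp (- \<eta> * real n)"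
  shows "negligible i P"
proof -
  obtain C' where C': "\<And>n. (real n + 1) ^ k \<le> C' * exp (\<eta> / 2 * real n)"
    using linear_power_le_exp[of "\<eta> / 2" k] \<eta> by auto
  have "real (card {t \<in> sized i n. P n t}) * \<rho> ^ n \<le> \<bar>C\<bar> * C' * exp (- (\<eta> / 2) * real n)" for n
  proof -
    note le[of n]
    also have "C * (real n + 1) ^ k * exp (- \<eta> * real n) \<le> \<bar>C\<bar> * (C' * exp (\<eta> / 2 * real n)) * exp (- \<eta> * real n)"
      using C'[of n] by (intro mult_right_mono mult_mono) auto
    also have "\<dots> = \<bar>C\<bar> * C' * (exp (\<eta> / 2 * real n) * exp (- \<eta> * real n))" by simp
    also have "exp (\<eta> / 2 * real n) * exp (- \<eta> * real n) = exp (- (\<eta> / 2) * real n)"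
      unfolding exp_add[symmetric] by (simp add: field_simps)
    finally show ?thesis .
  qed
  then show ?thesis unfolding negligible_def using \<eta> by (intro exI[of _ "\<bar>C\<bar> * C'"] exI[of _ "\<eta> / 2"]) simp
qed

lemma negligible_mono:
  assumes "negligible i Q" "\<And>n t. t \<in> sized i n \<Longrightarrow> P n t \<Longrightarrow> Q n t"
  shows "negligible i P"
proof -
  obtain C \<eta> where *: "0 < \<eta>" "\<And>n. real (card {t \<in> sized i n. Q n t}) * \<rho> ^ n \<le> C * exp (- \<eta> * real n)"
    using assms(1) by (auto simp: negligible_def)
  have "real (card {t \<in> sized i n. P n t}) * \<rho> ^ n \<le> C * exp (- \<eta> * real n)" for n
  proof -
    have "card {t \<in> sized i n. P n t} \<le> card {t \<in> sized i n. Q n t}" using assms(2) by (intro card_mono) auto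
    then have "real (card {t \<in> sized i n. P n t}) * \<rho> ^ n \<le> real (card {t \<in> sized i n. Q n t}) * \<rho> ^ n"
      using \<rho>_pos by (intro mult_right_mono) auto
    then show ?thesis using *(2)[of n] by linarith
  qed
  then show ?thesis unfolding negligible_def using *(1) by blast
qed

lemma negligible_disj:
  assumes "negligible i P" "negligible i Q"
  shows "negligible i (\<lambda>n t. P n t \<or> Q n t)"
proof -
  obtain C \<eta> where 1: "0 < \<eta>" "\<And>n. real (card {t \<in> sized i n. P n t}) * \<rho> ^ n \<le> C * exp (- \<eta> * real n)"
    using assms(1) by (auto simp: negligible_def)
  obtain C' \<eta>' where 2: "0 < \<eta>'" "\<And>n. real (card {t \<in> sized i n. Q n t}) * \<rho> ^ n \<le> C' * exp (- \<eta>' * real n)"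
    using assms(2) by (auto simp: negligible_def)
  define \<mu> where "\<mu> = min \<eta> \<eta>'"
  have "real (card {t \<in> sized i n. P n t \<or> Q n t}) * \<rho> ^ n \<le> (\<bar>C\<bar> + \<bar>C'\<bar>) * exp (- \<mu> * real n)" for n
  proof -
    have "{t \<in> sized i n. P n t \<or> Q n t} = {t \<in> sized i n. P n t} \<union> {t \<in> sized i n. Q n t}" by auto
    then have "card {t \<in> sized i n. P n t \<or> Q n t} \<le> card {t \<in> sized i n. P n t} + card {t \<in> sized i n. Q n t}"
      by (simp add: card_Un_le)
    then have "real (card {t \<in> sized i n. P n t \<or> Q n t}) * \<rho> ^ n \<le>
        (real (card {t \<in> sized i n. P n t}) + real (card {t \<in> sized i n. Q n t})) * \<rho> ^ n"
      using \<rho>_pos by (intro mult_right_mono) auto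
    also have "\<dots> \<le> C * exp (- \<eta> * real n) + C' * exp (- \<eta>' * real n)"
      using 1(2)[of n] 2(2)[of n] by (simp add: distrib_right)
    also have "\<dots> \<le> \<bar>C\<bar> * exp (- \<mu> * real n) + \<bar>C'\<bar> * exp (- \<mu> * real n)"
      by (intro add_mono mult_mono) (auto simp: \<mu>_def mult_right_mono)
    finally show ?thesis by (simp add: distrib_right)
  qed
  moreover have "\<mu> > 0" using 1 2 by (simp add: \<mu>_def)
  ultimately show ?thesis unfolding negligible_def by blast
qed

lemma negligible_finite_union:
  assumes "finite A" "\<And>a. a \<in> A \<Longrightarrow> negligible i (P a)"
  shows "negligible i (\<lambda>n t. \<exists>a\<in>A. P a n t)"
  using assms
proof (induction A rule: finite_induct)
  case empty
  show ?case by (rule negligibleI[of 1 _ _ 0 0]) simp_all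
next
  case (insert a A)
  have "negligible i (\<lambda>n t. P a n t \<or> (\<exists>a\<in>A. P a n t))" using insert by (intro negligible_disj) auto
  then show ?case by simp
qed

text \<open>The subexponential lower bound is taken at half the rate of the exceptional set, so the
  quotient still decays. It is available at every size for which the family has a tree, which is
  what the filter requires.\<close>

lemma negligible_tendsto_0:
  assumes i: "i \<in> crit" and P: "negligible i P"
  shows "((\<lambda>n. real (card {t \<in> sized i n. P n t}) / real (card (sized i n))) \<longlongrightarrow> 0)
    (inf sequentially (principal {n. sized i n \<noteq> {}}))"
proof -
  obtain C \<eta> where C: "0 < \<eta>" "\<And>n. real (card {t \<in> sized i n. P n t}) * \<rho> ^ n \<le> C * exp (- \<eta> * real n)"
    using P by (auto simp: negligible_def)
  have \<eta>2: "\<eta> / 2 > 0" using C(1) by simp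
  obtain \<kappa> where \<kappa>: "\<kappa> > 0" "\<And>n. sized i n \<noteq> {} \<Longrightarrow> real (card (sized i n)) * \<rho> ^ n \<ge> \<kappa> * exp (- (\<eta> / 2) * real n)"
    by (rule sized_lower_bound[OF i \<eta>2]) (rule that)
  have le: "real (card {t \<in> sized i n. P n t}) / real (card (sized i n)) \<le> C / \<kappa> * exp (- (\<eta> / 2) * real n)"
    if n: "sized i n \<noteq> {}" for n
  proof -
    have "real (card {t \<in> sized i n. P n t}) / real (card (sized i n)) =
        (real (card {t \<in> sized i n. P n t}) * \<rho> ^ n) / (real (card (sized i n)) * \<rho> ^ n)" using \<rho>_pos by simp
    also have "\<dots> \<le> (C * exp (- \<eta> * real n)) / (\<kappa> * exp (- (\<eta> / 2) * real n))"
    proof (rule frac_le)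
      have "0 \<le> real (card {t \<in> sized i n. P n t}) * \<rho> ^ n" using \<rho>_pos by simp
      then show "0 \<le> C * exp (- \<eta> * real n)" using C(2)[of n] by linarith
    qed (use C(2) \<kappa> n in auto)
    also have "\<dots> = C / \<kappa> * (exp (- \<eta> * real n) / exp (- (\<eta> / 2) * real n))"
      by (simp only: times_divide_eq_left times_divide_eq_right divide_divide_eq_left mult_ac)
    also have "exp (- \<eta> * real n) / exp (- (\<eta> / 2) * real n) = exp (- (\<eta> / 2) * real n)"
      unfolding exp_diff[symmetric] by (simp add: field_simps)
    finally show ?thesis .
  qed
  have "(\<lambda>n. exp (- (\<eta> / 2)) ^ n) \<longlonglongrightarrow> 0" using C(1) by (intro LIMSEQ_realpow_zero) auto
  moreover have "exp (- (\<eta> / 2)) ^ n = exp (- (\<eta> / 2) * real n)" for n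
    by (simp add: exp_of_nat_mult[symmetric] mult.commute)
  ultimately have "(\<lambda>n. C / \<kappa> * exp (- (\<eta> / 2) * real n)) \<longlonglongrightarrow> C / \<kappa> * 0"
    by (intro tendsto_intros) simp
  then have lim: "((\<lambda>n. C / \<kappa> * exp (- (\<eta> / 2) * real n)) \<longlongrightarrow> 0) (inf sequentially (principal {n. sized i n \<noteq> {}}))"
    by (intro filterlim_mono[OF _ order_refl inf_le1]) simp
  have ev: "\<forall>\<^sub>F n in inf sequentially (principal {n. sized i n \<noteq> {}}).
      real (card {t \<in> sized i n. P n t}) / real (card (sized i n)) \<le> C / \<kappa> * exp (- (\<eta> / 2) * real n)"
    using le by (simp add: eventually_inf_principal)
  show ?thesis by (rule tendsto_zero_upper_bound[OF ev lim]) simp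
qed

text \<open>The piece \<open>cs\<close> is any initial segment of a spine and t' any tree of the
  type at its end, so one event covers deviations at every height. The n + 1 possible lengths and
  the bound K (n + 1) for the rest cost a factor (n + 1)^2.\<close>

lemma negligible_deviation:
  fixes X :: "tree_context \<Rightarrow> real"
  assumes Xb: "\<And>i c. i \<in> crit \<Longrightarrow> c \<in> contexts S i \<Longrightarrow> \<bar>X c\<bar> \<le> real (context_size c)"
    and u: "\<And>i. i \<in> crit \<Longrightarrow> u i > 0" "\<And>i. i \<in> crit \<Longrightarrow> mat_vec crit (\<lambda>i j. M j i) u i = u i"
    and v: "\<And>i. i \<in> crit \<Longrightarrow> v i > 0" "\<And>i. i \<in> crit \<Longrightarrow> mat_vec crit M v i = v i"
    and zero: "bilinear_value crit u (\<lambda>i j. \<Sum>n. (\<Sum>c\<in>slice i j n. X c) * \<rho> ^ n) v = 0"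
    and \<delta>: "\<delta> > 0" and i: "i \<in> crit"
  shows "negligible i (\<lambda>n t. \<exists>cs t'. chain i cs \<and> t' \<in> fam (chain_end i cs) \<and> t = plug cs t' \<and>
    sum_list (map X cs) > \<delta> * real n)"
proof -
  obtain C \<eta> where C: "0 < C" "0 < \<eta>" "\<And>i h n. i \<in> crit \<Longrightarrow> h \<le> n \<Longrightarrow>
    (\<Sum>cs | cs \<in> chains i h n \<and> sum_list (map X cs) > \<delta> * real n. \<rho> ^ chain_size cs) \<le> C * exp (- \<eta> * real n)"
    by (rule chain_concentration[OF _ _ _ _ _ zero \<delta>], rule Xb, assumption+, rule u(1), assumption,
      rule u(2), assumption, rule v(1), assumption, rule v(2), assumption, rule that)
  obtain K where K: "0 < K" "\<And>i n. i \<in> crit \<Longrightarrow> real (card (sized i n)) * \<rho> ^ n \<le> K * (real n + 1)"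
    by (rule sized_upper_bound) (rule that)
  show ?thesis
  proof (rule negligibleI[OF C(2), where C = "K * C" and k = 2])
    fix n
    let ?B = "{t \<in> sized i n. \<exists>cs t'. chain i cs \<and> t' \<in> fam (chain_end i cs) \<and> t = plug cs t' \<and> sum_list (map X cs) > \<delta> * real n}"
    have "real (card ?B) * \<rho> ^ n \<le> K * (real n + 1) *
      (\<Sum>h\<le>n. \<Sum>cs | cs \<in> chains i h n \<and> sum_list (map X cs) > \<delta> * real n. \<rho> ^ chain_size cs)"
    proof (rule weighted_card_plug_le[OF i, where U = "\<lambda>cs. sized (chain_end i cs) (n - chain_size cs)"])
      fix t assume "t \<in> ?B"
      then obtain cs t' where t: "t \<in> sized i n" "chain i cs" "t' \<in> fam (chain_end i cs)" "t = plug cs t'"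
        "sum_list (map X cs) > \<delta> * real n" by auto
      have "n = chain_size cs + tree_size t'" using plug_in_fam[OF i t(2,3)] t(1,4) by (simp add: sized_def)
      then show "\<exists>h cs t'. h \<le> n \<and> t = plug cs t' \<and> cs \<in> chains i h n \<and> sum_list (map X cs) > \<delta> * real n \<and>
          t' \<in> sized (chain_end i cs) (n - chain_size cs)"
        using t length_le_chain_size[OF i t(2)]
        by (intro exI[of _ "length cs"] exI[of _ cs] exI[of _ t']) (simp add: chains_def sized_def)
    next
      fix h cs assume "cs \<in> chains i h n"
      then have "chain i cs" by (simp add: chains_def)
      note K(2)[OF chain_end_crit[OF i this], of "n - chain_size cs"]
      also have "K * (real (n - chain_size cs) + 1) \<le> K * (real n + 1)" using K(1) by simp
      finally show "real (card (sized (chain_end i cs) (n - chain_size cs))) * \<rho> ^ (n - chain_size cs) \<le> K * (real n + 1)" .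
    qed (use K in auto)
    also have "\<dots> \<le> K * (real n + 1) * (\<Sum>h\<le>n. C * exp (- \<eta> * real n))"
      using K(1) C(3)[OF i] by (intro mult_left_mono sum_mono) auto
    also have "\<dots> = K * C * (real n + 1) ^ 2 * exp (- \<eta> * real n)" by (simp add: power2_eq_square algebra_simps)
    finally show "real (card ?B) * \<rho> ^ n \<le> K * C * (real n + 1) ^ 2 * exp (- \<eta> * real n)" .
  qed
qed

text \<open>The rate refers to the size n of the whole tree, whatever the size m of the subtree. The
  spine above it has bounded mass for each of the n + 1 possible lengths, so one polynomial factor
  is lost.\<close>

lemma negligible_subtree:
  assumes i: "i \<in> crit" and \<eta>: "0 < \<eta>" and C: "0 \<le> C"
    and le: "\<And>j n m. j \<in> crit \<Longrightarrow> m \<le> n \<Longrightarrow>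
      real (card {t \<in> sized j m. Q n j t}) * \<rho> ^ m \<le> C * (real n + 1) ^ k * exp (- \<eta> * real n)"
  shows "negligible i (\<lambda>n t. \<exists>cs t'. chain i cs \<and> t' \<in> fam (chain_end i cs) \<and> t = plug cs t' \<and> Q n (chain_end i cs) t')"
proof -
  obtain K where K: "0 < K" "\<And>i h n. i \<in> crit \<Longrightarrow> (\<Sum>cs\<in>chains i h n. \<rho> ^ chain_size cs) \<le> K"
    by (rule chains_mass_bound) (rule that)
  show ?thesis
  proof (rule negligibleI[OF \<eta>, where C = "C * K" and k = "Suc k"])
    fix n
    let ?B = "{t \<in> sized i n. \<exists>cs t'. chain i cs \<and> t' \<in> fam (chain_end i cs) \<and> t = plug cs t' \<and> Q n (chain_end i cs) t'}"
    have "real (card ?B) * \<rho> ^ n \<le> C * (real n + 1) ^ k * exp (- \<eta> * real n) *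
      (\<Sum>h\<le>n. \<Sum>cs | cs \<in> chains i h n \<and> True. \<rho> ^ chain_size cs)"
    proof (rule weighted_card_plug_le[OF i, where U = "\<lambda>cs. {t \<in> sized (chain_end i cs) (n - chain_size cs). Q n (chain_end i cs) t}"])
      fix t assume "t \<in> ?B"
      then obtain cs t' where t: "t \<in> sized i n" "chain i cs" "t' \<in> fam (chain_end i cs)" "t = plug cs t'"
        "Q n (chain_end i cs) t'" by auto
      have "n = chain_size cs + tree_size t'" using plug_in_fam[OF i t(2,3)] t(1,4) by (simp add: sized_def)
      then show "\<exists>h cs t'. h \<le> n \<and> t = plug cs t' \<and> cs \<in> chains i h n \<and> True \<and>
          t' \<in> {t \<in> sized (chain_end i cs) (n - chain_size cs). Q n (chain_end i cs) t}"
        using t length_le_chain_size[OF i t(2)]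
        by (intro exI[of _ "length cs"] exI[of _ cs] exI[of _ t']) (simp add: chains_def sized_def)
    next
      fix h cs assume "cs \<in> chains i h n"
      then have "chain i cs" by (simp add: chains_def)
      then show "real (card {t \<in> sized (chain_end i cs) (n - chain_size cs). Q n (chain_end i cs) t}) * \<rho> ^ (n - chain_size cs) \<le>
          C * (real n + 1) ^ k * exp (- \<eta> * real n)"
        by (intro le chain_end_crit[OF i]) auto
    qed (use C in auto)
    also have "\<dots> \<le> C * (real n + 1) ^ k * exp (- \<eta> * real n) * (\<Sum>h\<le>n. K)"
      using K(2)[OF i] C by (intro mult_left_mono sum_mono) auto
    also have "\<dots> = C * K * (real n + 1) ^ Suc k * exp (- \<eta> * real n)" by (simp add: algebra_simps)
    finally show "real (card ?B) * \<rho> ^ n \<le> C * K * (real n + 1) ^ Suc k * exp (- \<eta> * real n)" .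
  qed
qed

text \<open>Terminal trees of size m have weight O(q^m), and m > \<delta> n makes this exponentially
  small in n.\<close>

lemma negligible_large_terminal:
  assumes i: "i \<in> crit" and \<delta>: "\<delta> > 0"
  shows "negligible i (\<lambda>n t. \<exists>cs t'. chain i cs \<and> t' \<in> fam (chain_end i cs) \<and> t = plug cs t' \<and>
    (t' \<in> terminal_trees S (chain_end i cs) \<and> real (tree_size t') > \<delta> * real n))"
proof -
  obtain C q where q: "0 < q" "q < 1" "0 < C"
    "\<And>j n. j \<in> crit \<Longrightarrow> real (card (terminal_sized j n)) * \<rho> ^ n \<le> C * q ^ n" by (rule terminal_decay) (rule that)
  show ?thesis
  proof (rule negligible_subtree[OF i, where C = C and k = 0 and \<eta> = "- ln q * \<delta>"
      and Q = "\<lambda>n j t'. t' \<in> terminal_trees S j \<and> real (tree_size t') > \<delta> * real n"])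
    fix j n m :: nat assume j: "j \<in> crit"
    let ?U = "{t \<in> sized j m. t \<in> terminal_trees S j \<and> real (tree_size t) > \<delta> * real n}"
    show "real (card ?U) * \<rho> ^ m \<le> C * (real n + 1) ^ 0 * exp (- (- ln q * \<delta>) * real n)"
    proof (cases "real m > \<delta> * real n")
      case True
      have "card ?U \<le> card (terminal_sized j m)"
        by (rule card_mono[OF finite_terminal_sized]) (auto simp: terminal_sized_def sized_def)
      then have "real (card ?U) * \<rho> ^ m \<le> real (card (terminal_sized j m)) * \<rho> ^ m"
        using \<rho>_pos by (intro mult_right_mono) auto
      also have "\<dots> \<le> C * q ^ m" by (rule q(4)[OF j])
      also have "\<dots> \<le> C * exp (- (- ln q) * (\<delta> * real n))"
        using True q by (intro mult_left_mono power_le_exp) auto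
      finally show ?thesis by (simp add: mult.assoc)
    next
      case False
      then have "?U = {}" by (auto simp: sized_def)
      then have "card ?U = 0" by (simp only: card.empty)
      then show ?thesis using q by (simp only: of_nat_0 mult_zero_left) simp
    qed
  qed (use q \<delta> in \<open>auto intro!: mult_neg_pos\<close>)
qed

text \<open>The subtree starting with the large context is counted by a convolution: the weight q^w
  of contexts of size w > \<delta> n against a linear bound for the filling, over at most n + 1
  sizes and finitely many types.\<close>

lemma negligible_large_context:
  assumes i: "i \<in> crit" and \<delta>: "\<delta> > 0"
  shows "negligible i (\<lambda>n t. \<exists>cs t'. chain i cs \<and> t' \<in> fam (chain_end i cs) \<and> t = plug cs t' \<and>
    (\<exists>c\<in>contexts S (chain_end i cs). \<exists>t''\<in>fam (context_target c). t' = fill c t'' \<and> real (context_size c) > \<delta> * real n))"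
proof -
  obtain C q where q: "0 < q" "q < 1" "0 < C"
    "\<And>i j n. i \<in> crit \<Longrightarrow> j \<in> crit \<Longrightarrow> real (card (slice i j n)) * \<rho> ^ n \<le> C * q ^ n" by (rule slice_decay) (rule that)
  obtain K where K: "0 < K" "\<And>i n. i \<in> crit \<Longrightarrow> real (card (sized i n)) * \<rho> ^ n \<le> K * (real n + 1)"
    by (rule sized_upper_bound) (rule that)
  show ?thesis
  proof (rule negligible_subtree[OF i, where C = "real (card crit) * C * K" and k = 2 and \<eta> = "- ln q * \<delta>" and
      Q = "\<lambda>n j t'. \<exists>c\<in>contexts S j. \<exists>t''\<in>fam (context_target c). t' = fill c t'' \<and> real (context_size c) > \<delta> * real n"])
    fix j n m :: nat assume j: "j \<in> crit" and m: "m \<le> n"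
    let ?U = "{t' \<in> sized j m. \<exists>c\<in>contexts S j. \<exists>t''\<in>fam (context_target c). t' = fill c t'' \<and> real (context_size c) > \<delta> * real n}"
    define Z where "Z = crit \<times> {w. w \<le> m \<and> real w > \<delta> * real n}"
    have finZ: "finite Z" by (simp add: Z_def)
    have Zcard: "card Z \<le> card crit * (n + 1)"
    proof -
      have "card {w. w \<le> m \<and> real w > \<delta> * real n} \<le> card {..n}" using m by (intro card_mono) auto
      then have "card crit * card {w. w \<le> m \<and> real w > \<delta> * real n} \<le> card crit * (n + 1)" by (intro mult_le_mono2) simp
      then show ?thesis by (simp only: Z_def card_cartesian_product)
    qed
    let ?I = "\<lambda>z. (\<lambda>(c, t). fill c t) ` (slice j (fst z) (snd z) \<times> sized (fst z) (m - snd z))"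
    have "?U \<subseteq> (\<Union>z\<in>Z. ?I z)"
    proof
      fix t assume "t \<in> ?U"
      then obtain c t'' where t: "t \<in> sized j m" "c \<in> contexts S j" "t'' \<in> fam (context_target c)" "t = fill c t''"
        "real (context_size c) > \<delta> * real n" by auto
      have sz: "m = context_size c + tree_size t''" using fill_in_trees[OF j t(2,3)] t(1,4) by (simp add: sized_def)
      show "t \<in> (\<Union>z\<in>Z. ?I z)"
      proof (rule UN_I[of "(context_target c, context_size c)"])
        show "(context_target c, context_size c) \<in> Z" using sz t(5) context_target_crit[OF j t(2)] by (simp add: Z_def)
        show "t \<in> ?I (context_target c, context_size c)"
          by (rule image_eqI[of _ _ "(c, t'')"]) (use t sz in \<open>simp_all add: slice_def sized_def\<close>)
      qed
    qed
    then have "card ?U \<le> card (\<Union>z\<in>Z. ?I z)" using j finZ by (intro card_mono) auto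
    also have "\<dots> \<le> (\<Sum>z\<in>Z. card (?I z))" by (rule card_UN_le[OF finZ])
    also have "\<dots> \<le> (\<Sum>z\<in>Z. card (slice j (fst z) (snd z) \<times> sized (fst z) (m - snd z)))"
      using j by (intro sum_mono card_image_le) simp
    finally have "real (card ?U) \<le> (\<Sum>z\<in>Z. real (card (slice j (fst z) (snd z)) * card (sized (fst z) (m - snd z))))"
      unfolding card_cartesian_product by (simp only: of_nat_le_iff of_nat_sum[symmetric])
    then have "real (card ?U) * \<rho> ^ m \<le>
        (\<Sum>z\<in>Z. real (card (slice j (fst z) (snd z)) * card (sized (fst z) (m - snd z)))) * \<rho> ^ m"
      using \<rho>_pos by (intro mult_right_mono) auto
    also have "\<dots> \<le> (\<Sum>z\<in>Z. C * exp (- (- ln q) * (\<delta> * real n)) * (K * (real n + 1)))"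
      unfolding sum_distrib_right
    proof (rule sum_mono)
      fix z assume z: "z \<in> Z"
      obtain j' w where e: "z = (j', w)" by (cases z)
      have jw: "j' \<in> crit" "w \<le> m" "real w > \<delta> * real n" using z e by (auto simp: Z_def)
      have "real (card (slice j j' w) * card (sized j' (m - w))) * \<rho> ^ m =
          (real (card (slice j j' w)) * \<rho> ^ w) * (real (card (sized j' (m - w))) * \<rho> ^ (m - w))"
        using jw(2) by (simp add: mult_ac power_add[symmetric])
      also have "\<dots> \<le> (C * q ^ w) * (K * (real (m - w) + 1))"
        by (rule mult_mono[OF q(4)[OF j jw(1), of w] K(2)[OF jw(1), of "m - w"]]) (use K q \<rho>_pos in auto)
      also have "\<dots> \<le> (C * exp (- (- ln q) * (\<delta> * real n))) * (K * (real n + 1))"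
        using q K m jw by (intro mult_mono mult_left_mono power_le_exp) auto
      finally show "real (card (slice j (fst z) (snd z)) * card (sized (fst z) (m - snd z))) * \<rho> ^ m \<le>
          C * exp (- (- ln q) * (\<delta> * real n)) * (K * (real n + 1))" by (simp add: e)
    qed
    also have "\<dots> = real (card Z) * (C * exp (- (- ln q) * (\<delta> * real n)) * (K * (real n + 1)))" by simp
    also have "\<dots> \<le> real (card crit * (n + 1)) * (C * exp (- (- ln q) * (\<delta> * real n)) * (K * (real n + 1)))"
      using q K Zcard by (intro mult_right_mono) (simp_all only: of_nat_le_iff, simp)
    also have "\<dots> = real (card crit) * C * K * (real n + 1) ^ 2 * exp (- (- ln q * \<delta>) * real n)"
      by (simp add: power2_eq_square algebra_simps)
    finally show "real (card ?U) * \<rho> ^ m \<le> real (card crit) * C * K * (real n + 1) ^ 2 * exp (- (- ln q * \<delta>) * real n)" .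
  qed (use q K \<delta> in \<open>auto intro!: mult_neg_pos\<close>)
qed

lemma side_count_le_context_size:
  assumes "i \<in> crit" "c \<in> contexts S i"
  shows "side_count e s c \<le> context_size c"
  using context_size_counts[OF assms] by (cases e; cases s) (simp_all add: left_count_def right_count_def)

text \<open>Every failure of \<open>good_chain\<close> is witnessed by cutting the spine at one
  place: where a prefix deviates, just above a large context, or at the end. Finitely many
  negligible events cover the three cases.\<close>

lemma negligible_bad_chain:
  fixes p :: "side \<Rightarrow> sign \<Rightarrow> real"
  assumes p: "\<And>e s. p e s \<in> {0..1}"
    and u: "\<And>i. i \<in> crit \<Longrightarrow> u i > 0" "\<And>i. i \<in> crit \<Longrightarrow> mat_vec crit (\<lambda>i j. M j i) u i = u i"
    and v: "\<And>i. i \<in> crit \<Longrightarrow> v i > 0" "\<And>i. i \<in> crit \<Longrightarrow> mat_vec crit M v i = v i"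
    and zero: "\<And>e s a. bilinear_value crit u (\<lambda>i j. \<Sum>n.
      (\<Sum>c\<in>slice i j n. a * (real (side_count e s c) - p e s * real (context_size c))) * \<rho> ^ n) v = 0"
    and \<delta>: "\<delta> > 0" and i: "i \<in> crit"
  shows "negligible i (\<lambda>n t. \<exists>cs t0. chain i cs \<and> t0 \<in> terminal_trees S (chain_end i cs) \<and> t = plug cs t0 \<and>
    \<not> good_chain p \<delta> n cs t0)"
proof -
  define X where "X z c = (case z of (e, s, a) \<Rightarrow> a * (real (side_count e s c) - p e s * real (context_size c)))"
    for z :: "side \<times> sign \<times> real" and c
  \<comment> \<open>Four leaf types and a sign: the factor 1 or -1 reduces the two-sided deviation
    to one-sided ones.\<close>
  define A where "A = ({LeftSide, RightSide} \<times> {Plus, Minus} \<times> {1, -1} :: (side \<times> sign \<times> real) set)"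
  define dev where "dev z n t \<longleftrightarrow> (\<exists>cs t'. chain i cs \<and> t' \<in> fam (chain_end i cs) \<and> t = plug cs t' \<and>
    sum_list (map (X z) cs) > \<delta> * real n)" for z n t
  have "negligible i (dev z)" if z: "z \<in> A" for z
  proof -
    obtain e s a where z': "z = (e, s, a)" by (cases z)
    have a: "\<bar>a\<bar> = 1" using z by (auto simp: A_def z')
    have Xz: "X z c = a * (real (side_count e s c) - p e s * real (context_size c))" for c by (simp add: X_def z')
    show ?thesis unfolding dev_def
    proof (rule negligible_deviation[OF _ u v _ \<delta> i])
      fix i c assume ic: "i \<in> crit" "c \<in> contexts S i"
      have "0 \<le> p e s * real (context_size c)" "p e s * real (context_size c) \<le> 1 * real (context_size c)"
        using p[of e s] mult_right_mono[of "p e s" 1 "real (context_size c)"] by auto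
      then show "\<bar>X z c\<bar> \<le> real (context_size c)"
        using side_count_le_context_size[OF ic, of e s] a by (simp add: Xz abs_mult abs_le_iff)
    next
      show "bilinear_value crit u (\<lambda>i j. \<Sum>n. (\<Sum>c\<in>slice i j n. X z c) * \<rho> ^ n) v = 0"
        using zero[of a e s] by (simp only: Xz)
    qed
  qed
  then have "negligible i (\<lambda>n t. \<exists>z\<in>A. dev z n t)" by (intro negligible_finite_union) (auto simp: A_def)
  note neg = negligible_disj[OF this negligible_disj[OF negligible_large_context[OF i \<delta>] negligible_large_terminal[OF i \<delta>]]]
  show ?thesis
  proof (rule negligible_mono[OF neg])
    fix n t assume "\<exists>cs t0. chain i cs \<and> t0 \<in> terminal_trees S (chain_end i cs) \<and> t = plug cs t0 \<and> \<not> good_chain p \<delta> n cs t0"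
    then obtain cs t0 where t: "chain i cs" "t0 \<in> terminal_trees S (chain_end i cs)" "t = plug cs t0" "\<not> good_chain p \<delta> n cs t0"
      by blast
    \<comment> \<open>Any cut of the spine leaves an initial piece and a tree of the type at the
      cut, the form in which the negligible events are stated.\<close>
    have split: "chain i as \<and> chain (chain_end i as) bs \<and> plug bs t0 \<in> fam (chain_end i as) \<and> t = plug as (plug bs t0)"
      if "cs = as @ bs" for as bs
    proof -
      have c: "chain i as" "chain (chain_end i as) bs" using t(1) that by (auto simp: chain_append)
      have "t0 \<in> fam (chain_end (chain_end i as) bs)" using terminal_in_fam[OF t(2)] that by (simp add: chain_end_append)
      then show ?thesis using plug_in_fam[OF chain_end_crit[OF i c(1)] c(2)] c t(3) that by simp
    qed
    consider (dev) h e s where "h \<le> length cs"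
        "\<bar>real (prefix_count (side_count e s) cs h) - p e s * real (prefix_count context_size cs h)\<bar> > \<delta> * real n"
      | (block) c where "c \<in> set cs" "real (context_size c) > \<delta> * real n"
      | (large) "real (tree_size t0) > \<delta> * real n"
      using t(4) unfolding good_chain_def by (meson not_le)
    then show "(\<exists>z\<in>A. dev z n t) \<or>
      (\<exists>cs t'. chain i cs \<and> t' \<in> fam (chain_end i cs) \<and> t = plug cs t' \<and>
        (\<exists>c\<in>contexts S (chain_end i cs). \<exists>t''\<in>fam (context_target c). t' = fill c t'' \<and> real (context_size c) > \<delta> * real n)) \<or>
      (\<exists>cs t'. chain i cs \<and> t' \<in> fam (chain_end i cs) \<and> t = plug cs t' \<and>
        (t' \<in> terminal_trees S (chain_end i cs) \<and> real (tree_size t') > \<delta> * real n))"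
    proof cases
      case dev
      define as where "as = take h cs"
      have Xsum: "sum_list (map (X (e, s, a)) bs) =
          a * (real (sum_list (map (side_count e s) bs)) - p e s * real (sum_list (map context_size bs)))" for a bs
        by (induction bs) (simp_all add: X_def algebra_simps)
      define y where "y = real (sum_list (map (side_count e s) as)) - p e s * real (sum_list (map context_size as))"
      have "\<bar>y\<bar> > \<delta> * real n" using dev(2) by (simp add: y_def as_def prefix_count_def)
      then have "\<exists>a\<in>{1, -1}. sum_list (map (X (e, s, a)) as) > \<delta> * real n"
        unfolding Xsum y_def[symmetric] by (simp add: abs_if split: if_splits)
      then obtain a where a: "a \<in> {1, -1}" "sum_list (map (X (e, s, a)) as) > \<delta> * real n" by blast
      have "(e, s, a) \<in> A" using a(1) by (cases e; cases s) (simp_all add: A_def)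
      moreover have "dev (e, s, a) n t" unfolding dev_def using split[of as "drop h cs"] a(2)
        by (intro exI[of _ as] exI[of _ "plug (drop h cs) t0"]) (simp add: as_def)
      ultimately show ?thesis by blast
    next
      case block
      obtain as bs where cs: "cs = as @ c # bs" using split_list[OF block(1)] by blast
      have 1: "chain i as" "c \<in> contexts S (chain_end i as)" "plug (c # bs) t0 \<in> fam (chain_end i as)" "t = plug as (plug (c # bs) t0)"
        using split[OF cs] by auto
      have "plug bs t0 \<in> fam (context_target c)"
        using split[of "as @ [c]" bs] cs by (simp add: chain_end_append)
      then have blk: "\<exists>d\<in>contexts S (chain_end i as). \<exists>t''\<in>fam (context_target d). plug (c # bs) t0 = fill d t'' \<and> real (context_size d) > \<delta> * real n"
        using 1(2) block(2) by (intro bexI[of _ c] bexI[of _ "plug bs t0"]) simp_all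
      have "\<exists>cs t'. chain i cs \<and> t' \<in> fam (chain_end i cs) \<and> t = plug cs t' \<and>
          (\<exists>c\<in>contexts S (chain_end i cs). \<exists>t''\<in>fam (context_target c). t' = fill c t'' \<and> real (context_size c) > \<delta> * real n)"
        by (intro exI conjI) (rule 1 blk)+
      then show ?thesis by (intro disjI2 disjI1)
    next
      case large
      then show ?thesis using t terminal_in_fam[OF t(2)] by blast
    qed
  qed
qed

end

section \<open>The limiting permuton\<close>

lemma bilinear_value_cong:
  "(\<And>i j. i \<in> I \<Longrightarrow> j \<in> I \<Longrightarrow> A i j = B i j) \<Longrightarrow> bilinear_value I u A v = bilinear_value I u B v"
  by (simp add: bilinear_value_def)

lemma bilinear_value_add:
  "bilinear_value I u (\<lambda>i j. A i j + B i j) v = bilinear_value I u A v + bilinear_value I u B v"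
  by (simp add: bilinear_value_def distrib_left distrib_right sum.distrib)

lemma bilinear_value_scale: "bilinear_value I u (\<lambda>i j. a * A i j) v = a * bilinear_value I u A v"
  by (simp add: bilinear_value_def sum_distrib_left mult_ac)

lemma bilinear_value_mono:
  assumes "\<And>i. i \<in> I \<Longrightarrow> u i \<ge> 0" "\<And>i. i \<in> I \<Longrightarrow> v i \<ge> 0" "\<And>i j. i \<in> I \<Longrightarrow> j \<in> I \<Longrightarrow> A i j \<le> B i j"
  shows "bilinear_value I u A v \<le> bilinear_value I u B v"
  unfolding bilinear_value_def using assms by (intro sum_mono mult_right_mono mult_left_mono) auto

lemma bilinear_value_scaled_vectors:
  assumes "\<And>i. i \<in> I \<Longrightarrow> u' i = c * u i" "\<And>i. i \<in> I \<Longrightarrow> v' i = d * v i"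
  shows "bilinear_value I u' A v' = c * d * bilinear_value I u A v"
  unfolding bilinear_value_def sum_distrib_left using assms by (intro sum.cong) (simp_all add: mult_ac)

context linear_critical_specification
begin

section \<open>The parameter of the limiting X-permuton\<close>

abbreviation M' :: "nat \<Rightarrow> nat \<Rightarrow> real" where
  "M' \<equiv> at_rho S (\<lambda>i j. fps_deriv (M_star S i j))"

text \<open>The operator z d/dz multiplies the n-th coefficient by n, the common size of the
  contexts it counts.\<close>

lemma context_size_sums:
  assumes i: "i \<in> crit" and j: "j \<in> crit"
  shows "(\<lambda>n. (\<Sum>c\<in>slice i j n. real (context_size c)) * \<rho> ^ n) sums (\<rho> * M' i j)"
proof -
  have "ereal \<bar>\<rho>\<bar> < fps_conv_radius (fps_deriv (M_star S i j))"
    using radius_M[OF i j] rho_eq \<rho>_pos fps_conv_radius_deriv[of "M_star S i j"] by (auto intro: less_le_trans)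
  from fps_sums_eval[OF this]
  have "(\<lambda>n. fps_nth (fps_deriv (M_star S i j)) n * \<rho> ^ n) sums M' i j"
    by (simp add: at_rho_def \<rho>_def)
  then have 1: "(\<lambda>n. \<rho> * (fps_nth (fps_deriv (M_star S i j)) n * \<rho> ^ n)) sums (\<rho> * M' i j)" by (rule sums_mult)
  have 2: "\<rho> * (fps_nth (fps_deriv (M_star S i j)) n * \<rho> ^ n) =
      (\<Sum>c\<in>slice i j (Suc n). real (context_size c)) * \<rho> ^ Suc n" for n
  proof -
    have "(\<Sum>c\<in>slice i j (Suc n). real (context_size c)) = (\<Sum>c\<in>slice i j (Suc n). real (Suc n))"
      by (intro sum.cong) (auto simp: slice_def)
    then show ?thesis using fps_nth_M_star[OF i j] by simp
  qed
  have "(\<lambda>n. (\<Sum>c\<in>slice i j (Suc n). real (context_size c)) * \<rho> ^ Suc n) sums (\<rho> * M' i j)"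
    using 1 unfolding 2 .
  moreover have "(\<Sum>c\<in>slice i j 0. real (context_size c)) * \<rho> ^ 0 = 0" by (auto simp: slice_def)
  ultimately show ?thesis
    using sums_Suc_iff[of "\<lambda>n. (\<Sum>c\<in>slice i j n. real (context_size c)) * \<rho> ^ n" "\<rho> * M' i j"] by simp
qed

text \<open>The factor \<rho> restores the marked leaf, which \<open>D_star\<close> leaves out.
  Convergence at \<rho> follows by comparison, since a side count is at most the size of the
  context.\<close>

lemma side_count_sums:
  assumes i: "i \<in> crit" and j: "j \<in> crit"
  shows "(\<lambda>n. (\<Sum>c\<in>slice i j n. real (side_count e s c)) * \<rho> ^ n) sums (\<rho> * at_rho S (D_star S e s) i j)"
proof -
  let ?a = "\<lambda>n. (\<Sum>c\<in>slice i j n. real (side_count e s c)) * \<rho> ^ n"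
  have "side_count e s c = 0" if "c \<in> slice i j 0" for c
    using side_count_le_context_size[OF i, of c e s] that by (simp add: slice_def)
  then have a0: "?a 0 = 0" by simp
  have "summable ?a"
  proof (rule summable_comparison_test'[OF sums_summable[OF context_size_sums[OF i j]], of 0])
    fix n
    have "real (side_count e s c) \<le> real (context_size c)" if "c \<in> slice i j n" for c
      using side_count_le_context_size[OF i, of c e s] that by (simp add: slice_def)
    then have "?a n \<le> (\<Sum>c\<in>slice i j n. real (context_size c)) * \<rho> ^ n"
      using \<rho>_pos by (intro mult_right_mono sum_mono) auto
    moreover have "0 \<le> ?a n" using \<rho>_pos by (simp add: sum_nonneg)
    ultimately show "norm (?a n) \<le> (\<Sum>c\<in>slice i j n. real (context_size c)) * \<rho> ^ n" by simp
  qed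
  then have sm: "summable (\<lambda>n. ?a (Suc n))" by (rule iffD2[OF summable_Suc_iff[of ?a]])
  have aS: "?a (Suc n) = \<rho> * (fps_nth (D_star S e s i j) n * \<rho> ^ n)" for n
    using fps_nth_D_star[OF i j] by simp
  have "summable (\<lambda>n. fps_nth (D_star S e s i j) n * \<rho> ^ n)"
    using sm \<rho>_pos unfolding aS by (simp add: summable_cmult_iff)
  then have "(\<lambda>n. fps_nth (D_star S e s i j) n * \<rho> ^ n) sums at_rho S (D_star S e s) i j"
    by (simp add: at_rho_def \<rho>_def eval_fps_def summable_sums)
  then have "(\<lambda>n. ?a (Suc n)) sums (\<rho> * at_rho S (D_star S e s) i j)" unfolding aS by (rule sums_mult)
  then show ?thesis using sums_Suc_iff[of ?a "\<rho> * at_rho S (D_star S e s) i j"] a0 by simp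
qed

lemma D_nonneg:
  assumes "i \<in> crit" "j \<in> crit"
  shows "at_rho S (D_star S e s) i j \<ge> 0"
proof -
  have "0 \<le> \<rho> * at_rho S (D_star S e s) i j"
    by (rule sums_le[OF _ sums_zero side_count_sums[OF assms, of e s]]) (use \<rho>_pos in \<open>simp add: sum_nonneg\<close>)
  then show ?thesis using \<rho>_pos by (simp add: zero_le_mult_iff)
qed

text \<open>Each leaf of a context has exactly one type, so the four counts add up to the size. This
  is what makes the entries of p sum to 1.\<close>

lemma sum_D:
  assumes i: "i \<in> crit" and j: "j \<in> crit"
  shows "(\<Sum>e\<in>{LeftSide, RightSide}. \<Sum>s\<in>{Plus, Minus}. at_rho S (D_star S e s) i j) = M' i j"
proof -
  have "(\<lambda>n. \<Sum>e\<in>{LeftSide, RightSide}. \<Sum>s\<in>{Plus, Minus}. (\<Sum>c\<in>slice i j n. real (side_count e s c)) * \<rho> ^ n) sums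
      (\<Sum>e\<in>{LeftSide, RightSide}. \<Sum>s\<in>{Plus, Minus}. \<rho> * at_rho S (D_star S e s) i j)"
    by (intro sums_sum side_count_sums i j)
  moreover have "(\<Sum>e\<in>{LeftSide, RightSide}. \<Sum>s\<in>{Plus, Minus}. (\<Sum>c\<in>slice i j n. real (side_count e s c)) * \<rho> ^ n) =
      (\<Sum>c\<in>slice i j n. real (context_size c)) * \<rho> ^ n" for n
  proof -
    have "(\<Sum>c\<in>slice i j n. real (context_size c)) =
        (\<Sum>c\<in>slice i j n. \<Sum>e\<in>{LeftSide, RightSide}. \<Sum>s\<in>{Plus, Minus}. real (side_count e s c))"
    proof (rule sum.cong[OF refl])
      fix c assume "c \<in> slice i j n"
      then have "c \<in> contexts S i" by (simp add: slice_def)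
      then show "real (context_size c) = (\<Sum>e\<in>{LeftSide, RightSide}. \<Sum>s\<in>{Plus, Minus}. real (side_count e s c))"
        using context_size_counts(1)[OF i, of c] by (simp add: left_count_def right_count_def)
    qed
    then show ?thesis by (simp add: sum.distrib distrib_right)
  qed
  ultimately have "(\<lambda>n. (\<Sum>c\<in>slice i j n. real (context_size c)) * \<rho> ^ n) sums
      (\<Sum>e\<in>{LeftSide, RightSide}. \<Sum>s\<in>{Plus, Minus}. \<rho> * at_rho S (D_star S e s) i j)" by simp
  then have "\<rho> * M' i j = (\<Sum>e\<in>{LeftSide, RightSide}. \<Sum>s\<in>{Plus, Minus}. \<rho> * at_rho S (D_star S e s) i j)"
    by (rule sums_unique2[OF context_size_sums[OF i j]])
  then have "\<rho> * M' i j = \<rho> * (\<Sum>e\<in>{LeftSide, RightSide}. \<Sum>s\<in>{Plus, Minus}. at_rho S (D_star S e s) i j)"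
    by (simp only: sum_distrib_left)
  then show ?thesis using \<rho>_pos by simp
qed

text \<open>Every context contains a leaf besides its hole. Paired with u and v this keeps the
  denominator of the formula for p positive.\<close>

lemma M'_ge:
  assumes i: "i \<in> crit" and j: "j \<in> crit"
  shows "M i j \<le> \<rho> * M' i j"
proof (rule sums_le[OF _ M_sums[OF i j] context_size_sums[OF i j]])
  fix n
  have "(\<Sum>c\<in>slice i j n. 1) \<le> (\<Sum>c\<in>slice i j n. real (context_size c))"
    using context_size_pos[OF i] by (intro sum_mono) (auto simp: slice_def Suc_le_eq)
  then show "real (card (slice i j n)) * \<rho> ^ n \<le> (\<Sum>c\<in>slice i j n. real (context_size c)) * \<rho> ^ n"
    using \<rho>_pos by (intro mult_right_mono) auto
qed

lemma bilinear_M'_pos: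
  assumes u: "\<And>i. i \<in> crit \<Longrightarrow> u i > 0"
    and v: "\<And>i. i \<in> crit \<Longrightarrow> v i > 0" "\<And>i. i \<in> crit \<Longrightarrow> mat_vec crit M v i = v i"
  shows "bilinear_value crit u M' v > 0"
proof -
  have "0 < (\<Sum>i\<in>crit. u i * v i)" using u v(1) crit_nonempty by (intro sum_pos) auto
  also have "\<dots> = bilinear_value crit u M v"
    unfolding bilinear_value_def
  proof (rule sum.cong[OF refl])
    fix i assume "i \<in> crit"
    then show "u i * v i = (\<Sum>j\<in>crit. u i * M i j * v j)"
      using v(2) by (simp add: mat_vec_def sum_distrib_left[symmetric] mult.assoc)
  qed
  also have "\<dots> \<le> bilinear_value crit u (\<lambda>i j. \<rho> * M' i j) v"
    using u v(1) M'_ge by (intro bilinear_value_mono) (auto simp: less_imp_le)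
  finally show ?thesis using \<rho>_pos by (simp add: bilinear_value_scale zero_less_mult_iff)
qed

section \<open>Convergence in distribution\<close>

lemma tree_perm_integral_close:
  fixes f :: "real \<times> real \<Rightarrow> real" and p :: "side \<Rightarrow> sign \<Rightarrow> real"
  assumes i: "i \<in> crit" and t: "t \<in> sized i n" and cs: "chain i cs" and t0: "t0 \<in> fam (chain_end i cs)"
    and eq: "t = plug cs t0" and good: "good_chain p \<delta> n cs t0" and \<delta>: "0 \<le> \<delta>"
    and p: "\<And>e s. p e s \<in> {0..1}"
    and sum_p: "p LeftSide Plus + p RightSide Plus + p LeftSide Minus + p RightSide Minus = 1"
    and f: "continuous_on unit_square f" and B: "\<And>z. z \<in> unit_square \<Longrightarrow> \<bar>f z\<bar> \<le> B"
    and lip: "\<And>x y x' y'. (x, y) \<in> unit_square \<Longrightarrow> (x', y') \<in> unit_square \<Longrightarrow>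
      \<bar>f (x, y) - f (x', y')\<bar> \<le> K * (\<bar>x - x'\<bar> + \<bar>y - y'\<bar>)" and K: "0 \<le> K"
  shows "\<bar>(\<integral>z. f z \<partial>permuton_of (tree_perm t)) - (\<integral>z. f z \<partial>X_permuton p)\<bar> \<le> \<delta> * (22 * (B + K)) + 2 * K / n"
proof -
  have n: "length (tree_perm t) = n" "n = chain_size cs + tree_size t0"
    using t plug_in_fam[OF i cs t0] by (auto simp: sized_def eq)
  have \<sigma>: "is_permutation (tree_perm t)" using t trees_standard is_permutation_tree_perm by (auto simp: sized_def)
  have "\<bar>(\<Sum>q<n. f (real q / real n, real (tree_perm t ! q) / real n)) / real n - (\<integral>z. f z \<partial>X_permuton p)\<bar> \<le>
      \<delta> * (22 * (B + K))"
    unfolding X_permuton_integral[OF p sum_p f] eq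
    by (rule good_chain_estimate[OF i cs t0 n(2) good \<delta> p sum_p B lip K])
  moreover have "\<bar>(\<integral>z. f z \<partial>permuton_of (tree_perm t)) -
      (\<Sum>q<n. f (real q / real n, real (tree_perm t ! q) / real n)) / real n\<bar> \<le> 2 * K / real n"
    unfolding n(1)[symmetric] by (rule permuton_integral_approx[OF \<sigma> f lip K])
  ultimately show ?thesis by linarith
qed

text \<open>A permutation whose integral of a Lipschitz function is far from the limit must come
  from a tree with a bad spine, once n is large. The proportion of such trees tends to 0.\<close>

lemma converges_to_X_permuton:
  fixes p :: "side \<Rightarrow> sign \<Rightarrow> real"
  assumes p: "\<And>e s. p e s \<in> {0..1}"
    and sum_p: "p LeftSide Plus + p RightSide Plus + p LeftSide Minus + p RightSide Minus = 1"
    and negl: "\<And>\<delta>. \<delta> > 0 \<Longrightarrow> negligible i (\<lambda>n t. \<exists>cs t0. chain i cs \<and> t0 \<in> terminal_trees S (chain_end i cs) \<and>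
      t = plug cs t0 \<and> \<not> good_chain p \<delta> n cs t0)"
    and i: "i \<in> crit"
  shows "converges_in_distribution weak_topology_permutons (\<lambda>n. map_pmf permuton_of (pmf_of_set (of_size S i n)))
    (return_pmf (X_permuton p)) (inf sequentially (principal {n. of_size S i n \<noteq> {}}))"
proof (rule converges_in_distribution_return_pmfI[OF X_permuton_in_permutons[OF p sum_p]])
  have bij: "bij_betw tree_perm (sized i n) (of_size S i n)" for n by (rule of_size_bij[OF crit_le[OF i]])
  have fin: "finite (of_size S i n)" for n using bij_betw_finite[OF bij[of n]] by simp
  have ne: "of_size S i n \<noteq> {} \<longleftrightarrow> sized i n \<noteq> {}" for n using bij_betw_imp_surj_on[OF bij[of n]] by auto
  show "\<forall>\<^sub>F n in inf sequentially (principal {n. of_size S i n \<noteq> {}}).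
      finite (set_pmf (map_pmf permuton_of (pmf_of_set (of_size S i n)))) \<and>
      set_pmf (map_pmf permuton_of (pmf_of_set (of_size S i n))) \<subseteq> permutons"
    unfolding eventually_inf_principal
  proof (rule always_eventually, intro allI impI)
    fix n assume "n \<in> {n. of_size S i n \<noteq> {}}"
    then have n: "of_size S i n \<noteq> {}" by simp
    have "is_permutation \<sigma>" if "\<sigma> \<in> of_size S i n" for \<sigma>
      using that spec crit_le[OF i] by (auto simp: of_size_def tree_specification_def)
    then show "finite (set_pmf (map_pmf permuton_of (pmf_of_set (of_size S i n)))) \<and>
        set_pmf (map_pmf permuton_of (pmf_of_set (of_size S i n))) \<subseteq> permutons"
      using n fin permuton_of_in_permutons by auto
  qed
  fix f :: "real \<times> real \<Rightarrow> real" and K e :: real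
  assume f: "continuous_on unit_square f" and K: "0 \<le> K" and e: "e > 0"
    and lip: "\<And>x y x' y'. (x, y) \<in> unit_square \<Longrightarrow> (x', y') \<in> unit_square \<Longrightarrow>
      \<bar>f (x, y) - f (x', y')\<bar> \<le> K * (\<bar>x - x'\<bar> + \<bar>y - y'\<bar>)"
  obtain B where B: "B \<ge> 0" "\<And>z. z \<in> unit_square \<Longrightarrow> \<bar>f z\<bar> \<le> B" by (rule continuous_on_square_bounded[OF f]) (rule that)
  \<comment> \<open>Makes the error 22 (B + K) \<delta> of a good spine at most e/2; the other half
    is for the discretization error 2 K / n. The added 1 avoids division by 0.\<close>
  define \<delta> where "\<delta> = e / (2 * (22 * (B + K) + 1))"
  have \<delta>: "\<delta> > 0" using e B(1) K by (simp add: \<delta>_def)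
  have \<delta>e: "\<delta> * (22 * (B + K)) \<le> e / 2"
  proof -
    have "\<delta> * (22 * (B + K)) \<le> \<delta> * (22 * (B + K) + 1)" using \<delta> by simp
    also have "\<dots> = e / 2" using B(1) K unfolding \<delta>_def by (simp add: field_simps)
    finally show ?thesis .
  qed
  define bad where "bad n t \<longleftrightarrow> (\<exists>cs t0. chain i cs \<and> t0 \<in> terminal_trees S (chain_end i cs) \<and> t = plug cs t0 \<and>
    \<not> good_chain p \<delta> n cs t0)" for n t
  let ?E = "{\<mu>. \<bar>(\<integral>z. f z \<partial>\<mu>) - (\<integral>z. f z \<partial>X_permuton p)\<bar> > e}"
  let ?G = "inf sequentially (principal {n. of_size S i n \<noteq> {}})"
  have le: "measure_pmf.prob (map_pmf permuton_of (pmf_of_set (of_size S i n))) ?E \<le>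
      real (card {t \<in> sized i n. bad n t}) / real (card (sized i n))"
    if n: "of_size S i n \<noteq> {}" "2 * K / real n \<le> e / 2" for n
  proof -
    have "of_size S i n \<inter> permuton_of -` ?E \<subseteq> tree_perm ` {t \<in> sized i n. bad n t}"
    proof
      fix \<sigma> assume \<sigma>: "\<sigma> \<in> of_size S i n \<inter> permuton_of -` ?E"
      then obtain t where t: "t \<in> sized i n" "\<sigma> = tree_perm t" using bij_betw_imp_surj_on[OF bij[of n]] by blast
      have "t \<in> fam i" using t(1) by (simp add: sized_def)
      then obtain cs t0 where cs: "chain i cs" "t0 \<in> terminal_trees S (chain_end i cs)" "t = plug cs t0"
        using chain_decomposition[OF i] by blast
      have "\<not> good_chain p \<delta> n cs t0"
      proof
        assume "good_chain p \<delta> n cs t0"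
        note tree_perm_integral_close[OF i t(1) cs(1) terminal_in_fam[OF cs(2)] cs(3) this less_imp_le[OF \<delta>] p sum_p f B(2) lip K]
        then show False using \<sigma> t(2) \<delta>e n(2) by simp
      qed
      then have "bad n t" unfolding bad_def using cs by blast
      then show "\<sigma> \<in> tree_perm ` {t \<in> sized i n. bad n t}" using t by blast
    qed
    then have "card (of_size S i n \<inter> permuton_of -` ?E) \<le> card (tree_perm ` {t \<in> sized i n. bad n t})"
      by (intro card_mono) auto
    also have "\<dots> \<le> card {t \<in> sized i n. bad n t}" by (intro card_image_le) simp
    finally have "real (card (of_size S i n \<inter> permuton_of -` ?E)) / real (card (of_size S i n)) \<le>
        real (card {t \<in> sized i n. bad n t}) / real (card (of_size S i n))"
      by (intro divide_right_mono) auto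
    then show ?thesis
      using measure_pmf_of_set[OF n(1) fin] by (simp add: card_of_size[OF crit_le[OF i]])
  qed
  have "(\<lambda>n. 2 * K / real n) \<longlonglongrightarrow> 0" by (rule tendsto_divide_0[OF tendsto_const]) (simp add: filterlim_real_sequentially filterlim_at_top_imp_at_infinity)
  then have "\<forall>\<^sub>F n in sequentially. 2 * K / real n < e / 2" using e by (intro order_tendstoD) auto
  then have "\<forall>\<^sub>F n in ?G. measure_pmf.prob (map_pmf permuton_of (pmf_of_set (of_size S i n))) ?E \<le>
      real (card {t \<in> sized i n. bad n t}) / real (card (sized i n))"
    unfolding eventually_inf_principal by (rule eventually_mono) (use le in auto)
  moreover have "((\<lambda>n. real (card {t \<in> sized i n. bad n t}) / real (card (sized i n))) \<longlongrightarrow> 0) ?G"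
    using negligible_tendsto_0[OF i negl[OF \<delta>]] unfolding ne bad_def .
  ultimately show "((\<lambda>n. measure_pmf.prob (map_pmf permuton_of (pmf_of_set (of_size S i n))) ?E) \<longlongrightarrow> 0) ?G"
    by (rule tendsto_zero_upper_bound) simp
qed

text \<open>The eigenvalue is simple on either side, so any other pair consists of multiples of the
  given vectors, and positivity excludes the factor 0.\<close>

lemma positive_eigenvectors_unique:
  assumes u: "\<And>i. i \<in> crit \<Longrightarrow> u i > 0" "\<And>i. i \<in> crit \<Longrightarrow> mat_vec crit (\<lambda>i j. M j i) u i = u i"
    and v: "\<And>i. i \<in> crit \<Longrightarrow> v i > 0" "\<And>i. i \<in> crit \<Longrightarrow> mat_vec crit M v i = v i"
    and pe: "positive_eigenvectors crit M 1 u' v'"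
  shows "\<exists>c d. c \<noteq> 0 \<and> d \<noteq> 0 \<and> (\<forall>i\<in>crit. u' i = c * u i) \<and> (\<forall>i\<in>crit. v' i = d * v i)"
proof -
  note pe' = pe[unfolded positive_eigenvectors_def]
  have u1: "mat_vec crit (\<lambda>i j. M j i) u i = 1 * u i" and v1: "mat_vec crit M v i = 1 * v i" if "i \<in> crit" for i
    using u(2) v(2) that by auto
  have "\<exists>c. \<forall>i\<in>crit. u' i = c * u i"
    by (rule perron_eigenvector_unique[OF finite_crit crit_nonempty _ irreducible_on_transpose[OF M_irreducible] u(1) u1])
      (use M_nonneg pe' in \<open>auto simp: mat_vec_def mult.commute\<close>)
  moreover have "\<exists>d. \<forall>i\<in>crit. v' i = d * v i"
    by (rule perron_eigenvector_unique[OF finite_crit crit_nonempty M_nonneg M_irreducible v(1) v1])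
      (use pe' in \<open>auto simp: mat_vec_def\<close>)
  ultimately obtain c d where cd: "\<forall>i\<in>crit. u' i = c * u i" "\<forall>i\<in>crit. v' i = d * v i" by blast
  obtain i where "i \<in> crit" using crit_nonempty by blast
  then have "c * u i > 0" "d * v i > 0" using pe' cd by auto
  then have "c \<noteq> 0" "d \<noteq> 0" by auto
  then show ?thesis using cd by blast
qed

lemma exists_positive_eigenvectors: "\<exists>u v. positive_eigenvectors crit M 1 u v"
proof -
  obtain u where u: "\<And>i. i \<in> crit \<Longrightarrow> u i > 0" "\<And>i. i \<in> crit \<Longrightarrow> mat_vec crit (\<lambda>i j. M j i) u i = u i"
    using exists_left_eigenvector by blast
  obtain v where v: "\<And>i. i \<in> crit \<Longrightarrow> v i > 0" "\<And>i. i \<in> crit \<Longrightarrow> mat_vec crit M v i = v i"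
    using exists_right_eigenvector by blast
  define c where "c = (\<Sum>i\<in>crit. u i * v i)"
  have c: "c > 0" unfolding c_def using u(1) v(1) crit_nonempty by (intro sum_pos) auto
  have "(\<Sum>i\<in>crit. u i / c * M i j) = u j / c" if "j \<in> crit" for j
    using u(2)[OF that] by (simp add: mat_vec_def sum_divide_distrib[symmetric] mult.commute)
  moreover have "(\<Sum>i\<in>crit. u i / c * v i) = 1" using c by (simp add: sum_divide_distrib[symmetric] c_def[symmetric])
  ultimately have "positive_eigenvectors crit M 1 (\<lambda>i. u i / c) v"
    unfolding positive_eigenvectors_def using u(1) v c by (simp add: mat_vec_def)
  then show ?thesis by blast
qed

text \<open>The parameter is built from eigenvectors without normalization. The quotient is
  homogeneous of degree 0 in u and in v, so every normalized pair returns the same value.\<close>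

lemma converges_with_parameter:
  "\<exists>p :: side \<Rightarrow> sign \<Rightarrow> real. (\<forall>e s. p e s \<in> {0..1}) \<and>
    p LeftSide Plus + p RightSide Plus + p LeftSide Minus + p RightSide Minus = 1 \<and>
    (\<forall>i\<in>crit. converges_in_distribution weak_topology_permutons
      (\<lambda>n. map_pmf permuton_of (pmf_of_set (of_size S i n)))
      (return_pmf (X_permuton p)) (inf sequentially (principal {n. of_size S i n \<noteq> {}}))) \<and>
    (\<forall>u v. positive_eigenvectors crit M 1 u v \<longrightarrow>
      (\<forall>e s. p e s = bilinear_value crit u (at_rho S (D_star S e s)) v / bilinear_value crit u M' v))"
proof -
  obtain u where u: "\<And>i. i \<in> crit \<Longrightarrow> u i > 0" "\<And>i. i \<in> crit \<Longrightarrow> mat_vec crit (\<lambda>i j. M j i) u i = u i"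
    using exists_left_eigenvector by blast
  obtain v where v: "\<And>i. i \<in> crit \<Longrightarrow> v i > 0" "\<And>i. i \<in> crit \<Longrightarrow> mat_vec crit M v i = v i"
    using exists_right_eigenvector by blast
  define b where "b = bilinear_value crit u M' v"
  define a where "a e s = bilinear_value crit u (at_rho S (D_star S e s)) v" for e s
  define p where "p e s = a e s / b" for e s
  have b: "b > 0" unfolding b_def by (rule bilinear_M'_pos[OF u(1) v])
  have a0: "a e s \<ge> 0" for e s
    unfolding a_def bilinear_value_def using u(1) v(1) D_nonneg by (intro sum_nonneg mult_nonneg_nonneg) (auto simp: less_imp_le)
  have "b = bilinear_value crit u (\<lambda>i j. \<Sum>e\<in>{LeftSide, RightSide}. \<Sum>s\<in>{Plus, Minus}. at_rho S (D_star S e s) i j) v"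
    unfolding b_def by (rule bilinear_value_cong) (rule sum_D[symmetric])
  then have suma: "a LeftSide Plus + a RightSide Plus + a LeftSide Minus + a RightSide Minus = b"
    by (simp add: a_def bilinear_value_add)
  then have sum_p: "p LeftSide Plus + p RightSide Plus + p LeftSide Minus + p RightSide Minus = 1"
    unfolding p_def add_divide_distrib[symmetric] using b by simp
  have p0: "p e s \<ge> 0" for e s using a0[of e s] b by (simp add: p_def)
  have p1: "p e s \<le> 1" for e s
    using sum_p p0[of LeftSide Plus] p0[of LeftSide Minus] p0[of RightSide Plus] p0[of RightSide Minus]
    by (cases e; cases s) simp_all
  have p: "p e s \<in> {0..1}" for e s using p0 p1 by simp
  \<comment> \<open>This is the choice of p, multiplied by \<rho>: the pairing of u and v with D - p
    M' vanishes for every leaf type, so the deviation variable is centred.\<close>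
  have zero: "bilinear_value crit u (\<lambda>i j. \<Sum>n.
      (\<Sum>c\<in>slice i j n. r * (real (side_count e s c) - p e s * real (context_size c))) * \<rho> ^ n) v = 0" for e s r
  proof -
    have "bilinear_value crit u (\<lambda>i j. \<Sum>n.
        (\<Sum>c\<in>slice i j n. r * (real (side_count e s c) - p e s * real (context_size c))) * \<rho> ^ n) v =
      bilinear_value crit u (\<lambda>i j. r * (\<rho> * at_rho S (D_star S e s) i j + (- p e s) * (\<rho> * M' i j))) v"
    proof (rule bilinear_value_cong)
      fix i j assume ij: "i \<in> crit" "j \<in> crit"
      have "(\<lambda>n. r * ((\<Sum>c\<in>slice i j n. real (side_count e s c)) * \<rho> ^ n +
          (- p e s) * ((\<Sum>c\<in>slice i j n. real (context_size c)) * \<rho> ^ n))) sums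
          (r * (\<rho> * at_rho S (D_star S e s) i j + (- p e s) * (\<rho> * M' i j)))"
        by (intro sums_mult sums_add side_count_sums context_size_sums ij)
      moreover have "r * ((\<Sum>c\<in>slice i j n. real (side_count e s c)) * \<rho> ^ n +
          (- p e s) * ((\<Sum>c\<in>slice i j n. real (context_size c)) * \<rho> ^ n)) =
          (\<Sum>c\<in>slice i j n. r * (real (side_count e s c) - p e s * real (context_size c))) * \<rho> ^ n" for n
      proof -
        have "(\<Sum>c\<in>slice i j n. r * (real (side_count e s c) - p e s * real (context_size c))) =
            r * ((\<Sum>c\<in>slice i j n. real (side_count e s c)) - p e s * (\<Sum>c\<in>slice i j n. real (context_size c)))"
          by (simp only: sum_distrib_left[symmetric] sum_subtractf)
        then show ?thesis by (simp only:) (simp add: algebra_simps)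
      qed
      ultimately show "(\<Sum>n. (\<Sum>c\<in>slice i j n. r * (real (side_count e s c) - p e s * real (context_size c))) * \<rho> ^ n) =
          r * (\<rho> * at_rho S (D_star S e s) i j + (- p e s) * (\<rho> * M' i j))"
        by (simp add: sums_unique[symmetric])
    qed
    also have "\<dots> = r * (\<rho> * a e s + (- p e s) * (\<rho> * b))"
      by (simp only: bilinear_value_scale bilinear_value_add a_def b_def)
    also have "\<dots> = 0" using b by (simp add: p_def)
    finally show ?thesis .
  qed
  have conv: "converges_in_distribution weak_topology_permutons (\<lambda>n. map_pmf permuton_of (pmf_of_set (of_size S i n)))
      (return_pmf (X_permuton p)) (inf sequentially (principal {n. of_size S i n \<noteq> {}}))" if i: "i \<in> crit" for i
    by (rule converges_to_X_permuton[OF p sum_p negligible_bad_chain[OF p u v zero _ i] i])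
  have formula: "p e s = bilinear_value crit u' (at_rho S (D_star S e s)) v' / bilinear_value crit u' M' v'"
    if pe: "positive_eigenvectors crit M 1 u' v'" for u' v' e s
  proof -
    obtain c d where cd: "c \<noteq> 0" "d \<noteq> 0" "\<forall>i\<in>crit. u' i = c * u i" "\<forall>i\<in>crit. v' i = d * v i"
      using positive_eigenvectors_unique[OF u v pe] by blast
    have "bilinear_value crit u' A v' = c * d * bilinear_value crit u A v" for A
      by (rule bilinear_value_scaled_vectors) (use cd in auto)
    then show ?thesis using cd(1,2) by (simp add: p_def a_def b_def)
  qed
  show ?thesis
    by (intro exI[of _ p] conjI allI impI ballI p sum_p conv formula)
qed

lemma perron_eigenvalue_M: "perron_eigenvalue crit M 1"
proof -
  obtain v where v: "\<And>i. i \<in> crit \<Longrightarrow> v i > 0" "\<And>i. i \<in> crit \<Longrightarrow> mat_vec crit M v i = v i"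
    using exists_right_eigenvector by blast
  show ?thesis
    by (rule perron_eigenvalue_of_eigenvector[OF finite_crit crit_nonempty M_nonneg v(1)]) (use v in auto)
qed

end

theorem theorem3p3:
  fixes S :: tree_system
  assumes spec: "tree_specification S"
    and nonempty: "\<forall>i\<le>last_index S. family S i \<noteq> {}"
    and some_infinite: "\<exists>i\<le>last_index S. infinite (family S i)"
    and some_leaf: "\<exists>i\<le>last_index S. leaf_coeff S i \<noteq> 0"
    and path_to_critical: "\<forall>i\<in>subcritical S. \<exists>j\<in>critical S. (i, j) \<in> (dependency S)\<^sup>*"
    and G_star: "induced_strongly_connected (dependency S) (critical S)"
    and linear: "essentially_linear S"
    and radius_F: "\<forall>i\<in>critical S.
      fps_conv_radius (F_subst S i (\<lambda>l. if l \<in> critical S then 0 else genfun S l)) > rho S"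
    and radius_dF: "\<forall>i\<in>critical S. \<forall>j\<in>critical S.
      fps_conv_radius (dF_subst S i j (genfun S)) > rho S"
    and aperiodic: "\<exists>i\<in>subcritical S. \<not> periodic_fps (genfun S i)"
  shows "perron_eigenvalue (critical S) (at_rho S (M_star S)) 1 \<and>
    (\<exists>u v. positive_eigenvectors (critical S) (at_rho S (M_star S)) 1 u v) \<and>
    (\<exists>p :: side \<Rightarrow> sign \<Rightarrow> real.
      (\<forall>e s. p e s \<in> {0..1}) \<and>
      p LeftSide Plus + p RightSide Plus + p LeftSide Minus + p RightSide Minus = 1 \<and>
      (\<forall>i\<in>critical S.
        converges_in_distribution weak_topology_permutons
          (\<lambda>n. map_pmf permuton_of (pmf_of_set (of_size S i n)))
          (return_pmf (X_permuton p))
          (inf sequentially (principal {n. of_size S i n \<noteq> {}}))) \<and>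
      (\<forall>u v. positive_eigenvectors (critical S) (at_rho S (M_star S)) 1 u v \<longrightarrow>
        (\<forall>e s. p e s =
          bilinear_value (critical S) u (at_rho S (D_star S e s)) v /
          bilinear_value (critical S) u (at_rho S (\<lambda>i j. fps_deriv (M_star S i j))) v)))"
proof -
  interpret linear_critical_specification S
    by unfold_locales (fact spec nonempty linear some_infinite G_star radius_F radius_dF)+
  show ?thesis by (intro conjI perron_eigenvalue_M exists_positive_eigenvectors converges_with_parameter)
qed

end
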